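(* Let $n\ge1$, let $U$ be a Haar-distributed random matrix in $\mathrm{U}(2n)$, and let $V=U^DU$. Put $\tilde v_{ij}=e_i^{T}JVe_j$ for $i,j\in[2n]$. For $k\ge1$ and two sequences $\mathbf{i}=(i_1,\dots,i_{2k})$, $\mathbf{j}=(j_1,\dots,j_{2k})$ in $[2n]$, $$\mathbb{E}\big[\tilde v_{i_1,i_2}\tilde v_{i_3,i_4}\cdots\tilde v_{i_{2k-1},i_{2k}}\overline{\tilde v_{j_1,j_2}\tilde v_{j_3,j_4}\cdots\tilde v_{j_{2k-1},j_{2k}}}\big]=\sum_{\sigma\in S_{2k}}\delta_\sigma(\mathbf{i},\mathbf{j})\,\mathrm{Wg}^{\mathrm{A\,II}}(\sigma;n),$$ where $\mathrm{Wg}^{\mathrm{A\,II}}(\cdot;n)=T^{\mathrm{Sp}}(\cdot;n)*\mathrm{Wg}^{\mathrm{U}}(\cdot;2n)$ (convolution on $S_{2k}$). Moreover, if $k\neq l$, then for all sequences $(i_1,\dots,i_{2k})$ and $(j_1,\dots,j_{2l})$ in $[2n]$, $\mathbb{E}\big[\tilde v_{i_1,i_2}\cdots\tilde v_{i_{2k-1},i_{2k}}\overline{\tilde v_{j_1,j_2}\cdots\tilde v_{j_{2l-1},j_{2l}}}\big]=0$.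
   Context: $J=\begin{pmatrix}O_n&I_n\\-I_n&O_n\end{pmatrix}$, $X^D=JX^TJ^T$, $e_i$ the standard basis column vectors of $\mathbb{C}^{2n}$. $S_{m}$ is the symmetric group on $[m]$, $\epsilon$ its sign, and convolution is $(f_1*f_2)(\sigma)=\sum_{\tau\in S_m}f_1(\tau)f_2(\tau^{-1}\sigma)$. $\delta_\sigma(\mathbf{i},\mathbf{j})=\prod_{s=1}^{2k}\delta_{i_{\sigma(s)},j_s}$. For $\sigma\in S_{2k}$, the coset-type of $\sigma$ is the partition $\mu=(\mu_1,\dots,\mu_l)\vdash k$ such that the graph on $[2k]$ with edges $\{2r-1,2r\}$ and $\{\sigma(2r-1),\sigma(2r)\}$ ($1\le r\le k$) has connected components with $2\mu_1,\dots,2\mu_l$ vertices; $\ell(\mu)=l$. $T^{\mathrm{Sp}}(\sigma;z)=(-1)^k\epsilon(\sigma)(-2z)^{\ell(\mu)}$ with $\mu$ the coset-type of $\sigma$. The unitary Weingarten function on $S_{m}$ is $\mathrm{Wg}^{\mathrm{U}}(\cdot;z)=\frac{1}{m!}\sum_{\lambda\vdash m,\ C_\lambda(z)\neq0}\frac{f^\lambda}{C_\lambda(z)}\chi^\lambda$, where $\chi^\lambda$ is the irreducible character of $S_m$, $f^\lambda=\chi^\lambda(\mathrm{id})$, and $C_\lambda(z)=\prod_{(i,j)\in\lambda}(z+j-i)$ ($(i,j)\in\lambda$ meaning $1\le j\le\lambda_i$). *)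

theory Defs
  imports "HOL-Probability.Probability" "HOL-Combinatorics.Permutations" "HOL-Library.FuncSet"
    "HOL-Library.Multiset"
begin

(* Matrices are functions nat => nat => complex; an N x N matrix uses indices in {1..N}. *)
type_synonym cmat = "nat \<Rightarrow> nat \<Rightarrow> complex"

definition mmult :: "nat \<Rightarrow> cmat \<Rightarrow> cmat \<Rightarrow> cmat" where
  "mmult N A B = (\<lambda>i j. \<Sum>t\<in>{1..N}. A i t * B t j)"

definition mtrans :: "cmat \<Rightarrow> cmat" where
  "mtrans A = (\<lambda>i j. A j i)"

definition madj :: "cmat \<Rightarrow> cmat" where
  "madj A = (\<lambda>i j. cnj (A j i))"

definition midentity :: "nat \<Rightarrow> cmat" where
  "midentity N = (\<lambda>i j. if i = j \<and> i \<in> {1..N} then 1 else 0)"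

(* J = [[O_n, I_n], [-I_n, O_n]] as a 2n x 2n matrix *)
definition Jmat :: "nat \<Rightarrow> cmat" where
  "Jmat n = (\<lambda>i j. if i \<in> {1..n} \<and> j = i + n then 1
                   else if i \<in> {n+1..2*n} \<and> i = j + n then -1 else 0)"

(* U(N): unitary N x N matrices (entries outside {1..N}^2 are zero) *)
definition unitary_group :: "nat \<Rightarrow> cmat set" where
  "unitary_group N = {U. (\<forall>i j. (i \<notin> {1..N} \<or> j \<notin> {1..N}) \<longrightarrow> U i j = 0)
                        \<and> mmult N (madj U) U = midentity N}"

(* Haar probability measure on U(N): a Borel probability measure on the matrix space,
   concentrated on U(N) and invariant under left multiplication by U(N)
   (by uniqueness of Haar measure on the compact group U(N) this characterises it). *)
definition haar_unitary :: "nat \<Rightarrow> cmat measure \<Rightarrow> bool" where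
  "haar_unitary N \<mu> \<longleftrightarrow> prob_space \<mu> \<and> sets \<mu> = sets borel
     \<and> unitary_group N \<in> sets \<mu> \<and> emeasure \<mu> (unitary_group N) = 1
     \<and> (\<forall>W\<in>unitary_group N. distr \<mu> borel (\<lambda>U. mmult N W U) = \<mu>)"

(* X^D = J X^T J^T for 2n x 2n matrices *)
definition sp_dual :: "nat \<Rightarrow> cmat \<Rightarrow> cmat" where
  "sp_dual n X = mmult (2*n) (mmult (2*n) (Jmat n) (mtrans X)) (mtrans (Jmat n))"

(* \<tilde>v_{ij} = e_i^T J V e_j with V = U^D U *)
definition vtilde :: "nat \<Rightarrow> cmat \<Rightarrow> nat \<Rightarrow> nat \<Rightarrow> complex" where
  "vtilde n U i j = mmult (2*n) (Jmat n) (mmult (2*n) (sp_dual n U) U) i j"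

(* \<delta>_\<sigma>(i,j) = \<Prod>_{s=1}^{2k} \<delta>_{i_{\<sigma>(s)}, j_s} *)
definition delta_perm :: "nat \<Rightarrow> (nat \<Rightarrow> nat) \<Rightarrow> (nat \<Rightarrow> nat) \<Rightarrow> (nat \<Rightarrow> nat) \<Rightarrow> complex" where
  "delta_perm k \<sigma> i j = (\<Prod>s\<in>{1..2*k}. if i (\<sigma> s) = j s then 1 else 0)"

(* coset-type of \<sigma> \<in> S_{2k} *)
definition coset_edges :: "nat \<Rightarrow> (nat \<Rightarrow> nat) \<Rightarrow> (nat \<times> nat) set" where
  "coset_edges k \<sigma> = {(2*r-1, 2*r) | r. r \<in> {1..k}} \<union> {(\<sigma> (2*r-1), \<sigma> (2*r)) | r. r \<in> {1..k}}"

definition coset_components :: "nat \<Rightarrow> (nat \<Rightarrow> nat) \<Rightarrow> nat set set" where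
  "coset_components k \<sigma> = {1..2*k} // ((coset_edges k \<sigma> \<union> (coset_edges k \<sigma>)\<inverse>)\<^sup>*)"

(* the partition \<mu>, as the multiset of its parts (half the component sizes) *)
definition coset_type :: "nat \<Rightarrow> (nat \<Rightarrow> nat) \<Rightarrow> nat multiset" where
  "coset_type k \<sigma> = image_mset (\<lambda>C. card C div 2) (mset_set (coset_components k \<sigma>))"

(* \<ell>(\<mu>) *)
definition coset_length :: "nat \<Rightarrow> (nat \<Rightarrow> nat) \<Rightarrow> nat" where
  "coset_length k \<sigma> = size (coset_type k \<sigma>)"

definition T_Sp :: "nat \<Rightarrow> (nat \<Rightarrow> nat) \<Rightarrow> complex \<Rightarrow> complex" where
  "T_Sp k \<sigma> z = (-1)^k * of_int (sign \<sigma>) * (-2 * z) ^ coset_length k \<sigma>"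

(* partitions of m as non-increasing lists of positive integers *)
definition partitions :: "nat \<Rightarrow> nat list set" where
  "partitions m = {p. sum_list p = m \<and> sorted_wrt (\<ge>) p \<and> (\<forall>x\<in>set p. 0 < x)}"

(* C_\<lambda>(z) = \<Prod>_{(i,j)\<in>\<lambda>} (z + j - i) *)
definition content_poly :: "nat list \<Rightarrow> complex \<Rightarrow> complex" where
  "content_poly p z = (\<Prod>i\<in>{1..length p}. \<Prod>j\<in>{1..p!(i-1)}. z + of_int (int j - int i))"

(* number of fixed points of \<sigma> on ordered set partitions of {1..m} with block sizes \<alpha>_1..\<alpha>_l,
   i.e. the permutation character of S_m induced from the trivial character of the Young subgroup *)
definition young_count :: "nat \<Rightarrow> nat \<Rightarrow> (nat \<Rightarrow> nat) \<Rightarrow> (nat \<Rightarrow> int) \<Rightarrow> nat" where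
  "young_count m l \<sigma> \<alpha> = card {f \<in> {1..m} \<rightarrow>\<^sub>E {1..l}. (\<forall>s\<in>{1..m}. f (\<sigma> s) = f s)
        \<and> (\<forall>i\<in>{1..l}. int (card {s\<in>{1..m}. f s = i}) = \<alpha> i)}"

(* irreducible character \<chi>^\<lambda> of S_m (m = |\<lambda>|), via the Frobenius / Jacobi-Trudi determinantal formula
   \<chi>^\<lambda> = \<Sum>_{w\<in>S_l} sgn(w) 1\<up>_{S_{(\<lambda>_i - i + w(i))_i}} *)
definition irr_char :: "nat list \<Rightarrow> (nat \<Rightarrow> nat) \<Rightarrow> int" where
  "irr_char p \<sigma> = (\<Sum>w | w permutes {1..length p}.
      sign w * int (young_count (sum_list p) (length p) \<sigma>
                      (\<lambda>i. int (p!(i-1)) - int i + int (w i))))"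

(* unitary Weingarten function on S_m *)
definition Wg_U :: "nat \<Rightarrow> (nat \<Rightarrow> nat) \<Rightarrow> complex \<Rightarrow> complex" where
  "Wg_U m \<sigma> z = (1 / of_nat (fact m)) *
     (\<Sum>p\<in>{p\<in>partitions m. content_poly p z \<noteq> 0}.
        of_int (irr_char p id) / content_poly p z * of_int (irr_char p \<sigma>))"

(* convolution on S_m: (f1*f2)(\<sigma>) = \<Sum>_\<tau> f1(\<tau>) f2(\<tau>^{-1}\<sigma>) *)
definition convolution :: "nat \<Rightarrow> ((nat \<Rightarrow> nat) \<Rightarrow> complex) \<Rightarrow> ((nat \<Rightarrow> nat) \<Rightarrow> complex)
                            \<Rightarrow> (nat \<Rightarrow> nat) \<Rightarrow> complex" where
  "convolution m f1 f2 \<sigma> = (\<Sum>\<tau> | \<tau> permutes {1..m}. f1 \<tau> * f2 (inv \<tau> \<circ> \<sigma>))"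

definition Wg_AII :: "nat \<Rightarrow> nat \<Rightarrow> (nat \<Rightarrow> nat) \<Rightarrow> complex" where
  "Wg_AII n k = convolution (2*k) (\<lambda>\<sigma>. T_Sp k \<sigma> (of_nat n)) (\<lambda>\<sigma>. Wg_U (2*k) \<sigma> (of_nat (2*n)))"

(* \<tilde>v_{i1,i2}...\<tilde>v_{i_{2k-1},i_{2k}} * conj(\<tilde>v_{j1,j2}...\<tilde>v_{j_{2l-1},j_{2l}}) *)
definition vt_moment :: "nat \<Rightarrow> cmat \<Rightarrow> nat \<Rightarrow> (nat \<Rightarrow> nat) \<Rightarrow> nat \<Rightarrow> (nat \<Rightarrow> nat) \<Rightarrow> complex" where
  "vt_moment n U k i l j = (\<Prod>r\<in>{1..k}. vtilde n U (i (2*r-1)) (i (2*r)))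
                          * cnj (\<Prod>r\<in>{1..l}. vtilde n U (j (2*r-1)) (j (2*r)))"

end

theory Submission
  imports Defs
begin

text \<open>
  Let \<open>N = 2n\<close>, \<open>m = 2k\<close>, and let \<open>M\<close> be the operator on the \<open>m\<close>-fold tensor power of \<open>\<complex>\<^sup>N\<close> whose entry at
  \<open>(x, a)\<close> is the moment with index sequences \<open>a\<close> and \<open>x\<close>. Haar measure is also right invariant (by
  Fubini, from left invariance), so \<open>M\<close> commutes with \<open>W\<^sup>\<otimes>\<^sup>m\<close> for every unitary \<open>W\<close>. Differentiation at
  the identity and polarization show that \<open>M\<close> commutes with the derivation
  \<open>\<Sum>\<^sub>t 1 \<otimes> \<dots> \<otimes> Y \<otimes> \<dots> \<otimes> 1\<close> of every matrix \<open>Y\<close>, and then, by induction on the number of nontrivial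
  factors, with the symmetrization of every \<open>X\<^sub>1 \<otimes> \<dots> \<otimes> X\<^sub>m\<close>. For matrix units this says
  \<open>\<Sum>\<^sub>\<tau> M(x, a \<circ> \<tau>) N\<^bsup>c(\<tau>)\<^esup> = \<Sum>\<^sub>\<tau> [x = a \<circ> \<tau>] t(\<tau>)\<close>, where \<open>c\<close> counts cycles and
  \<open>t(\<tau>) = \<Sum>\<^sub>b M(b \<circ> \<tau>, b)\<close>. Unitarity turns \<open>t(\<tau>)\<close> into \<open>\<Sum>\<^sub>p \<Prod>\<^sub>r J(p\<^bsub>2r-1\<^esub>, p\<^bsub>2r\<^esub>) J(p\<^bsub>\<tau>(2r-1)\<^esub>, p\<^bsub>\<tau>(2r)\<^esub>)\<close>, to
  which every component of the graph of \<open>\<tau>\<close> contributes a factor \<open>2n\<close> up to sign, so \<open>t\<close> is \<open>T\<^sup>S\<^sup>p\<close>.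
  The Weingarten function inverts \<open>N\<^bsup>c\<^esup>\<close> on the tensor power, and this yields the formula. If \<open>k \<noteq> l\<close>, left
  invariance under a suitable scalar matrix shows that the expectation equals its negative.

  The inversion rests on three facts about the functions \<open>\<chi>\<^sup>\<lambda>\<close> given by the determinantal formula. They are
  orthonormal, since the pairing with a Young character counts nonnegative integer matrices and the
  determinant can be peeled row by row. They are eigenfunctions of convolution by \<open>N\<^bsup>c\<^esup>\<close> with eigenvalue
  \<open>C\<^sub>\<lambda>(N)\<close>, since by the equality case of Cauchy--Schwarz \<open>\<chi>\<^sup>\<lambda>\<close> is the conjugation average of a
  Young symmetrizer. Finally, the \<open>f\<^sup>\<lambda> \<chi>\<^sup>\<lambda>\<close> sum to \<open>m!\<close> times the delta function at the identity.
\<close>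

section \<open>Orthonormality of the irreducible characters\<close>

text \<open>The characters are available only through the determinantal formula: no module realises
  them, so Schur orthogonality and Schur-Weyl duality are replaced by identities between functions
  on the symmetric group. Cycles enter only through the count of colourings fixed by a permutation,
  so that facts about \<open>N\<close> to the number of cycles become bijections. The obstacle is
  that \<open>N\<close> may be smaller than \<open>m\<close>. Then some content product vanishes,
  convolution by the cycle function is not invertible on the group, and the Weingarten function
  inverts it only up to the characters with vanishing content product. These act as zero on the
  tensor power, which suffices because all functions involved depend on a permutation \<sigma> only
  through \<open>a \<circ> \<sigma>\<close>. Accordingly the operator is never written as a
  combination of permutations in advance: commutation with symmetrized matrix units gives a linear
  system for the entries \<open>M z (a \<circ> \<tau>)\<close>, which the pseudo-inverse solves. On
  the symplectic side the sign of \<tau> is read off from a permutation that carries one matching to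
  the other and preserves a colour class of a proper 2-colouring.\<close>

definition colourings :: "'a set \<Rightarrow> 'b set \<Rightarrow> ('b \<Rightarrow> int) \<Rightarrow> ('a \<Rightarrow> 'b) set" where
  "colourings B A \<alpha> = {f \<in> B \<rightarrow>\<^sub>E A. \<forall>a\<in>A. int (card {s\<in>B. f s = a}) = \<alpha> a}"

lemma finite_colourings: "finite B \<Longrightarrow> finite A \<Longrightarrow> finite (colourings B A \<alpha>)"
  unfolding colourings_def by (simp add: finite_PiE)

text \<open>Block sizes stay integers because the Jacobi-Trudi shifts can make them negative, which
  simply leaves no colouring. Abstract colour sets are needed since pairs of colours serve as
  colours in \<open>colourings_inner\<close>.\<close>

lemma young_count_colourings:
  "young_count m l \<sigma> \<alpha> = card {f \<in> colourings {1..m} {1..l} \<alpha>. \<forall>s\<in>{1..m}. f (\<sigma> s) = f s}"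
  unfolding young_count_def colourings_def by (rule arg_cong[where f = card]) auto

lemma colourings_nonempty:
  assumes "finite A" "finite B" "\<And>a. a \<in> A \<Longrightarrow> 0 \<le> \<alpha> a" "(\<Sum>a\<in>A. \<alpha> a) = int (card B)"
  shows "colourings B A \<alpha> \<noteq> {}"
  using assms
proof (induction A arbitrary: B rule: finite_induct)
  case empty
  then show ?case by (auto simp: colourings_def)
next
  case (insert a A)
  have "0 \<le> (\<Sum>a\<in>A. \<alpha> a)" using insert.prems(2) by (intro sum_nonneg) auto
  with insert have "nat (\<alpha> a) \<le> card B" by auto
  then obtain C where C: "C \<subseteq> B" "card C = nat (\<alpha> a)"
    using obtain_subset_with_card_n by metis
  have fC: "finite C" using C insert.prems(1) finite_subset by blast
  have "(\<Sum>a\<in>A. \<alpha> a) = int (card (B - C))"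
    using insert C fC \<open>nat (\<alpha> a) \<le> card B\<close> by (simp add: card_Diff_subset of_nat_diff)
  then obtain f where f: "f \<in> colourings (B - C) A \<alpha>"
    using insert.IH[of "B - C"] insert.prems by auto
  define g where "g = (\<lambda>s. if s \<in> C then a else f s)"
  have "g \<in> B \<rightarrow>\<^sub>E insert a A"
    using f C unfolding g_def colourings_def by (auto simp: PiE_iff extensional_def)
  moreover have "{s\<in>B. g s = a} = C"
    using f C insert.hyps unfolding g_def colourings_def by (auto simp: PiE_iff)
  moreover have "{s\<in>B. g s = b} = {s\<in>B-C. f s = b}" if "b \<in> A" for b
    using f C insert.hyps that unfolding g_def colourings_def by (auto simp: PiE_iff)
  ultimately have "g \<in> colourings B (insert a A) \<alpha>"
    using f C insert.prems(2)[of a] unfolding colourings_def by auto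
  then show ?case by blast
qed

text \<open>Equal block sizes mean equal multisets of values, and functions with the same multiset
  of values differ by a permutation of the domain.\<close>

lemma colourings_transitive:
  assumes "finite B" "f \<in> colourings B A \<alpha>" "g \<in> colourings B A \<alpha>"
  obtains p where "p permutes B" "g = f \<circ> p"
proof -
  have "count (image_mset g (mset_set B)) b = count (image_mset f (mset_set B)) b" for b
  proof (cases "b \<in> A")
    case True
    have e: "{a \<in> B. h a = b} = {a \<in> B. b = h a}" for h :: "'a \<Rightarrow> 'b" by auto
    show ?thesis using assms True
      by (simp add: count_image_mset_eq_card_vimage colourings_def)
        (metis (mono_tags, lifting) of_nat_eq_iff)
  next
    case False
    with assms have "b \<notin> g ` B" "b \<notin> f ` B" by (auto simp: colourings_def)
    then show ?thesis using assms(1)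
      by (metis count_eq_zero_iff finite_set_mset_mset_set set_image_mset)
  qed
  then have "image_mset g (mset_set B) = image_mset f (mset_set B)" by (rule multiset_eqI)
  from image_mset_eq_implies_permutes[OF assms(1) this]
  obtain p where p: "p permutes B" "\<forall>x\<in>B. g x = f (p x)" by auto
  have "g x = (f \<circ> p) x" for x
    using p assms by (cases "x \<in> B") (auto simp: colourings_def PiE_iff extensional_def permutes_not_in)
  then show ?thesis using p that by blast
qed

lemma comp_permutes_colourings:
  assumes "p permutes B" "f \<in> colourings B A \<alpha>"
  shows "f \<circ> p \<in> colourings B A \<alpha>"
proof -
  have "{s\<in>B. f (p s) = a} = inv p ` {s\<in>B. f s = a}" for a
  proof (intro equalityI subsetI)
    fix x assume "x \<in> {s\<in>B. f (p s) = a}"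
    then have "p x \<in> {s\<in>B. f s = a}" using permutes_in_image[OF assms(1)] by auto
    then show "x \<in> inv p ` {s\<in>B. f s = a}"
      using permutes_inverses(2)[OF assms(1), of x] by force
  next
    fix x assume "x \<in> inv p ` {s\<in>B. f s = a}"
    then show "x \<in> {s\<in>B. f (p s) = a}"
      using permutes_inverses(1)[OF assms(1)] permutes_in_image[OF permutes_inv[OF assms(1)]] by auto
  qed
  moreover have "inj_on (inv p) X" for X
    using permutes_inj[OF permutes_inv[OF assms(1)]] inj_on_subset by blast
  ultimately have "card {s\<in>B. f (p s) = a} = card {s\<in>B. f s = a}" for a
    by (simp add: card_image)
  then show ?thesis using assms permutes_in_image[OF assms(1)]
    by (auto simp: colourings_def PiE_iff extensional_def permutes_not_in)
qed

text \<open>Burnside's lemma for a transitive action: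
  \<open>\<sigma> \<mapsto> f0 \<circ> \<sigma>\<close> is onto, and its fibre over \<open>f\<close>
  is a coset of the stabiliser of \<open>f\<close>.\<close>

lemma orbit_count:
  assumes "finite A" "finite B" "\<And>a. a \<in> A \<Longrightarrow> 0 \<le> \<alpha> a" "(\<Sum>a\<in>A. \<alpha> a) = int (card B)"
  shows "(\<Sum>\<sigma> | \<sigma> permutes B. card {f \<in> colourings B A \<alpha>. \<forall>s\<in>B. f (\<sigma> s) = f s}) = fact (card B)"
proof -
  define S where "S = {p. p permutes B}"
  let ?X = "colourings B A \<alpha>"
  have fS: "finite S" unfolding S_def by (rule finite_permutations[OF assms(2)])
  have fX: "finite ?X" using finite_colourings assms by blast
  obtain f0 where f0: "f0 \<in> ?X" using colourings_nonempty[of A B \<alpha>] assms by auto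
  have fiber: "card {\<sigma>\<in>S. f0 \<circ> \<sigma> = f} = card {\<sigma>\<in>S. \<forall>s\<in>B. f (\<sigma> s) = f s}" if fX': "f \<in> ?X" for f
  proof -
    obtain g where g: "g permutes B" "f = f0 \<circ> g"
      using colourings_transitive[OF assms(2) f0 fX'] by blast
    have "bij_betw (\<lambda>\<sigma>. g \<circ> \<sigma>) {\<sigma>\<in>S. \<forall>s\<in>B. f (\<sigma> s) = f s} {\<sigma>\<in>S. f0 \<circ> \<sigma> = f}"
    proof (rule bij_betwI[where g = "\<lambda>\<sigma>. inv g \<circ> \<sigma>"])
      show "(\<lambda>\<sigma>. g \<circ> \<sigma>) \<in> {\<sigma>\<in>S. \<forall>s\<in>B. f (\<sigma> s) = f s} \<rightarrow> {\<sigma>\<in>S. f0 \<circ> \<sigma> = f}"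
      proof
        fix \<sigma> assume s: "\<sigma> \<in> {\<sigma>\<in>S. \<forall>s\<in>B. f (\<sigma> s) = f s}"
        have "f (\<sigma> x) = f x" for x
          using s by (cases "x \<in> B") (auto simp: S_def permutes_not_in)
        then show "g \<circ> \<sigma> \<in> {\<sigma>\<in>S. f0 \<circ> \<sigma> = f}" 
          using s g by (auto simp: S_def permutes_compose fun_eq_iff)
      qed
      show "(\<lambda>\<sigma>. inv g \<circ> \<sigma>) \<in> {\<sigma>\<in>S. f0 \<circ> \<sigma> = f} \<rightarrow> {\<sigma>\<in>S. \<forall>s\<in>B. f (\<sigma> s) = f s}"
        using g by (auto simp: S_def permutes_compose permutes_inv permutes_inverses fun_eq_iff)
      show "inv g \<circ> (g \<circ> \<sigma>) = \<sigma>" for \<sigma> using g by (auto simp: fun_eq_iff permutes_inverses)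
      show "g \<circ> (inv g \<circ> \<sigma>) = \<sigma>" for \<sigma> using g by (auto simp: fun_eq_iff permutes_inverses)
    qed
    from bij_betw_same_card[OF this, symmetric] show ?thesis .
  qed
  have "fact (card B) = card S" unfolding S_def using card_permutations[OF refl assms(2)] by simp
  also have "\<dots> = card (\<Union>f\<in>?X. {\<sigma>\<in>S. f0 \<circ> \<sigma> = f})"
    by (rule arg_cong[where f = card]) (auto simp: S_def comp_permutes_colourings[OF _ f0])
  also have "\<dots> = (\<Sum>f\<in>?X. card {\<sigma>\<in>S. f0 \<circ> \<sigma> = f})"
    by (rule card_UN_disjoint) (use fX fS in auto)
  also have "\<dots> = (\<Sum>f\<in>?X. card {\<sigma>\<in>S. \<forall>s\<in>B. f (\<sigma> s) = f s})"
    by (rule sum.cong) (use fiber in auto)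
  also have "\<dots> = (\<Sum>f\<in>?X. \<Sum>\<sigma>\<in>S. if \<forall>s\<in>B. f (\<sigma> s) = f s then 1 else 0)"
    using fS by (simp add: sum.If_cases Int_def)
  also have "\<dots> = (\<Sum>\<sigma>\<in>S. \<Sum>f\<in>?X. if \<forall>s\<in>B. f (\<sigma> s) = f s then 1 else 0)"
    by (rule sum.swap)
  also have "\<dots> = (\<Sum>\<sigma>\<in>S. card {f \<in> ?X. \<forall>s\<in>B. f (\<sigma> s) = f s})"
    using fX by (simp add: sum.If_cases Int_def)
  finally show ?thesis unfolding S_def by simp
qed

section \<open>Contingency tables and products of Young characters\<close>

definition contingency :: "'b set \<Rightarrow> 'c set \<Rightarrow> ('b \<Rightarrow> int) \<Rightarrow> ('c \<Rightarrow> int) \<Rightarrow> ('b \<times> 'c \<Rightarrow> nat) set" where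
  "contingency L H \<alpha> \<nu> = {M \<in> L \<times> H \<rightarrow>\<^sub>E UNIV.
     (\<forall>i\<in>L. int (\<Sum>j\<in>H. M (i, j)) = \<alpha> i) \<and> (\<forall>j\<in>H. int (\<Sum>i\<in>L. M (i, j)) = \<nu> j)}"

lemma finite_contingency:
  assumes "finite L" "finite H"
  shows "finite (contingency L H \<alpha> \<nu>)"
proof (rule finite_subset)
  show "contingency L H \<alpha> \<nu> \<subseteq> L \<times> H \<rightarrow>\<^sub>E {..nat (\<Sum>i\<in>L. \<bar>\<alpha> i\<bar>)}"
  proof
    fix M assume M: "M \<in> contingency L H \<alpha> \<nu>"
    have "M (i, j) \<le> nat (\<Sum>i\<in>L. \<bar>\<alpha> i\<bar>)" if "i \<in> L" "j \<in> H" for i j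
    proof -
      have "M (i, j) \<le> (\<Sum>j\<in>H. M (i, j))" using that assms by (intro member_le_sum) auto
      moreover have "int (\<Sum>j\<in>H. M (i, j)) = \<alpha> i" using M that by (auto simp: contingency_def)
      moreover have "\<bar>\<alpha> i\<bar> \<le> (\<Sum>i\<in>L. \<bar>\<alpha> i\<bar>)" using that assms by (intro member_le_sum) auto
      ultimately show ?thesis by linarith
    qed
    then show "M \<in> L \<times> H \<rightarrow>\<^sub>E {..nat (\<Sum>i\<in>L. \<bar>\<alpha> i\<bar>)}" using M by (auto simp: contingency_def PiE_iff)
  qed
qed (use assms in \<open>simp add: finite_PiE\<close>)

lemma card_pairs_sum:
  assumes "finite B" "finite L" "finite H" "h \<in> B \<rightarrow>\<^sub>E L \<times> H" "i \<in> L"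
  shows "card {s\<in>B. fst (h s) = i} = (\<Sum>j\<in>H. card {s\<in>B. h s = (i, j)})"
proof -
  have "{s\<in>B. fst (h s) = i} = (\<Union>j\<in>H. {s\<in>B. h s = (i, j)})"
    using assms by (fastforce simp: PiE_iff)
  moreover have "card \<dots> = (\<Sum>j\<in>H. card {s\<in>B. h s = (i, j)})"
    by (rule card_UN_disjoint) (use assms in auto)
  ultimately show ?thesis by simp
qed

lemma card_pairs_sum':
  assumes "finite B" "finite L" "finite H" "h \<in> B \<rightarrow>\<^sub>E L \<times> H" "j \<in> H"
  shows "card {s\<in>B. snd (h s) = j} = (\<Sum>i\<in>L. card {s\<in>B. h s = (i, j)})"
proof -
  have "{s\<in>B. snd (h s) = j} = (\<Union>i\<in>L. {s\<in>B. h s = (i, j)})"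
    using assms by (fastforce simp: PiE_iff)
  moreover have "card \<dots> = (\<Sum>i\<in>L. card {s\<in>B. h s = (i, j)})"
    by (rule card_UN_disjoint) (use assms in auto)
  ultimately show ?thesis by simp
qed

text \<open>A product of permutation characters is the permutation character on pairs, and a pair of
  colourings is one colouring by \<open>L \<times> H\<close>. Its block sizes form a contingency
  table, each table describes one orbit, and \<open>orbit_count\<close> yields m! per orbit.\<close>

lemma colourings_inner:
  assumes fin: "finite B" "finite L" "finite H"
    and tot: "(\<Sum>i\<in>L. \<alpha> i) = int (card B)"
  shows "(\<Sum>\<sigma> | \<sigma> permutes B. card {f \<in> colourings B L \<alpha>. \<forall>s\<in>B. f (\<sigma> s) = f s} *
            card {f \<in> colourings B H \<nu>. \<forall>s\<in>B. f (\<sigma> s) = f s})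
         = fact (card B) * card (contingency L H \<alpha> \<nu>)"
proof -
  have "card {f \<in> colourings B L \<alpha>. \<forall>s\<in>B. f (\<sigma> s) = f s} * card {f \<in> colourings B H \<nu>. \<forall>s\<in>B. f (\<sigma> s) = f s}
      = (\<Sum>M\<in>contingency L H \<alpha> \<nu>. card {h \<in> colourings B (L \<times> H) (\<lambda>x. int (M x)). \<forall>s\<in>B. h (\<sigma> s) = h s})"
    if \<sigma>: "\<sigma> permutes B" for \<sigma>
  proof -
    let ?F = "\<lambda>A \<alpha>. {f \<in> colourings B A \<alpha>. \<forall>s\<in>B. f (\<sigma> s) = f s}"
    let ?Z = "\<lambda>M. {h \<in> colourings B (L \<times> H) (\<lambda>x. int (M x)). \<forall>s\<in>B. h (\<sigma> s) = h s}"
    let ?U = "\<Union>M\<in>contingency L H \<alpha> \<nu>. ?Z M"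
    have inB: "s \<in> B \<Longrightarrow> \<sigma> s \<in> B" for s using \<sigma> by (simp add: permutes_in_image)
    have "bij_betw (\<lambda>h. (restrict (fst \<circ> h) B, restrict (snd \<circ> h) B)) ?U (?F L \<alpha> \<times> ?F H \<nu>)"
    proof (rule bij_betwI[where g = "\<lambda>(f, g). restrict (\<lambda>s. (f s, g s)) B"])
      show "(\<lambda>h. (restrict (fst \<circ> h) B, restrict (snd \<circ> h) B)) \<in> ?U \<rightarrow> ?F L \<alpha> \<times> ?F H \<nu>"
      proof
        fix h assume "h \<in> ?U"
        then obtain M where M: "M \<in> contingency L H \<alpha> \<nu>" and h: "h \<in> ?Z M" by auto
        have hP: "h \<in> B \<rightarrow>\<^sub>E L \<times> H" using h by (auto simp: colourings_def)
        have cM: "card {s\<in>B. h s = (i, j)} = M (i, j)" if "i \<in> L" "j \<in> H" for i j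
          using h that by (auto simp: colourings_def)
        have "int (card {s\<in>B. fst (h s) = i}) = \<alpha> i" if "i \<in> L" for i
          using card_pairs_sum[OF fin hP that] cM that M by (simp add: contingency_def)
        moreover have "int (card {s\<in>B. snd (h s) = j}) = \<nu> j" if "j \<in> H" for j
          using card_pairs_sum'[OF fin hP that] cM that M by (simp add: contingency_def)
        moreover have "{s\<in>B. restrict (fst \<circ> h) B s = i} = {s\<in>B. fst (h s) = i}" 
           "{s\<in>B. restrict (snd \<circ> h) B s = j} = {s\<in>B. snd (h s) = j}" for i j by auto
        ultimately show "(restrict (fst \<circ> h) B, restrict (snd \<circ> h) B) \<in> ?F L \<alpha> \<times> ?F H \<nu>"
          using hP h inB by (auto simp: colourings_def PiE_iff mem_Times_iff)
      qed
      show "(\<lambda>(f, g). restrict (\<lambda>s. (f s, g s)) B) \<in> ?F L \<alpha> \<times> ?F H \<nu> \<rightarrow> ?U"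
      proof (clarify)
        fix f g assume f: "f \<in> colourings B L \<alpha>" "\<forall>s\<in>B. f (\<sigma> s) = f s"
          and g: "g \<in> colourings B H \<nu>" "\<forall>s\<in>B. g (\<sigma> s) = g s"
        let ?h = "restrict (\<lambda>s. (f s, g s)) B"
        define M where "M = restrict (\<lambda>x. card {s\<in>B. ?h s = x}) (L \<times> H)"
        have hP: "?h \<in> B \<rightarrow>\<^sub>E L \<times> H" using f g by (auto simp: colourings_def PiE_iff)
        have sub: "{s\<in>B. fst (?h s) = i} = {s\<in>B. f s = i}" "{s\<in>B. snd (?h s) = j} = {s\<in>B. g s = j}" for i j by auto
        have "M \<in> contingency L H \<alpha> \<nu>"
          unfolding contingency_def
        proof (intro CollectI conjI ballI)
          show "M \<in> L \<times> H \<rightarrow>\<^sub>E UNIV" by (simp add: M_def)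
          fix i assume i: "i \<in> L"
          have "(\<Sum>j\<in>H. M (i, j)) = card {s\<in>B. fst (?h s) = i}"
            using card_pairs_sum[OF fin hP i] i by (simp add: M_def)
          then show "int (\<Sum>j\<in>H. M (i, j)) = \<alpha> i" unfolding sub using f i by (simp add: colourings_def)
        next
          fix j assume j: "j \<in> H"
          have "(\<Sum>i\<in>L. M (i, j)) = card {s\<in>B. snd (?h s) = j}"
            using card_pairs_sum'[OF fin hP j] j by (simp add: M_def)
          then show "int (\<Sum>i\<in>L. M (i, j)) = \<nu> j" unfolding sub using g j by (simp add: colourings_def)
        qed
        moreover have "?h \<in> ?Z M" using hP f g inB by (auto simp: colourings_def M_def)
        ultimately show "?h \<in> ?U" by blast
      qed
      show "(\<lambda>(f, g). restrict (\<lambda>s. (f s, g s)) B) (restrict (fst \<circ> h) B, restrict (snd \<circ> h) B) = h" if "h \<in> ?U" for h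
        using that by (auto simp: colourings_def fun_eq_iff PiE_iff extensional_def)
      show "(\<lambda>h. (restrict (fst \<circ> h) B, restrict (snd \<circ> h) B)) ((\<lambda>(f, g). restrict (\<lambda>s. (f s, g s)) B) y) = y" 
        if "y \<in> ?F L \<alpha> \<times> ?F H \<nu>" for y
        using that by (auto simp: colourings_def fun_eq_iff PiE_iff extensional_def)
    qed
    from bij_betw_same_card[OF this, symmetric]
    have "card (?F L \<alpha> \<times> ?F H \<nu>) = card ?U" .
    also have "\<dots> = (\<Sum>M\<in>contingency L H \<alpha> \<nu>. card (?Z M))"
    proof (rule card_UN_disjoint)
      show "finite (contingency L H \<alpha> \<nu>)" using finite_contingency fin by blast
      show "\<forall>M\<in>contingency L H \<alpha> \<nu>. finite (?Z M)" using finite_colourings[of B "L \<times> H"] fin by auto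
      show "\<forall>M\<in>contingency L H \<alpha> \<nu>. \<forall>M'\<in>contingency L H \<alpha> \<nu>. M \<noteq> M' \<longrightarrow> ?Z M \<inter> ?Z M' = {}"
      proof (intro ballI impI)
        fix M M' assume MM: "M \<in> contingency L H \<alpha> \<nu>" "M' \<in> contingency L H \<alpha> \<nu>" "M \<noteq> M'"
        have "M = M'" if "\<And>x. x \<in> L \<times> H \<Longrightarrow> M x = M' x"
          using PiE_ext[of M "L \<times> H" "\<lambda>_. UNIV" M'] that MM(1,2) by (simp add: contingency_def)
        with MM(3) obtain x where x: "x \<in> L \<times> H" "M x \<noteq> M' x" by blast
        have "h \<notin> ?Z M'" if "h \<in> ?Z M" for h
        proof
          assume "h \<in> ?Z M'"
          with that x have "int (card {s\<in>B. h s = x}) = int (M x)" "int (card {s\<in>B. h s = x}) = int (M' x)"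
            unfolding colourings_def by blast+
          with x show False by simp
        qed
        then show "?Z M \<inter> ?Z M' = {}" by blast
      qed
    qed
    finally show ?thesis by (simp add: card_cartesian_product)
  qed
  then have "(\<Sum>\<sigma> | \<sigma> permutes B. card {f \<in> colourings B L \<alpha>. \<forall>s\<in>B. f (\<sigma> s) = f s} *
            card {f \<in> colourings B H \<nu>. \<forall>s\<in>B. f (\<sigma> s) = f s})
     = (\<Sum>\<sigma> | \<sigma> permutes B. \<Sum>M\<in>contingency L H \<alpha> \<nu>. card {h \<in> colourings B (L \<times> H) (\<lambda>x. int (M x)). \<forall>s\<in>B. h (\<sigma> s) = h s})"
    by (intro sum.cong) auto
  also have "\<dots> = (\<Sum>M\<in>contingency L H \<alpha> \<nu>. \<Sum>\<sigma> | \<sigma> permutes B. card {h \<in> colourings B (L \<times> H) (\<lambda>x. int (M x)). \<forall>s\<in>B. h (\<sigma> s) = h s})"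
    by (rule sum.swap)
  also have "\<dots> = (\<Sum>M\<in>contingency L H \<alpha> \<nu>. fact (card B))"
  proof (rule sum.cong[OF refl])
    fix M assume M: "M \<in> contingency L H \<alpha> \<nu>"
    have "(\<Sum>x\<in>L \<times> H. int (M x)) = (\<Sum>i\<in>L. \<Sum>j\<in>H. int (M (i, j)))"
      by (simp add: sum.cartesian_product)
    also have "\<dots> = int (card B)" using M tot by (simp add: contingency_def)
    finally show "(\<Sum>\<sigma> | \<sigma> permutes B. card {h \<in> colourings B (L \<times> H) (\<lambda>x. int (M x)). \<forall>s\<in>B. h (\<sigma> s) = h s}) = fact (card B)"
      using fin by (intro orbit_count) auto
  qed
  finally show ?thesis by simp
qed

definition compositions :: "'b set \<Rightarrow> int \<Rightarrow> ('b \<Rightarrow> nat) set" where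
  "compositions L r = {\<beta> \<in> L \<rightarrow>\<^sub>E UNIV. int (\<Sum>i\<in>L. \<beta> i) = r}"

lemma finite_compositions:
  assumes "finite L"
  shows "finite (compositions L r)"
proof (rule finite_subset)
  show "compositions L r \<subseteq> L \<rightarrow>\<^sub>E {..nat r}"
  proof
    fix \<beta> assume b: "\<beta> \<in> compositions L r"
    have "\<beta> i \<le> nat r" if "i \<in> L" for i
      using member_le_sum[of i L \<beta>] assms that b unfolding compositions_def by (auto simp del: of_nat_sum)
    then show "\<beta> \<in> L \<rightarrow>\<^sub>E {..nat r}" using b by (auto simp: compositions_def PiE_iff)
  qed
qed (use assms in \<open>simp add: finite_PiE\<close>)

lemma contingency_cong:
  assumes "\<And>i. i \<in> L \<Longrightarrow> \<alpha> i = \<alpha>' i" "\<And>j. j \<in> H \<Longrightarrow> \<nu> j = \<nu>' j"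
  shows "contingency L H \<alpha> \<nu> = contingency L H \<alpha>' \<nu>'"
  unfolding contingency_def using assms by auto

text \<open>Column \<open>k\<close> is recorded as \<beta> and deleted. On products of complete
  symmetric functions this is skewing by the complete function of degree \<nu> k.\<close>

lemma card_contingency_insert:
  assumes "finite L" "finite H" "k \<notin> H"
  shows "card (contingency L (insert k H) \<alpha> \<nu>)
    = (\<Sum>\<beta>\<in>compositions L (\<nu> k). card (contingency L H (\<lambda>i. \<alpha> i - int (\<beta> i)) \<nu>))"
proof -
  let ?C = "contingency L (insert k H) \<alpha> \<nu>"
  let ?D = "\<lambda>\<beta>. contingency L H (\<lambda>i. \<alpha> i - int (\<beta> i)) \<nu>"
  have "bij_betw (\<lambda>M. (restrict (\<lambda>i. M (i, k)) L, restrict M (L \<times> H))) ?C (Sigma (compositions L (\<nu> k)) ?D)"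
  proof (rule bij_betwI[where g = "\<lambda>(\<beta>, M). restrict (\<lambda>(i, j). if j = k then \<beta> i else M (i, j)) (L \<times> insert k H)"])
    show "(\<lambda>M. (restrict (\<lambda>i. M (i, k)) L, restrict M (L \<times> H))) \<in> ?C \<rightarrow> Sigma (compositions L (\<nu> k)) ?D"
    proof
      fix M assume M: "M \<in> ?C"
      have "restrict (\<lambda>i. M (i, k)) L \<in> compositions L (\<nu> k)"
        using M by (simp add: compositions_def contingency_def)
      moreover have "restrict M (L \<times> H) \<in> ?D (restrict (\<lambda>i. M (i, k)) L)"
        unfolding contingency_def
      proof (intro CollectI conjI ballI)
        fix i assume "i \<in> L"
        then have "int (\<Sum>j\<in>insert k H. M (i, j)) = \<alpha> i" using M by (simp add: contingency_def)
        then show "int (\<Sum>j\<in>H. restrict M (L \<times> H) (i, j)) = \<alpha> i - int (restrict (\<lambda>i. M (i, k)) L i)"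
          using assms \<open>i \<in> L\<close> by simp
      next
        fix j assume "j \<in> H"
        then have "int (\<Sum>i\<in>L. M (i, j)) = \<nu> j" using M by (simp add: contingency_def)
        then show "int (\<Sum>i\<in>L. restrict M (L \<times> H) (i, j)) = \<nu> j" using \<open>j \<in> H\<close> by simp
      qed auto
      ultimately show "(restrict (\<lambda>i. M (i, k)) L, restrict M (L \<times> H)) \<in> Sigma (compositions L (\<nu> k)) ?D" by blast
    qed
    show "(\<lambda>(\<beta>, M). restrict (\<lambda>(i, j). if j = k then \<beta> i else M (i, j)) (L \<times> insert k H))
      \<in> Sigma (compositions L (\<nu> k)) ?D \<rightarrow> ?C"
    proof clarify
      fix \<beta> M assume b: "\<beta> \<in> compositions L (\<nu> k)" and M: "M \<in> ?D \<beta>"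
      let ?M = "restrict (\<lambda>(i, j). if j = k then \<beta> i else M (i, j)) (L \<times> insert k H)"
      show "?M \<in> ?C"
        unfolding contingency_def
      proof (intro CollectI conjI ballI)
        fix i assume i: "i \<in> L"
        have "(\<Sum>j\<in>H. ?M (i, j)) = (\<Sum>j\<in>H. M (i, j))" using i assms by (intro sum.cong) auto
        moreover have "int (\<Sum>j\<in>H. M (i, j)) = \<alpha> i - int (\<beta> i)" using M i by (simp add: contingency_def)
        ultimately show "int (\<Sum>j\<in>insert k H. ?M (i, j)) = \<alpha> i"
          using assms i by simp
      next
        fix j assume j: "j \<in> insert k H"
        show "int (\<Sum>i\<in>L. ?M (i, j)) = \<nu> j"
        proof (cases "j = k")
          case True
          then show ?thesis using b by (simp add: compositions_def)
        next
          case False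
          then have "(\<Sum>i\<in>L. ?M (i, j)) = (\<Sum>i\<in>L. M (i, j))" using j by (intro sum.cong) auto
          then show ?thesis using M j False by (simp add: contingency_def)
        qed
      qed auto
    qed
    show "(\<lambda>(\<beta>, M). restrict (\<lambda>(i, j). if j = k then \<beta> i else M (i, j)) (L \<times> insert k H))
        (restrict (\<lambda>i. M (i, k)) L, restrict M (L \<times> H)) = M" if "M \<in> ?C" for M
    proof -
      have "M \<in> extensional (L \<times> insert k H)" using that by (auto simp: contingency_def PiE_def)
      then show ?thesis by (auto simp: fun_eq_iff extensional_def restrict_def)
    qed
    show "(\<lambda>M. (restrict (\<lambda>i. M (i, k)) L, restrict M (L \<times> H)))
      ((\<lambda>(\<beta>, M). restrict (\<lambda>(i, j). if j = k then \<beta> i else M (i, j)) (L \<times> insert k H)) y) = y"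
      if "y \<in> Sigma (compositions L (\<nu> k)) ?D" for y
    proof -
      obtain \<beta> M where y: "y = (\<beta>, M)" by force
      have "\<beta> \<in> extensional L" "M \<in> extensional (L \<times> H)"
        using that y by (auto simp: compositions_def contingency_def PiE_def)
      then show ?thesis using assms(3) by (auto simp: y fun_eq_iff extensional_def restrict_def)
    qed
  qed
  from bij_betw_same_card[OF this] show ?thesis
    using finite_compositions assms finite_contingency by (subst card_SigmaI[symmetric]) auto
qed

section \<open>Alternating sums and column operations\<close>

lemma sum_sign_reverse_zero:
  fixes F :: "'a \<Rightarrow> int"
  assumes "\<And>x. x \<in> X \<Longrightarrow> \<phi> x \<in> X" "\<And>x. x \<in> X \<Longrightarrow> \<phi> (\<phi> x) = x" "\<And>x. x \<in> X \<Longrightarrow> F (\<phi> x) = - F x"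
  shows "sum F X = 0"
proof -
  have "sum F X = sum (\<lambda>x. F (\<phi> x)) X"
    by (rule sum.reindex_bij_witness[of _ \<phi> \<phi>]) (use assms in auto)
  also have "\<dots> = - sum F X" using assms(3) by (simp add: sum_negf)
  finally show ?thesis by simp
qed

text \<open>If \<open>c\<close> is read as the product of complete symmetric functions with the
  given indices, this is the determinant with entries h of index \<kappa> i + g j. Column operations
  then act on \<open>g\<close> alone.\<close>

definition alternant :: "nat set \<Rightarrow> (nat \<Rightarrow> int) \<Rightarrow> ((nat \<Rightarrow> int) \<Rightarrow> int) \<Rightarrow> (nat \<Rightarrow> int) \<Rightarrow> int" where
  "alternant L \<kappa> c g = (\<Sum>w | w permutes L. sign w * c (\<lambda>i. \<kappa> i + g (w i)))"

lemma alternant_swap: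
  assumes "finite L" "a \<in> L" "b \<in> L" "a \<noteq> b"
  shows "alternant L \<kappa> c (g \<circ> Transposition.transpose a b) = - alternant L \<kappa> c g"
proof -
  have t: "Transposition.transpose a b permutes L" using assms by (simp add: permutes_swap_id)
  have "alternant L \<kappa> c (g \<circ> Transposition.transpose a b)
    = (\<Sum>w | w permutes L. sign (Transposition.transpose a b \<circ> w) * c (\<lambda>i. \<kappa> i + (g \<circ> Transposition.transpose a b) ((Transposition.transpose a b \<circ> w) i)))"
    unfolding alternant_def by (rule setum_permutations_compose_left[OF t])
  also have "\<dots> = (\<Sum>w | w permutes L. - (sign w * c (\<lambda>i. \<kappa> i + g (w i))))"
  proof (rule sum.cong[OF refl])
    fix w assume "w \<in> {w. w permutes L}"
    then have "permutation w" "permutation (Transposition.transpose a b)"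
      using assms(1) t permutation_permutes by blast+
    then show "sign (Transposition.transpose a b \<circ> w) * c (\<lambda>i. \<kappa> i + (g \<circ> Transposition.transpose a b) ((Transposition.transpose a b \<circ> w) i)) = - (sign w * c (\<lambda>i. \<kappa> i + g (w i)))"
      using assms(4) by (simp add: sign_compose sign_swap_id)
  qed
  finally show ?thesis by (simp add: alternant_def sum_negf)
qed

lemma alternant_cong:
  assumes "\<And>j. j \<in> L \<Longrightarrow> g j = g' j" "\<And>f f'. (\<And>i. i \<in> L \<Longrightarrow> f i = f' i) \<Longrightarrow> c f = c f'"
  shows "alternant L \<kappa> c g = alternant L \<kappa> c g'"
  unfolding alternant_def
proof (rule sum.cong[OF refl])
  fix w assume w: "w \<in> {w. w permutes L}"
  have "c (\<lambda>i. \<kappa> i + g (w i)) = c (\<lambda>i. \<kappa> i + g' (w i))"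
    by (rule assms(2)) (use w assms(1) permutes_in_image in fastforce)
  then show "sign w * c (\<lambda>i. \<kappa> i + g (w i)) = sign w * c (\<lambda>i. \<kappa> i + g' (w i))" by simp
qed

text \<open>In determinantal terms: in \<open>det (h\<^bsub>\<kappa> i - i + j\<^esub>)\<close> the skewing operator \<open>h\<^sub>r\<^sup>\<bottom>\<close> only needs to act on
  the first column, the other contributions cancel by column operations.\<close>

lemma alternant_skew:
  fixes k l :: nat
  assumes kl: "k \<le> l" and r: "0 \<le> r"
    and c: "\<And>f f'. (\<And>i. i \<in> {k..l} \<Longrightarrow> f i = f' i) \<Longrightarrow> c f = c f'"
  shows "(\<Sum>\<gamma>\<in>compositions {k..l} r. alternant {k..l} \<kappa> c (\<lambda>j. int j - int (\<gamma> j)))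
    = alternant {k..l} \<kappa> c (\<lambda>j. if j = k then int k - r else int j)"
proof -
  let ?L = "{k..l}"
  let ?F = "\<lambda>\<gamma>. alternant ?L \<kappa> c (\<lambda>j. int j - int (\<gamma> j))"
  define \<gamma>0 where "\<gamma>0 = (\<lambda>j\<in>?L. if j = k then nat r else 0)"
  have g0: "\<gamma>0 \<in> compositions ?L r"
    using kl r by (simp add: compositions_def \<gamma>0_def flip: of_nat_sum)
  define X where "X = compositions ?L r - {\<gamma>0}"
  define m where "m \<gamma> = Max {j\<in>?L. k < j \<and> 0 < \<gamma> j}" for \<gamma> :: "nat \<Rightarrow> nat"
  \<comment> \<open>With m = \<open>m \<gamma>\<close>, the last lowered column beyond
    \<open>k\<close>, this exchanges the values of j - \<gamma>(j) at m - 1 and m: (m-1) -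
    (\<gamma>(m) - 1) = m - \<gamma>(m), and m - (\<gamma>(m-1) + 1) = (m-1) - \<gamma>(m-1). The
    determinant changes sign while m stays the last lowered column, so this is a sign-reversing
    involution.\<close>
  define \<phi> where "\<phi> \<gamma> = \<gamma>(m \<gamma> - 1 := \<gamma> (m \<gamma>) - 1, m \<gamma> := \<gamma> (m \<gamma> - 1) + 1)" for \<gamma>
  have ex: "\<exists>j\<in>?L. k < j \<and> 0 < \<gamma> j" if "\<gamma> \<in> X" for \<gamma>
  proof (rule ccontr)
    assume *: "\<not> ?thesis"
    have z: "\<gamma> j = 0" if "j \<in> ?L" "j \<noteq> k" for j using * that by force
    have "int (\<Sum>i\<in>?L. \<gamma> i) = r" using that by (simp add: X_def compositions_def)
    moreover have "(\<Sum>i\<in>?L. \<gamma> i) = (\<Sum>i\<in>?L. if i = k then \<gamma> k else 0)" using z by (intro sum.cong) auto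
    ultimately have "\<gamma> k = nat r" using kl by simp
    then have "\<gamma> = \<gamma>0" using z that
      by (auto simp: X_def compositions_def \<gamma>0_def fun_eq_iff PiE_iff extensional_def)
    then show False using that by (simp add: X_def)
  qed
  have m: "m \<gamma> \<in> ?L \<and> k < m \<gamma> \<and> 0 < \<gamma> (m \<gamma>)" if "\<gamma> \<in> X" for \<gamma>
  proof -
    have "{j\<in>?L. k < j \<and> 0 < \<gamma> j} \<noteq> {}" using ex[OF that] by blast
    from Max_in[OF _ this] show ?thesis unfolding m_def by simp
  qed
  have mmax: "\<gamma> j = 0" if "\<gamma> \<in> X" "j \<in> ?L" "m \<gamma> < j" for \<gamma> j
    using Max_ge[of "{j\<in>?L. k < j \<and> 0 < \<gamma> j}" j] m[OF that(1)] that unfolding m_def by fastforce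
  have phiX: "\<phi> \<gamma> \<in> X" and mphi: "m (\<phi> \<gamma>) = m \<gamma>" if g: "\<gamma> \<in> X" for \<gamma>
  proof -
    let ?m = "m \<gamma>"
    have mm: "?m \<in> ?L" "?m - 1 \<in> ?L" "?m - 1 \<noteq> ?m" "0 < \<gamma> ?m" "k < ?m" using m[OF g] by auto
    have "(\<Sum>i\<in>?L. \<phi> \<gamma> i) = (\<Sum>i\<in>?L - {?m, ?m - 1}. \<phi> \<gamma> i) + (\<phi> \<gamma> ?m + \<phi> \<gamma> (?m - 1))"
      using mm by (subst sum.subset_diff[of "{?m, ?m - 1}"]) auto
    also have "(\<Sum>i\<in>?L - {?m, ?m - 1}. \<phi> \<gamma> i) = (\<Sum>i\<in>?L - {?m, ?m - 1}. \<gamma> i)"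
      by (intro sum.cong) (auto simp: \<phi>_def)
    also have "\<phi> \<gamma> ?m + \<phi> \<gamma> (?m - 1) = \<gamma> ?m + \<gamma> (?m - 1)"
      using mm by (auto simp: \<phi>_def)
    also have "(\<Sum>i\<in>?L - {?m, ?m - 1}. \<gamma> i) + (\<gamma> ?m + \<gamma> (?m - 1)) = (\<Sum>i\<in>?L. \<gamma> i)"
      using mm sum.subset_diff[of "{?m, ?m - 1}" ?L \<gamma>] by auto
    finally have "(\<Sum>i\<in>?L. \<phi> \<gamma> i) = (\<Sum>i\<in>?L. \<gamma> i)" .
    moreover have "\<phi> \<gamma> \<in> ?L \<rightarrow>\<^sub>E UNIV"
      using g mm by (auto simp: X_def compositions_def \<phi>_def PiE_iff extensional_def)
    ultimately have comp: "\<phi> \<gamma> \<in> compositions ?L r"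
      using g by (simp add: X_def compositions_def del: of_nat_sum)
    have "\<phi> \<gamma> ?m > 0" by (simp add: \<phi>_def)
    moreover have "\<gamma>0 ?m = 0" using mm by (simp add: \<gamma>0_def)
    ultimately have "\<phi> \<gamma> \<noteq> \<gamma>0" by auto
    with comp show "\<phi> \<gamma> \<in> X" by (simp add: X_def)
    show "m (\<phi> \<gamma>) = ?m"
      unfolding m_def[of "\<phi> \<gamma>"]
    proof (rule Max_eqI)
      show "?m \<in> {j\<in>?L. k < j \<and> 0 < \<phi> \<gamma> j}" using mm by (auto simp: \<phi>_def)
      fix y assume y: "y \<in> {j\<in>?L. k < j \<and> 0 < \<phi> \<gamma> j}"
      show "y \<le> ?m"
      proof (rule ccontr)
        assume "\<not> y \<le> ?m"
        then have "y \<noteq> ?m" "y \<noteq> ?m - 1" by auto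
        then have "\<phi> \<gamma> y = \<gamma> y" by (simp add: \<phi>_def)
        moreover have "\<gamma> y = 0" using y mmax[OF g, of y] \<open>\<not> y \<le> ?m\<close> by simp
        ultimately have "\<phi> \<gamma> y = 0" by simp
        then show False using y by simp
      qed
    qed simp
  qed
  have "sum ?F X = 0"
  proof (rule sum_sign_reverse_zero[where \<phi> = \<phi>])
    fix \<gamma> assume g: "\<gamma> \<in> X"
    let ?m = "m \<gamma>"
    have mm: "?m \<in> ?L" "?m - 1 \<in> ?L" "?m - 1 \<noteq> ?m" "0 < \<gamma> ?m" "k < ?m" using m[OF g] by auto
    show "\<phi> \<gamma> \<in> X" by (rule phiX[OF g])
    show "\<phi> (\<phi> \<gamma>) = \<gamma>"
      using mm mphi[OF g] by (auto simp: \<phi>_def[of "\<phi> \<gamma>"] fun_eq_iff) (auto simp: \<phi>_def)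
    have "?F (\<phi> \<gamma>) = alternant ?L \<kappa> c ((\<lambda>j. int j - int (\<gamma> j)) \<circ> Transposition.transpose (?m - 1) ?m)"
      by (rule alternant_cong[OF _ c]) (use mm in \<open>auto simp: \<phi>_def transpose_def of_nat_diff\<close>)
    then show "?F (\<phi> \<gamma>) = - ?F \<gamma>" using alternant_swap[of ?L "?m - 1" ?m] mm by simp
  qed
  then have "sum ?F (compositions ?L r) = ?F \<gamma>0"
    using g0 finite_compositions[of ?L r] unfolding X_def by (simp add: sum_diff1)
  also have "\<dots> = alternant ?L \<kappa> c (\<lambda>j. if j = k then int k - r else int j)"
    by (rule alternant_cong[OF _ c]) (use r in \<open>auto simp: \<gamma>0_def\<close>)
  finally show ?thesis .
qed


section \<open>Pairing the determinant with a Young character\<close>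

lemma compositions_comp:
  assumes "w permutes L" "\<beta> \<in> compositions L r"
  shows "\<beta> \<circ> w \<in> compositions L r"
proof -
  have "(\<Sum>i\<in>L. \<beta> (w i)) = (\<Sum>i\<in>L. \<beta> i)"
    using sum.permute[OF assms(1), of \<beta>] by (simp add: o_def)
  then show ?thesis using assms permutes_in_image[OF assms(1)]
    by (auto simp: compositions_def PiE_iff extensional_def permutes_not_in simp del: of_nat_sum)
qed

text \<open>For k = 1 and a partition \<kappa> with \<open>l\<close> parts this is the Kostka number
  of shape \<kappa> and content \<nu>. The lower bound \<open>k\<close> marks the rows and columns
  that have not yet been peeled off.\<close>

definition skew_pairing :: "nat \<Rightarrow> nat \<Rightarrow> nat \<Rightarrow> (nat \<Rightarrow> int) \<Rightarrow> (nat \<Rightarrow> int) \<Rightarrow> int" where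
  "skew_pairing k l h \<kappa> \<nu> = (\<Sum>w | w permutes {k..l}. sign w *
     int (card (contingency {k..l} {k..h} (\<lambda>i. \<kappa> i - int i + int (w i)) \<nu>)))"

text \<open>Deleting column \<open>k\<close> lowers row i by \<beta> i. Substituting
  \<open>\<beta> \<circ> w\<close> for \<beta> makes the loss a function of the determinant column w
  i, and \<open>alternant_skew\<close> concentrates it in column \<open>k\<close>.\<close>

lemma skew_pairing_first_column:
  assumes kl: "k \<le> l" and kh: "k \<le> h" and r: "0 \<le> \<nu> k"
  shows "skew_pairing k l h \<kappa> \<nu> = (\<Sum>w | w permutes {k..l}. sign w *
     int (card (contingency {k..l} {Suc k..h}
       (\<lambda>i. \<kappa> i - int i + (if w i = k then int k - \<nu> k else int (w i))) \<nu>)))"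
proof -
  let ?L = "{k..l}" and ?H = "{Suc k..h}"
  let ?c = "\<lambda>\<alpha>. int (card (contingency ?L ?H \<alpha> \<nu>))"
  have H: "{k..h} = insert k ?H" using kh by auto
  have "skew_pairing k l h \<kappa> \<nu> = (\<Sum>w | w permutes ?L. sign w *
     (\<Sum>\<beta>\<in>compositions ?L (\<nu> k). ?c (\<lambda>i. \<kappa> i - int i + int (w i) - int (\<beta> i))))"
    unfolding skew_pairing_def H by (subst card_contingency_insert) auto
  also have "\<dots> = (\<Sum>w | w permutes ?L. \<Sum>\<beta>\<in>compositions ?L (\<nu> k).
      sign w * ?c (\<lambda>i. \<kappa> i - int i + (int (w i) - int (\<beta> (w i)))))"
  proof (rule sum.cong[OF refl])
    fix w assume w: "w \<in> {w. w permutes ?L}"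
    then have w': "w permutes ?L" by simp
    have "(\<Sum>\<beta>\<in>compositions ?L (\<nu> k). ?c (\<lambda>i. \<kappa> i - int i + int (w i) - int (\<beta> i)))
       = (\<Sum>\<beta>\<in>compositions ?L (\<nu> k). ?c (\<lambda>i. \<kappa> i - int i + (int (w i) - int (\<beta> (w i)))))"
      by (rule sum.reindex_bij_witness[of _ "\<lambda>\<beta>. \<beta> \<circ> w" "\<lambda>\<beta>. \<beta> \<circ> inv w"])
        (use w' in \<open>auto simp: compositions_comp permutes_inv fun_eq_iff permutes_inverses algebra_simps\<close>)
    then show "sign w * (\<Sum>\<beta>\<in>compositions ?L (\<nu> k). ?c (\<lambda>i. \<kappa> i - int i + int (w i) - int (\<beta> i)))
      = (\<Sum>\<beta>\<in>compositions ?L (\<nu> k). sign w * ?c (\<lambda>i. \<kappa> i - int i + (int (w i) - int (\<beta> (w i)))))"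
      by (simp add: sum_distrib_left)
  qed
  also have "\<dots> = (\<Sum>\<gamma>\<in>compositions ?L (\<nu> k). alternant ?L (\<lambda>i. \<kappa> i - int i) ?c (\<lambda>j. int j - int (\<gamma> j)))"
    unfolding alternant_def by (rule sum.swap)
  also have "\<dots> = alternant ?L (\<lambda>i. \<kappa> i - int i) ?c (\<lambda>j. if j = k then int k - \<nu> k else int j)"
    by (rule alternant_skew[OF kl r]) (metis contingency_cong)
  finally show ?thesis by (simp add: alternant_def)
qed

lemma contingency_negative: "i \<in> L \<Longrightarrow> \<alpha> i < 0 \<Longrightarrow> contingency L H \<alpha> \<nu> = {}"
  by (force simp: contingency_def simp flip: of_nat_sum)

text \<open>The row i with w i = k satisfies i \<ge> k, so its margin is at most \<kappa> k - \<nu>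
  k < 0 and every term counts an empty set.\<close>

lemma skew_pairing_too_long:
  assumes kl: "k \<le> l" and kh: "k \<le> h" and dec: "\<And>i. i \<in> {k..l} \<Longrightarrow> \<kappa> i \<le> \<kappa> k"
    and pos: "0 \<le> \<kappa> k" and gt: "\<kappa> k < \<nu> k"
  shows "skew_pairing k l h \<kappa> \<nu> = 0"
proof -
  have z: "0 \<le> \<nu> k" using pos gt by simp
  show ?thesis unfolding skew_pairing_first_column[where \<nu> = \<nu>, OF kl kh z]
  proof (rule sum.neutral, rule ballI)
    fix w assume "w \<in> {w. w permutes {k..l}}"
    then have w: "w permutes {k..l}" by simp
    define i where "i = inv w k"
    have "w i = k" "i \<in> {k..l}" using w kl permutes_in_image[OF permutes_inv[OF w], of k]
      unfolding i_def by (auto simp: permutes_inverses)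
    then have "contingency {k..l} {Suc k..h}
       (\<lambda>i. \<kappa> i - int i + (if w i = k then int k - \<nu> k else int (w i))) \<nu> = {}"
      using dec[of i] gt by (intro contingency_negative[of i]) auto
    then show "sign w * int (card (contingency {k..l} {Suc k..h}
       (\<lambda>i. \<kappa> i - int i + (if w i = k then int k - \<nu> k else int (w i))) \<nu>)) = 0" by simp
  qed
qed

lemma card_contingency_zero_row:
  assumes "finite L" "finite H" "k \<notin> L" "\<alpha> k = 0"
  shows "card (contingency (insert k L) H \<alpha> \<nu>) = card (contingency L H \<alpha> \<nu>)"
proof -
  have "bij_betw (\<lambda>M. restrict M (L \<times> H)) (contingency (insert k L) H \<alpha> \<nu>) (contingency L H \<alpha> \<nu>)"
  proof (rule bij_betwI[where g = "\<lambda>M. restrict (\<lambda>(i, j). if i = k then 0 else M (i, j)) (insert k L \<times> H)"])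
    have zero: "M (k, j) = 0" if "M \<in> contingency (insert k L) H \<alpha> \<nu>" "j \<in> H" for M j
    proof -
      have "int (\<Sum>j\<in>H. M (k, j)) = 0" using that assms(4) by (simp add: contingency_def del: of_nat_sum)
      then have "(\<Sum>j\<in>H. M (k, j)) = 0" by (simp only: of_nat_eq_0_iff)
      then show ?thesis using that assms(2) by simp
    qed
    show "(\<lambda>M. restrict M (L \<times> H)) \<in> contingency (insert k L) H \<alpha> \<nu> \<rightarrow> contingency L H \<alpha> \<nu>"
    proof
      fix M assume M: "M \<in> contingency (insert k L) H \<alpha> \<nu>"
      have 1: "int (\<Sum>j\<in>H. restrict M (L \<times> H) (i, j)) = \<alpha> i" if "i \<in> L" for i
        using M that by (simp add: contingency_def)
      have 2: "int (\<Sum>i\<in>L. restrict M (L \<times> H) (i, j)) = \<nu> j" if j: "j \<in> H" for j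
      proof -
        have "int (\<Sum>i\<in>insert k L. M (i, j)) = \<nu> j" using M j unfolding contingency_def by blast
        then show ?thesis using j assms zero[OF M j] by simp
      qed
      show "restrict M (L \<times> H) \<in> contingency L H \<alpha> \<nu>"
        unfolding contingency_def by (intro CollectI conjI ballI 1 2) auto
    qed
    show "(\<lambda>M. restrict (\<lambda>(i, j). if i = k then 0 else M (i, j)) (insert k L \<times> H))
      \<in> contingency L H \<alpha> \<nu> \<rightarrow> contingency (insert k L) H \<alpha> \<nu>"
    proof
      fix M assume M: "M \<in> contingency L H \<alpha> \<nu>"
      let ?M = "restrict (\<lambda>(i, j). if i = k then 0 else M (i, j)) (insert k L \<times> H)"
      have 1: "int (\<Sum>j\<in>H. ?M (i, j)) = \<alpha> i" if "i \<in> insert k L" for i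
      proof (cases "i = k")
        case False
        then have "(\<Sum>j\<in>H. ?M (i, j)) = (\<Sum>j\<in>H. M (i, j))" using that by (intro sum.cong) auto
        then show ?thesis using M that False by (simp add: contingency_def)
      qed (use assms in simp)
      have 2: "int (\<Sum>i\<in>insert k L. ?M (i, j)) = \<nu> j" if j: "j \<in> H" for j
      proof -
        have "(\<Sum>i\<in>L. ?M (i, j)) = (\<Sum>i\<in>L. M (i, j))" using j assms by (intro sum.cong) auto
        then show ?thesis using M j assms by (simp add: contingency_def)
      qed
      show "?M \<in> contingency (insert k L) H \<alpha> \<nu>"
        unfolding contingency_def by (intro CollectI conjI ballI 1 2) auto
    qed
    show "restrict (\<lambda>(i, j). if i = k then 0 else restrict M (L \<times> H) (i, j)) (insert k L \<times> H) = M"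
      if "M \<in> contingency (insert k L) H \<alpha> \<nu>" for M
    proof -
      have "M \<in> extensional (insert k L \<times> H)" using that by (auto simp: contingency_def PiE_def)
      then show ?thesis using zero[OF that] by (auto simp: fun_eq_iff extensional_def restrict_def)
    qed
    show "restrict (restrict (\<lambda>(i, j). if i = k then 0 else M (i, j)) (insert k L \<times> H)) (L \<times> H) = M"
      if "M \<in> contingency L H \<alpha> \<nu>" for M
    proof -
      have "M \<in> extensional (L \<times> H)" using that by (auto simp: contingency_def PiE_def)
      then show ?thesis using assms(3) by (auto simp: fun_eq_iff extensional_def restrict_def)
    qed
  qed
  from bij_betw_same_card[OF this] show ?thesis .
qed

lemma skew_pairing_peel:
  assumes kl: "k \<le> l" and kh: "k \<le> h" and dec: "\<And>i. i \<in> {k..l} \<Longrightarrow> \<kappa> i \<le> \<kappa> k"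
    and pos: "0 \<le> \<kappa> k" and eq: "\<nu> k = \<kappa> k"
  shows "skew_pairing k l h \<kappa> \<nu> = skew_pairing (Suc k) l h \<kappa> \<nu>"
proof -
  have z: "0 \<le> \<nu> k" using pos eq by simp
  let ?c = "\<lambda>w. contingency {k..l} {Suc k..h}
       (\<lambda>i. \<kappa> i - int i + (if w i = k then int k - \<nu> k else int (w i))) \<nu>"
  have L: "{k..l} = insert k {Suc k..l}" using kl by auto
  have sub: "{w. w permutes {Suc k..l}} \<subseteq> {w. w permutes {k..l}}"
    using permutes_subset[of _ "{Suc k..l}" "{k..l}"] by auto
  have "?c w = {}" if w: "w permutes {k..l}" and nw: "\<not> w permutes {Suc k..l}" for w
  proof -
    define i where "i = inv w k"
    have i: "w i = k" "i \<in> {k..l}" using w kl permutes_in_image[OF permutes_inv[OF w], of k]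
      unfolding i_def by (auto simp: permutes_inverses)
    have "i \<noteq> k"
    proof
      assume "i = k"
      with i have "w k = k" by simp
      then have "w permutes {Suc k..l}" using w by (intro permutes_superset[OF w]) (auto simp: not_less_eq_eq dest: le_antisym)
      with nw show False ..
    qed
    then show ?thesis using i dec[of i] eq by (intro contingency_negative[of i]) auto
  qed
  then have "skew_pairing k l h \<kappa> \<nu> = (\<Sum>w | w permutes {Suc k..l}. sign w * int (card (?c w)))"
    unfolding skew_pairing_first_column[where \<nu> = \<nu>, OF kl kh z]
    by (intro sum.mono_neutral_right finite_permutations sub) auto
  also have "\<dots> = skew_pairing (Suc k) l h \<kappa> \<nu>"
    unfolding skew_pairing_def
  proof (rule sum.cong[OF refl])
    fix w assume "w \<in> {w. w permutes {Suc k..l}}"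
    then have w: "w permutes {Suc k..l}" by simp
    then have "w k = k" by (simp add: permutes_not_in)
    then have "card (?c w) = card (contingency {Suc k..l} {Suc k..h}
       (\<lambda>i. \<kappa> i - int i + (if w i = k then int k - \<nu> k else int (w i))) \<nu>)"
      unfolding L using eq by (intro card_contingency_zero_row) auto
    also have "contingency {Suc k..l} {Suc k..h}
       (\<lambda>i. \<kappa> i - int i + (if w i = k then int k - \<nu> k else int (w i))) \<nu>
      = contingency {Suc k..l} {Suc k..h} (\<lambda>i. \<kappa> i - int i + int (w i)) \<nu>"
    proof (rule contingency_cong)
      fix i assume "i \<in> {Suc k..l}"
      then have "w i \<in> {Suc k..l}" using permutes_in_image[OF w] by blast
      then show "\<kappa> i - int i + (if w i = k then int k - \<nu> k else int (w i)) = \<kappa> i - int i + int (w i)" by auto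
    qed simp
    finally show "sign w * int (card (?c w)) = sign w * int (card (contingency {Suc k..l} {Suc k..h} (\<lambda>i. \<kappa> i - int i + int (w i)) \<nu>))"
      by simp
  qed
  finally show ?thesis .
qed

text \<open>Induction by removing the maximum, which is at least the cardinality. The equality case
  later pins down the column-injective colourings.\<close>

lemma sum_distinct_positive:
  fixes A :: "nat set"
  assumes "finite A" "0 \<notin> A"
  shows "\<Sum>{1..card A} \<le> \<Sum>A" and "\<Sum>A = \<Sum>{1..card A} \<Longrightarrow> A = {1..card A}"
proof -
  have "\<Sum>{1..card A} \<le> \<Sum>A \<and> (\<Sum>A = \<Sum>{1..card A} \<longrightarrow> A = {1..card A})"
    using assms
  proof (induction "card A" arbitrary: A)
    case 0
    then show ?case by simp
  next
    case (Suc c)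
    let ?M = "Max A" and ?B = "A - {Max A}"
    have M: "?M \<in> A" using Suc by (intro Max_in) auto
    have cB: "card ?B = c" using Suc M by simp
    have IH: "\<Sum>{1..c} \<le> \<Sum>?B" "\<Sum>?B = \<Sum>{1..c} \<Longrightarrow> ?B = {1..c}"
      using Suc.hyps(1)[of ?B] cB Suc.prems by auto
    have "A \<subseteq> {1..?M}" using Suc.prems by (auto simp: Suc_le_eq intro: gr0I)
    then have "card A \<le> ?M" using card_mono[of "{1..?M}" A] by simp
    then have le: "Suc c \<le> ?M" using Suc by simp
    have SA: "\<Sum>A = ?M + \<Sum>?B" using M Suc.prems by (simp add: sum.remove)
    have S1: "\<Sum>{1..card A} = Suc c + \<Sum>{1..c}" by (simp only: Suc.hyps(2)[symmetric]) simp
    show ?case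
    proof (intro conjI impI)
      show "\<Sum>{1..card A} \<le> \<Sum>A" using SA S1 IH le by linarith
      assume "\<Sum>A = \<Sum>{1..card A}"
      then have "?M = Suc c" "\<Sum>?B = \<Sum>{1..c}" using SA S1 IH le by linarith+
      then have "A = insert (Suc c) {1..c}" using IH M by (metis insert_Diff)
      also have "insert (Suc c) {1..c} = {1..Suc c}" by auto
      finally show "A = {1..card A}" by (simp only: Suc.hyps(2))
    qed
  qed
  then show "\<Sum>{1..card A} \<le> \<Sum>A" and "\<Sum>A = \<Sum>{1..card A} \<Longrightarrow> A = {1..card A}" by auto
qed

section \<open>Partitions and the orthonormality relations\<close>

abbreviation part :: "nat list \<Rightarrow> nat \<Rightarrow> int" where
  "part p i \<equiv> int (p ! (i - 1))"

lemma finite_partitions: "finite (partitions m)"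
proof (rule finite_subset)
  show "partitions m \<subseteq> {p. set p \<subseteq> {..m} \<and> length p \<le> m}"
  proof
    fix p assume p: "p \<in> partitions m"
    have "length p \<le> sum_list p" if "\<forall>x\<in>set p. 0 < x" for p :: "nat list"
      using that by (induction p) auto
    moreover have "x \<le> sum_list p" if "x \<in> set p" for x using that by (auto intro: member_le_sum_list)
    ultimately show "p \<in> {p. set p \<subseteq> {..m} \<and> length p \<le> m}" using p by (auto simp: partitions_def)
  qed
qed (rule finite_lists_length_le, simp)

lemma part_decreasing:
  assumes "p \<in> partitions m" "1 \<le> i" "i \<le> j" "j \<le> length p"
  shows "part p j \<le> part p i"
proof (cases "i = j")
  case False
  then have "i - 1 < j - 1" "j - 1 < length p" using assms by auto
  then show ?thesis using assms(1) by (auto simp: partitions_def sorted_wrt_iff_nth_less)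
qed simp

lemma sum_part: "(\<Sum>i\<in>{1..length p}. part p i) = int (sum_list p)"
proof -
  have "(\<Sum>i\<in>{1..length p}. part p i) = (\<Sum>i\<in>{0..<length p}. int (p ! i))"
    by (rule sum.reindex_bij_witness[of _ Suc "\<lambda>i. i - 1"]) auto
  then show ?thesis by (simp add: sum_list_sum_nth)
qed

lemma sum_shifted_part:
  assumes "w permutes {1..length p}"
  shows "(\<Sum>i\<in>{1..length p}. part p i - int i + int (w i)) = int (sum_list p)"
proof -
  have "(\<Sum>i\<in>{1..length p}. int (w i)) = (\<Sum>i\<in>{1..length p}. int i)"
    using sum.permute[OF assms, of int] by (simp add: o_def)
  then show ?thesis using sum_part[of p] by (simp add: sum.distrib sum_subtractf)
qed

text \<open>The differences w(i) - i sum to 0, so every shift keeps the total m and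
  \<open>colourings_inner\<close> applies to each term of the determinant.\<close>

lemma irr_char_young_inner:
  assumes p: "p \<in> partitions m"
  shows "(\<Sum>\<sigma> | \<sigma> permutes {1..m}. irr_char p \<sigma> * int (young_count m h \<sigma> \<nu>))
    = fact m * skew_pairing 1 (length p) h (part p) \<nu>"
proof -
  let ?S = "{\<sigma>. \<sigma> permutes {1..m}}" and ?W = "{w. w permutes {1..length p}}"
  let ?\<alpha> = "\<lambda>w i. part p i - int i + int (w i)"
  have sp: "sum_list p = m" using p by (simp add: partitions_def)
  have "(\<Sum>\<sigma>\<in>?S. irr_char p \<sigma> * int (young_count m h \<sigma> \<nu>))
     = (\<Sum>\<sigma>\<in>?S. \<Sum>w\<in>?W. sign w * int (young_count m (length p) \<sigma> (?\<alpha> w) * young_count m h \<sigma> \<nu>))"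
    unfolding irr_char_def sp sum_distrib_right by (simp add: mult.assoc)
  also have "\<dots> = (\<Sum>w\<in>?W. \<Sum>\<sigma>\<in>?S. sign w * int (young_count m (length p) \<sigma> (?\<alpha> w) * young_count m h \<sigma> \<nu>))"
    by (rule sum.swap)
  also have "\<dots> = (\<Sum>w\<in>?W. sign w * int (\<Sum>\<sigma>\<in>?S. young_count m (length p) \<sigma> (?\<alpha> w) * young_count m h \<sigma> \<nu>))"
    by (simp only: sum_distrib_left of_nat_sum)
  also have "\<dots> = (\<Sum>w\<in>?W. sign w * int (fact m * card (contingency {1..length p} {1..h} (?\<alpha> w) \<nu>)))"
  proof (rule sum.cong[OF refl])
    fix w assume "w \<in> ?W"
    then have "(\<Sum>i\<in>{1..length p}. ?\<alpha> w i) = int (card {1..m})" using sum_shifted_part[of w p] sp by simp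
    from colourings_inner[OF _ _ _ this, of "{1..h}" \<nu>]
    show "sign w * int (\<Sum>\<sigma>\<in>?S. young_count m (length p) \<sigma> (?\<alpha> w) * young_count m h \<sigma> \<nu>)
      = sign w * int (fact m * card (contingency {1..length p} {1..h} (?\<alpha> w) \<nu>))"
      by (simp add: young_count_colourings)
  qed
  finally show ?thesis by (simp add: skew_pairing_def sum_distrib_left mult.left_commute)
qed

lemma permutes_fixes_below_ge:
  assumes "w permutes {1..h::nat}" "\<And>i. i < k \<Longrightarrow> w i = i"
  shows "k \<le> w k"
proof (rule ccontr)
  assume "\<not> k \<le> w k"
  then have "w (w k) = w k" using assms(2) by simp
  then have "w k = k" using permutes_inj[OF assms(1)] by (auto dest: injD)
  then show False using \<open>\<not> k \<le> w k\<close> by simp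
qed

lemma skew_pairing_steps:
  assumes p: "p \<in> partitions m" and K: "1 \<le> K" "K \<le> Suc (length p)" "K \<le> Suc h"
    and eq: "\<And>i. 1 \<le> i \<Longrightarrow> i < K \<Longrightarrow> \<nu> i = part p i"
  shows "skew_pairing 1 (length p) h (part p) \<nu> = skew_pairing K (length p) h (part p) \<nu>"
  using K eq
proof (induction K rule: nat_induct_at_least)
  case base
  then show ?case by simp
next
  case (Suc K)
  have "skew_pairing 1 (length p) h (part p) \<nu> = skew_pairing K (length p) h (part p) \<nu>"
    using Suc by auto
  also have "\<dots> = skew_pairing (Suc K) (length p) h (part p) \<nu>"
    by (rule skew_pairing_peel) (use Suc part_decreasing[OF p] in auto)
  finally show ?case .
qed

text \<open>Peel the rows on which the margins agree; the first column longer than its row then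
  kills the rest. This is the vanishing half of the unitriangularity of Kostka numbers.\<close>

lemma skew_pairing_vanish:
  assumes p: "p \<in> partitions m" and K: "1 \<le> K" "K \<le> length p" "K \<le> h"
    and eq: "\<And>i. 1 \<le> i \<Longrightarrow> i < K \<Longrightarrow> \<nu> i = part p i" and gt: "part p K < \<nu> K"
  shows "skew_pairing 1 (length p) h (part p) \<nu> = 0"
proof -
  have "skew_pairing K (length p) h (part p) \<nu> = 0"
    by (rule skew_pairing_too_long) (use K gt part_decreasing[OF p] in auto)
  then show ?thesis using skew_pairing_steps[OF p, where \<nu> = \<nu>] K eq by simp
qed

text \<open>A shift raises the first part that it moves, because w(K) > K at the first moved index
  K. Hence the first excess occurs at K if K < D, and otherwise at D, where q is already
  larger.\<close>

lemma skew_pairing_less: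
  assumes p: "p \<in> partitions m" and D: "1 \<le> D" "D \<le> length p" "D \<le> length q"
    and eq: "\<And>i. 1 \<le> i \<Longrightarrow> i < D \<Longrightarrow> part p i = part q i" and lt: "part p D < part q D"
    and w: "w permutes {1..length q}"
  shows "skew_pairing 1 (length p) (length q) (part p) (\<lambda>i. part q i - int i + int (w i)) = 0"
proof (cases "\<exists>i<D. w i \<noteq> i")
  case True
  define K where "K = (LEAST i. w i \<noteq> i)"
  have K: "w K \<noteq> K" "\<And>i. i < K \<Longrightarrow> w i = i" "K < D"
  proof -
    show "w K \<noteq> K" unfolding K_def using True by (metis (mono_tags, lifting) LeastI)
    show "w i = i" if "i < K" for i using not_less_Least that unfolding K_def by blast
    obtain i where "i < D" "w i \<noteq> i" using True by blast
    then show "K < D" unfolding K_def by (meson Least_le le_less_trans)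
  qed
  have K1: "1 \<le> K" using K(1) permutes_not_in[OF w, of 0] by (cases K) auto
  have "K < w K" using permutes_fixes_below_ge[OF w K(2)] K(1) by (simp add: order.not_eq_order_implies_strict)
  then show ?thesis
    by (intro skew_pairing_vanish[OF p K1]) (use K K1 D eq in auto)
next
  case False
  then have "D \<le> w D" using permutes_fixes_below_ge[OF w] by simp
  then show ?thesis by (intro skew_pairing_vanish[OF p D(1)]) (use False D eq lt in auto)
qed

text \<open>For \<open>w \<noteq> id\<close> the first moved index gives an excess. For
  \<open>w = id\<close> all rows can be peeled, and exactly one empty table is left.\<close>

lemma skew_pairing_self:
  assumes p: "p \<in> partitions m" and w: "w permutes {1..length p}"
  shows "skew_pairing 1 (length p) (length p) (part p) (\<lambda>i. part p i - int i + int (w i)) = (if w = id then 1 else 0)"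
proof (cases "w = id")
  case True
  have "skew_pairing 1 (length p) (length p) (part p) (part p)
      = skew_pairing (Suc (length p)) (length p) (length p) (part p) (part p)"
    by (rule skew_pairing_steps[OF p]) auto
  also have "\<dots> = 1"
    by (simp add: skew_pairing_def contingency_def PiE_empty_domain)
  finally show ?thesis using True by simp
next
  case False
  then have ex: "\<exists>i. w i \<noteq> i" by (auto simp: fun_eq_iff)
  define K where "K = (LEAST i. w i \<noteq> i)"
  have K: "w K \<noteq> K" "\<And>i. i < K \<Longrightarrow> w i = i"
  proof -
    show "w K \<noteq> K" unfolding K_def using ex by (rule LeastI_ex)
    show "w i = i" if "i < K" for i using not_less_Least that unfolding K_def by blast
  qed
  have KL: "1 \<le> K" "K \<le> length p" using K(1) permutes_not_in[OF w, of K] by auto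
  have "K < w K" using permutes_fixes_below_ge[OF w K(2)] K(1) by (simp add: order.not_eq_order_implies_strict)
  then have "skew_pairing 1 (length p) (length p) (part p) (\<lambda>i. part p i - int i + int (w i)) = 0"
    by (intro skew_pairing_vanish[OF p KL(1)]) (use K KL in auto)
  then show ?thesis using False by (simp only: if_False)
qed

lemma irr_char_inner_expand:
  assumes p: "p \<in> partitions m" and q: "q \<in> partitions m"
  shows "(\<Sum>\<sigma> | \<sigma> permutes {1..m}. irr_char p \<sigma> * irr_char q \<sigma>)
    = (\<Sum>w | w permutes {1..length q}. sign w * (fact m *
        skew_pairing 1 (length p) (length q) (part p) (\<lambda>i. part q i - int i + int (w i))))"
proof -
  have sq: "sum_list q = m" using q by (simp add: partitions_def)
  have "(\<Sum>\<sigma> | \<sigma> permutes {1..m}. irr_char p \<sigma> * irr_char q \<sigma>)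
    = (\<Sum>\<sigma> | \<sigma> permutes {1..m}. \<Sum>w | w permutes {1..length q}. sign w * (irr_char p \<sigma> *
         int (young_count m (length q) \<sigma> (\<lambda>i. part q i - int i + int (w i)))))"
    unfolding irr_char_def[of q] sq sum_distrib_left by (simp add: mult.left_commute)
  also have "\<dots> = (\<Sum>w | w permutes {1..length q}. sign w * (\<Sum>\<sigma> | \<sigma> permutes {1..m}. irr_char p \<sigma> *
         int (young_count m (length q) \<sigma> (\<lambda>i. part q i - int i + int (w i)))))"
    unfolding sum_distrib_left by (rule sum.swap)
  finally show ?thesis unfolding irr_char_young_inner[OF p] .
qed

text \<open>Neither list is a proper prefix of the other, because the leftover parts would be
  positive while the totals agree.\<close>

lemma partitions_differ:
  assumes "p \<in> partitions m" "q \<in> partitions m" "p \<noteq> q"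
  shows "\<exists>D. 1 \<le> D \<and> D \<le> length p \<and> D \<le> length q \<and> part p D \<noteq> part q D \<and>
    (\<forall>i. 1 \<le> i \<and> i < D \<longrightarrow> part p i = part q i)"
proof -
  let ?P = "\<lambda>i. i < length p \<and> i < length q \<and> p ! i \<noteq> q ! i"
  have aux: "p = q" if "length p \<le> length q" "\<And>i. i < length p \<Longrightarrow> p ! i = q ! i"
      "sum_list p = sum_list q" "\<forall>x\<in>set q. 0 < x" for p q :: "nat list"
  proof -
    have "p = take (length p) q" using that by (intro nth_equalityI) auto
    then obtain r where r: "q = p @ r" by (metis append_take_drop_id)
    then have "r = []" using that by (cases r) auto
    with r show ?thesis by simp
  qed
  have "\<exists>i. ?P i"
  proof (rule ccontr)
    assume "\<not> ?thesis"
    then have *: "\<And>i. i < length p \<Longrightarrow> i < length q \<Longrightarrow> p ! i = q ! i" by blast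
    show False using aux[of p q] aux[of q p] assms * by (cases "length p \<le> length q") (auto simp: partitions_def)
  qed
  define d where "d = (LEAST i. ?P i)"
  have d: "?P d" unfolding d_def using \<open>\<exists>i. ?P i\<close> by (rule LeastI_ex)
  have eq: "p ! (i - 1) = q ! (i - 1)" if "1 \<le> i" "i < Suc d" for i
    using not_less_Least[of "i - 1" ?P] d that unfolding d_def by auto
  show ?thesis
  proof (intro exI[of _ "Suc d"] conjI allI impI)
    show "part p i = part q i" if "1 \<le> i \<and> i < Suc d" for i using eq[of i] that by simp
  qed (use d in auto)
qed

text \<open>Of two different partitions, the one with the larger first differing part is expanded
  into Young characters; all its shifts are then too long for the other.\<close>

theorem irr_char_orthonormal:
  assumes p: "p \<in> partitions m" and q: "q \<in> partitions m"
  shows "(\<Sum>\<sigma> | \<sigma> permutes {1..m}. irr_char p \<sigma> * irr_char q \<sigma>) = (if p = q then fact m else 0)"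
proof (cases "p = q")
  case True
  have "(\<Sum>w | w permutes {1..length p}. sign w * (fact m *
        skew_pairing 1 (length p) (length p) (part p) (\<lambda>i. part p i - int i + int (w i))))
     = (\<Sum>w | w permutes {1..length p}. if w = id then fact m else 0)"
  proof (rule sum.cong[OF refl])
    fix w assume "w \<in> {w. w permutes {1..length p}}"
    then have w: "w permutes {1..length p}" by simp
    show "sign w * (fact m * skew_pairing 1 (length p) (length p) (part p) (\<lambda>i. part p i - int i + int (w i)))
        = (if w = id then fact m else 0)"
      unfolding skew_pairing_self[OF p w] by simp
  qed
  also have "\<dots> = fact m" using finite_permutations[of "{1..length p}"] by (simp add: permutes_id)
  finally show ?thesis using True irr_char_inner_expand[OF p q] by simp
next
  case False
  have less: "(\<Sum>\<sigma> | \<sigma> permutes {1..m}. irr_char p \<sigma> * irr_char q \<sigma>) = 0"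
    if p: "p \<in> partitions m" and q: "q \<in> partitions m"
      and D: "1 \<le> D" "D \<le> length p" "D \<le> length q" "part p D < part q D"
      "\<And>i. 1 \<le> i \<Longrightarrow> i < D \<Longrightarrow> part p i = part q i" for p q D
    unfolding irr_char_inner_expand[OF p q]
  proof (rule sum.neutral, rule ballI)
    fix w assume "w \<in> {w. w permutes {1..length q}}"
    then have w: "w permutes {1..length q}" by simp
    show "sign w * (fact m * skew_pairing 1 (length p) (length q) (part p) (\<lambda>i. part q i - int i + int (w i))) = 0"
    proof -
      have "skew_pairing 1 (length p) (length q) (part p) (\<lambda>i. part q i - int i + int (w i)) = 0"
        by (rule skew_pairing_less[OF p D(1,2,3) _ D(4) w]) (rule D(5))
      then show ?thesis by (simp only: mult_zero_right)
    qed
  qed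
  obtain D where D: "1 \<le> D" "D \<le> length p" "D \<le> length q"
    "part p D \<noteq> part q D" "\<forall>i. 1 \<le> i \<and> i < D \<longrightarrow> part p i = part q i"
    using partitions_differ[OF p q False] by blast
  have "part p D < part q D \<or> part q D < part p D" using D(4) by (simp only: neq_iff)
  then have "(\<Sum>\<sigma> | \<sigma> permutes {1..m}. irr_char p \<sigma> * irr_char q \<sigma>) = 0"
  proof
    assume lt: "part p D < part q D"
    show ?thesis by (rule less[OF p q D(1,2,3) lt]) (use D(5) in blast)
  next
    assume lt: "part q D < part p D"
    have "(\<Sum>\<sigma> | \<sigma> permutes {1..m}. irr_char q \<sigma> * irr_char p \<sigma>) = 0"
      by (rule less[OF q p D(1,3,2) lt]) (use D(5) in metis)
    then show ?thesis by (simp only: mult.commute)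
  qed
  with False show ?thesis by simp
qed

section \<open>Young symmetrizers\<close>

definition stab :: "'a set \<Rightarrow> ('a \<Rightarrow> 'b) \<Rightarrow> ('a \<Rightarrow> 'a) set" where
  "stab B f = {p. p permutes B \<and> (\<forall>s\<in>B. f (p s) = f s)}"

text \<open>Subgroups are kept as sets of functions so that row groups, column groups and the full
  symmetric group share the same reindexing lemmas.\<close>

definition perm_group :: "'a set \<Rightarrow> ('a \<Rightarrow> 'a) set \<Rightarrow> bool" where
  "perm_group B H \<longleftrightarrow> finite B \<and> H \<subseteq> {p. p permutes B} \<and> id \<in> H \<and>
     (\<forall>p\<in>H. \<forall>q\<in>H. p \<circ> q \<in> H) \<and> (\<forall>p\<in>H. inv p \<in> H)"

lemma perm_group_stab: "finite B \<Longrightarrow> perm_group B (stab B f)"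
  unfolding perm_group_def
proof (intro conjI ballI)
  fix p q assume p: "p \<in> stab B f" and q: "q \<in> stab B f"
  show "p \<circ> q \<in> stab B f"
    using p q permutes_in_image[of q B] by (auto simp: stab_def intro: permutes_compose)
next
  fix p assume p: "p \<in> stab B f"
  then have pB: "p permutes B" by (simp add: stab_def)
  show "inv p \<in> stab B f"
    unfolding stab_def
  proof (intro CollectI conjI ballI)
    show "inv p permutes B" using pB by (rule permutes_inv)
    fix s assume "s \<in> B"
    then have "inv p s \<in> B" using permutes_in_image[OF permutes_inv[OF pB]] by blast
    then have "f (p (inv p s)) = f (inv p s)" using p by (simp add: stab_def)
    then show "f (inv p s) = f s" using permutes_inverses(1)[OF pB] by simp
  qed
qed (auto simp: stab_def permutes_id)

lemma perm_group_permutes: "finite B \<Longrightarrow> perm_group B {p. p permutes B}"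
  unfolding perm_group_def by (auto simp: permutes_id permutes_compose permutes_inv)

lemma perm_group_finite: "perm_group B H \<Longrightarrow> finite H"
  unfolding perm_group_def using finite_permutations finite_subset by blast

lemma perm_groupD:
  assumes "perm_group B H" "p \<in> H"
  shows "p permutes B" "inv p \<in> H" "q \<in> H \<Longrightarrow> p \<circ> q \<in> H" "p \<circ> inv p = id" "inv p \<circ> p = id"
    "inv (inv p) = p" "finite B"
  using assms unfolding perm_group_def
  by (auto intro: permutes_inv_inv simp: permutes_inv_o)

lemma sum_group_left:
  assumes "perm_group B H" "h \<in> H"
  shows "(\<Sum>p\<in>H. F (h \<circ> p)) = (\<Sum>p\<in>H. F p)"
  by (rule sum.reindex_bij_witness[of _ "\<lambda>p. inv h \<circ> p" "\<lambda>p. h \<circ> p"])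
    (use perm_groupD[OF assms] perm_groupD(3)[OF assms(1)] in \<open>auto simp: o_assoc\<close>)

lemma sum_group_right:
  assumes "perm_group B H" "h \<in> H"
  shows "(\<Sum>p\<in>H. F (p \<circ> h)) = (\<Sum>p\<in>H. F p)"
  by (rule sum.reindex_bij_witness[of _ "\<lambda>p. p \<circ> inv h" "\<lambda>p. p \<circ> h"])
    (use perm_groupD[OF assms] perm_groupD(3)[OF assms(1)] assms(2) in \<open>auto simp: o_assoc[symmetric]\<close>)

lemma sum_group_inv:
  assumes "perm_group B H"
  shows "(\<Sum>p\<in>H. F (inv p)) = (\<Sum>p\<in>H. F p)"
  by (rule sum.reindex_bij_witness[of _ inv inv]) (use perm_groupD[OF assms] in auto)

lemma sign_group:
  assumes "perm_group B H" "p \<in> H" "q \<in> H"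
  shows "sign (p \<circ> q) = sign p * sign q" "sign (inv p) = sign p"
proof -
  have "permutation p" "permutation q"
    using perm_groupD(1,7)[OF assms(1,2)] perm_groupD(1)[OF assms(1,3)] unfolding permutation_permutes by blast+
  then show "sign (p \<circ> q) = sign p * sign q" "sign (inv p) = sign p"
    by (simp_all add: sign_compose sign_inverse)
qed

lemma comp_eq_id_iff:
  assumes "p permutes B"
  shows "p \<circ> x = id \<longleftrightarrow> x = inv p" "x \<circ> p = id \<longleftrightarrow> x = inv p"
  using permutes_inv_o[OF assms] by (metis comp_id id_comp o_assoc)+

text \<open>A Young diagram given by the coordinates of its labels. The label set is an arbitrary
  finite set so that deleting a corner yields another instance.\<close>

locale tableau =
  fixes B :: "nat set" and r c :: "nat \<Rightarrow> nat"
  assumes fin: "finite B"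
    and box_inj: "\<And>s t. s \<in> B \<Longrightarrow> t \<in> B \<Longrightarrow> r s = r t \<Longrightarrow> c s = c t \<Longrightarrow> s = t"
    and box_pos: "\<And>s. s \<in> B \<Longrightarrow> 1 \<le> r s \<and> 1 \<le> c s"
    and box_down: "\<And>s i j. s \<in> B \<Longrightarrow> 1 \<le> i \<Longrightarrow> i \<le> r s \<Longrightarrow> 1 \<le> j \<Longrightarrow> j \<le> c s \<Longrightarrow> \<exists>t\<in>B. r t = i \<and> c t = j"
begin

abbreviation "RG \<equiv> stab B r"
abbreviation "CG \<equiv> stab B c"
abbreviation "SG \<equiv> {p. p permutes B}"

lemmas RG = perm_group_stab[OF fin, of r]
lemmas CG = perm_group_stab[OF fin, of c]
lemmas SG = perm_group_permutes[OF fin]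

lemma RG_CG: "p \<in> RG \<Longrightarrow> p \<in> CG \<Longrightarrow> p = id"
  unfolding stab_def using box_inj
  by (auto simp: fun_eq_iff) (metis permutes_def permutes_in_image)

text \<open>The function \<phi> is left arbitrary because one straightening law serves for the delta
  function, for characters and for the cycle function.\<close>

definition sandwich :: "((nat \<Rightarrow> nat) \<Rightarrow> int) \<Rightarrow> (nat \<Rightarrow> nat) \<Rightarrow> int" where
  "sandwich \<phi> x = (\<Sum>p\<in>RG. \<Sum>q\<in>CG. sign q * \<phi> (p \<circ> x \<circ> q))"

text \<open>The coefficients of the Young symmetrizer; \<open>sandwich \<phi> id\<close> is the linear functional that it represents.\<close>

definition young :: "(nat \<Rightarrow> nat) \<Rightarrow> int" where
  "young = sandwich (\<lambda>x. if x = id then 1 else 0)"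

lemma r_column:
  assumes "j \<in> c ` B"
  shows "r ` {s\<in>B. c s = j} = {1..card {s\<in>B. c s = j}}" and "inj_on r {s\<in>B. c s = j}"
proof -
  let ?K = "{s\<in>B. c s = j}"
  show inj: "inj_on r ?K" using box_inj by (auto simp: inj_on_def)
  obtain s0 where s0: "s0 \<in> ?K" using assms by auto
  have fK: "finite ?K" using fin by simp
  define h where "h = Max (r ` ?K)"
  have "h \<in> r ` ?K" unfolding h_def using fK s0 by (intro Max_in) auto
  then obtain s where s: "s \<in> ?K" "r s = h" by auto
  have "r ` ?K = {1..h}"
  proof
    show "r ` ?K \<subseteq> {1..h}" using box_pos Max_ge[of "r ` ?K"] fK unfolding h_def by auto
    show "{1..h} \<subseteq> r ` ?K"
    proof
      fix i assume "i \<in> {1..h}"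
      then obtain t where "t \<in> B" "r t = i" "c t = j"
        using box_down[of s i j] s box_pos[of s] by auto
      then show "i \<in> r ` ?K" by auto
    qed
  qed
  moreover from this have "card ?K = h" using card_image[OF inj] by simp
  ultimately show "r ` ?K = {1..card ?K}" by simp
qed

text \<open>In a column of height h, distinct positive labels have sum at least 1 + ... + h, with
  equality only for the labels 1, ..., h. These are the row indices of the column in some
  order.\<close>

lemma column_injective:
  fixes f :: "nat \<Rightarrow> nat"
  assumes pos: "\<And>s. s \<in> B \<Longrightarrow> 1 \<le> f s"
    and inj: "\<And>s t. s \<in> B \<Longrightarrow> t \<in> B \<Longrightarrow> c s = c t \<Longrightarrow> f s = f t \<Longrightarrow> s = t"
  shows "sum r B \<le> sum f B" and "sum f B = sum r B \<Longrightarrow> \<exists>q\<in>CG. \<forall>s\<in>B. f s = r (q s)"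
proof -
  let ?K = "\<lambda>j. {s\<in>B. c s = j}"
  have finj: "inj_on f (?K j)" for j using inj by (auto simp: inj_on_def)
  have grp: "sum g B = (\<Sum>j\<in>c ` B. sum g (?K j))" for g :: "nat \<Rightarrow> nat"
    using sum.group[of B "c ` B" c g] fin by simp
  have f0: "0 \<notin> f ` ?K j" for j using pos by fastforce
  have fK: "finite (f ` ?K j)" for j using fin by simp
  have cf: "card (f ` ?K j) = card (?K j)" for j using card_image[OF finj] by simp
  have sumf: "sum f (?K j) = \<Sum>(f ` ?K j)" for j using finj by (simp add: sum.reindex)
  have sumr: "sum r (?K j) = \<Sum>{1..card (?K j)}" if "j \<in> c ` B" for j
    using r_column[OF that] by (metis sum.reindex_cong[of r "?K j" _ "\<lambda>x. x" r, OF _ refl])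
  have le: "sum r (?K j) \<le> sum f (?K j)" if "j \<in> c ` B" for j
    using sum_distinct_positive(1)[OF fK f0, of j] cf sumf sumr[OF that] by simp
  show "sum r B \<le> sum f B" unfolding grp by (rule sum_mono) (rule le)
  assume "sum f B = sum r B"
  then have "(\<Sum>j\<in>c ` B. sum r (?K j)) = (\<Sum>j\<in>c ` B. sum f (?K j))" unfolding grp by simp
  then have eq: "sum r (?K j) = sum f (?K j)" if "j \<in> c ` B" for j
    using sum_mono_inv[of "\<lambda>j. sum r (?K j)" "c ` B" "\<lambda>j. sum f (?K j)" j] le that fin by simp
  have img: "f ` ?K j = r ` ?K j" if "j \<in> c ` B" for j
    using sum_distinct_positive(2)[OF fK f0, of j] cf[of j] sumf[of j] sumr[OF that] eq[OF that] r_column(1)[OF that] by simp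
  have ex: "\<exists>t\<in>B. c t = c s \<and> r t = f s" if "s \<in> B" for s
  proof -
    have "f s \<in> r ` ?K (c s)" using img[of "c s"] that by blast
    then show ?thesis by auto
  qed
  define q where "q s = (if s \<in> B then SOME t. t \<in> B \<and> c t = c s \<and> r t = f s else s)" for s
  have q: "q s \<in> B \<and> c (q s) = c s \<and> r (q s) = f s" if "s \<in> B" for s
    using someI_ex[of "\<lambda>t. t \<in> B \<and> c t = c s \<and> r t = f s"] ex[OF that] that unfolding q_def by auto
  have "inj_on q B" using q inj by (metis inj_onI)
  moreover have "q ` B \<subseteq> B" using q by auto
  ultimately have "bij_betw q B B" using fin by (simp add: bij_betw_def endo_inj_surj)
  then have "q permutes B" by (rule bij_imp_permutes) (simp add: q_def)
  then show "\<exists>q\<in>CG. \<forall>s\<in>B. f s = r (q s)" using q by (auto simp: stab_def)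
qed

lemma transpose_CG: "s \<in> B \<Longrightarrow> t \<in> B \<Longrightarrow> c s = c t \<Longrightarrow> Transposition.transpose s t \<in> CG"
  and transpose_RG: "s \<in> B \<Longrightarrow> t \<in> B \<Longrightarrow> r s = r t \<Longrightarrow> Transposition.transpose s t \<in> RG"
  by (auto simp: stab_def permutes_swap_id Transposition.transpose_def)

lemma sandwich_factor:
  assumes "p0 \<in> RG" "q0 \<in> CG"
  shows "sandwich \<phi> (p0 \<circ> q0) = sign q0 * sandwich \<phi> id"
proof -
  have "sandwich \<phi> (p0 \<circ> q0) = (\<Sum>p\<in>RG. \<Sum>q\<in>CG. sign q0 * (sign (q0 \<circ> q) * \<phi> ((p \<circ> p0) \<circ> (q0 \<circ> q))))"
    unfolding sandwich_def
    by (intro sum.cong refl) (simp add: sign_group[OF CG assms(2)] o_assoc)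
  also have "\<dots> = (\<Sum>p\<in>RG. \<Sum>q\<in>CG. sign q0 * (sign q * \<phi> ((p \<circ> p0) \<circ> q)))"
    by (intro sum.cong refl sum_group_left[OF CG assms(2), of "\<lambda>q. sign q0 * (sign q * \<phi> (_ \<circ> q))"])
  also have "\<dots> = (\<Sum>p\<in>RG. \<Sum>q\<in>CG. sign q0 * (sign q * \<phi> (p \<circ> q)))"
    by (rule sum_group_right[OF RG assms(1), of "\<lambda>p. \<Sum>q\<in>CG. sign q0 * (sign q * \<phi> (p \<circ> q))"])
  finally show ?thesis by (simp add: sandwich_def sum_distrib_left)
qed

text \<open>The transposition of \<open>s\<close> and \<open>t\<close> costs a sign in the column
  group; moved through \<open>x\<close> it becomes a row transposition, absorbed without a
  sign.\<close>

lemma sandwich_collision: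
  assumes x: "x \<in> SG" and st: "s \<in> B" "t \<in> B" "s \<noteq> t" "c s = c t" "r (x s) = r (x t)"
  shows "sandwich \<phi> x = 0"
proof -
  let ?T = "Transposition.transpose s t" and ?T' = "Transposition.transpose (x s) (x t)"
  have xB: "x permutes B" using x by simp
  have T: "?T \<in> CG" using st transpose_CG by blast
  have T': "?T' \<in> RG" using st transpose_RG permutes_in_image[OF xB] by blast
  have conj: "?T' \<circ> x = x \<circ> ?T"
    by (rule ext) (simp add: Transposition.transpose_def inj_eq[OF permutes_inj[OF xB]])
  have "sandwich \<phi> x = (\<Sum>p\<in>RG. \<Sum>q\<in>CG. sign (?T \<circ> q) * \<phi> (p \<circ> x \<circ> (?T \<circ> q)))"
    unfolding sandwich_def
    by (intro sum.cong refl sum_group_left[OF CG T, of "\<lambda>q. sign q * \<phi> (_ \<circ> q)", symmetric])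
  also have "\<dots> = (\<Sum>p\<in>RG. \<Sum>q\<in>CG. - (sign q * \<phi> ((p \<circ> ?T') \<circ> x \<circ> q)))"
  proof (intro sum.cong refl)
    fix p q :: "nat \<Rightarrow> nat" assume "q \<in> CG"
    have "p \<circ> x \<circ> (?T \<circ> q) = (p \<circ> ?T') \<circ> x \<circ> q" using conj by (metis o_assoc)
    then show "sign (?T \<circ> q) * \<phi> (p \<circ> x \<circ> (?T \<circ> q)) = - (sign q * \<phi> ((p \<circ> ?T') \<circ> x \<circ> q))"
      using sign_group(1)[OF CG T \<open>q \<in> CG\<close>] st by (simp add: sign_swap_id)
  qed
  also have "\<dots> = - sandwich \<phi> x"
    using sum_group_right[OF RG T', of "\<lambda>p. \<Sum>q\<in>CG. - (sign q * \<phi> (p \<circ> x \<circ> q))"]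
    by (simp add: sandwich_def sum_negf)
  finally show ?thesis by simp
qed

text \<open>Without a collision, \<open>r \<circ> x\<close> is injective on columns and has the same
  total as \<open>r\<close>. The equality case of \<open>column_injective\<close> writes it as
  \<open>r \<circ> q\<close>, and then \<open>x \<circ> inv q\<close> preserves rows.\<close>

lemma RG_CG_or_collision:
  assumes x: "x \<in> SG"
  shows "(\<exists>p\<in>RG. \<exists>q\<in>CG. x = p \<circ> q) \<or> (\<exists>s\<in>B. \<exists>t\<in>B. s \<noteq> t \<and> c s = c t \<and> r (x s) = r (x t))"
proof (cases "\<exists>s\<in>B. \<exists>t\<in>B. s \<noteq> t \<and> c s = c t \<and> r (x s) = r (x t)")
  case False
  have xB: "x permutes B" using x by simp
  have "sum (\<lambda>s. r (x s)) B = sum r B" using sum.permute[OF xB, of r] by (simp add: o_def)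
  then obtain q where q: "q \<in> CG" "\<And>s. s \<in> B \<Longrightarrow> r (x s) = r (q s)"
    using column_injective(2)[of "\<lambda>s. r (x s)"] False box_pos permutes_in_image[OF xB] by blast
  have qB: "q permutes B" using q by (simp add: stab_def)
  have "x \<circ> inv q \<in> RG"
    unfolding stab_def
  proof (intro CollectI conjI ballI)
    show "x \<circ> inv q permutes B" using xB qB by (simp add: permutes_compose permutes_inv)
    fix s assume "s \<in> B"
    then have "inv q s \<in> B" using permutes_in_image[OF permutes_inv[OF qB]] by blast
    then show "r ((x \<circ> inv q) s) = r s" using q(2)[of "inv q s"] permutes_inverses(1)[OF qB] by simp
  qed
  moreover have "x = (x \<circ> inv q) \<circ> q" using permutes_inv_o(2)[OF qB] by (simp add: o_assoc[symmetric])
  ultimately show ?thesis using q(1) by blast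
qed simp

lemma young_id: "young id = 1"
proof -
  have "young id = (\<Sum>p\<in>RG. \<Sum>q\<in>CG. if p = id then (if q = id then 1 else 0) else 0)"
    unfolding young_def sandwich_def
  proof (intro sum.cong refl)
    fix p q assume pq: "p \<in> RG" "q \<in> CG"
    have "p \<circ> q = id \<longleftrightarrow> p = id \<and> q = id"
    proof
      assume "p \<circ> q = id"
      then have "p = inv q" using comp_eq_id_iff(2)[of q B p] pq by (simp add: stab_def)
      then have "p \<in> CG" using perm_groupD(2)[OF CG pq(2)] by simp
      then have "p = id" using RG_CG pq by blast
      then show "p = id \<and> q = id" using \<open>p \<circ> q = id\<close> by simp
    qed simp
    then show "sign q * (if p \<circ> id \<circ> q = id then 1 else 0) = (if p = id then if q = id then 1 else 0 else 0)"
      by simp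
  qed
  also have "\<dots> = (\<Sum>p\<in>RG. if p = id then 1 else 0)"
    using perm_group_finite[OF CG] CG by (intro sum.cong refl) (simp add: perm_group_def)
  also have "\<dots> = 1"
    using perm_group_finite[OF RG] RG by (simp add: perm_group_def)
  finally show ?thesis .
qed

text \<open>In both cases of \<open>RG_CG_or_collision\<close> the sandwich at \<open>x\<close> is a
  multiple, not depending on \<phi>, of the sandwich at the identity. The delta function calibrates
  that multiple as \<open>young x\<close>.\<close>

theorem sandwich_young:
  assumes "x \<in> SG"
  shows "sandwich \<phi> x = young x * sandwich \<phi> id"
  using RG_CG_or_collision[OF assms]
proof (elim disjE bexE conjE)
  fix p q assume "p \<in> RG" "q \<in> CG" "x = p \<circ> q"
  then show ?thesis using sandwich_factor[of p q] young_id by (simp add: young_def)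
next
  fix s t assume "s \<in> B" "t \<in> B" "s \<noteq> t" "c s = c t" "r (x s) = r (x t)"
  then show ?thesis using sandwich_collision[OF assms] by (simp add: young_def)
qed

text \<open>\<open>young x\<close> is the signed number of factorisations of x as
  \<open>inv p \<circ> inv q\<close>; inverting both group elements matches them with the terms of
  \<open>sandwich\<close>.\<close>

lemma sum_young: "(\<Sum>x\<in>SG. young x * \<psi> x) = sandwich \<psi> id"
proof -
  have fSG: "finite SG" using perm_group_finite[OF SG] .
  have "(\<Sum>x\<in>SG. young x * \<psi> x)
      = (\<Sum>x\<in>SG. \<Sum>p\<in>RG. \<Sum>q\<in>CG. if x = inv p \<circ> inv q then sign q * \<psi> x else 0)"
    unfolding young_def sandwich_def sum_distrib_right
  proof (intro sum.cong refl)
    fix x p q assume *: "x \<in> SG" "p \<in> RG" "q \<in> CG"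
    have "p \<circ> x \<circ> q = id \<longleftrightarrow> p \<circ> x = inv q" using comp_eq_id_iff(2)[of q B "p \<circ> x"] * by (simp add: stab_def)
    also have "\<dots> \<longleftrightarrow> x = inv p \<circ> inv q"
      using perm_groupD(4,5)[OF RG *(2)] by (metis comp_id id_comp o_assoc)
    finally show "sign q * (if p \<circ> x \<circ> q = id then 1 else 0) * \<psi> x = (if x = inv p \<circ> inv q then sign q * \<psi> x else 0)"
      by simp
  qed
  also have "\<dots> = (\<Sum>p\<in>RG. \<Sum>x\<in>SG. \<Sum>q\<in>CG. if x = inv p \<circ> inv q then sign q * \<psi> x else 0)"
    by (rule sum.swap)
  also have "\<dots> = (\<Sum>p\<in>RG. \<Sum>q\<in>CG. \<Sum>x\<in>SG. if x = inv p \<circ> inv q then sign q * \<psi> x else 0)"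
    by (intro sum.cong refl sum.swap)
  also have "\<dots> = (\<Sum>p\<in>RG. \<Sum>q\<in>CG. sign (inv q) * \<psi> (inv p \<circ> inv q))"
  proof (intro sum.cong refl)
    fix p q assume *: "p \<in> RG" "q \<in> CG"
    then have "inv p \<circ> inv q \<in> SG" by (auto simp: stab_def permutes_inv permutes_compose)
    then show "(\<Sum>x\<in>SG. if x = inv p \<circ> inv q then sign q * \<psi> x else 0) = sign (inv q) * \<psi> (inv p \<circ> inv q)"
      using fSG sign_group(2)[OF CG *(2) *(2)] by simp
  qed
  also have "\<dots> = (\<Sum>p\<in>RG. \<Sum>q\<in>CG. sign q * \<psi> (inv p \<circ> q))"
    by (intro sum.cong refl sum_group_inv[OF CG, of "\<lambda>q. sign q * \<psi> (_ \<circ> q)"])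
  also have "\<dots> = (\<Sum>p\<in>RG. \<Sum>q\<in>CG. sign q * \<psi> (p \<circ> q))"
    by (rule sum_group_inv[OF RG, of "\<lambda>p. \<Sum>q\<in>CG. sign q * \<psi> (p \<circ> q)"])
  finally show ?thesis by (simp add: sandwich_def)
qed

end

section \<open>Class functions and the conjugation average of the symmetrizer\<close>

definition class_function :: "'a set \<Rightarrow> (('a \<Rightarrow> 'a) \<Rightarrow> 'c) \<Rightarrow> bool" where
  "class_function B \<phi> \<longleftrightarrow> (\<forall>g x. g permutes B \<longrightarrow> x permutes B \<longrightarrow> \<phi> (g \<circ> x \<circ> inv g) = \<phi> x)"

lemma class_functionD: "class_function B \<phi> \<Longrightarrow> g permutes B \<Longrightarrow> x permutes B \<Longrightarrow> \<phi> (g \<circ> x \<circ> inv g) = \<phi> x"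
  by (simp add: class_function_def)

lemma class_function_commute:
  assumes "class_function B \<phi>" "x permutes B" "y permutes B"
  shows "\<phi> (x \<circ> y) = \<phi> (y \<circ> x)"
proof -
  have "x \<circ> (y \<circ> x) \<circ> inv x = x \<circ> y" using permutes_inv_o(1)[OF assms(2)] by (simp add: o_assoc[symmetric])
  then show ?thesis using class_functionD[OF assms(1,2), of "y \<circ> x"] assms by (simp add: permutes_compose)
qed

context tableau begin

text \<open>An unnormalised sum over conjugates, so that everything stays in the integers.\<close>

definition conj_young :: "(nat \<Rightarrow> nat) \<Rightarrow> int" where
  "conj_young y = (\<Sum>g\<in>SG. young (inv g \<circ> y \<circ> g))"

text \<open>The scalar by which the symmetrizer squares to a multiple of itself, read off at the
  identity, where \<open>young\<close> is 1.\<close>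

definition kappa :: int where
  "kappa = (\<Sum>x\<in>SG. young x * young (inv x))"

text \<open>In the group algebra this is e g e = const e. The row sum of the first factor and the
  column sum of the second form a sandwich at \<open>x\<close> of a function that does not involve
  \<open>x\<close>; the constant is found at x = id.\<close>

lemma young_triple:
  assumes g: "g \<in> SG" and x: "x \<in> SG"
  shows "(\<Sum>z\<in>SG. young z * young (inv g \<circ> inv z \<circ> x)) = young x * (\<Sum>z\<in>SG. young z * young (inv g \<circ> inv z))"
proof -
  define \<psi> where "\<psi> p q w = (if p \<circ> inv g \<circ> inv q \<circ> w = id then 1 else 0 :: int)" for p q w :: "nat \<Rightarrow> nat"
  have *: "(\<Sum>z\<in>SG. young z * young (inv g \<circ> inv z \<circ> x)) = young x * (\<Sum>p'\<in>RG. \<Sum>q\<in>CG. sign q * sandwich (\<psi> p' q) id)"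
    if x: "x \<in> SG" for x
  proof -
    have "(\<Sum>z\<in>SG. young z * young (inv g \<circ> inv z \<circ> x))
      = (\<Sum>p\<in>RG. \<Sum>q\<in>CG. sign q * young (inv g \<circ> inv (p \<circ> q) \<circ> x))"
      unfolding sum_young by (simp add: sandwich_def)
    also have "\<dots> = (\<Sum>p\<in>RG. \<Sum>q\<in>CG. \<Sum>p'\<in>RG. \<Sum>q'\<in>CG. sign q * (sign q' * \<psi> p' q (inv p \<circ> x \<circ> q')))"
      unfolding young_def sandwich_def sum_distrib_left
    proof (intro sum.cong refl)
      fix p q p' q' assume "p \<in> RG" "q \<in> CG"
      then have "inv (p \<circ> q) = inv q \<circ> inv p"
        by (auto simp: stab_def intro!: o_inv_distrib permutes_bij)
      then show "sign q * (sign q' * (if p' \<circ> (inv g \<circ> inv (p \<circ> q) \<circ> x) \<circ> q' = id then 1 else 0))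
         = sign q * (sign q' * \<psi> p' q (inv p \<circ> x \<circ> q'))"
        by (simp add: \<psi>_def o_assoc)
    qed
    also have "\<dots> = (\<Sum>p\<in>RG. \<Sum>q\<in>CG. \<Sum>p'\<in>RG. \<Sum>q'\<in>CG. sign q * (sign q' * \<psi> p' q (p \<circ> x \<circ> q')))"
      by (rule sum_group_inv[OF RG, of "\<lambda>p. \<Sum>q\<in>CG. \<Sum>p'\<in>RG. \<Sum>q'\<in>CG. sign q * (sign q' * \<psi> p' q (p \<circ> x \<circ> q'))"])
    also have "\<dots> = (\<Sum>q\<in>CG. \<Sum>p\<in>RG. \<Sum>p'\<in>RG. \<Sum>q'\<in>CG. sign q * (sign q' * \<psi> p' q (p \<circ> x \<circ> q')))"
      by (rule sum.swap)
    also have "\<dots> = (\<Sum>q\<in>CG. \<Sum>p'\<in>RG. \<Sum>p\<in>RG. \<Sum>q'\<in>CG. sign q * (sign q' * \<psi> p' q (p \<circ> x \<circ> q')))"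
      by (intro sum.cong refl sum.swap)
    also have "\<dots> = (\<Sum>p'\<in>RG. \<Sum>q\<in>CG. \<Sum>p\<in>RG. \<Sum>q'\<in>CG. sign q * (sign q' * \<psi> p' q (p \<circ> x \<circ> q')))"
      by (rule sum.swap)
    also have "\<dots> = (\<Sum>p'\<in>RG. \<Sum>q\<in>CG. sign q * sandwich (\<psi> p' q) x)"
      by (simp add: sandwich_def sum_distrib_left)
    also have "\<dots> = (\<Sum>p'\<in>RG. \<Sum>q\<in>CG. young x * (sign q * sandwich (\<psi> p' q) id))"
      by (simp add: sandwich_young[OF x] mult.left_commute)
    finally show ?thesis by (simp only: sum_distrib_left)
  qed
  have "id \<in> SG" by (simp add: permutes_id)
  from *[OF x] *[OF this] show ?thesis by (simp add: young_id)
qed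

lemma young_convolution:
  assumes "x \<in> SG"
  shows "(\<Sum>z\<in>SG. young z * young (inv z \<circ> x)) = kappa * young x"
proof -
  have "id \<in> SG" by (simp add: permutes_id)
  from young_triple[OF this assms] show ?thesis by (simp add: kappa_def mult.commute)
qed

text \<open>Reindexing by \<open>inv z \<circ> inv g\<close> turns the constant of
  \<open>young_triple\<close> into the convolution square of \<open>young\<close> at
  \<open>inv g\<close>.\<close>

lemma young_shift:
  assumes g: "g \<in> SG"
  shows "(\<Sum>z\<in>SG. young z * young (inv g \<circ> inv z)) = kappa * young (inv g)"
proof -
  have g': "inv g \<in> SG" "g permutes B" using g by (auto intro: permutes_inv)
  have "(\<Sum>z\<in>SG. young z * young (inv g \<circ> inv z)) = (\<Sum>u\<in>SG. young u * young (inv u \<circ> inv g))"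
  proof (rule sum.reindex_bij_witness[of _ "\<lambda>u. inv u \<circ> inv g" "\<lambda>z. inv g \<circ> inv z"])
    fix z assume z: "z \<in> SG"
    then have zB: "z permutes B" by simp
    have i: "inv (inv g \<circ> inv z) = z \<circ> g"
      using o_inv_distrib[OF permutes_bij[OF permutes_inv[OF g'(2)]] permutes_bij[OF permutes_inv[OF zB]]]
      by (simp add: permutes_inv_inv[OF g'(2)] permutes_inv_inv[OF zB])
    show e: "inv (inv g \<circ> inv z) \<circ> inv g = z"
      unfolding i using permutes_inv_o(1)[OF g'(2)] by (simp add: o_assoc[symmetric])
    show "inv g \<circ> inv z \<in> SG" using zB g' by (auto intro: permutes_compose permutes_inv)
    show "young (inv g \<circ> inv z) * young (inv (inv g \<circ> inv z) \<circ> inv g) = young z * young (inv g \<circ> inv z)"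
      unfolding e by simp
  next
    fix z assume z: "z \<in> SG"
    then have zB: "z permutes B" by simp
    have i: "inv (inv z \<circ> inv g) = g \<circ> z"
      using o_inv_distrib[OF permutes_bij[OF permutes_inv[OF zB]] permutes_bij[OF permutes_inv[OF g'(2)]]]
      by (simp add: permutes_inv_inv[OF g'(2)] permutes_inv_inv[OF zB])
    show "inv g \<circ> inv (inv z \<circ> inv g) = z"
      unfolding i using permutes_inv_o(2)[OF g'(2)] by (simp add: o_assoc)
    show "inv z \<circ> inv g \<in> SG" using zB g' by (auto intro: permutes_compose permutes_inv)
  qed
  then show ?thesis using young_convolution[OF g'(1)] by simp
qed

text \<open>A class function can be moved past the row factor, so convolving it with the symmetrizer
  places it between row and column group. The straightening law makes its sandwich at the identity
  the eigenvalue.\<close>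

lemma class_function_young:
  assumes \<phi>: "class_function B \<phi>" and y: "y \<in> SG"
  shows "(\<Sum>\<tau>\<in>SG. \<phi> \<tau> * young (inv \<tau> \<circ> y)) = young y * sandwich \<phi> id"
proof -
  have yB: "y permutes B" using y by simp
  have "(\<Sum>\<tau>\<in>SG. \<phi> \<tau> * young (inv \<tau> \<circ> y)) = (\<Sum>z\<in>SG. young z * \<phi> (y \<circ> inv z))"
  proof (rule sum.reindex_bij_witness[of _ "\<lambda>z. y \<circ> inv z" "\<lambda>\<tau>. inv \<tau> \<circ> y"])
    fix z assume "z \<in> SG"
    then have zB: "z permutes B" by simp
    have i: "inv (inv z \<circ> y) = inv y \<circ> z"
      using o_inv_distrib[OF permutes_bij[OF permutes_inv[OF zB]] permutes_bij[OF yB]]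
      by (simp add: permutes_inv_inv[OF zB])
    show e: "y \<circ> inv (inv z \<circ> y) = z"
      unfolding i using permutes_inv_o(1)[OF yB] by (simp add: o_assoc)
    show "inv z \<circ> y \<in> SG" using zB yB by (auto intro: permutes_compose permutes_inv)
    show "young (inv z \<circ> y) * \<phi> (y \<circ> inv (inv z \<circ> y)) = \<phi> z * young (inv z \<circ> y)"
      unfolding e by simp
    have i: "inv (y \<circ> inv z) = z \<circ> inv y"
      using o_inv_distrib[OF permutes_bij[OF yB] permutes_bij[OF permutes_inv[OF zB]]]
      by (simp add: permutes_inv_inv[OF zB])
    show "inv (y \<circ> inv z) \<circ> y = z"
      unfolding i using permutes_inv_o(2)[OF yB] by (simp add: o_assoc[symmetric])
    show "y \<circ> inv z \<in> SG" using zB yB by (auto intro: permutes_compose permutes_inv)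
  qed
  also have "\<dots> = (\<Sum>p\<in>RG. \<Sum>q\<in>CG. sign (inv q) * \<phi> (inv p \<circ> y \<circ> inv q))"
    unfolding sum_young sandwich_def
  proof (intro sum.cong refl)
    fix p q assume pq: "p \<in> RG" "q \<in> CG"
    then have B: "p permutes B" "q permutes B" by (auto simp: stab_def)
    have "inv (p \<circ> id \<circ> q) = inv q \<circ> inv p"
      using o_inv_distrib[OF permutes_bij[OF B(1)] permutes_bij[OF B(2)]] by simp
    moreover have "\<phi> (y \<circ> (inv q \<circ> inv p)) = \<phi> (inv p \<circ> (y \<circ> inv q))"
      using class_function_commute[OF \<phi>, of "y \<circ> inv q" "inv p"] B yB
      by (simp add: o_assoc permutes_compose permutes_inv)
    ultimately show "sign q * \<phi> (y \<circ> inv (p \<circ> id \<circ> q)) = sign (inv q) * \<phi> (inv p \<circ> y \<circ> inv q)"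
      using sign_group(2)[OF CG pq(2) pq(2)] by (simp add: o_assoc)
  qed
  also have "\<dots> = (\<Sum>p\<in>RG. \<Sum>q\<in>CG. sign q * \<phi> (inv p \<circ> y \<circ> q))"
    by (intro sum.cong refl sum_group_inv[OF CG, of "\<lambda>q. sign q * \<phi> (_ \<circ> q)"])
  also have "\<dots> = sandwich \<phi> y"
    unfolding sandwich_def by (rule sum_group_inv[OF RG, of "\<lambda>p. \<Sum>q\<in>CG. sign q * \<phi> (p \<circ> y \<circ> q)"])
  finally show ?thesis using sandwich_young[OF y] by simp
qed

lemma sum_conj:
  assumes "g permutes B"
  shows "(\<Sum>x\<in>SG. F (inv g \<circ> x \<circ> g)) = (\<Sum>x\<in>SG. F x)"
proof -
  have "g \<in> SG" "inv g \<in> SG" using assms by (auto intro: permutes_inv)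
  then have "(\<Sum>x\<in>SG. F x) = (\<Sum>x\<in>SG. F (x \<circ> g))" "(\<Sum>x\<in>SG. F (x \<circ> g)) = (\<Sum>x\<in>SG. F (inv g \<circ> x \<circ> g))"
    using sum_group_right[OF SG, of g F] sum_group_left[OF SG, of "inv g" "\<lambda>x. F (x \<circ> g)"] by simp_all
  then show ?thesis by simp
qed

lemma class_function_conj_young: "class_function B conj_young"
  unfolding class_function_def conj_young_def
proof (intro allI impI)
  fix g x assume g: "g permutes B" and x: "x permutes B"
  have "(\<Sum>h\<in>SG. young (inv h \<circ> (g \<circ> x \<circ> inv g) \<circ> h)) = (\<Sum>h\<in>SG. young (inv (inv g \<circ> h) \<circ> x \<circ> (inv g \<circ> h)))"
  proof (intro sum.cong refl)
    fix h assume "h \<in> SG"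
    then have h: "h permutes B" by simp
    have "inv (inv g \<circ> h) = inv h \<circ> g"
      using o_inv_distrib[OF permutes_bij[OF permutes_inv[OF g]] permutes_bij[OF h]]
      by (simp add: permutes_inv_inv[OF g])
    then show "young (inv h \<circ> (g \<circ> x \<circ> inv g) \<circ> h) = young (inv (inv g \<circ> h) \<circ> x \<circ> (inv g \<circ> h))"
      by (simp add: o_assoc)
  qed
  also have "\<dots> = (\<Sum>h\<in>SG. young (inv h \<circ> x \<circ> h))"
    by (rule sum_group_left[OF SG, of "inv g" "\<lambda>h. young (inv h \<circ> x \<circ> h)"]) (use g in \<open>simp add: permutes_inv\<close>)
  finally show "(\<Sum>h\<in>SG. young (inv h \<circ> (g \<circ> x \<circ> inv g) \<circ> h)) = (\<Sum>h\<in>SG. young (inv h \<circ> x \<circ> h))" .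
qed

text \<open>A class function does not see conjugation, so each of the m! conjugates contributes the
  same pairing with \<open>young\<close>.\<close>

lemma inner_conj_young:
  assumes \<phi>: "class_function B \<phi>"
  shows "(\<Sum>y\<in>SG. \<phi> y * conj_young y) = fact (card B) * sandwich \<phi> id"
proof -
  have "(\<Sum>y\<in>SG. \<phi> y * conj_young y) = (\<Sum>g\<in>SG. \<Sum>y\<in>SG. \<phi> y * young (inv g \<circ> y \<circ> g))"
    unfolding conj_young_def sum_distrib_left by (rule sum.swap)
  also have "\<dots> = (\<Sum>g\<in>SG. \<Sum>y\<in>SG. \<phi> (inv g \<circ> y \<circ> g) * young (inv g \<circ> y \<circ> g))"
  proof (intro sum.cong refl)
    fix g y assume "g \<in> SG" "y \<in> SG"
    then have "\<phi> (inv g \<circ> y \<circ> inv (inv g)) = \<phi> y" by (intro class_functionD[OF \<phi>]) (auto intro: permutes_inv)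
    then show "\<phi> y * young (inv g \<circ> y \<circ> g) = \<phi> (inv g \<circ> y \<circ> g) * young (inv g \<circ> y \<circ> g)"
      using \<open>g \<in> SG\<close> by (simp add: permutes_inv_inv)
  qed
  also have "\<dots> = (\<Sum>g\<in>SG. \<Sum>y\<in>SG. \<phi> y * young y)"
    by (intro sum.cong refl sum_conj[of _ "\<lambda>y. \<phi> y * young y"]) simp
  also have "\<dots> = (\<Sum>g\<in>SG. sandwich \<phi> id)"
    by (intro sum.cong refl) (simp add: sum_young mult.commute flip: sum_young)
  finally show ?thesis by (simp add: card_permutations[OF refl fin])
qed

text \<open>For each g, \<open>young_triple\<close> and \<open>young_shift\<close> evaluate the
  inner sum as kappa times \<open>young g * young (inv g)\<close>; the sum over g is kappa once
  more.\<close>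

lemma sandwich_conj_young: "sandwich conj_young id = kappa\<^sup>2"
proof -
  have i: "id \<in> SG" by (simp add: permutes_id)
  have "sandwich conj_young id = (\<Sum>\<tau>\<in>SG. conj_young \<tau> * young (inv \<tau>))"
    using class_function_young[OF class_function_conj_young i] young_id by simp
  also have "\<dots> = (\<Sum>z\<in>SG. young z * conj_young (inv z))"
    by (rule sum.reindex_bij_witness[of _ inv inv]) (auto simp: permutes_inv permutes_inv_inv)
  also have "\<dots> = (\<Sum>g\<in>SG. \<Sum>z\<in>SG. young z * young (inv g \<circ> inv z \<circ> g))"
    unfolding conj_young_def sum_distrib_left by (rule sum.swap)
  also have "\<dots> = (\<Sum>g\<in>SG. kappa * (young g * young (inv g)))"
    by (intro sum.cong refl) (subst young_triple, auto simp: young_shift)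
  finally show ?thesis by (simp add: kappa_def power2_eq_square sum_distrib_left)
qed

text \<open>Otherwise \<open>conj_young\<close> would have norm 0, although its value at the
  identity is the order of the group.\<close>

lemma kappa_nonzero: "kappa \<noteq> 0"
proof
  assume "kappa = 0"
  then have "(\<Sum>y\<in>SG. conj_young y * conj_young y) = 0"
    using inner_conj_young[OF class_function_conj_young] sandwich_conj_young by simp
  then have "conj_young id * conj_young id = 0"
    using perm_group_finite[OF SG] by (subst (asm) sum_nonneg_eq_0_iff) (auto simp: permutes_id)
  moreover have "conj_young id = (\<Sum>g\<in>SG. 1)"
    unfolding conj_young_def by (intro sum.cong refl) (auto simp: permutes_inv_o young_id)
  ultimately show False using card_permutations[OF refl fin] by simp
qed

lemma class_function_conj_young_eigen:
  assumes \<phi>: "class_function B \<phi>" and y: "y \<in> SG"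
  shows "(\<Sum>\<tau>\<in>SG. \<phi> \<tau> * conj_young (inv \<tau> \<circ> y)) = sandwich \<phi> id * conj_young y"
proof -
  have "(\<Sum>\<tau>\<in>SG. \<phi> \<tau> * conj_young (inv \<tau> \<circ> y)) = (\<Sum>g\<in>SG. \<Sum>\<tau>\<in>SG. \<phi> \<tau> * young (inv g \<circ> (inv \<tau> \<circ> y) \<circ> g))"
    unfolding conj_young_def sum_distrib_left by (rule sum.swap)
  also have "\<dots> = (\<Sum>g\<in>SG. young (inv g \<circ> y \<circ> g) * sandwich \<phi> id)"
  proof (intro sum.cong refl)
    fix g assume "g \<in> SG"
    then have g: "g permutes B" by simp
    have "(\<Sum>\<tau>\<in>SG. \<phi> \<tau> * young (inv g \<circ> (inv \<tau> \<circ> y) \<circ> g))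
      = (\<Sum>\<tau>\<in>SG. \<phi> (inv g \<circ> \<tau> \<circ> g) * young (inv (inv g \<circ> \<tau> \<circ> g) \<circ> (inv g \<circ> y \<circ> g)))"
    proof (intro sum.cong refl)
      fix \<tau> assume "\<tau> \<in> SG"
      then have t: "\<tau> permutes B" by simp
      have 1: "\<phi> (inv g \<circ> \<tau> \<circ> g) = \<phi> \<tau>"
        using class_functionD[OF \<phi> permutes_inv[OF g] t] by (simp add: permutes_inv_inv[OF g])
      have 2: "inv (inv g \<circ> \<tau> \<circ> g) = inv g \<circ> inv \<tau> \<circ> g"
        using o_inv_distrib[OF permutes_bij[OF permutes_compose[OF t permutes_inv[OF g]]] permutes_bij[OF g]]
          o_inv_distrib[OF permutes_bij[OF permutes_inv[OF g]] permutes_bij[OF t]]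
        by (simp add: permutes_inv_inv[OF g] o_assoc)
      have "inv g \<circ> inv \<tau> \<circ> g \<circ> (inv g \<circ> y \<circ> g) = inv g \<circ> inv \<tau> \<circ> (g \<circ> inv g) \<circ> y \<circ> g" by (simp only: o_assoc)
      also have "\<dots> = inv g \<circ> (inv \<tau> \<circ> y) \<circ> g" by (simp add: permutes_inv_o(1)[OF g] o_assoc)
      finally show "\<phi> \<tau> * young (inv g \<circ> (inv \<tau> \<circ> y) \<circ> g)
        = \<phi> (inv g \<circ> \<tau> \<circ> g) * young (inv (inv g \<circ> \<tau> \<circ> g) \<circ> (inv g \<circ> y \<circ> g))" using 1 2 by simp
    qed
    also have "\<dots> = (\<Sum>\<tau>\<in>SG. \<phi> \<tau> * young (inv \<tau> \<circ> (inv g \<circ> y \<circ> g)))"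
      by (rule sum_conj[OF g, of "\<lambda>\<tau>. \<phi> \<tau> * young (inv \<tau> \<circ> (inv g \<circ> y \<circ> g))"])
    also have "\<dots> = young (inv g \<circ> y \<circ> g) * sandwich \<phi> id"
      by (rule class_function_young[OF \<phi>]) (use g y in \<open>auto intro: permutes_compose permutes_inv\<close>)
    finally show "(\<Sum>\<tau>\<in>SG. \<phi> \<tau> * young (inv g \<circ> (inv \<tau> \<circ> y) \<circ> g)) = young (inv g \<circ> y \<circ> g) * sandwich \<phi> id" .
  qed
  also have "\<dots> = sandwich \<phi> id * conj_young y"
    by (simp add: conj_young_def sum_distrib_left mult.commute)
  finally show ?thesis .
qed

text \<open>The equality case of the Cauchy--Schwarz inequality.\<close>

theorem conj_young_unique:
  assumes \<phi>: "class_function B \<phi>" and norm: "(\<Sum>y\<in>SG. \<phi> y * \<phi> y) = fact (card B)"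
    and sandwich: "sandwich \<phi> id = kappa" and y: "y \<in> SG"
  shows "conj_young y = kappa * \<phi> y"
proof -
  \<comment> \<open>All three inner products produce m! times the square of kappa, with coefficients
    1, -2 and 1.\<close>
  have "(\<Sum>y\<in>SG. (kappa * \<phi> y - conj_young y)\<^sup>2)
    = kappa\<^sup>2 * (\<Sum>y\<in>SG. \<phi> y * \<phi> y) - 2 * kappa * (\<Sum>y\<in>SG. \<phi> y * conj_young y) + (\<Sum>y\<in>SG. conj_young y * conj_young y)"
    by (simp add: power2_diff power2_eq_square sum.distrib sum_subtractf sum_distrib_left algebra_simps)
  also have "\<dots> = 0"
    unfolding norm inner_conj_young[OF \<phi>] inner_conj_young[OF class_function_conj_young] sandwich sandwich_conj_young
    by (simp add: power2_eq_square)
  finally have "(kappa * \<phi> y - conj_young y)\<^sup>2 = 0"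
    using perm_group_finite[OF SG] y by (subst (asm) sum_nonneg_eq_0_iff) auto
  then show ?thesis by simp
qed

text \<open>Transfers the eigenvalue from \<open>conj_young\<close> to \<phi>; this is where
  division by kappa is required.\<close>

corollary class_function_eigen:
  assumes \<phi>: "class_function B \<phi>" and norm: "(\<Sum>y\<in>SG. \<phi> y * \<phi> y) = fact (card B)"
    and sandwich: "sandwich \<phi> id = kappa" and y: "y \<in> SG" and \<psi>: "class_function B \<psi>"
  shows "(\<Sum>\<tau>\<in>SG. \<psi> \<tau> * \<phi> (inv \<tau> \<circ> y)) = sandwich \<psi> id * \<phi> y"
proof -
  have "kappa * (\<Sum>\<tau>\<in>SG. \<psi> \<tau> * \<phi> (inv \<tau> \<circ> y)) = (\<Sum>\<tau>\<in>SG. \<psi> \<tau> * conj_young (inv \<tau> \<circ> y))"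
    unfolding sum_distrib_left
  proof (intro sum.cong refl)
    fix \<tau> assume "\<tau> \<in> SG"
    then have "inv \<tau> \<circ> y \<in> SG" using y by (auto intro: permutes_compose permutes_inv)
    from conj_young_unique[OF \<phi> norm sandwich this]
    show "kappa * (\<psi> \<tau> * \<phi> (inv \<tau> \<circ> y)) = \<psi> \<tau> * conj_young (inv \<tau> \<circ> y)" by simp
  qed
  also have "\<dots> = kappa * (sandwich \<psi> id * \<phi> y)"
    using class_function_conj_young_eigen[OF \<psi> y] conj_young_unique[OF \<phi> norm sandwich y] by simp
  finally show ?thesis using kappa_nonzero by simp
qed

end

lemma int_card_sum_if: "finite X \<Longrightarrow> int (card {x \<in> X. P x}) = (\<Sum>x\<in>X. if P x then 1 else 0)"
  by (simp add: sum.If_cases Int_def)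

lemma comp_left_eq_iff:
  assumes "p permutes B"
  shows "p \<circ> x = y \<longleftrightarrow> x = inv p \<circ> y"
proof
  assume "p \<circ> x = y"
  then have "inv p \<circ> y = (inv p \<circ> p) \<circ> x" by (simp only: o_assoc[symmetric])
  then show "x = inv p \<circ> y" by (simp add: permutes_inv_o(2)[OF assms])
next
  assume "x = inv p \<circ> y"
  then have "p \<circ> x = (p \<circ> inv p) \<circ> y" by (simp add: o_assoc)
  then show "p \<circ> x = y" by (simp add: permutes_inv_o(1)[OF assms])
qed

section \<open>Young characters under the tableau functional\<close>

context tableau begin

text \<open>Written over quadruples with product p' q0 p q = id, so that fixing \<open>q0\<close>
  isolates the weight of a single colouring, as in \<open>fix_weight_row\<close>.\<close>

lemma kappa_expand:
  "kappa = (\<Sum>p'\<in>RG. \<Sum>q0\<in>CG. \<Sum>p\<in>RG. \<Sum>q\<in>CG. sign q0 * (sign q * (if p' \<circ> q0 \<circ> p \<circ> q = id then 1 else 0)))"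
proof -
  have "kappa = (\<Sum>p'\<in>RG. \<Sum>q0\<in>CG. sign q0 * young (inv (p' \<circ> q0)))"
    unfolding kappa_def sum_young by (simp add: sandwich_def)
  also have "\<dots> = (\<Sum>p'\<in>RG. \<Sum>q0\<in>CG. \<Sum>p\<in>RG. \<Sum>q\<in>CG. sign q0 * (sign (inv q) * (if p' \<circ> q0 \<circ> inv p \<circ> inv q = id then 1 else 0)))"
    unfolding young_def sandwich_def sum_distrib_left
  proof (intro sum.cong refl)
    fix p' q0 p q assume *: "p' \<in> RG" "q0 \<in> CG" "p \<in> RG" "q \<in> CG"
    then have B: "p' permutes B" "q0 permutes B" "p permutes B" "q permutes B" by (auto simp: stab_def)
    let ?x = "p' \<circ> q0"
    have xB: "?x permutes B" using B by (simp add: permutes_compose)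
    have pB: "p \<circ> inv ?x permutes B" using B xB by (simp add: permutes_compose permutes_inv)
    have "p \<circ> inv ?x \<circ> q = id \<longleftrightarrow> p \<circ> inv ?x = inv q" using comp_eq_id_iff(2)[OF B(4)] .
    also have "\<dots> \<longleftrightarrow> inv ?x = inv p \<circ> inv q"
      by (rule comp_left_eq_iff[OF B(3)])
    also have "\<dots> \<longleftrightarrow> ?x \<circ> (inv p \<circ> inv q) = id"
      unfolding comp_eq_id_iff(1)[OF xB] by (rule eq_commute)
    finally show "sign q0 * (sign q * (if p \<circ> inv ?x \<circ> q = id then 1 else 0))
      = sign q0 * (sign (inv q) * (if p' \<circ> q0 \<circ> inv p \<circ> inv q = id then 1 else 0))"
      using sign_group(2)[OF CG *(4,4)] by (simp add: o_assoc)
  qed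
  also have "\<dots> = (\<Sum>p'\<in>RG. \<Sum>q0\<in>CG. \<Sum>p\<in>RG. \<Sum>q\<in>CG. sign q0 * (sign q * (if p' \<circ> q0 \<circ> p \<circ> q = id then 1 else 0)))"
  proof (rule sum.cong[OF refl], rule sum.cong[OF refl])
    fix p' q0 :: "nat \<Rightarrow> nat"
    define F where "F p q = sign q0 * (sign q * (if p' \<circ> q0 \<circ> p \<circ> q = id then 1 else 0))" for p q :: "nat \<Rightarrow> nat"
    have "(\<Sum>p\<in>RG. \<Sum>q\<in>CG. sign q0 * (sign (inv q) * (if p' \<circ> q0 \<circ> inv p \<circ> inv q = id then 1 else 0)))
      = (\<Sum>p\<in>RG. \<Sum>q\<in>CG. F (inv p) (inv q))" by (simp only: F_def)
    also have "\<dots> = (\<Sum>p\<in>RG. \<Sum>q\<in>CG. F (inv p) q)"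
      by (rule sum.cong[OF refl]) (rule sum_group_inv[OF CG])
    also have "\<dots> = (\<Sum>p\<in>RG. \<Sum>q\<in>CG. F p q)"
      by (rule sum_group_inv[OF RG, of "\<lambda>p. \<Sum>q\<in>CG. F p q"])
    finally show "(\<Sum>p\<in>RG. \<Sum>q\<in>CG. sign q0 * (sign (inv q) * (if p' \<circ> q0 \<circ> inv p \<circ> inv q = id then 1 else 0)))
      = (\<Sum>p\<in>RG. \<Sum>q\<in>CG. sign q0 * (sign q * (if p' \<circ> q0 \<circ> p \<circ> q = id then 1 else 0)))" by (simp only: F_def)
  qed
  finally show ?thesis .
qed

text \<open>The share of one colouring in the sandwich, at the identity, of a permutation character
  on colourings.\<close>

definition fix_weight :: "(nat \<Rightarrow> nat) \<Rightarrow> int" where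
  "fix_weight f = (\<Sum>p\<in>RG. \<Sum>q\<in>CG. sign q * (if \<forall>s\<in>B. f (p (q s)) = f s then 1 else 0))"

lemma fix_weight_collision:
  assumes st: "s \<in> B" "t \<in> B" "s \<noteq> t" "c s = c t" "f s = f t"
  shows "fix_weight f = 0"
proof -
  let ?T = "Transposition.transpose s t"
  have T: "?T \<in> CG" using st transpose_CG by blast
  have TB: "?T permutes B" using T by (simp add: stab_def)
  have fT: "f (?T x) = f x" for x using st by (simp add: Transposition.transpose_def)
  have "fix_weight f = (\<Sum>p\<in>RG. \<Sum>q\<in>CG. sign (q \<circ> ?T) * (if \<forall>s\<in>B. f (p ((q \<circ> ?T) s)) = f s then 1 else 0))"
    unfolding fix_weight_def
    by (intro sum.cong refl sum_group_right[OF CG T, of "\<lambda>q. sign q * (if \<forall>s\<in>B. f (_ (q s)) = f s then 1 else 0)", symmetric])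
  also have "\<dots> = (\<Sum>p\<in>RG. \<Sum>q\<in>CG. - (sign q * (if \<forall>s\<in>B. f (p (q s)) = f s then 1 else 0)))"
  proof (intro sum.cong refl)
    fix p q :: "nat \<Rightarrow> nat" assume "q \<in> CG"
    have "(\<forall>s\<in>B. f (p ((q \<circ> ?T) s)) = f s) \<longleftrightarrow> (\<forall>s\<in>B. f (p (q (?T s))) = f (?T s))" by (simp add: fT)
    also have "\<dots> \<longleftrightarrow> (\<forall>s\<in>?T ` B. f (p (q s)) = f s)" by blast
    also have "?T ` B = B" using permutes_image[OF TB] .
    finally show "sign (q \<circ> ?T) * (if \<forall>s\<in>B. f (p ((q \<circ> ?T) s)) = f s then 1 else 0)
      = - (sign q * (if \<forall>s\<in>B. f (p (q s)) = f s then 1 else 0))"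
      using sign_group(1)[OF CG \<open>q \<in> CG\<close> T] st by (simp add: sign_swap_id)
  qed
  also have "\<dots> = - fix_weight f" by (simp add: fix_weight_def sum_negf)
  finally show ?thesis by simp
qed

text \<open>p q fixes \<open>r \<circ> q0\<close> exactly when the conjugate by q0 of p q preserves
  rows, that is, when its inverse is some p' in \<open>RG\<close>. Replacing q by
  \<open>q \<circ> q0\<close> gives the condition of \<open>kappa_expand\<close> and contributes the
  sign of q0.\<close>

lemma fix_weight_row:
  assumes q0: "q0 \<in> CG"
  shows "fix_weight (restrict (r \<circ> q0) B)
    = (\<Sum>p'\<in>RG. \<Sum>p\<in>RG. \<Sum>q\<in>CG. sign q0 * (sign q * (if p' \<circ> q0 \<circ> p \<circ> q = id then 1 else 0)))"
proof -
  have q0B: "q0 permutes B" using q0 by (simp add: stab_def)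
  have "fix_weight (restrict (r \<circ> q0) B)
     = (\<Sum>p\<in>RG. \<Sum>q\<in>CG. \<Sum>p'\<in>RG. sign q * (if p' \<circ> q0 \<circ> p \<circ> (q \<circ> inv q0) = id then 1 else 0))"
    unfolding fix_weight_def
  proof (intro sum.cong refl)
    fix p q assume *: "p \<in> RG" "q \<in> CG"
    then have B: "p permutes B" "q permutes B" by (auto simp: stab_def)
    let ?y = "q0 \<circ> p \<circ> (q \<circ> inv q0)"
    have yB: "?y permutes B" using B q0B by (simp add: permutes_compose permutes_inv)
    have img: "q0 ` B = B" using permutes_image[OF q0B] .
    have "(\<forall>s\<in>B. restrict (r \<circ> q0) B (p (q s)) = restrict (r \<circ> q0) B s) \<longleftrightarrow> (\<forall>s\<in>B. r (?y (q0 s)) = r (q0 s))"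
      using B by (simp add: permutes_in_image permutes_inverses(2)[OF q0B])
    also have "\<dots> \<longleftrightarrow> (\<forall>s\<in>q0 ` B. r (?y s) = r s)" by blast
    also have "\<dots> \<longleftrightarrow> ?y \<in> RG" unfolding img using yB by (simp add: stab_def)
    also have "\<dots> \<longleftrightarrow> inv ?y \<in> RG" using perm_groupD(2)[OF RG] permutes_inv_inv[OF yB] by metis
    finally have e: "(\<forall>s\<in>B. restrict (r \<circ> q0) B (p (q s)) = restrict (r \<circ> q0) B s) \<longleftrightarrow> inv ?y \<in> RG" .
    have "(\<Sum>p'\<in>RG. sign q * (if p' \<circ> q0 \<circ> p \<circ> (q \<circ> inv q0) = id then 1 else 0))
       = (\<Sum>p'\<in>RG. if p' = inv ?y then sign q else 0)"
      using comp_eq_id_iff(2)[OF yB] by (intro sum.cong refl) (simp add: o_assoc)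
    then show "sign q * (if \<forall>s\<in>B. restrict (r \<circ> q0) B (p (q s)) = restrict (r \<circ> q0) B s then 1 else 0)
      = (\<Sum>p'\<in>RG. sign q * (if p' \<circ> q0 \<circ> p \<circ> (q \<circ> inv q0) = id then 1 else 0))"
      unfolding e using perm_group_finite[OF RG] by simp
  qed
  also have "\<dots> = (\<Sum>p\<in>RG. \<Sum>q\<in>CG. \<Sum>p'\<in>RG. sign (q \<circ> q0) * (if p' \<circ> q0 \<circ> p \<circ> ((q \<circ> q0) \<circ> inv q0) = id then 1 else 0))"
    by (intro sum.cong refl sum_group_right[OF CG q0, of "\<lambda>q. \<Sum>p'\<in>RG. sign q * (if p' \<circ> q0 \<circ> _ \<circ> (q \<circ> inv q0) = id then 1 else 0)", symmetric])
  also have "\<dots> = (\<Sum>p\<in>RG. \<Sum>q\<in>CG. \<Sum>p'\<in>RG. sign q0 * (sign q * (if p' \<circ> q0 \<circ> p \<circ> q = id then 1 else 0)))"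
  proof (intro sum.cong refl)
    fix p q p' :: "nat \<Rightarrow> nat" assume "q \<in> CG"
    have "(q \<circ> q0) \<circ> inv q0 = q" using permutes_inv_o(1)[OF q0B] by (simp add: o_assoc[symmetric])
    then show "sign (q \<circ> q0) * (if p' \<circ> q0 \<circ> p \<circ> ((q \<circ> q0) \<circ> inv q0) = id then 1 else 0)
      = sign q0 * (sign q * (if p' \<circ> q0 \<circ> p \<circ> q = id then 1 else 0))"
      using sign_group(1)[OF CG \<open>q \<in> CG\<close> q0] by simp
  qed
  also have "\<dots> = (\<Sum>p\<in>RG. \<Sum>p'\<in>RG. \<Sum>q\<in>CG. sign q0 * (sign q * (if p' \<circ> q0 \<circ> p \<circ> q = id then 1 else 0)))"
    by (intro sum.cong refl sum.swap)
  finally show ?thesis by (subst sum.swap)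
qed

lemma colouring_weighted_sum:
  assumes "f \<in> colourings B {1..l} \<alpha>"
  shows "int (sum f B) = (\<Sum>i\<in>{1..l}. int i * \<alpha> i)"
proof -
  have f: "f ` B \<subseteq> {1..l}" "\<And>i. i \<in> {1..l} \<Longrightarrow> int (card {s\<in>B. f s = i}) = \<alpha> i"
    using assms by (auto simp: colourings_def PiE_iff)
  have "sum f B = (\<Sum>i\<in>{1..l}. sum f {s\<in>B. f s = i})"
    using sum.group[of B "{1..l}" f f] fin f(1) by simp
  also have "\<dots> = (\<Sum>i\<in>{1..l}. i * card {s\<in>B. f s = i})" by (intro sum.cong refl) simp
  finally show ?thesis using f(2) by simp
qed

lemma sandwich_colourings:
  "sandwich (\<lambda>\<sigma>. int (card {f \<in> colourings B {1..l} \<alpha>. \<forall>s\<in>B. f (\<sigma> s) = f s})) id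
    = (\<Sum>f\<in>colourings B {1..l} \<alpha>. fix_weight f)"
proof -
  let ?X = "colourings B {1..l} \<alpha>"
  have fX: "finite ?X" using finite_colourings fin by blast
  have "sandwich (\<lambda>\<sigma>. int (card {f \<in> ?X. \<forall>s\<in>B. f (\<sigma> s) = f s})) id
     = (\<Sum>p\<in>RG. \<Sum>q\<in>CG. \<Sum>f\<in>?X. sign q * (if \<forall>s\<in>B. f (p (q s)) = f s then 1 else 0))"
    unfolding sandwich_def int_card_sum_if[OF fX] sum_distrib_left comp_apply id_apply ..
  also have "\<dots> = (\<Sum>p\<in>RG. \<Sum>f\<in>?X. \<Sum>q\<in>CG. sign q * (if \<forall>s\<in>B. f (p (q s)) = f s then 1 else 0))"
    by (intro sum.cong refl sum.swap)
  also have "\<dots> = (\<Sum>f\<in>?X. fix_weight f)" unfolding fix_weight_def by (rule sum.swap)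
  finally show ?thesis .
qed

text \<open>The weighted total lies below the minimum attained by column-injective labellings, so
  every colouring has a collision in some column.\<close>

lemma sandwich_colourings_zero:
  assumes "(\<Sum>i\<in>{1..l}. int i * \<alpha> i) < int (sum r B)"
  shows "sandwich (\<lambda>\<sigma>. int (card {f \<in> colourings B {1..l} \<alpha>. \<forall>s\<in>B. f (\<sigma> s) = f s})) id = 0"
  unfolding sandwich_colourings
proof (rule sum.neutral, rule ballI)
  fix f assume f: "f \<in> colourings B {1..l} \<alpha>"
  then have pos: "\<And>s. s \<in> B \<Longrightarrow> 1 \<le> f s" by (auto simp: colourings_def PiE_iff)
  have "sum f B < sum r B" using colouring_weighted_sum[OF f] assms by (simp only: of_nat_less_iff)
  then obtain s t where "s \<in> B" "t \<in> B" "c s = c t" "f s = f t" "s \<noteq> t"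
    using column_injective(1)[OF pos] by fastforce
  then show "fix_weight f = 0" using fix_weight_collision by blast
qed

text \<open>Here the weighted total equals the minimum, so only the colourings
  \<open>r \<circ> q\<close> with q in the column group survive, each for exactly one q. Their
  weights add up to \<open>kappa_expand\<close>.\<close>

lemma sandwich_colourings_shape:
  assumes rl: "r ` B \<subseteq> {1..l}" and \<alpha>: "\<And>i. i \<in> {1..l} \<Longrightarrow> \<alpha> i = int (card {s\<in>B. r s = i})"
  shows "sandwich (\<lambda>\<sigma>. int (card {f \<in> colourings B {1..l} \<alpha>. \<forall>s\<in>B. f (\<sigma> s) = f s})) id = kappa"
proof -
  let ?X = "colourings B {1..l} \<alpha>" and ?h = "\<lambda>q. restrict (r \<circ> q) B"
  have fX: "finite ?X" using finite_colourings fin by blast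
  have rX: "restrict r B \<in> ?X"
  proof -
    have "{s\<in>B. restrict r B s = i} = {s\<in>B. r s = i}" for i by auto
    then show ?thesis using rl \<alpha> by (auto simp: colourings_def)
  qed
  have hX: "?h q \<in> ?X" if "q \<in> CG" for q
  proof -
    have q: "q permutes B" using that by (simp add: stab_def)
    have "?h q = restrict r B \<circ> q"
      using permutes_in_image[OF q] permutes_not_in[OF q] by (auto simp: fun_eq_iff restrict_def)
    then show ?thesis using comp_permutes_colourings[OF q rX] by simp
  qed
  have inj: "inj_on ?h CG"
  proof (rule inj_onI)
    fix p q assume pq: "p \<in> CG" "q \<in> CG" "?h p = ?h q"
    have "p s = q s" for s
    proof (cases "s \<in> B")
      case True
      then have "r (p s) = r (q s)" using pq(3) by (metis comp_apply restrict_apply')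
      then show ?thesis using box_inj[of "p s" "q s"] pq(1,2) True by (auto simp: stab_def permutes_in_image)
    next
      case False
      moreover have "p permutes B" "q permutes B" using pq by (auto simp: stab_def)
      ultimately show ?thesis by (simp add: permutes_not_in)
    qed
    then show "p = q" by auto
  qed
  have tot: "(\<Sum>i\<in>{1..l}. int i * \<alpha> i) = int (sum r B)"
    using colouring_weighted_sum[OF rX] by simp
  have "fix_weight f = 0" if f: "f \<in> ?X - ?h ` CG" for f
  proof (rule ccontr)
    assume nz: "fix_weight f \<noteq> 0"
    have pos: "\<And>s. s \<in> B \<Longrightarrow> 1 \<le> f s" using f by (auto simp: colourings_def PiE_iff)
    have inj: "s = t" if "s \<in> B" "t \<in> B" "c s = c t" "f s = f t" for s t
      using fix_weight_collision that nz by blast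
    have "f \<in> ?X" using f by blast
    from colouring_weighted_sum[OF this] tot have "sum f B = sum r B" by (simp only: of_nat_eq_iff)
    then obtain q where q: "q \<in> CG" "\<forall>s\<in>B. f s = r (q s)"
      using column_injective(2)[of f] pos inj by blast
    then have "f = ?h q" using f by (auto simp: fun_eq_iff colourings_def PiE_iff extensional_def)
    then show False using f q(1) by blast
  qed
  then have "(\<Sum>f\<in>?X. fix_weight f) = (\<Sum>f\<in>?h ` CG. fix_weight f)"
    using hX fX by (intro sum.mono_neutral_right) auto
  also have "\<dots> = (\<Sum>q\<in>CG. fix_weight (?h q))" using inj by (simp add: sum.reindex)
  also have "\<dots> = (\<Sum>q0\<in>CG. \<Sum>p'\<in>RG. \<Sum>p\<in>RG. \<Sum>q\<in>CG. sign q0 * (sign q * (if p' \<circ> q0 \<circ> p \<circ> q = id then 1 else 0)))"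
    by (intro sum.cong refl fix_weight_row)
  also have "\<dots> = kappa" unfolding kappa_expand by (rule sum.swap)
  finally show ?thesis unfolding sandwich_colourings .
qed

end

section \<open>Convolution with the number of fixed colourings\<close>

text \<open>This is N to the number of cycles, since a fixed colouring is constant on cycles; the
  counting form avoids cycle decompositions.\<close>

definition fix_count :: "nat \<Rightarrow> 'a set \<Rightarrow> ('a \<Rightarrow> 'a) \<Rightarrow> nat" where
  "fix_count N B \<sigma> = card {b \<in> B \<rightarrow>\<^sub>E {1..N}. \<forall>s\<in>B. b (\<sigma> s) = b s}"

lemma class_function_fixed:
  fixes B :: "'a set" and X :: "('a \<Rightarrow> 'b) set"
  assumes X: "\<And>b h. b \<in> X \<Longrightarrow> h permutes B \<Longrightarrow> b \<circ> h \<in> X"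
  shows "class_function B (\<lambda>\<sigma>. card {b \<in> X. \<forall>s\<in>B. b (\<sigma> s) = b s})"
  unfolding class_function_def
proof (intro allI impI)
  fix g x :: "'a \<Rightarrow> 'a" assume g: "g permutes B" and x: "x permutes B"
  let ?F = "\<lambda>x. {b \<in> X. \<forall>s\<in>B. b (x s) = b s}"
  have g': "inv g permutes B" using g by (rule permutes_inv)
  have "bij_betw (\<lambda>b. b \<circ> g) (?F (g \<circ> x \<circ> inv g)) (?F x)"
  proof (rule bij_betwI[where g = "\<lambda>b. b \<circ> inv g"])
    show "(\<lambda>b. b \<circ> g) \<in> ?F (g \<circ> x \<circ> inv g) \<rightarrow> ?F x"
    proof
      fix b assume b: "b \<in> ?F (g \<circ> x \<circ> inv g)"
      have "b (g (x s)) = b (g s)" if "s \<in> B" for s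
      proof -
        have "g s \<in> B" using that g by (simp add: permutes_in_image)
        then have "b ((g \<circ> x \<circ> inv g) (g s)) = b (g s)" using b by blast
        then show ?thesis by (simp add: permutes_inverses(2)[OF g])
      qed
      then show "b \<circ> g \<in> ?F x" using b X[OF _ g] by simp
    qed
    show "(\<lambda>b. b \<circ> inv g) \<in> ?F x \<rightarrow> ?F (g \<circ> x \<circ> inv g)"
    proof
      fix b assume b: "b \<in> ?F x"
      have "b (x (inv g s)) = b (inv g s)" if "s \<in> B" for s
        using b that permutes_in_image[OF g'] by blast
      then show "b \<circ> inv g \<in> ?F (g \<circ> x \<circ> inv g)" using b X[OF _ g'] by (simp add: permutes_inverses(2)[OF g])
    qed
    show "b \<circ> g \<circ> inv g = b" for b :: "'a \<Rightarrow> 'b" by (simp add: o_assoc[symmetric] permutes_inv_o(1)[OF g])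
    show "b \<circ> inv g \<circ> g = b" for b :: "'a \<Rightarrow> 'b" by (simp add: o_assoc[symmetric] permutes_inv_o(2)[OF g])
  qed
  from bij_betw_same_card[OF this] show "card (?F (g \<circ> x \<circ> inv g)) = card (?F x)" .
qed

lemma comp_permutes_PiE: "b \<in> B \<rightarrow>\<^sub>E A \<Longrightarrow> h permutes B \<Longrightarrow> b \<circ> h \<in> B \<rightarrow>\<^sub>E A"
  using permutes_in_image[of h B] by (auto simp: PiE_iff extensional_def permutes_not_in)

lemma fix_count_class_function: "class_function B (fix_count N B)"
  unfolding fix_count_def by (rule class_function_fixed) (rule comp_permutes_PiE)

lemma fix_count_insert_fixed:
  assumes "finite B" "e \<notin> B" "\<alpha> permutes B"
  shows "fix_count N (insert e B) \<alpha> = N * fix_count N B \<alpha>"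
proof -
  let ?F = "{b \<in> insert e B \<rightarrow>\<^sub>E {1..N}. \<forall>s\<in>insert e B. b (\<alpha> s) = b s}"
  let ?G = "{b \<in> B \<rightarrow>\<^sub>E {1..N}. \<forall>s\<in>B. b (\<alpha> s) = b s}"
  have ae: "\<alpha> e = e" using assms by (simp add: permutes_not_in)
  have aB: "s \<in> B \<Longrightarrow> \<alpha> s \<in> B" for s using assms(3) by (simp add: permutes_in_image)
  have "bij_betw (\<lambda>b. (b e, restrict b B)) ?F ({1..N} \<times> ?G)"
  proof (rule bij_betwI[where g = "\<lambda>(x, b). b(e := x)"])
    show "(\<lambda>b. (b e, restrict b B)) \<in> ?F \<rightarrow> {1..N} \<times> ?G" using aB by (auto simp: PiE_iff)
    show "(\<lambda>(x, b). b(e := x)) \<in> {1..N} \<times> ?G \<rightarrow> ?F"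
      using aB ae assms(2) by (auto simp: PiE_iff extensional_def)
    show "(\<lambda>(x, b). b(e := x)) (b e, restrict b B) = b" if "b \<in> ?F" for b
      using that by (auto simp: PiE_iff extensional_def fun_eq_iff)
    show "(\<lambda>b. (b e, restrict b B)) ((\<lambda>(x, b). b(e := x)) y) = y" if "y \<in> {1..N} \<times> ?G" for y
      using that assms(2) by (auto simp: PiE_iff extensional_def fun_eq_iff)
  qed
  from bij_betw_same_card[OF this] show ?thesis by (simp add: fix_count_def card_cartesian_product)
qed

text \<open>The transposition inserts \<open>e\<close> into the cycle of \<open>t\<close>, so the
  number of cycles stays the same and the colour of \<open>e\<close> is forced.\<close>

lemma fix_count_insert_transpose:
  assumes "finite B" "e \<notin> B" "t \<in> B" "\<alpha> permutes B"
  shows "fix_count N (insert e B) (\<alpha> \<circ> Transposition.transpose t e) = fix_count N B \<alpha>"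
proof -
  let ?T = "Transposition.transpose t e"
  let ?F = "{b \<in> insert e B \<rightarrow>\<^sub>E {1..N}. \<forall>s\<in>insert e B. b ((\<alpha> \<circ> ?T) s) = b s}"
  let ?G = "{b \<in> B \<rightarrow>\<^sub>E {1..N}. \<forall>s\<in>B. b (\<alpha> s) = b s}"
  have ae: "\<alpha> e = e" using assms by (simp add: permutes_not_in)
  have aB: "s \<in> B \<Longrightarrow> \<alpha> s \<in> B" for s using assms(4) by (simp add: permutes_in_image)
  have iff: "(\<forall>s\<in>insert e B. b ((\<alpha> \<circ> ?T) s) = b s) \<longleftrightarrow> b e = b t \<and> (\<forall>s\<in>B. b (\<alpha> s) = b s)" for b :: "'a \<Rightarrow> nat"
  proof
    assume *: "\<forall>s\<in>insert e B. b ((\<alpha> \<circ> ?T) s) = b s"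
    have 1: "b e = b t" using *[rule_format, of t] assms(3) ae by simp
    have 2: "b (\<alpha> t) = b e" using *[rule_format, of e] by simp
    have "b (\<alpha> s) = b s" if "s \<in> B" for s
    proof (cases "s = t")
      case False
      then have "?T s = s" using that assms(2) by (auto simp: Transposition.transpose_def)
      then show ?thesis using *[rule_format, of s] that by simp
    qed (use 1 2 in simp)
    with 1 show "b e = b t \<and> (\<forall>s\<in>B. b (\<alpha> s) = b s)" by simp
  next
    assume "b e = b t \<and> (\<forall>s\<in>B. b (\<alpha> s) = b s)"
    then show "\<forall>s\<in>insert e B. b ((\<alpha> \<circ> ?T) s) = b s"
      using ae assms(3) by (auto simp: Transposition.transpose_def)
  qed
  have "bij_betw (\<lambda>b. restrict b B) ?F ?G"
  proof (rule bij_betwI[where g = "\<lambda>b. b(e := b t)"])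
    show "(\<lambda>b. restrict b B) \<in> ?F \<rightarrow> ?G" unfolding iff using aB by (auto simp: PiE_iff)
    show "(\<lambda>b. b(e := b t)) \<in> ?G \<rightarrow> ?F"
      unfolding iff using aB assms by (auto simp: PiE_iff extensional_def)
    show "(restrict b B)(e := restrict b B t) = b" if "b \<in> ?F" for b
      using that unfolding iff using assms(3) by (auto simp: PiE_iff extensional_def fun_eq_iff)
    show "restrict (b(e := b t)) B = b" if "b \<in> ?G" for b
      using that assms(2) by (auto simp: PiE_iff extensional_def fun_eq_iff)
  qed
  from bij_betw_same_card[OF this] show ?thesis by (simp add: fix_count_def)
qed

text \<open>Coset decomposition over the smaller stabiliser; the representative is determined by the
  preimage t of \<open>e\<close>.\<close>

lemma sum_stab_insert:
  assumes "finite B" "e \<notin> B"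
  shows "(\<Sum>p\<in>stab (insert e B) f. F p)
    = (\<Sum>t\<in>{t\<in>insert e B. f t = f e}. \<Sum>p\<in>stab B f. F (p \<circ> Transposition.transpose t e))"
proof -
  let ?B = "insert e B" and ?T = "\<lambda>t. Transposition.transpose t e"
  have sub: "stab B f \<subseteq> stab ?B f"
    using assms by (auto simp: stab_def permutes_not_in intro: permutes_subset)
  have "(\<Sum>x\<in>{t\<in>?B. f t = f e} \<times> stab B f. F (snd x \<circ> ?T (fst x))) = (\<Sum>p\<in>stab ?B f. F p)"
  proof (rule sum.reindex_bij_witness[of _ "\<lambda>p. (inv p e, p \<circ> ?T (inv p e))" "\<lambda>x. snd x \<circ> ?T (fst x)"])
    fix x assume x: "x \<in> {t\<in>?B. f t = f e} \<times> stab B f"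
    obtain t p where tp: "x = (t, p)" by force
    have t: "t \<in> ?B" "f t = f e" and p: "p \<in> stab B f" using x tp by auto
    have pB: "p permutes ?B" "p e = e" using p sub assms(2) by (auto simp: stab_def permutes_not_in)
    have T: "?T t \<in> stab ?B f" using t by (auto simp: stab_def permutes_swap_id Transposition.transpose_def)
    show "snd x \<circ> ?T (fst x) \<in> stab ?B f"
      using perm_groupD(3)[OF perm_group_stab[of ?B f], of p "?T t"] p sub T assms(1) tp by auto
    have "inv (p \<circ> ?T t) = inv (?T t) \<circ> inv p"
      using o_inv_distrib[OF permutes_bij[OF pB(1)], of "?T t"] T by (auto simp: stab_def permutes_bij)
    moreover have "inv p e = e" using pB by (metis permutes_inv_eq)
    ultimately have "inv (p \<circ> ?T t) e = t" by simp
    moreover have "p \<circ> ?T t \<circ> ?T t = p" by (simp add: fun_eq_iff)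
    ultimately show "(inv (snd x \<circ> ?T (fst x)) e, snd x \<circ> ?T (fst x) \<circ> ?T (inv (snd x \<circ> ?T (fst x)) e)) = x"
      by (simp add: tp)
  next
    fix p assume p: "p \<in> stab ?B f"
    then have pB: "p permutes ?B" by (simp add: stab_def)
    let ?t = "inv p e"
    have pt: "p ?t = e" using permutes_inverses(1)[OF pB] by simp
    have tB: "?t \<in> ?B" using permutes_in_image[OF permutes_inv[OF pB], of e] by simp
    have "f (p ?t) = f ?t" using p tB unfolding stab_def by blast
    then have ft: "f ?t = f e" unfolding pt by simp
    have T: "?T ?t \<in> stab ?B f" using tB ft by (auto simp: stab_def permutes_swap_id Transposition.transpose_def)
    have st: "p \<circ> ?T ?t \<in> stab ?B f"
      using perm_groupD(3)[OF perm_group_stab[of ?B f], of p "?T ?t"] p T assms(1) by auto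
    have e: "(p \<circ> ?T ?t) e = e" using pt by simp
    have "p \<circ> ?T ?t permutes ?B" using st unfolding stab_def by blast
    then have "p \<circ> ?T ?t permutes B" by (rule permutes_superset) (use e in blast)
    then have "p \<circ> ?T ?t \<in> stab B f" using st unfolding stab_def by blast
    then show "(?t, p \<circ> ?T ?t) \<in> {t\<in>?B. f t = f e} \<times> stab B f" using tB ft by simp
    show "snd (?t, p \<circ> ?T ?t) \<circ> ?T (fst (?t, p \<circ> ?T ?t)) = p" by (simp add: fun_eq_iff)
  qed simp_all
  then show ?thesis by (simp add: sum.cartesian_product case_prod_beta)
qed

section \<open>The content product as the eigenvalue of the cycle function\<close>

context tableau begin

text \<open>The rightmost box of the bottom row. Its maximality is returned too, because the lengths
  of its row and column are counted from it.\<close>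

lemma corner:
  assumes "B \<noteq> {}"
  obtains e where "e \<in> B" "\<And>s. s \<in> B \<Longrightarrow> r s \<le> r e" "\<And>s. s \<in> B \<Longrightarrow> r s = r e \<Longrightarrow> c s \<le> c e"
    "tableau (B - {e}) r c"
proof -
  have "\<exists>s. s \<in> B" using assms by auto
  define R where "R = Max (r ` B)"
  have R: "R \<in> r ` B" "\<And>s. s \<in> B \<Longrightarrow> r s \<le> R" unfolding R_def using fin assms by auto
  let ?K = "{s\<in>B. r s = R}"
  define C where "C = Max (c ` ?K)"
  have "finite ?K" "?K \<noteq> {}" using fin R by auto
  then have C: "C \<in> c ` ?K" "\<And>s. s \<in> ?K \<Longrightarrow> c s \<le> C" unfolding C_def by auto
  then obtain e where e: "e \<in> B" "r e = R" "c e = C" by auto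
  have "tableau (B - {e}) r c"
  proof
    fix s i j assume s: "s \<in> B - {e}" and ij: "1 \<le> i" "i \<le> r s" "1 \<le> j" "j \<le> c s"
    then obtain t where t: "t \<in> B" "r t = i" "c t = j" using box_down by blast
    have "t \<noteq> e"
    proof
      assume "t = e"
      then have "r s = R" using t e ij s R(2)[of s] by simp
      moreover from this have "c s = C" using C(2)[of s] s t e ij \<open>t = e\<close> by simp
      ultimately show False using box_inj[of s e] s e by simp
    qed
    then show "\<exists>t\<in>B - {e}. r t = i \<and> c t = j" using t by blast
  qed (use fin box_inj box_pos in auto)
  then show ?thesis using that[of e] e R C by auto
qed

end

text \<open>Induction on a corner \<open>e\<close>. Cosets split both groups according to a box t in
  the row and a box s in the column of \<open>e\<close>. The pair (e, e) adds a cycle and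
  contributes N, each of the c(e) - 1 pairs (t, e) contributes 1, each of the r(e) - 1 pairs (e, s)
  contributes -1, and mixed pairs vanish. Together they make the content factor of
  \<open>e\<close>.\<close>

lemma sandwich_fix_count_aux:
  assumes "tableau B r c"
  shows "tableau.sandwich B r c (\<lambda>\<sigma>. int (fix_count N B \<sigma>)) id = (\<Prod>s\<in>B. int N + int (c s) - int (r s))"
  using assms
proof (induction "card B" arbitrary: B)
  case 0
  then interpret T: tableau B r c by simp
  have "B = {}" using 0 T.fin by simp
  then have "stab B r = {id}" "stab B c = {id}" by (auto simp: stab_def)
  then show ?case unfolding T.sandwich_def using \<open>B = {}\<close> by (simp add: fix_count_def PiE_empty_domain)
next
  case (Suc k)
  interpret T: tableau B r c by fact
  have "B \<noteq> {}" using Suc.hyps(2) by auto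
  then obtain e where e: "e \<in> B" "\<And>s. s \<in> B \<Longrightarrow> r s \<le> r e" "\<And>s. s \<in> B \<Longrightarrow> r s = r e \<Longrightarrow> c s \<le> c e"
    and tab: "tableau (B - {e}) r c" using T.corner by metis
  define B' where "B' = B - {e}"
  interpret T': tableau B' r c using tab by (simp add: B'_def)
  have B: "B = insert e B'" "e \<notin> B'" using e by (auto simp: B'_def)
  have "card B' = k" using Suc.hyps(2) B T'.fin by simp
  with Suc.hyps(1)[of B'] T'.tableau_axioms
  have IH: "T'.sandwich (\<lambda>\<sigma>. int (fix_count N B' \<sigma>)) id = (\<Prod>s\<in>B'. int N + int (c s) - int (r s))" by simp
  let ?T = "\<lambda>t. Transposition.transpose t e"
  let ?FB = "\<lambda>\<sigma>. int (fix_count N B \<sigma>)" and ?FB' = "\<lambda>\<sigma>. int (fix_count N B' \<sigma>)"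
  let ?P = "T'.sandwich ?FB' id"
  let ?row = "{t\<in>B'. r t = r e}" and ?col = "{t\<in>B'. c t = c e}"
  \<comment> \<open>The value \<open>e\<close> encodes the trivial coset, its transposition with
    itself being the identity. Column cosets are taken on the opposite side from row cosets, so that
    the two transpositions meet in the middle.\<close>
  define H where "H t s = (\<Sum>p\<in>stab B' r. \<Sum>q\<in>stab B' c. sign (?T s \<circ> q) * ?FB (p \<circ> ?T t \<circ> (?T s \<circ> q)))" for t s
  have cls: "fix_count N B (x \<circ> y) = fix_count N B (y \<circ> x)" if "x permutes B" "y permutes B" for x y
    using class_function_commute[OF fix_count_class_function that] .
  have cls': "fix_count N B' (x \<circ> y) = fix_count N B' (y \<circ> x)" if "x permutes B'" "y permutes B'" for x y
    using class_function_commute[OF fix_count_class_function that] .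
  have ins: "\<alpha> permutes B" if "\<alpha> permutes B'" for \<alpha> using that B permutes_subset by blast
  have TB: "?T t permutes B" if "t \<in> B" for t using that e by (simp add: permutes_swap_id)
  have sgn: "sign (?T s \<circ> q) = (if s = e then sign q else - sign q)" if "q \<in> stab B' c" "s \<in> B" for s q
  proof -
    have "permutation q" using that T'.fin unfolding stab_def permutation_permutes by blast
    moreover have "permutation (?T s)" by (rule permutation_swap_id)
    ultimately show ?thesis by (simp add: sign_compose sign_swap_id)
  qed
  have ee: "H e e = int N * ?P"
    unfolding H_def T'.sandwich_def sum_distrib_left
  proof (intro sum.cong refl)
    fix p q assume pq: "p \<in> stab B' r" "q \<in> stab B' c"
    then have "p \<circ> q permutes B'" by (auto simp: stab_def permutes_compose)
    then have "fix_count N B (p \<circ> q) = N * fix_count N B' (p \<circ> q)"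
      unfolding B(1) by (rule fix_count_insert_fixed[OF T'.fin B(2)])
    then show "sign (?T e \<circ> q) * ?FB (p \<circ> ?T e \<circ> (?T e \<circ> q)) = int N * (sign q * ?FB' (p \<circ> id \<circ> q))"
      by simp
  qed
  have swap: "fix_count N B (p \<circ> ?T t \<circ> q) = fix_count N B' (p \<circ> q)"
    if "p permutes B'" "q permutes B'" "t \<in> B'" for p q t
  proof -
    have "fix_count N B (p \<circ> ?T t \<circ> q) = fix_count N B (q \<circ> p \<circ> ?T t)"
    proof -
      have "t \<in> B" using that(3) B by simp
      then have "p \<circ> ?T t permutes B" using ins[OF that(1)] TB by (intro permutes_compose)
      from cls[OF this ins[OF that(2)]] show ?thesis by (simp only: o_assoc)
    qed
    also have "\<dots> = fix_count N B' (q \<circ> p)"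
      unfolding B(1) using that by (intro fix_count_insert_transpose[OF T'.fin B(2)]) (auto simp: permutes_compose)
    finally show ?thesis using cls' that by simp
  qed
  have te: "H t e = ?P" if "t \<in> ?row" for t
    unfolding H_def T'.sandwich_def
  proof (intro sum.cong refl)
    fix p q assume pq: "p \<in> stab B' r" "q \<in> stab B' c"
    then show "sign (?T e \<circ> q) * ?FB (p \<circ> ?T t \<circ> (?T e \<circ> q)) = sign q * ?FB' (p \<circ> id \<circ> q)"
      using swap[of p q t] that by (simp add: stab_def)
  qed
  have es: "H e s = - ?P" if "s \<in> ?col" for s
    unfolding H_def T'.sandwich_def sum_negf[symmetric]
  proof (intro sum.cong refl)
    fix p q assume pq: "p \<in> stab B' r" "q \<in> stab B' c"
    have "s \<noteq> e" "s \<in> B" using that B by auto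
    then show "sign (?T s \<circ> q) * ?FB (p \<circ> ?T e \<circ> (?T s \<circ> q)) = - (sign q * ?FB' (p \<circ> id \<circ> q))"
      using swap[of p q s] that pq sgn[OF pq(2)] by (simp add: stab_def o_assoc)
  qed
  have ts: "H t s = 0" if t: "t \<in> ?row" and s: "s \<in> ?col" for t s
  proof -
    have ne: "t \<noteq> e" "s \<noteq> e" "t \<in> B'" "s \<in> B'" using t s B by auto
    have "t \<noteq> s"
    proof
      assume "t = s"
      then have "t = e" using T.box_inj[of t e] t s e by (auto simp: B'_def)
      then show False using ne by simp
    qed
    let ?U = "Transposition.transpose t s"
    have U: "?U permutes B'" using ne by (simp add: permutes_swap_id)
    \<comment> \<open>The product of two transpositions through \<open>e\<close> becomes one inside
      \<open>B'\<close> and one through \<open>e\<close>; \<open>swap\<close> removes the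
      latter.\<close>
    have tt: "?T t \<circ> ?T s = ?U \<circ> ?T t"
      using ne \<open>t \<noteq> s\<close> by (auto simp: fun_eq_iff Transposition.transpose_def)
    have "H t s = - T'.sandwich ?FB' ?U"
      unfolding H_def T'.sandwich_def sum_negf[symmetric]
    proof (intro sum.cong refl)
      fix p q assume pq: "p \<in> stab B' r" "q \<in> stab B' c"
      then have pq': "p permutes B'" "q permutes B'" by (auto simp: stab_def)
      have "p \<circ> ?T t \<circ> (?T s \<circ> q) = p \<circ> (?T t \<circ> ?T s) \<circ> q" by (simp only: o_assoc)
      also have "\<dots> = (p \<circ> ?U) \<circ> ?T t \<circ> q" unfolding tt by (simp only: o_assoc)
      finally have eq: "p \<circ> ?T t \<circ> (?T s \<circ> q) = (p \<circ> ?U) \<circ> ?T t \<circ> q" .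
      have "fix_count N B (p \<circ> ?T t \<circ> (?T s \<circ> q)) = fix_count N B' (p \<circ> ?U \<circ> q)"
        unfolding eq by (rule swap[OF permutes_compose[OF U pq'(1)] pq'(2) ne(3)])
      then show "sign (?T s \<circ> q) * ?FB (p \<circ> ?T t \<circ> (?T s \<circ> q)) = - (sign q * ?FB' (p \<circ> ?U \<circ> q))"
        using sgn[OF pq(2), of s] ne(2,4) B(1) by simp
    qed
    moreover have "T'.sandwich ?FB' ?U = 0"
    proof -
      \<comment> \<open>The box u in the row of s and the column of t lies in the diagram because e
        dominates both coordinates. \<open>?U\<close> sends t to s and fixes u, so t and u share a
        column while their images share a row.\<close>
      have "r s \<le> r e" "1 \<le> r s" "1 \<le> c t" "c t \<le> c e"
        using e(2)[of s] e(3)[of t] t s T.box_pos[of s] T.box_pos[of t] B(1) by simp_all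
      then obtain u where u: "u \<in> B" "r u = r s" "c u = c t"
        using T.box_down[OF e(1), of "r s" "c t"] by blast
      have h: "t \<in> B" "s \<in> B" "r t = r e" "c s = c e" using t s B(1) by auto
      have it: "c t = c e \<Longrightarrow> t = e" by (rule T.box_inj[OF h(1) e(1) h(3)])
      have i2: "r s = r e \<Longrightarrow> s = e" by (rule T.box_inj[OF h(2) e(1) _ h(4)])
      have "u \<noteq> e" using it u(3) ne(1) by metis
      have "u \<noteq> t" using i2 u(2) h(3) ne(2) by metis
      have "u \<noteq> s" using it u(3) h(4) ne(1) by metis
      have U': "?U t = s" "?U u = u" using \<open>u \<noteq> t\<close> \<open>u \<noteq> s\<close> by auto
      have "u \<in> B'" using u(1) \<open>u \<noteq> e\<close> by (simp add: B'_def)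
      then show ?thesis
        using \<open>u \<noteq> t\<close> U u(2,3) ne(3)
        by (intro T'.sandwich_collision[of ?U t u]) (simp_all add: U')
    qed
    ultimately show ?thesis by simp
  qed
  have rows: "{t\<in>insert e B'. r t = r e} = insert e ?row" and cols: "{t\<in>insert e B'. c t = c e} = insert e ?col" by auto
  have nin: "e \<notin> ?row" "e \<notin> ?col" "finite ?row" "finite ?col" using B T'.fin by auto
  have card_row: "int (card ?row) = int (c e) - 1"
  proof -
    have "bij_betw c ?row {1..<c e}"
      unfolding bij_betw_def
    proof
      show "inj_on c ?row" using T'.box_inj by (auto simp: inj_on_def)
      show "c ` ?row = {1..<c e}"
      proof
        show "c ` ?row \<subseteq> {1..<c e}"
        proof clarify
          fix t assume t: "t \<in> B'" "r t = r e"
          then have "c t \<le> c e" "c t \<noteq> c e" "1 \<le> c t" using e T.box_inj[of t e] T.box_pos[of t] B by auto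
          then show "c t \<in> {1..<c e}" by simp
        qed
        show "{1..<c e} \<subseteq> c ` ?row"
        proof
          fix j assume j: "j \<in> {1..<c e}"
          then obtain t where "t \<in> B" "r t = r e" "c t = j"
            using T.box_down[OF e(1), of "r e" j] T.box_pos[OF e(1)] by auto
          then show "j \<in> c ` ?row" using j B by auto
        qed
      qed
    qed
    from bij_betw_same_card[OF this] show ?thesis using T.box_pos[OF e(1)] by simp
  qed
  have card_col: "int (card ?col) = int (r e) - 1"
  proof -
    have "bij_betw r ?col {1..<r e}"
      unfolding bij_betw_def
    proof
      show "inj_on r ?col" using T'.box_inj by (auto simp: inj_on_def)
      show "r ` ?col = {1..<r e}"
      proof
        show "r ` ?col \<subseteq> {1..<r e}"
        proof clarify
          fix t assume t: "t \<in> B'" "c t = c e"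
          then have "r t \<le> r e" "r t \<noteq> r e" "1 \<le> r t" using e T.box_inj[of t e] T.box_pos[of t] B by auto
          then show "r t \<in> {1..<r e}" by simp
        qed
        show "{1..<r e} \<subseteq> r ` ?col"
        proof
          fix j assume j: "j \<in> {1..<r e}"
          then obtain t where "t \<in> B" "r t = j" "c t = c e"
            using T.box_down[OF e(1), of j "c e"] T.box_pos[OF e(1)] by auto
          then show "j \<in> r ` ?col" using j B by auto
        qed
      qed
    qed
    from bij_betw_same_card[OF this] show ?thesis using T.box_pos[OF e(1)] by simp
  qed
  have decomp: "T.sandwich ?FB id = (\<Sum>t\<in>insert e ?row. \<Sum>s\<in>insert e ?col. H t s)"
  proof -
    have "T.sandwich ?FB id = (\<Sum>p\<in>stab B r. \<Sum>q\<in>stab B c. sign (inv q) * ?FB (p \<circ> inv q))"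
      unfolding T.sandwich_def
      by (rule sum.cong[OF refl]) (simp add: sum_group_inv[OF T.CG, of "\<lambda>q. sign q * ?FB (_ \<circ> q)"])
    also have "\<dots> = (\<Sum>t\<in>insert e ?row. \<Sum>p\<in>stab B' r. \<Sum>s\<in>insert e ?col. \<Sum>q\<in>stab B' c.
        sign (inv (q \<circ> ?T s)) * ?FB (p \<circ> ?T t \<circ> inv (q \<circ> ?T s)))"
      unfolding B(1) sum_stab_insert[OF T'.fin B(2)] rows cols ..
    also have "\<dots> = (\<Sum>t\<in>insert e ?row. \<Sum>p\<in>stab B' r. \<Sum>s\<in>insert e ?col. \<Sum>q\<in>stab B' c.
        sign (?T s \<circ> inv q) * ?FB (p \<circ> ?T t \<circ> (?T s \<circ> inv q)))"
    proof (intro sum.cong refl)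
      fix p s q assume "q \<in> stab B' c"
      then have "bij q" by (auto simp: stab_def permutes_bij)
      then show "sign (inv (q \<circ> ?T s)) * ?FB (p \<circ> ?T t \<circ> inv (q \<circ> ?T s)) = sign (?T s \<circ> inv q) * ?FB (p \<circ> ?T t \<circ> (?T s \<circ> inv q))" for t
        by (simp add: o_inv_distrib)
    qed
    also have "\<dots> = (\<Sum>t\<in>insert e ?row. \<Sum>p\<in>stab B' r. \<Sum>s\<in>insert e ?col. \<Sum>q\<in>stab B' c.
        sign (?T s \<circ> q) * ?FB (p \<circ> ?T t \<circ> (?T s \<circ> q)))"
    proof (rule sum.cong[OF refl], rule sum.cong[OF refl], rule sum.cong[OF refl])
      fix t p s
      show "(\<Sum>q\<in>stab B' c. sign (?T s \<circ> inv q) * ?FB (p \<circ> ?T t \<circ> (?T s \<circ> inv q)))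
        = (\<Sum>q\<in>stab B' c. sign (?T s \<circ> q) * ?FB (p \<circ> ?T t \<circ> (?T s \<circ> q)))"
        by (rule sum_group_inv[OF T'.CG, of "\<lambda>q. sign (?T s \<circ> q) * ?FB (p \<circ> ?T t \<circ> (?T s \<circ> q))"])
    qed
    also have "\<dots> = (\<Sum>t\<in>insert e ?row. \<Sum>s\<in>insert e ?col. H t s)"
      unfolding H_def by (rule sum.cong[OF refl]) (rule sum.swap)
    finally show ?thesis .
  qed
  also have "\<dots> = (\<Sum>s\<in>insert e ?col. H e s) + (\<Sum>t\<in>?row. \<Sum>s\<in>insert e ?col. H t s)"
    using nin by simp
  also have "(\<Sum>s\<in>insert e ?col. H e s) = int N * ?P - int (card ?col) * ?P"
    using nin ee es by simp
  also have "(\<Sum>t\<in>?row. \<Sum>s\<in>insert e ?col. H t s) = (\<Sum>t\<in>?row. ?P)"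
    using nin te ts by (intro sum.cong refl) simp
  also have "int N * ?P - int (card ?col) * ?P + (\<Sum>t\<in>?row. ?P) = (int N + int (c e) - int (r e)) * ?P"
    by (simp add: card_row card_col algebra_simps)
  also have "\<dots> = (\<Prod>s\<in>B. int N + int (c s) - int (r s))"
    unfolding IH B(1) using B(2) T'.fin by simp
  finally show ?case .
qed

theorem (in tableau) sandwich_fix_count:
  "sandwich (\<lambda>\<sigma>. int (fix_count N B \<sigma>)) id = (\<Prod>s\<in>B. int N + int (c s) - int (r s))"
  by (rule sandwich_fix_count_aux) (rule tableau_axioms)

lemma sum_permutes_single:
  assumes "finite L" "\<And>w. w permutes L \<Longrightarrow> w \<noteq> id \<Longrightarrow> F w = 0"
  shows "(\<Sum>w | w permutes L. F w) = F id"
proof -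
  have "(\<Sum>w | w permutes L. F w) = (\<Sum>w\<in>{id}. F w)"
    by (rule sum.mono_neutral_right) (use assms in \<open>auto simp: finite_permutations permutes_id\<close>)
  then show ?thesis by simp
qed

text \<open>Any bijection between the labels 1, ..., m and the boxes serves. The content product is
  carried along for the comparison with \<open>content_poly\<close>.\<close>

lemma partition_tableau:
  assumes p: "p \<in> partitions m"
  shows "\<exists>r c. tableau {1..m} r c \<and> r ` {1..m} \<subseteq> {1..length p} \<and>
    (\<forall>i\<in>{1..length p}. part p i = int (card {s\<in>{1..m}. r s = i})) \<and>
    (\<forall>z. (\<Prod>s\<in>{1..m}. z + of_int (int (c s) - int (r s))) = content_poly p z)"
proof -
  let ?L = "{1..length p}"
  define D where "D = Sigma ?L (\<lambda>i. {1..p ! (i - 1)})"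
  have "card D = (\<Sum>i\<in>?L. p ! (i - 1))" by (simp add: D_def)
  also have "int \<dots> = int m" using sum_part[of p] p by (simp add: partitions_def)
  finally have "card D = card {1..m}" by simp
  moreover have fD: "finite D" by (simp add: D_def)
  ultimately obtain h where h: "bij_betw h {1..m} D"
    by (metis bij_betw_iff_card finite_atLeastAtMost)
  define r where "r = fst \<circ> h"
  define c where "c = snd \<circ> h"
  have hD: "h s \<in> D" if "s \<in> {1..m}" for s using h that bij_betwE by blast
  have Dh: "\<exists>s\<in>{1..m}. h s = x" if "x \<in> D" for x
    using h that unfolding bij_betw_def by (metis imageE)
  have hinj: "inj_on h {1..m}" using h by (simp add: bij_betw_def)
  have rc: "r s \<in> ?L" "c s \<in> {1..p ! (r s - 1)}" if "s \<in> {1..m}" for s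
    using hD[OF that] unfolding D_def r_def c_def by (auto simp: mem_Sigma_iff split: prod.splits)
  have tab: "tableau {1..m} r c"
  proof
    fix s t assume st: "s \<in> {1..m}" "t \<in> {1..m}" "r s = r t" "c s = c t"
    then have "h s = h t" by (simp add: r_def c_def prod_eq_iff)
    then show "s = t" using inj_onD[OF hinj _ st(1,2)] by blast
  next
    fix s i j assume s: "s \<in> {1..m}" and ij: "1 \<le> i" "i \<le> r s" "1 \<le> j" "j \<le> c s"
    have "part p (r s) \<le> part p i"
      using part_decreasing[OF p ij(1,2)] rc(1)[OF s] by simp
    then have "(i, j) \<in> D" using rc[OF s] ij by (auto simp: D_def)
    from Dh[OF this] obtain t where "t \<in> {1..m}" "h t = (i, j)" by blast
    then show "\<exists>t\<in>{1..m}. r t = i \<and> c t = j" by (intro bexI[of _ t]) (simp_all add: r_def c_def)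
  next
    show "1 \<le> r s \<and> 1 \<le> c s" if "s \<in> {1..m}" for s using rc[OF that] by auto
  qed simp
  have cnt: "part p i = int (card {s\<in>{1..m}. r s = i})" if i: "i \<in> ?L" for i
  proof -
    have "bij_betw c {s\<in>{1..m}. r s = i} {1..p ! (i - 1)}"
      unfolding bij_betw_def
    proof
      show "inj_on c {s\<in>{1..m}. r s = i}"
      proof (rule inj_onI)
        fix s t assume "s \<in> {s\<in>{1..m}. r s = i}" "t \<in> {s\<in>{1..m}. r s = i}" "c s = c t"
        then have "s \<in> {1..m}" "t \<in> {1..m}" "h s = h t" by (simp_all add: r_def c_def prod_eq_iff)
        then show "s = t" using inj_onD[OF hinj] by blast
      qed
      show "c ` {s\<in>{1..m}. r s = i} = {1..p ! (i - 1)}"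
      proof
        show "c ` {s\<in>{1..m}. r s = i} \<subseteq> {1..p ! (i - 1)}" using rc(2) by blast
        show "{1..p ! (i - 1)} \<subseteq> c ` {s\<in>{1..m}. r s = i}"
        proof
          fix j assume "j \<in> {1..p ! (i - 1)}"
          then have "(i, j) \<in> D" using i by (auto simp: D_def)
          then obtain s where "s \<in> {1..m}" "h s = (i, j)" using Dh by blast
          then show "j \<in> c ` {s\<in>{1..m}. r s = i}" by (force simp: r_def c_def)
        qed
      qed
    qed
    from bij_betw_same_card[OF this] show ?thesis by simp
  qed
  have cont: "(\<Prod>s\<in>{1..m}. z + of_int (int (c s) - int (r s))) = content_poly p z" for z :: complex
  proof -
    have "(\<Prod>s\<in>{1..m}. z + of_int (int (c s) - int (r s))) = (\<Prod>x\<in>D. z + of_int (int (snd x) - int (fst x)))"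
      unfolding r_def c_def using prod.reindex_bij_betw[OF h, of "\<lambda>x. z + of_int (int (snd x) - int (fst x))"] by simp
    also have "\<dots> = content_poly p z"
      unfolding D_def content_poly_def by (subst prod.Sigma) (auto simp: case_prod_beta)
    finally show ?thesis .
  qed
  have "r ` {1..m} \<subseteq> ?L" using rc(1) by blast
  with tab cnt cont show ?thesis by blast
qed

lemma class_function_young_count: "class_function {1..m} (\<lambda>\<sigma>. young_count m l \<sigma> \<alpha>)"
  unfolding young_count_colourings
  by (rule class_function_fixed) (rule comp_permutes_colourings)

lemma class_function_irr_char:
  assumes "p \<in> partitions m"
  shows "class_function {1..m} (irr_char p)"
proof -
  have "sum_list p = m" using assms by (simp add: partitions_def)
  then show ?thesis
    using class_functionD[OF class_function_young_count] by (simp add: class_function_def irr_char_def)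
qed

text \<open>The strict rearrangement inequality, from positivity of the sum of the squares of i -
  w(i).\<close>

lemma sum_index_perm_less:
  assumes w: "w permutes {1..l::nat}" and "w \<noteq> id"
  shows "(\<Sum>i\<in>{1..l}. int i * int (w i)) < (\<Sum>i\<in>{1..l}. int i * int i)"
proof -
  have sq: "(\<Sum>i\<in>{1..l}. int (w i) * int (w i)) = (\<Sum>i\<in>{1..l}. int i * int i)"
    using sum.permute[OF w, of "\<lambda>i. int i * int i"] by (simp add: o_def)
  obtain k where k: "w k \<noteq> k" using assms(2) by (auto simp: fun_eq_iff)
  then have kl: "k \<in> {1..l}" using permutes_not_in[OF w] by blast
  have "0 < (\<Sum>i\<in>{1..l}. (int i - int (w i))\<^sup>2)"
    by (rule sum_pos2[OF _ kl]) (use k in auto)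
  also have "(\<Sum>i\<in>{1..l}. (int i - int (w i))\<^sup>2)
    = (\<Sum>i\<in>{1..l}. int i * int i) + (\<Sum>i\<in>{1..l}. int (w i) * int (w i)) - 2 * (\<Sum>i\<in>{1..l}. int i * int (w i))"
    by (simp add: power2_diff power2_eq_square sum.distrib sum_subtractf sum_distrib_left algebra_simps)
  finally show ?thesis using sq by simp
qed

text \<open>Under the tableau functional only the term w = id of the determinant survives, since
  every other shift has too small a weighted total. So the functional takes the value kappa on the
  character, which together with the norm m! puts it into the equality case of
  Cauchy-Schwarz.\<close>

theorem irr_char_eigen:
  assumes p: "p \<in> partitions m" and y: "y permutes {1..m}"
  shows "(\<Sum>\<tau> | \<tau> permutes {1..m}. of_nat (fix_count N {1..m} \<tau>) * of_int (irr_char p (inv \<tau> \<circ> y)))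
    = content_poly p (of_nat N) * of_int (irr_char p y)"
proof -
  obtain r c where tab: "tableau {1..m} r c" and rl: "r ` {1..m} \<subseteq> {1..length p}"
    and cnt: "\<forall>i\<in>{1..length p}. part p i = int (card {s\<in>{1..m}. r s = i})"
    and cont: "\<forall>z. (\<Prod>s\<in>{1..m}. z + of_int (int (c s) - int (r s))) = content_poly p z"
    using partition_tableau[OF p] by blast
  interpret tableau "{1..m}" r c by (rule tab)
  let ?l = "length p" and ?\<alpha> = "\<lambda>w i. part p i - int i + int (w i)"
  have sp: "sum_list p = m" using p by (simp add: partitions_def)
  have lin: "sandwich (irr_char p) id = (\<Sum>w | w permutes {1..?l}. sign w * sandwich (\<lambda>\<sigma>. int (young_count m ?l \<sigma> (?\<alpha> w))) id)"
  proof -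
    have "sandwich (irr_char p) id = (\<Sum>p'\<in>RG. \<Sum>q\<in>CG. \<Sum>w | w permutes {1..?l}. sign w * (sign q * int (young_count m ?l (p' \<circ> id \<circ> q) (?\<alpha> w))))"
      unfolding sandwich_def irr_char_def sp by (simp add: sum_distrib_left mult.left_commute)
    also have "\<dots> = (\<Sum>p'\<in>RG. \<Sum>w | w permutes {1..?l}. \<Sum>q\<in>CG. sign w * (sign q * int (young_count m ?l (p' \<circ> id \<circ> q) (?\<alpha> w))))"
      by (rule sum.cong[OF refl], rule sum.swap)
    also have "\<dots> = (\<Sum>w | w permutes {1..?l}. \<Sum>p'\<in>RG. \<Sum>q\<in>CG. sign w * (sign q * int (young_count m ?l (p' \<circ> id \<circ> q) (?\<alpha> w))))"
      by (rule sum.swap)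
    finally show ?thesis by (simp only: sandwich_def sum_distrib_left)
  qed
  have shape: "(\<Sum>i\<in>{1..?l}. int i * part p i) = int (sum r {1..m})"
  proof -
    have "sum r {1..m} = (\<Sum>i\<in>{1..?l}. sum r {s\<in>{1..m}. r s = i})"
      using sum.group[of "{1..m}" "{1..?l}" r r] rl by simp
    also have "\<dots> = (\<Sum>i\<in>{1..?l}. i * card {s\<in>{1..m}. r s = i})" by (intro sum.cong refl) simp
    finally show ?thesis using cnt by simp
  qed
  have zero: "sandwich (\<lambda>\<sigma>. int (young_count m ?l \<sigma> (?\<alpha> w))) id = 0" if w: "w permutes {1..?l}" "w \<noteq> id" for w
  proof -
    have "(\<Sum>i\<in>{1..?l}. int i * ?\<alpha> w i) = (\<Sum>i\<in>{1..?l}. int i * part p i)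
        + ((\<Sum>i\<in>{1..?l}. int i * int (w i)) - (\<Sum>i\<in>{1..?l}. int i * int i))"
      by (simp add: algebra_simps sum.distrib sum_subtractf)
    also have "\<dots> < int (sum r {1..m})" using sum_index_perm_less[OF w] shape by simp
    finally show ?thesis unfolding young_count_colourings by (rule sandwich_colourings_zero)
  qed
  have one: "sandwich (\<lambda>\<sigma>. int (young_count m ?l \<sigma> (?\<alpha> id))) id = kappa"
    unfolding young_count_colourings
  proof (rule sandwich_colourings_shape[OF rl])
    fix i assume "i \<in> {1..?l}"
    then show "?\<alpha> id i = int (card {s\<in>{1..m}. r s = i})" using cnt by (simp only: id_apply)
  qed
  have "sandwich (irr_char p) id = sign (id :: nat \<Rightarrow> nat) * sandwich (\<lambda>\<sigma>. int (young_count m ?l \<sigma> (?\<alpha> id))) id"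
    unfolding lin
  proof (subst sum_permutes_single)
    fix w assume w: "w permutes {1..?l}" "w \<noteq> id"
    show "sign w * sandwich (\<lambda>\<sigma>. int (young_count m ?l \<sigma> (?\<alpha> w))) id = 0"
      unfolding zero[OF w] by simp
  qed (simp_all only: finite_atLeastAtMost)
  then have sandwich: "sandwich (irr_char p) id = kappa" unfolding one by simp
  have norm: "(\<Sum>y\<in>SG. irr_char p y * irr_char p y) = fact (card {1..m})"
    using irr_char_orthonormal[OF p p] by simp
  have cf: "class_function {1..m} (\<lambda>\<sigma>. int (fix_count N {1..m} \<sigma>))"
    using fix_count_class_function[of "{1..m}" N] by (simp add: class_function_def)
  have "(\<Sum>\<tau>\<in>SG. int (fix_count N {1..m} \<tau>) * irr_char p (inv \<tau> \<circ> y))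
    = (\<Prod>s\<in>{1..m}. int N + int (c s) - int (r s)) * irr_char p y"
    unfolding sandwich_fix_count[symmetric]
    by (rule class_function_eigen[OF class_function_irr_char[OF p] norm sandwich _ cf]) (use y in blast)
  then have "complex_of_int (\<Sum>\<tau>\<in>SG. int (fix_count N {1..m} \<tau>) * irr_char p (inv \<tau> \<circ> y))
    = of_int (\<Prod>s\<in>{1..m}. int N + int (c s) - int (r s)) * of_int (irr_char p y)"
    by (simp only: of_int_mult)
  also have "of_int (\<Prod>s\<in>{1..m}. int N + int (c s) - int (r s)) = content_poly p (of_nat N)"
    unfolding cont[rule_format, symmetric] by (simp add: add_diff_eq)
  finally show ?thesis by (simp only: of_int_sum of_int_mult of_int_of_nat_eq)
qed

section \<open>Completeness of the irreducible characters\<close>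

text \<open>Summation by parts: the parts decrease, and the partial sums of w(i) - i are nonnegative
  because w takes distinct positive values.\<close>

lemma content_sum_nonneg:
  assumes p: "p \<in> partitions m" and w: "w permutes {1..length p}"
  shows "0 \<le> (\<Sum>i\<in>{1..length p}. part p i * (int (w i) - int i))"
proof -
  let ?l = "length p" and ?d = "\<lambda>i. int (w i) - int i"
  have D: "0 \<le> (\<Sum>i\<in>{1..j}. ?d i)" if "j \<le> ?l" for j
  proof -
    have inj: "inj_on w {1..j}" using permutes_inj[OF w] inj_on_subset by blast
    have "0 \<notin> w ` {1..j}"
    proof
      assume "0 \<in> w ` {1..j}"
      then obtain i where i: "i \<in> {1..j}" "w i = 0" by force
      then have "w i \<in> {1..?l}" using permutes_in_image[OF w, of i] that by simp
      with i show False by simp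
    qed
    from sum_distinct_positive(1)[OF _ this] have "\<Sum>{1..card (w ` {1..j})} \<le> \<Sum>(w ` {1..j})" by simp
    then have "(\<Sum>i\<in>{1..j}. i) \<le> (\<Sum>i\<in>{1..j}. w i)"
      using card_image[OF inj] inj by (simp add: sum.reindex)
    then have "int (\<Sum>i\<in>{1..j}. i) \<le> int (\<Sum>i\<in>{1..j}. w i)" by (simp only: of_nat_le_iff)
    then show ?thesis by (simp add: sum_subtractf)
  qed
  have "part p j * (\<Sum>i\<in>{1..j}. ?d i) \<le> (\<Sum>i\<in>{1..j}. part p i * ?d i)" if "1 \<le> j" "j \<le> ?l" for j
    using that
  proof (induction j rule: nat_induct_at_least)
    case base
    then show ?case by simp
  next
    case (Suc j)
    have "part p (Suc j) * (\<Sum>i\<in>{1..Suc j}. ?d i) = part p (Suc j) * (\<Sum>i\<in>{1..j}. ?d i) + part p (Suc j) * ?d (Suc j)"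
      by (simp add: distrib_left)
    also have "part p (Suc j) * (\<Sum>i\<in>{1..j}. ?d i) \<le> part p j * (\<Sum>i\<in>{1..j}. ?d i)"
      using part_decreasing[OF p, of j "Suc j"] D[of j] Suc by (intro mult_right_mono) auto
    also have "\<dots> \<le> (\<Sum>i\<in>{1..j}. part p i * ?d i)" using Suc by simp
    finally show ?case by (simp add: add.commute)
  qed
  then have "part p ?l * (\<Sum>i\<in>{1..?l}. ?d i) \<le> (\<Sum>i\<in>{1..?l}. part p i * ?d i)" if "1 \<le> ?l" using that by blast
  moreover have "0 \<le> part p ?l * (\<Sum>i\<in>{1..?l}. ?d i)" using D[of ?l] by simp
  ultimately show ?thesis by (cases "1 \<le> ?l") (simp_all only: order_trans, simp)
qed

text \<open>Expanding the square leaves a nonnegative cross term and a positive square term. So the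
  sum of squares orders the terms of the determinant with the identity strictly lowest.\<close>

lemma sum_squares_shift:
  assumes p: "p \<in> partitions m" and w: "w permutes {1..length p}" "w \<noteq> id"
  shows "(\<Sum>i\<in>{1..length p}. (part p i)\<^sup>2) < (\<Sum>i\<in>{1..length p}. (part p i - int i + int (w i))\<^sup>2)"
proof -
  obtain k where k: "w k \<noteq> k" using w(2) by (auto simp: fun_eq_iff)
  then have kl: "k \<in> {1..length p}" using permutes_not_in[OF w(1)] by blast
  have pos: "0 < (\<Sum>i\<in>{1..length p}. (int (w i) - int i)\<^sup>2)"
    by (rule sum_pos2[OF _ kl]) (use k in auto)
  have "(\<Sum>i\<in>{1..length p}. (part p i - int i + int (w i))\<^sup>2)
    = (\<Sum>i\<in>{1..length p}. (part p i)\<^sup>2 + 2 * (part p i * (int (w i) - int i)) + (int (w i) - int i)\<^sup>2)"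
    by (rule sum.cong[OF refl]) (simp add: power2_eq_square algebra_simps)
  also have "\<dots> = (\<Sum>i\<in>{1..length p}. (part p i)\<^sup>2) + 2 * (\<Sum>i\<in>{1..length p}. part p i * (int (w i) - int i))
      + (\<Sum>i\<in>{1..length p}. (int (w i) - int i)\<^sup>2)"
    by (simp add: sum.distrib sum_distrib_left)
  finally show ?thesis using pos content_sum_nonneg[OF p w(1)] by linarith
qed

text \<open>Dropping empty blocks and reordering the others does not change the permutation
  character, so every admissible \<nu> can be replaced by a partition.\<close>

lemma young_count_sorted:
  fixes \<nu> :: "nat \<Rightarrow> int"
  assumes nonneg: "\<And>i. i \<in> {1..h} \<Longrightarrow> 0 \<le> \<nu> i" and tot: "(\<Sum>i\<in>{1..h}. \<nu> i) = int m"
  obtains p where "p \<in> partitions m" "(\<Sum>i\<in>{1..length p}. (part p i)\<^sup>2) = (\<Sum>i\<in>{1..h}. (\<nu> i)\<^sup>2)"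
    "\<And>\<sigma>. \<sigma> permutes {1..m} \<Longrightarrow> young_count m h \<sigma> \<nu> = young_count m (length p) \<sigma> (part p)"
proof -
  define A where "A = {i\<in>{1..h}. 0 < \<nu> i}"
  have fA: "finite A" by (simp add: A_def)
  define xs where "xs = sort_key (\<lambda>i. - \<nu> i) (sorted_list_of_set A)"
  have xs: "distinct xs" "set xs = A" using fA by (simp_all add: xs_def)
  define p where "p = map (\<lambda>i. nat (\<nu> i)) xs"
  let ?L = "{1..length p}"
  have bij: "bij_betw (\<lambda>j. xs ! (j - 1)) ?L A"
  proof -
    have "bij_betw (\<lambda>j. j - 1) ?L {..<length xs}"
      by (rule bij_betwI[where g = Suc]) (auto simp: p_def)
    moreover have "bij_betw ((!) xs) {..<length xs} A"
      using bij_betw_nth[OF xs(1) refl, of A] xs(2) by simp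
    ultimately show ?thesis using bij_betw_trans[of "\<lambda>j. j - 1" ?L "{..<length xs}" "(!) xs" A] by (simp add: o_def)
  qed
  have xsA: "xs ! (j - 1) \<in> A" if "j \<in> ?L" for j using bij that bij_betwE by blast
  have pj: "part p j = \<nu> (xs ! (j - 1))" if "j \<in> ?L" for j
    using xsA[OF that] that by (auto simp: p_def A_def)
  have sumA: "(\<Sum>i\<in>A. f (\<nu> i)) = (\<Sum>i\<in>{1..h}. f (\<nu> i))" if "f 0 = (0::int)" for f
    unfolding A_def using nonneg that by (intro sum.mono_neutral_left) (auto simp: order.not_eq_order_implies_strict, metis atLeastAtMost_iff le_less not_less)
  have sumL: "(\<Sum>j\<in>?L. f (part p j)) = (\<Sum>i\<in>{1..h}. f (\<nu> i))" if "f 0 = (0::int)" for f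
    using sum.reindex_bij_betw[OF bij, of "\<lambda>i. f (\<nu> i)"] sumA[of f, OF that] pj by simp
  have sp: "sum_list p = m"
  proof -
    have "int (sum_list p) = (\<Sum>i\<in>{1..h}. \<nu> i)" using sumL[of "\<lambda>x. x"] sum_part[of p] by simp
    then show ?thesis using tot by simp
  qed
  have "sorted_wrt (\<ge>) p"
  proof -
    have "sorted (map (\<lambda>i. - \<nu> i) xs)" by (simp add: xs_def)
    then show ?thesis by (auto simp: p_def sorted_wrt_map sorted_map elim!: sorted_wrt_mono_rel[rotated])
  qed
  then have pp: "p \<in> partitions m"
    using sp xs by (auto simp: partitions_def p_def A_def)
  have yc: "young_count m h \<sigma> \<nu> = young_count m (length p) \<sigma> (part p)" if \<sigma>: "\<sigma> permutes {1..m}" for \<sigma>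
  proof -
    let ?x = "\<lambda>j. xs ! (j - 1)"
    let ?F = "{f \<in> colourings {1..m} {1..h} \<nu>. \<forall>s\<in>{1..m}. f (\<sigma> s) = f s}"
    let ?G = "{f \<in> colourings {1..m} ?L (part p). \<forall>s\<in>{1..m}. f (\<sigma> s) = f s}"
    let ?y = "inv_into ?L ?x"
    have y: "?y i \<in> ?L" "?x (?y i) = i" if "i \<in> A" for i
      using that bij inv_into_into[of i ?x ?L] f_inv_into_f[of i ?x ?L] by (auto simp: bij_betw_def)
    have yx: "?y (?x j) = j" if "j \<in> ?L" for j using inv_into_f_f[OF bij_betw_imp_inj_on[OF bij] that] .
    have iff: "?y i = j \<longleftrightarrow> i = ?x j" if "i \<in> A" "j \<in> ?L" for i j
      using y(2)[OF that(1)] yx[OF that(2)] by metis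
    have sB: "\<sigma> s \<in> {1..m}" if "s \<in> {1..m}" for s using that \<sigma> by (simp only: permutes_in_image)
    have FA: "f s \<in> A" if "f \<in> ?F" "s \<in> {1..m}" for f s
    proof -
      have "f s \<in> {1..h}" "int (card {t\<in>{1..m}. f t = f s}) = \<nu> (f s)" using that by (auto simp: colourings_def)
      moreover have "0 < card {t\<in>{1..m}. f t = f s}" using that by (auto simp: card_gt_0_iff)
      ultimately show ?thesis unfolding A_def by auto
    qed
    have "bij_betw (\<lambda>f. restrict (?y \<circ> f) {1..m}) ?F ?G"
    proof (rule bij_betwI[where g = "\<lambda>f. restrict (?x \<circ> f) {1..m}"])
      show "(\<lambda>f. restrict (?y \<circ> f) {1..m}) \<in> ?F \<rightarrow> ?G"
      proof
        fix f assume f: "f \<in> ?F"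
        have "{s\<in>{1..m}. restrict (?y \<circ> f) {1..m} s = j} = {s\<in>{1..m}. f s = ?x j}" if "j \<in> ?L" for j
          by (intro Collect_cong conj_cong refl) (simp add: iff[OF FA[OF f] that] del: One_nat_def)
        moreover have "?x j \<in> {1..h}" if "j \<in> ?L" for j using xsA[OF that] by (simp add: A_def)
        ultimately show "restrict (?y \<circ> f) {1..m} \<in> ?G"
          using f y(1) FA[OF f] pj sB unfolding colourings_def by auto
      qed
      show "(\<lambda>f. restrict (?x \<circ> f) {1..m}) \<in> ?G \<rightarrow> ?F"
      proof
        fix f assume f: "f \<in> ?G"
        have fL: "f s \<in> ?L" if "s \<in> {1..m}" for s using f that by (auto simp: colourings_def)
        have "int (card {s\<in>{1..m}. restrict (?x \<circ> f) {1..m} s = i}) = \<nu> i" if i: "i \<in> {1..h}" for i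
        proof (cases "i \<in> A")
          case True
          have "{s\<in>{1..m}. restrict (?x \<circ> f) {1..m} s = i} = {s\<in>{1..m}. f s = ?y i}"
            by (intro Collect_cong conj_cong refl) (metis (no_types, lifting) True comp_apply fL iff restrict_apply')
          then show ?thesis using f y[OF True] pj[of "?y i"] by (auto simp: colourings_def)
        next
          case False
          then have "{s\<in>{1..m}. restrict (?x \<circ> f) {1..m} s = i} = {}" using xsA fL by auto
          moreover have "\<nu> i = 0" using False i nonneg[OF i] by (simp add: A_def)
          ultimately show ?thesis by (simp only: card.empty)
        qed
        moreover have "restrict (?x \<circ> f) {1..m} \<in> {1..m} \<rightarrow>\<^sub>E {1..h}"
          using xsA fL by (auto simp: A_def)
        ultimately show "restrict (?x \<circ> f) {1..m} \<in> ?F"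
          using f sB unfolding colourings_def by auto
      qed
      show "restrict (?x \<circ> restrict (?y \<circ> f) {1..m}) {1..m} = f" if "f \<in> ?F" for f
      proof
        fix s show "restrict (?x \<circ> restrict (?y \<circ> f) {1..m}) {1..m} s = f s"
          using that FA[OF that] y by (cases "s \<in> {1..m}") (auto simp: colourings_def PiE_iff extensional_def)
      qed
      show "restrict (?y \<circ> restrict (?x \<circ> f) {1..m}) {1..m} = f" if "f \<in> ?G" for f
      proof
        fix s show "restrict (?y \<circ> restrict (?x \<circ> f) {1..m}) {1..m} s = f s"
          using that yx by (cases "s \<in> {1..m}") (auto simp: colourings_def PiE_iff extensional_def)
      qed
    qed
    from bij_betw_same_card[OF this] show ?thesis by (simp add: young_count_colourings)
  qed
  show ?thesis by (rule that[OF pp _ yc]) (use sumL[of "\<lambda>x. x\<^sup>2"] in auto)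
qed

lemma colourings_total:
  assumes "finite B" "finite A" "f \<in> colourings B A \<alpha>"
  shows "(\<Sum>a\<in>A. \<alpha> a) = int (card B)"
proof -
  have "(\<Sum>a\<in>A. \<alpha> a) = (\<Sum>a\<in>A. int (card {s\<in>B. f s = a}))" using assms by (intro sum.cong) (auto simp: colourings_def)
  also have "\<dots> = int (\<Sum>a\<in>A. card {s\<in>B. f s = a})" by simp
  also have "(\<Sum>a\<in>A. card {s\<in>B. f s = a}) = (\<Sum>a\<in>A. \<Sum>s\<in>{s\<in>B. f s = a}. 1)" by simp
  also have "\<dots> = (\<Sum>s\<in>B. 1)" using assms by (intro sum.group) (auto simp: colourings_def)
  finally show ?thesis by simp
qed

lemma young_count_eq_0:
  assumes "\<not> ((\<forall>i\<in>{1..h}. 0 \<le> \<nu> i) \<and> (\<Sum>i\<in>{1..h}. \<nu> i) = int m)"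
  shows "young_count m h \<sigma> \<nu> = 0"
proof -
  have "colourings {1..m} {1..h} \<nu> = {}"
  proof (rule ccontr)
    assume "\<not> ?thesis"
    then obtain f where f: "f \<in> colourings {1..m} {1..h} \<nu>" by blast
    then have "\<forall>i\<in>{1..h}. 0 \<le> \<nu> i" by (force simp: colourings_def)
    moreover have "(\<Sum>i\<in>{1..h}. \<nu> i) = int m" using colourings_total[OF _ _ f] by simp
    ultimately show False using assms by blast
  qed
  then show ?thesis by (simp add: young_count_colourings)
qed

text \<open>Unitriangularity: the character of p is its Young character plus signed Young characters
  with a larger sum of squares, which are orthogonal by induction.\<close>

lemma orthogonal_irr_char_young:
  fixes z :: "(nat \<Rightarrow> nat) \<Rightarrow> real"
  assumes orth: "\<And>p. p \<in> partitions m \<Longrightarrow> (\<Sum>\<sigma> | \<sigma> permutes {1..m}. z \<sigma> * of_int (irr_char p \<sigma>)) = 0"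
  shows "(\<Sum>\<sigma> | \<sigma> permutes {1..m}. z \<sigma> * of_nat (young_count m h \<sigma> \<nu>)) = 0"
proof (induction "nat ((int m)\<^sup>2 - (\<Sum>i\<in>{1..h}. (\<nu> i)\<^sup>2))" arbitrary: h \<nu> rule: less_induct)
  case less
  show ?case
  proof (cases "(\<forall>i\<in>{1..h}. 0 \<le> \<nu> i) \<and> (\<Sum>i\<in>{1..h}. \<nu> i) = int m")
    case False
    then show ?thesis using young_count_eq_0[OF False] by simp
  next
    case True
    obtain p where p: "p \<in> partitions m" and sq: "(\<Sum>i\<in>{1..length p}. (part p i)\<^sup>2) = (\<Sum>i\<in>{1..h}. (\<nu> i)\<^sup>2)"
      and yc: "\<And>\<sigma>. \<sigma> permutes {1..m} \<Longrightarrow> young_count m h \<sigma> \<nu> = young_count m (length p) \<sigma> (part p)"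
      using young_count_sorted[of h \<nu> m] True by blast
    have sp: "sum_list p = m" using p by (simp add: partitions_def)
    let ?l = "length p" and ?\<alpha> = "\<lambda>w i. part p i - int i + int (w i)"
    let ?S = "{\<sigma>. \<sigma> permutes {1..m}}" and ?W = "{w. w permutes {1..?l}}"
    \<comment> \<open>The measure is a truncated difference in the natural numbers; this bound makes
      its decrease strict.\<close>
    have bound: "(\<Sum>i\<in>{1..k}. (\<beta> i)\<^sup>2) \<le> (int m)\<^sup>2"
      if "(\<forall>i\<in>{1..k}. 0 \<le> \<beta> i) \<and> (\<Sum>i\<in>{1..k}. \<beta> i) = int m" for k and \<beta> :: "nat \<Rightarrow> int"
    proof -
      have "(\<Sum>i\<in>{1..k}. (\<beta> i)\<^sup>2) \<le> (\<Sum>i\<in>{1..k}. \<beta> i * (\<Sum>i\<in>{1..k}. \<beta> i))"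
        unfolding power2_eq_square using that
        by (intro sum_mono mult_left_mono member_le_sum) auto
      then show ?thesis using that by (simp add: sum_distrib_right[symmetric] power2_eq_square)
    qed
    have zero: "(\<Sum>\<sigma>\<in>?S. z \<sigma> * of_nat (young_count m ?l \<sigma> (?\<alpha> w))) = 0" if w: "w permutes {1..?l}" "w \<noteq> id" for w
    proof (cases "(\<forall>i\<in>{1..?l}. 0 \<le> ?\<alpha> w i) \<and> (\<Sum>i\<in>{1..?l}. ?\<alpha> w i) = int m")
      case False
      then show ?thesis using young_count_eq_0[OF False] by simp
    next
      case True
      show ?thesis
        by (rule less) (use sum_squares_shift[OF p w] bound[OF True] sq in linarith)
    qed
    have "0 = (\<Sum>\<sigma>\<in>?S. z \<sigma> * of_int (irr_char p \<sigma>))" using orth[OF p] by simp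
    also have "\<dots> = (\<Sum>\<sigma>\<in>?S. \<Sum>w\<in>?W. of_int (sign w) * (z \<sigma> * of_nat (young_count m ?l \<sigma> (?\<alpha> w))))"
      by (simp add: irr_char_def sp sum_distrib_left mult.left_commute)
    also have "\<dots> = (\<Sum>w\<in>?W. of_int (sign w) * (\<Sum>\<sigma>\<in>?S. z \<sigma> * of_nat (young_count m ?l \<sigma> (?\<alpha> w))))"
      unfolding sum_distrib_left by (rule sum.swap)
    also have "\<dots> = of_int (sign (id :: nat \<Rightarrow> nat)) * (\<Sum>\<sigma>\<in>?S. z \<sigma> * of_nat (young_count m ?l \<sigma> (?\<alpha> id)))"
    proof (rule trans[OF sum_permutes_single])
      fix w assume w: "w permutes {1..?l}" "w \<noteq> id"
      show "of_int (sign w) * (\<Sum>\<sigma>\<in>?S. z \<sigma> * of_nat (young_count m ?l \<sigma> (?\<alpha> w))) = 0"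
        unfolding zero[OF w] by simp
    qed (simp_all only: finite_atLeastAtMost)
    also have "?\<alpha> id = part p" by auto
    finally show ?thesis using yc by simp
  qed
qed

text \<open>With all blocks of size one the Young character is that of the regular
  representation.\<close>

lemma young_count_regular:
  assumes "\<sigma> permutes {1..m}"
  shows "0 < young_count m m id (\<lambda>_. 1)" and "\<sigma> \<noteq> id \<Longrightarrow> young_count m m \<sigma> (\<lambda>_. 1) = 0"
proof -
  have "(\<lambda>s\<in>{1..m}. s) \<in> {f \<in> colourings {1..m} {1..m} (\<lambda>_. 1). \<forall>s\<in>{1..m}. f (id s) = f s}"
  proof -
    have "{s\<in>{1..m}. (\<lambda>s\<in>{1..m}. s) s = a} = {a}" if "a \<in> {1..m}" for a using that by auto
    then show ?thesis by (auto simp: colourings_def simp del: restrict_apply)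
  qed
  then show "0 < young_count m m id (\<lambda>_. 1)"
    unfolding young_count_colourings using finite_colourings[of "{1..m}" "{1..m}" "\<lambda>_. 1"]
    by (subst card_gt_0_iff) auto
  assume "\<sigma> \<noteq> id"
  then obtain s where s: "\<sigma> s \<noteq> s" by (auto simp: fun_eq_iff)
  then have sm: "s \<in> {1..m}" using permutes_not_in[OF assms] by blast
  then have sm': "\<sigma> s \<in> {1..m}" using assms by (simp only: permutes_in_image)
  have "{f \<in> colourings {1..m} {1..m} (\<lambda>_. 1). \<forall>s\<in>{1..m}. f (\<sigma> s) = f s} = {}"
  proof (rule ccontr)
    assume "\<not> ?thesis"
    then obtain f where f: "f \<in> colourings {1..m} {1..m} (\<lambda>_. 1)" "\<forall>s\<in>{1..m}. f (\<sigma> s) = f s" by blast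
    have "f s \<in> {1..m}" using f sm by (auto simp: colourings_def)
    then have "card {t\<in>{1..m}. f t = f s} = 1" using f by (auto simp: colourings_def)
    moreover have "{s, \<sigma> s} \<subseteq> {t\<in>{1..m}. f t = f s}" using sm sm' f(2) by auto
    ultimately have "card {s, \<sigma> s} \<le> 1" using card_mono[of "{t\<in>{1..m}. f t = f s}" "{s, \<sigma> s}"] by simp
    then show False using s by simp
  qed
  then show "young_count m m \<sigma> (\<lambda>_. 1) = 0" by (simp only: young_count_colourings card.empty)
qed

text \<open>The defect z is orthogonal to all irreducible characters by orthonormality, hence to the
  regular character, which forces z(id) = 0. As z is itself a delta function minus a combination of
  characters, its norm is m! z(id) = 0.\<close>

theorem irr_char_complete:
  assumes "\<sigma> permutes {1..m}"
  shows "(\<Sum>p\<in>partitions m. irr_char p id * irr_char p \<sigma>) = (if \<sigma> = id then fact m else 0)"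
proof -
  let ?S = "{\<sigma>. \<sigma> permutes {1..m}}"
  have fS: "finite ?S" by (rule finite_permutations) simp
  have idS: "id \<in> ?S" by (simp add: permutes_id)
  define z :: "(nat \<Rightarrow> nat) \<Rightarrow> real" where
    "z \<sigma> = (if \<sigma> = id then fact m else 0) - (\<Sum>p\<in>partitions m. of_int (irr_char p id) * of_int (irr_char p \<sigma>))" for \<sigma>
  have expand: "(\<Sum>\<sigma>\<in>?S. f \<sigma> * z \<sigma>) = fact m * f id
      - (\<Sum>p\<in>partitions m. of_int (irr_char p id) * (\<Sum>\<sigma>\<in>?S. f \<sigma> * of_int (irr_char p \<sigma>)))" for f
  proof -
    have "(\<Sum>\<sigma>\<in>?S. f \<sigma> * z \<sigma>) = (\<Sum>\<sigma>\<in>?S. if \<sigma> = id then fact m * f id else 0)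
       - (\<Sum>\<sigma>\<in>?S. \<Sum>p\<in>partitions m. of_int (irr_char p id) * (f \<sigma> * of_int (irr_char p \<sigma>)))"
      unfolding sum_subtractf[symmetric] z_def
      by (rule sum.cong[OF refl]) (simp add: right_diff_distrib sum_distrib_left mult.left_commute)
    also have "(\<Sum>\<sigma>\<in>?S. \<Sum>p\<in>partitions m. of_int (irr_char p id) * (f \<sigma> * of_int (irr_char p \<sigma>)))
      = (\<Sum>p\<in>partitions m. of_int (irr_char p id) * (\<Sum>\<sigma>\<in>?S. f \<sigma> * of_int (irr_char p \<sigma>)))"
      unfolding sum_distrib_left by (rule sum.swap)
    also have "(\<Sum>\<sigma>\<in>?S. if \<sigma> = id then fact m * f id else 0) = fact m * f id"
      by (simp only: sum.delta[OF fS] idS if_True)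
    finally show ?thesis .
  qed
  have orth: "(\<Sum>\<sigma>\<in>?S. z \<sigma> * of_int (irr_char q \<sigma>)) = 0" if q: "q \<in> partitions m" for q
  proof -
    have inner: "(\<Sum>\<sigma>\<in>?S. of_int (irr_char q \<sigma>) * of_int (irr_char p \<sigma>)) = (if p = q then fact m else 0 :: real)"
      if "p \<in> partitions m" for p
    proof -
      have "real_of_int (\<Sum>\<sigma>\<in>?S. irr_char q \<sigma> * irr_char p \<sigma>) = of_int (if q = p then fact m else 0)"
        by (simp only: irr_char_orthonormal[OF q that])
      then show ?thesis by auto
    qed
    have "(\<Sum>\<sigma>\<in>?S. z \<sigma> * of_int (irr_char q \<sigma>)) = (\<Sum>\<sigma>\<in>?S. of_int (irr_char q \<sigma>) * z \<sigma>)"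
      by (simp add: mult.commute)
    also have "\<dots> = fact m * of_int (irr_char q id) - (\<Sum>p\<in>partitions m. of_int (irr_char p id) * (if p = q then fact m else 0))"
      unfolding expand using inner by simp
    also have "\<dots> = 0" using finite_partitions[of m] q by (simp add: if_distrib cong: if_cong)
    finally show ?thesis .
  qed
  have "(\<Sum>\<sigma>\<in>?S. z \<sigma> * of_nat (young_count m m \<sigma> (\<lambda>_. 1))) = 0"
    using orthogonal_irr_char_young[of m z] orth by blast
  moreover have "(\<Sum>\<sigma>\<in>?S. z \<sigma> * of_nat (young_count m m \<sigma> (\<lambda>_. 1)))
      = (\<Sum>\<sigma>\<in>?S. if \<sigma> = id then z id * of_nat (young_count m m id (\<lambda>_. 1)) else 0)"
    by (rule sum.cong[OF refl]) (use young_count_regular(2) in auto)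
  ultimately have "z id * of_nat (young_count m m id (\<lambda>_. 1)) = 0"
    by (simp only: sum.delta[OF fS] idS if_True)
  then have zid: "z id = 0" using young_count_regular(1)[of id m] by (simp add: permutes_id)
  have "(\<Sum>\<sigma>\<in>?S. z \<sigma> * z \<sigma>) = 0" unfolding expand using zid orth by simp
  then have "z \<sigma> * z \<sigma> = 0"
    using fS assms by (subst (asm) sum_nonneg_eq_0_iff) auto
  then have "real_of_int (if \<sigma> = id then fact m else 0) = of_int (\<Sum>p\<in>partitions m. irr_char p id * irr_char p \<sigma>)"
    by (simp add: z_def split: if_splits)
  then show ?thesis by (simp only: of_int_eq_iff)
qed

section \<open>The Weingarten function as a pseudo-inverse\<close>

lemma sum_perms_left_quotient:
  assumes "finite B" "y permutes B"
  shows "(\<Sum>\<tau> | \<tau> permutes B. F \<tau> (inv \<tau> \<circ> y)) = (\<Sum>\<tau> | \<tau> permutes B. F (y \<circ> inv \<tau>) \<tau>)"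
proof (rule sum.reindex_bij_witness[of _ "\<lambda>\<tau>. y \<circ> inv \<tau>" "\<lambda>\<tau>. inv \<tau> \<circ> y"])
  fix z assume "z \<in> {\<tau>. \<tau> permutes B}"
  then have z: "z permutes B" by simp
  have "inv (inv z \<circ> y) = inv y \<circ> z"
    using o_inv_distrib[OF permutes_bij[OF permutes_inv[OF z]] permutes_bij[OF assms(2)]]
    by (simp add: permutes_inv_inv[OF z])
  then show e: "y \<circ> inv (inv z \<circ> y) = z" using permutes_inv_o(1)[OF assms(2)] by (simp add: o_assoc)
  show "inv z \<circ> y \<in> {\<tau>. \<tau> permutes B}" using z assms by (auto intro: permutes_compose permutes_inv)
  show "F (y \<circ> inv (inv z \<circ> y)) (inv z \<circ> y) = F z (inv z \<circ> y)" unfolding e ..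
  have i: "inv (y \<circ> inv z) = z \<circ> inv y"
    using o_inv_distrib[OF permutes_bij[OF assms(2)] permutes_bij[OF permutes_inv[OF z]]]
    by (simp add: permutes_inv_inv[OF z])
  show "inv (y \<circ> inv z) \<circ> y = z" unfolding i using permutes_inv_o(2)[OF assms(2)] by (simp add: o_assoc[symmetric])
  show "y \<circ> inv z \<in> {\<tau>. \<tau> permutes B}" using z assms by (auto intro: permutes_compose permutes_inv)
qed

lemma convolution_class_function_commute:
  assumes f: "class_function {1..m} f" and \<sigma>: "\<sigma> permutes {1..m}"
  shows "convolution m f g \<sigma> = convolution m g f \<sigma>"
proof -
  have "convolution m f g \<sigma> = (\<Sum>\<tau> | \<tau> permutes {1..m}. f (\<sigma> \<circ> inv \<tau>) * g \<tau>)"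
    unfolding convolution_def
    by (rule sum_perms_left_quotient[OF _ \<sigma>, of "\<lambda>x y. f x * g y"]) simp
  also have "\<dots> = convolution m g f \<sigma>"
    unfolding convolution_def
  proof (rule sum.cong[OF refl])
    fix \<tau> assume "\<tau> \<in> {\<tau>. \<tau> permutes {1..m}}"
    then have "f (\<sigma> \<circ> inv \<tau>) = f (inv \<tau> \<circ> \<sigma>)"
      using class_function_commute[OF f \<sigma>, of "inv \<tau>"] by (simp add: permutes_inv)
    then show "f (\<sigma> \<circ> inv \<tau>) * g \<tau> = g \<tau> * f (inv \<tau> \<circ> \<sigma>)" by simp
  qed
  finally show ?thesis .
qed

lemma class_function_Wg_U: "class_function {1..m} (\<lambda>\<sigma>. Wg_U m \<sigma> z)"
  unfolding class_function_def Wg_U_def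
proof (intro allI impI)
  fix g x :: "nat \<Rightarrow> nat" assume gx: "g permutes {1..m}" "x permutes {1..m}"
  have "irr_char p (g \<circ> x \<circ> inv g) = irr_char p x" if "p \<in> partitions m" for p
    by (rule class_functionD[OF class_function_irr_char[OF that] gx])
  then show "1 / of_nat (fact m) * (\<Sum>p\<in>{p \<in> partitions m. content_poly p z \<noteq> 0}.
      of_int (irr_char p id) / content_poly p z * of_int (irr_char p (g \<circ> x \<circ> inv g)))
    = 1 / of_nat (fact m) * (\<Sum>p\<in>{p \<in> partitions m. content_poly p z \<noteq> 0}.
      of_int (irr_char p id) / content_poly p z * of_int (irr_char p x))"
    by simp
qed

lemma irr_char_fix_count_convolution:
  assumes p: "p \<in> partitions m" and \<sigma>: "\<sigma> permutes {1..m}"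
  shows "convolution m (\<lambda>\<sigma>. of_int (irr_char p \<sigma>)) (\<lambda>\<sigma>. of_nat (fix_count N {1..m} \<sigma>)) \<sigma>
    = content_poly p (of_nat N) * of_int (irr_char p \<sigma>)"
proof -
  have "class_function {1..m} (\<lambda>\<sigma>. complex_of_int (irr_char p \<sigma>))"
    using class_function_irr_char[OF p] by (simp add: class_function_def)
  from convolution_class_function_commute[OF this \<sigma>, of "\<lambda>\<sigma>. of_nat (fix_count N {1..m} \<sigma>)"]
  show ?thesis using irr_char_eigen[OF p \<sigma>, of N] by (simp only: convolution_def)
qed

text \<open>If \<open>C\<^sub>\<lambda>(N) = 0\<close>, then \<open>\<chi>\<^sup>\<lambda>\<close> acts as zero on the \<open>m\<close>-fold tensor power of an \<open>N\<close>-dimensional space: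
  the Hilbert--Schmidt norm of its action is a pairing with the function \<open>N\<close> to the number of cycles.\<close>

lemma irr_char_vanishes_on_tensors:
  assumes p: "p \<in> partitions m" and zero: "content_poly p (of_nat N) = 0"
    and a: "a \<in> {1..m} \<rightarrow>\<^sub>E {1..N}"
  shows "(\<Sum>\<sigma> | \<sigma> permutes {1..m}. of_int (irr_char p \<sigma>) * (\<phi> (a \<circ> \<sigma>) :: complex)) = 0"
proof -
  let ?S = "{\<sigma>. \<sigma> permutes {1..m}}" and ?P = "{1..m} \<rightarrow>\<^sub>E {1..N}"
  have fP: "finite ?P" by (simp add: finite_PiE)
  \<comment> \<open>Matrix entries of the character acting on the tensor basis. They are integers,
    so a vanishing sum of squares kills each of them before the complex \<phi> is paired with
    them.\<close>
  define u where "u a x = (\<Sum>\<sigma>\<in>?S. if x = a \<circ> \<sigma> then irr_char p \<sigma> else 0)" for a x :: "nat \<Rightarrow> nat"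
  have agree: "(\<Sum>a\<in>?P. if a \<circ> \<sigma> = a \<circ> \<tau> then 1 else 0) = int (fix_count N {1..m} (\<tau> \<circ> inv \<sigma>))"
    if st: "\<sigma> \<in> ?S" "\<tau> \<in> ?S" for \<sigma> \<tau>
  proof -
    have s: "\<sigma> permutes {1..m}" "\<tau> permutes {1..m}" using st by auto
    have st': "\<tau> \<circ> inv \<sigma> permutes {1..m}" using s by (simp add: permutes_compose permutes_inv)
    have "(\<forall>s\<in>{1..m}. a ((\<tau> \<circ> inv \<sigma>) s) = a s) \<longleftrightarrow> a \<circ> \<sigma> = a \<circ> \<tau>" for a :: "nat \<Rightarrow> nat"
    proof
      assume *: "\<forall>s\<in>{1..m}. a ((\<tau> \<circ> inv \<sigma>) s) = a s"
      have "a ((\<tau> \<circ> inv \<sigma>) s) = a s" for s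
        using * permutes_not_in[OF st'] by (cases "s \<in> {1..m}") auto
      from this[of "\<sigma> _"] show "a \<circ> \<sigma> = a \<circ> \<tau>" by (auto simp: fun_eq_iff permutes_inverses(2)[OF s(1)])
    next
      assume "a \<circ> \<sigma> = a \<circ> \<tau>"
      then have "a (\<tau> (inv \<sigma> s)) = a (\<sigma> (inv \<sigma> s))" for s by (metis comp_apply)
      then show "\<forall>s\<in>{1..m}. a ((\<tau> \<circ> inv \<sigma>) s) = a s" by (simp add: permutes_inverses(1)[OF s(1)])
    qed
    then show ?thesis unfolding fix_count_def int_card_sum_if[OF fP] by simp
  qed
  have "(\<Sum>a\<in>?P. \<Sum>x\<in>?P. u a x * u a x)
     = (\<Sum>a\<in>?P. \<Sum>x\<in>?P. \<Sum>\<sigma>\<in>?S. \<Sum>\<tau>\<in>?S. if x = a \<circ> \<sigma> then if x = a \<circ> \<tau> then irr_char p \<sigma> * irr_char p \<tau> else 0 else 0)"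
    unfolding u_def sum_product by (intro sum.cong refl) auto
  also have "\<dots> = (\<Sum>a\<in>?P. \<Sum>\<sigma>\<in>?S. \<Sum>x\<in>?P. \<Sum>\<tau>\<in>?S. if x = a \<circ> \<sigma> then if x = a \<circ> \<tau> then irr_char p \<sigma> * irr_char p \<tau> else 0 else 0)"
    by (rule sum.cong[OF refl], rule sum.swap)
  also have "\<dots> = (\<Sum>a\<in>?P. \<Sum>\<sigma>\<in>?S. \<Sum>\<tau>\<in>?S. \<Sum>x\<in>?P. if x = a \<circ> \<sigma> then if x = a \<circ> \<tau> then irr_char p \<sigma> * irr_char p \<tau> else 0 else 0)"
    by (rule sum.cong[OF refl], rule sum.cong[OF refl], rule sum.swap)
  also have "\<dots> = (\<Sum>a\<in>?P. \<Sum>\<sigma>\<in>?S. \<Sum>\<tau>\<in>?S. irr_char p \<sigma> * irr_char p \<tau> * (if a \<circ> \<sigma> = a \<circ> \<tau> then 1 else 0))"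
  proof (rule sum.cong[OF refl], rule sum.cong[OF refl], rule sum.cong[OF refl])
    fix a \<sigma> \<tau> assume "a \<in> ?P" "\<sigma> \<in> ?S"
    then have "a \<circ> \<sigma> \<in> ?P" by (intro comp_permutes_PiE) simp_all
    then show "(\<Sum>x\<in>?P. if x = a \<circ> \<sigma> then if x = a \<circ> \<tau> then irr_char p \<sigma> * irr_char p \<tau> else 0 else 0)
      = irr_char p \<sigma> * irr_char p \<tau> * (if a \<circ> \<sigma> = a \<circ> \<tau> then 1 else 0)"
      using fP by (subst sum.delta) auto
  qed
  also have "\<dots> = (\<Sum>\<sigma>\<in>?S. \<Sum>a\<in>?P. \<Sum>\<tau>\<in>?S. irr_char p \<sigma> * irr_char p \<tau> * (if a \<circ> \<sigma> = a \<circ> \<tau> then 1 else 0))"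
    by (rule sum.swap)
  also have "\<dots> = (\<Sum>\<sigma>\<in>?S. \<Sum>\<tau>\<in>?S. \<Sum>a\<in>?P. irr_char p \<sigma> * irr_char p \<tau> * (if a \<circ> \<sigma> = a \<circ> \<tau> then 1 else 0))"
    by (rule sum.cong[OF refl], rule sum.swap)
  also have "\<dots> = (\<Sum>\<sigma>\<in>?S. \<Sum>\<tau>\<in>?S. irr_char p \<sigma> * irr_char p \<tau> * int (fix_count N {1..m} (\<tau> \<circ> inv \<sigma>)))"
    by (intro sum.cong refl) (simp only: sum_distrib_left[symmetric] agree)
  also have "\<dots> = (\<Sum>\<tau>\<in>?S. irr_char p \<tau> * (\<Sum>\<sigma>\<in>?S. irr_char p \<sigma> * int (fix_count N {1..m} (\<tau> \<circ> inv \<sigma>))))"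
    by (subst sum.swap) (simp add: sum_distrib_left mult.left_commute mult.assoc)
  also have "\<dots> = 0"
  proof (rule sum.neutral, rule ballI)
    fix \<tau> assume "\<tau> \<in> ?S"
    then have t: "\<tau> permutes {1..m}" by simp
    have "(\<Sum>\<sigma>\<in>?S. irr_char p \<sigma> * int (fix_count N {1..m} (\<tau> \<circ> inv \<sigma>)))
        = (\<Sum>\<sigma>\<in>?S. irr_char p (inv \<sigma> \<circ> \<tau>) * int (fix_count N {1..m} \<sigma>))"
      by (rule sum_perms_left_quotient[OF _ t, of "\<lambda>x y. irr_char p y * int (fix_count N {1..m} x)", symmetric]) simp
    moreover have "complex_of_int \<dots> = 0"
      using irr_char_eigen[OF p t, of N] zero by (simp add: mult.commute)
    ultimately have "(\<Sum>\<sigma>\<in>?S. irr_char p \<sigma> * int (fix_count N {1..m} (\<tau> \<circ> inv \<sigma>))) = 0"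
      by (simp only: of_int_eq_0_iff)
    then show "irr_char p \<tau> * (\<Sum>\<sigma>\<in>?S. irr_char p \<sigma> * int (fix_count N {1..m} (\<tau> \<circ> inv \<sigma>))) = 0" by (simp only: mult_zero_right)
  qed
  finally have "(\<Sum>a\<in>?P. \<Sum>x\<in>?P. u a x * u a x) = 0" .
  then have "(\<Sum>x\<in>?P. u a x * u a x) = 0"
    using fP a by (subst (asm) sum_nonneg_eq_0_iff) (auto intro: sum_nonneg)
  then have u0: "u a x = 0" if "x \<in> ?P" for x
    using fP that by (subst (asm) sum_nonneg_eq_0_iff) auto
  have "(\<Sum>\<sigma>\<in>?S. of_int (irr_char p \<sigma>) * \<phi> (a \<circ> \<sigma>))
     = (\<Sum>\<sigma>\<in>?S. \<Sum>x\<in>?P. if x = a \<circ> \<sigma> then of_int (irr_char p \<sigma>) * \<phi> x else 0)"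
  proof (rule sum.cong[OF refl])
    fix \<sigma> assume "\<sigma> \<in> ?S"
    then have "a \<circ> \<sigma> \<in> ?P" using a by (intro comp_permutes_PiE) simp_all
    then show "of_int (irr_char p \<sigma>) * \<phi> (a \<circ> \<sigma>) = (\<Sum>x\<in>?P. if x = a \<circ> \<sigma> then of_int (irr_char p \<sigma>) * \<phi> x else 0)"
      using fP by (subst sum.delta) auto
  qed
  also have "\<dots> = (\<Sum>x\<in>?P. \<Sum>\<sigma>\<in>?S. if x = a \<circ> \<sigma> then of_int (irr_char p \<sigma>) * \<phi> x else 0)"
    by (rule sum.swap)
  also have "\<dots> = (\<Sum>x\<in>?P. of_int (u a x) * \<phi> x)"
    unfolding u_def of_int_sum sum_distrib_right by (intro sum.cong refl) auto
  also have "\<dots> = 0" using u0 by simp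
  finally show ?thesis .
qed

text \<open>Convolution cancels the denominators and leaves the sum of f \<chi> over partitions with
  nonzero content product. The omitted characters annihilate functions of
  \<open>a \<circ> \<sigma>\<close>, so they may be added back, and completeness turns the sum into
  a delta function.\<close>

theorem Wg_U_pseudo_inverse:
  fixes \<phi> :: "(nat \<Rightarrow> nat) \<Rightarrow> complex"
  assumes a: "a \<in> {1..m} \<rightarrow>\<^sub>E {1..N}"
  shows "(\<Sum>\<sigma> | \<sigma> permutes {1..m}.
      convolution m (\<lambda>\<sigma>. Wg_U m \<sigma> (of_nat N)) (\<lambda>\<sigma>. of_nat (fix_count N {1..m} \<sigma>)) \<sigma> * \<phi> (a \<circ> \<sigma>)) = \<phi> a"
proof -
  let ?S = "{\<sigma>. \<sigma> permutes {1..m}}" and ?C = "\<lambda>p. content_poly p (of_nat N)"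
  let ?f = "\<lambda>p. complex_of_int (irr_char p id)" and ?G = "\<lambda>\<sigma>. of_nat (fix_count N {1..m} \<sigma>)"
  have fS: "finite ?S" by (rule finite_permutations) simp
  have idS: "id \<in> ?S" by (simp add: permutes_id)
  have conv: "convolution m (\<lambda>\<sigma>. Wg_U m \<sigma> (of_nat N)) ?G \<sigma>
     = (1 / fact m) * (\<Sum>p\<in>{p\<in>partitions m. ?C p \<noteq> 0}. ?f p * of_int (irr_char p \<sigma>))"
    if \<sigma>: "\<sigma> \<in> ?S" for \<sigma>
  proof -
    have "convolution m (\<lambda>\<sigma>. Wg_U m \<sigma> (of_nat N)) ?G \<sigma>
      = (\<Sum>\<tau>\<in>?S. \<Sum>p\<in>{p\<in>partitions m. ?C p \<noteq> 0}. (1 / fact m) * (?f p / ?C p) * (of_int (irr_char p \<tau>) * ?G (inv \<tau> \<circ> \<sigma>)))"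
      unfolding convolution_def Wg_U_def sum_distrib_left sum_distrib_right
      by (intro sum.cong refl) simp
    also have "\<dots> = (\<Sum>p\<in>{p\<in>partitions m. ?C p \<noteq> 0}. (1 / fact m) * (?f p / ?C p) * convolution m (\<lambda>\<sigma>. of_int (irr_char p \<sigma>)) ?G \<sigma>)"
      unfolding convolution_def sum_distrib_left by (rule sum.swap)
    also have "\<dots> = (\<Sum>p\<in>{p\<in>partitions m. ?C p \<noteq> 0}. (1 / fact m) * (?f p * of_int (irr_char p \<sigma>)))"
      by (intro sum.cong refl) (use \<sigma> irr_char_fix_count_convolution in auto)
    finally show ?thesis by (simp only: sum_distrib_left)
  qed
  have "(\<Sum>\<sigma>\<in>?S. convolution m (\<lambda>\<sigma>. Wg_U m \<sigma> (of_nat N)) ?G \<sigma> * \<phi> (a \<circ> \<sigma>))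
    = (\<Sum>\<sigma>\<in>?S. \<Sum>p\<in>{p\<in>partitions m. ?C p \<noteq> 0}. (?f p / fact m) * (of_int (irr_char p \<sigma>) * \<phi> (a \<circ> \<sigma>)))"
  proof (rule sum.cong[OF refl])
    fix \<sigma> assume s: "\<sigma> \<in> ?S"
    show "convolution m (\<lambda>\<sigma>. Wg_U m \<sigma> (of_nat N)) ?G \<sigma> * \<phi> (a \<circ> \<sigma>)
      = (\<Sum>p\<in>{p\<in>partitions m. ?C p \<noteq> 0}. (?f p / fact m) * (of_int (irr_char p \<sigma>) * \<phi> (a \<circ> \<sigma>)))"
      unfolding conv[OF s] by (simp add: sum_distrib_left sum_distrib_right mult.assoc)
  qed
  also have "\<dots> = (\<Sum>p\<in>{p\<in>partitions m. ?C p \<noteq> 0}. (?f p / fact m) * (\<Sum>\<sigma>\<in>?S. of_int (irr_char p \<sigma>) * \<phi> (a \<circ> \<sigma>)))"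
    unfolding sum_distrib_left by (rule sum.swap)
  also have "\<dots> = (\<Sum>p\<in>partitions m. (?f p / fact m) * (\<Sum>\<sigma>\<in>?S. of_int (irr_char p \<sigma>) * \<phi> (a \<circ> \<sigma>)))"
    by (rule sum.mono_neutral_left)
      (use finite_partitions irr_char_vanishes_on_tensors[OF _ _ a] in auto)
  also have "\<dots> = (\<Sum>\<sigma>\<in>?S. \<Sum>p\<in>partitions m. (?f p / fact m) * (of_int (irr_char p \<sigma>) * \<phi> (a \<circ> \<sigma>)))"
    unfolding sum_distrib_left by (rule sum.swap)
  also have "\<dots> = (\<Sum>\<sigma>\<in>?S. if \<sigma> = id then \<phi> (a \<circ> \<sigma>) else 0)"
  proof (rule sum.cong[OF refl])
    fix \<sigma> assume "\<sigma> \<in> ?S"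
    then have "complex_of_int (\<Sum>p\<in>partitions m. irr_char p id * irr_char p \<sigma>) = of_int (if \<sigma> = id then fact m else 0)"
      by (simp only: irr_char_complete mem_Collect_eq)
    then have "(\<Sum>p\<in>partitions m. ?f p * of_int (irr_char p \<sigma>)) = (if \<sigma> = id then fact m else 0)" by auto
    moreover have "(\<Sum>p\<in>partitions m. (?f p / fact m) * (of_int (irr_char p \<sigma>) * \<phi> (a \<circ> \<sigma>)))
      = (\<Sum>p\<in>partitions m. ?f p * of_int (irr_char p \<sigma>)) * (\<phi> (a \<circ> \<sigma>) / fact m)"
      by (simp add: sum_distrib_right sum_divide_distrib mult.assoc)
    ultimately show "(\<Sum>p\<in>partitions m. (?f p / fact m) * (of_int (irr_char p \<sigma>) * \<phi> (a \<circ> \<sigma>))) = (if \<sigma> = id then \<phi> (a \<circ> \<sigma>) else 0)"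
      by simp
  qed
  also have "\<dots> = \<phi> (a \<circ> id)" by (simp only: sum.delta[OF fS] idS if_True)
  finally show ?thesis by simp
qed

section \<open>Operators commuting with derivations of a tensor power\<close>

abbreviation tuples :: "nat \<Rightarrow> nat \<Rightarrow> (nat \<Rightarrow> nat) set" where
  "tuples m N \<equiv> {1..m} \<rightarrow>\<^sub>E {1..N}"

lemma finite_tuples: "finite (tuples m N)"
  by (simp add: finite_PiE)

text \<open>Operators on the \<open>m\<close>-fold tensor power of an \<open>N\<close>-dimensional space are given by their entries,
  indexed by pairs of tuples.\<close>

type_synonym tensor_op = "(nat \<Rightarrow> nat) \<Rightarrow> (nat \<Rightarrow> nat) \<Rightarrow> complex"

definition commutes :: "nat \<Rightarrow> nat \<Rightarrow> tensor_op \<Rightarrow> tensor_op \<Rightarrow> bool" where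
  "commutes m N M A \<longleftrightarrow> (\<forall>z\<in>tuples m N. \<forall>y\<in>tuples m N.
     (\<Sum>x\<in>tuples m N. A z x * M x y) = (\<Sum>x\<in>tuples m N. M z x * A x y))"

definition tensor :: "nat \<Rightarrow> (nat \<Rightarrow> cmat) \<Rightarrow> tensor_op" where
  "tensor m X z x = (\<Prod>s\<in>{1..m}. X s (z s) (x s))"

text \<open>The identity without a size bound: it is exactly the value at 0 of the curve that is
  differentiated later, whereas \<open>midentity\<close> vanishes outside {1..N}.\<close>

definition kron :: cmat where
  "kron i j = (if i = j then 1 else 0)"

definition derivation_op :: "nat \<Rightarrow> cmat \<Rightarrow> tensor_op" where
  "derivation_op m Y z x = (\<Sum>t\<in>{1..m}. tensor m (\<lambda>s. if s = t then Y else kron) z x)"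

definition symmetrized :: "nat \<Rightarrow> (nat \<Rightarrow> cmat) \<Rightarrow> tensor_op" where
  "symmetrized m X z x = (\<Sum>\<tau> | \<tau> permutes {1..m}. tensor m (X \<circ> \<tau>) z x)"

lemma commutes_cong:
  assumes "\<And>z x. z \<in> tuples m N \<Longrightarrow> x \<in> tuples m N \<Longrightarrow> A z x = A' z x"
  shows "commutes m N M A \<longleftrightarrow> commutes m N M A'"
  unfolding commutes_def using assms by (intro ball_cong refl) (simp cong: sum.cong)

lemma commutes_sum:
  assumes "\<And>i. i \<in> I \<Longrightarrow> commutes m N M (A i)"
  shows "commutes m N M (\<lambda>z x. \<Sum>i\<in>I. A i z x)"
  unfolding commutes_def
proof (intro ballI)
  fix z y assume zy: "z \<in> tuples m N" "y \<in> tuples m N"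
  have "(\<Sum>x\<in>tuples m N. (\<Sum>i\<in>I. A i z x) * M x y) = (\<Sum>i\<in>I. \<Sum>x\<in>tuples m N. A i z x * M x y)"
    unfolding sum_distrib_right by (rule sum.swap)
  also have "\<dots> = (\<Sum>i\<in>I. \<Sum>x\<in>tuples m N. M z x * A i x y)"
    by (rule sum.cong[OF refl]) (use assms zy in \<open>auto simp: commutes_def\<close>)
  also have "\<dots> = (\<Sum>x\<in>tuples m N. M z x * (\<Sum>i\<in>I. A i x y))"
    unfolding sum_distrib_left by (rule sum.swap)
  finally show "(\<Sum>x\<in>tuples m N. (\<Sum>i\<in>I. A i z x) * M x y) = (\<Sum>x\<in>tuples m N. M z x * (\<Sum>i\<in>I. A i x y))" .
qed

lemma commutes_scale:
  assumes "commutes m N M A"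
  shows "commutes m N M (\<lambda>z x. k * A z x)"
  using assms unfolding commutes_def by (simp add: sum_distrib_left[symmetric] mult.assoc mult.left_commute)

lemma commutes_scaleD:
  assumes "commutes m N M (\<lambda>z x. k * A z x)" "k \<noteq> 0"
  shows "commutes m N M A"
  using commutes_scale[OF assms(1), of "1 / k"] assms(2) by simp

lemma commutes_diff:
  assumes "commutes m N M A" "commutes m N M B"
  shows "commutes m N M (\<lambda>z x. A z x - B z x)"
  using assms unfolding commutes_def by (simp add: left_diff_distrib right_diff_distrib sum_subtractf)

lemma commutes_mult:
  assumes "commutes m N M A" "commutes m N M B"
  shows "commutes m N M (\<lambda>z x. \<Sum>u\<in>tuples m N. A z u * B u x)"
  unfolding commutes_def
proof (intro ballI)
  let ?T = "tuples m N"
  fix z y assume zy: "z \<in> ?T" "y \<in> ?T"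
  have "(\<Sum>x\<in>?T. (\<Sum>u\<in>?T. A z u * B u x) * M x y) = (\<Sum>u\<in>?T. A z u * (\<Sum>x\<in>?T. B u x * M x y))"
    unfolding sum_distrib_right sum_distrib_left by (subst sum.swap) (simp add: mult.assoc)
  also have "\<dots> = (\<Sum>u\<in>?T. A z u * (\<Sum>x\<in>?T. M u x * B x y))"
    by (rule sum.cong[OF refl]) (use assms(2) zy in \<open>simp add: commutes_def\<close>)
  also have "\<dots> = (\<Sum>x\<in>?T. (\<Sum>u\<in>?T. A z u * M u x) * B x y)"
    unfolding sum_distrib_right sum_distrib_left by (subst sum.swap) (simp add: mult.assoc)
  also have "\<dots> = (\<Sum>x\<in>?T. (\<Sum>u\<in>?T. M z u * A u x) * B x y)"
    by (rule sum.cong[OF refl]) (use assms(1) zy in \<open>simp add: commutes_def\<close>)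
  also have "\<dots> = (\<Sum>u\<in>?T. M z u * (\<Sum>x\<in>?T. A u x * B x y))"
    unfolding sum_distrib_right sum_distrib_left by (subst sum.swap) (simp add: mult.assoc)
  finally show "(\<Sum>x\<in>?T. (\<Sum>u\<in>?T. A z u * B u x) * M x y) = (\<Sum>u\<in>?T. M z u * (\<Sum>x\<in>?T. A u x * B x y))" .
qed

lemma tuplesD: "z \<in> tuples m N \<Longrightarrow> s \<in> {1..m} \<Longrightarrow> z s \<in> {1..N}"
  by (auto simp: PiE_iff)

lemma sum_tensor:
  "(\<Sum>x\<in>tuples m N. tensor m X z x * tensor m Y x y) = tensor m (\<lambda>s. mmult N (X s) (Y s)) z y"
  unfolding tensor_def mmult_def
  by (subst prod_sum_PiE) (auto simp: prod.distrib)

lemma tensor_cong: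
  assumes "\<And>s. s \<in> {1..m} \<Longrightarrow> X s (z s) (x s) = Y s (z s) (x s)"
  shows "tensor m X z x = tensor m Y z x"
  unfolding tensor_def by (rule prod.cong[OF refl]) (rule assms)

lemma mmult_kron_right: "j \<in> {1..N} \<Longrightarrow> mmult N A kron i j = A i j"
proof -
  assume j: "j \<in> {1..N}"
  have "mmult N A kron i j = (\<Sum>t\<in>{1..N}. if t = j then A i t else 0)"
    unfolding mmult_def kron_def by (intro sum.cong) auto
  then show ?thesis using j by simp
qed

lemma mmult_kron_left: "i \<in> {1..N} \<Longrightarrow> mmult N kron A i j = A i j"
proof -
  assume i: "i \<in> {1..N}"
  have "mmult N kron A i j = (\<Sum>t\<in>{1..N}. if i = t then A t j else 0)"
    unfolding mmult_def kron_def by (intro sum.cong) auto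
  then show ?thesis using i by simp
qed

lemma tensor_kron:
  assumes "z \<in> tuples m N" "x \<in> tuples m N"
  shows "tensor m (\<lambda>s. kron) z x = (if z = x then 1 else 0)"
proof (cases "z = x")
  case False
  then obtain s where "s \<in> {1..m}" "z s \<noteq> x s"
    using PiE_ext[OF assms] by blast
  then have "tensor m (\<lambda>s. kron) z x = 0" unfolding tensor_def by (intro prod_zero) (auto simp: kron_def)
  then show ?thesis using False by simp
qed (simp add: tensor_def kron_def)

lemma commutes_kron: "commutes m N M (tensor m (\<lambda>s. kron))"
proof -
  have "commutes m N M (\<lambda>z x. if z = x then 1 else 0)"
    unfolding commutes_def
  proof (intro ballI)
    fix z y assume zy: "z \<in> tuples m N" "y \<in> tuples m N"
    have "(\<Sum>x\<in>tuples m N. (if z = x then 1 else 0) * M x y) = (\<Sum>x\<in>tuples m N. if z = x then M x y else 0)"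
      by (intro sum.cong) auto
    also have "\<dots> = M z y" using zy by (simp add: finite_PiE)
    also have "\<dots> = (\<Sum>x\<in>tuples m N. if x = y then M z x else 0)" using zy by (simp add: finite_PiE)
    also have "\<dots> = (\<Sum>x\<in>tuples m N. M z x * (if x = y then 1 else 0))" by (intro sum.cong) auto
    finally show "(\<Sum>x\<in>tuples m N. (if z = x then 1 else 0) * M x y)
      = (\<Sum>x\<in>tuples m N. M z x * (if x = y then 1 else 0))" .
  qed
  then show ?thesis
    using commutes_cong[of m N "tensor m (\<lambda>s. kron)" "\<lambda>z x. if z = x then 1 else 0" M] tensor_kron by blast
qed

lemma symmetrized_perm:
  assumes "\<pi> permutes {1..m}"
  shows "symmetrized m (X \<circ> \<pi>) z x = symmetrized m X z x"
  unfolding symmetrized_def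
  using setum_permutations_compose_left[OF assms, of "\<lambda>\<tau>. tensor m (X \<circ> \<tau>) z x"] by (simp add: o_assoc)

text \<open>At slot t the factor \<open>X (\<tau> t)\<close> is multiplied by Y; for fixed \<tau>,
  summing over slots is the same as summing over factors.\<close>

lemma symmetrized_derivation:
  assumes z: "z \<in> tuples m N" and y: "y \<in> tuples m N"
  shows "(\<Sum>x\<in>tuples m N. symmetrized m X z x * derivation_op m Y x y)
    = (\<Sum>t\<in>{1..m}. symmetrized m (X(t := mmult N (X t) Y)) z y)"
proof -
  let ?S = "{\<tau>. \<tau> permutes {1..m}}"
  have "(\<Sum>x\<in>tuples m N. symmetrized m X z x * derivation_op m Y x y)
     = (\<Sum>x\<in>tuples m N. \<Sum>\<tau>\<in>?S. \<Sum>t\<in>{1..m}. tensor m (X \<circ> \<tau>) z x * tensor m (\<lambda>s. if s = t then Y else kron) x y)"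
    unfolding symmetrized_def derivation_op_def sum_product ..
  also have "\<dots> = (\<Sum>\<tau>\<in>?S. \<Sum>x\<in>tuples m N. \<Sum>t\<in>{1..m}. tensor m (X \<circ> \<tau>) z x * tensor m (\<lambda>s. if s = t then Y else kron) x y)"
    by (rule sum.swap)
  also have "\<dots> = (\<Sum>\<tau>\<in>?S. \<Sum>t\<in>{1..m}. \<Sum>x\<in>tuples m N. tensor m (X \<circ> \<tau>) z x * tensor m (\<lambda>s. if s = t then Y else kron) x y)"
    by (rule sum.cong[OF refl], rule sum.swap)
  also have "\<dots> = (\<Sum>\<tau>\<in>?S. \<Sum>t\<in>{1..m}. tensor m (\<lambda>s. mmult N ((X \<circ> \<tau>) s) (if s = t then Y else kron)) z y)"
    by (simp only: sum_tensor)
  also have "\<dots> = (\<Sum>\<tau>\<in>?S. \<Sum>t\<in>{1..m}. tensor m (X(\<tau> t := mmult N (X (\<tau> t)) Y) \<circ> \<tau>) z y)"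
  proof (rule sum.cong[OF refl], rule sum.cong[OF refl])
    fix \<tau> t assume "\<tau> \<in> ?S" and t: "t \<in> {1..m}"
    then have inj: "\<tau> s = \<tau> t \<longleftrightarrow> s = t" for s using permutes_inj[of \<tau>] by (auto dest: injD)
    show "tensor m (\<lambda>s. mmult N ((X \<circ> \<tau>) s) (if s = t then Y else kron)) z y
      = tensor m (X(\<tau> t := mmult N (X (\<tau> t)) Y) \<circ> \<tau>) z y"
    proof (rule tensor_cong)
      fix s assume "s \<in> {1..m}"
      then have "y s \<in> {1..N}" using tuplesD[OF y] by blast
      then show "mmult N ((X \<circ> \<tau>) s) (if s = t then Y else kron) (z s) (y s)
        = (X(\<tau> t := mmult N (X (\<tau> t)) Y) \<circ> \<tau>) s (z s) (y s)"
        using mmult_kron_right[of "y s" N "X (\<tau> s)" "z s"] inj[of s] by (cases "s = t") simp_all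
    qed
  qed
  also have "\<dots> = (\<Sum>\<tau>\<in>?S. \<Sum>t\<in>{1..m}. tensor m (X(t := mmult N (X t) Y) \<circ> \<tau>) z y)"
  proof (rule sum.cong[OF refl])
    fix \<tau> assume "\<tau> \<in> ?S"
    then have "\<tau> permutes {1..m}" by simp
    from sum.permute[OF this, of "\<lambda>t. tensor m (X(t := mmult N (X t) Y) \<circ> \<tau>) z y"]
    show "(\<Sum>t\<in>{1..m}. tensor m (X(\<tau> t := mmult N (X (\<tau> t)) Y) \<circ> \<tau>) z y)
      = (\<Sum>t\<in>{1..m}. tensor m (X(t := mmult N (X t) Y) \<circ> \<tau>) z y)" by (simp add: o_def)
  qed
  also have "\<dots> = (\<Sum>t\<in>{1..m}. symmetrized m (X(t := mmult N (X t) Y)) z y)"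
    unfolding symmetrized_def by (rule sum.swap)
  finally show ?thesis .
qed

text \<open>Replace the last nontrivial factor Y = X (Suc r) by the identity and multiply by the
  derivation of Y. For t \<le> r the product stays within r nontrivial factors; each of the other m
  - r terms puts Y into a free slot and equals the wanted symmetrization. As m - r > 0, it can be
  solved for.\<close>

lemma commutes_symmetrized_aux:
  assumes D: "\<And>Y. commutes m N M (derivation_op m Y)"
  shows "r \<le> m \<Longrightarrow> (\<And>t. t \<in> {r<..m} \<Longrightarrow> X t = kron) \<Longrightarrow> commutes m N M (symmetrized m X)"
proof (induction r arbitrary: X)
  case 0
  have "symmetrized m X z x = (\<Sum>\<tau> | \<tau> permutes {1..m}. tensor m (\<lambda>s. kron) z x)" for z x
    unfolding symmetrized_def
  proof (intro sum.cong refl tensor_cong)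
    fix \<tau> s assume "\<tau> \<in> {\<tau>. \<tau> permutes {1..m}}" "s \<in> {1..m}"
    then have "\<tau> s \<in> {1..m}" using permutes_in_image[of \<tau>] by blast
    then show "(X \<circ> \<tau>) s (z s) (x s) = kron (z s) (x s)" using 0 by simp
  qed
  then have "symmetrized m X = (\<lambda>z x. \<Sum>\<tau> | \<tau> permutes {1..m}. tensor m (\<lambda>s. kron) z x)" by (intro ext)
  then show ?case by (simp only: commutes_sum commutes_kron)
next
  case (Suc r)
  define X' where "X' = X(Suc r := kron)"
  define Y where "Y = X (Suc r)"
  have X': "X' t = kron" if "t \<in> {r<..m}" for t
    using that Suc.prems(2)[of t] by (cases "t = Suc r") (auto simp: X'_def)
  let ?Z = "\<lambda>t. symmetrized m (X'(t := mmult N (X' t) Y))"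
  have small: "commutes m N M (?Z t)" if "t \<in> {1..r}" for t
    by (rule Suc.IH) (use that X' Suc.prems(1) in auto)
  have large: "?Z t z y = symmetrized m X z y" if t: "t \<in> {Suc r..m}" and zy: "z \<in> tuples m N" "y \<in> tuples m N" for t z y
  proof -
    let ?T = "Transposition.transpose t (Suc r)"
    have tm: "t \<in> {1..m}" "Suc r \<in> {1..m}" using t by auto
    have T: "?T permutes {1..m}" using tm by (rule permutes_swap_id)
    have "?Z t z y = symmetrized m (X \<circ> ?T) z y"
      unfolding symmetrized_def
    proof (intro sum.cong refl tensor_cong)
      fix \<tau> s assume "\<tau> \<in> {\<tau>. \<tau> permutes {1..m}}" and s: "s \<in> {1..m}"
      then have ts: "\<tau> s \<in> {1..m}" using permutes_in_image[of \<tau>] by blast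
      have zs: "z s \<in> {1..N}" using tuplesD[OF zy(1) s] .
      have kt: "X' t = kron" using X'[of t] t by auto
      show "(X'(t := mmult N (X' t) Y) \<circ> \<tau>) s (z s) (y s) = (X \<circ> ?T \<circ> \<tau>) s (z s) (y s)"
      proof (cases "\<tau> s = t")
        case True
        then show ?thesis using kt mmult_kron_left[OF zs, of Y] by (simp add: Y_def)
      next
        case False
        show ?thesis
        proof (cases "\<tau> s = Suc r")
          case True
          then have "X t = kron" using t Suc.prems(2)[of t] False by auto
          then show ?thesis using True False by (simp add: X'_def)
        next
          case F: False
          then have "?T (\<tau> s) = \<tau> s" using False by (simp add: Transposition.transpose_def)
          then show ?thesis using False F by (simp add: X'_def)
        qed
      qed
    qed
    then show ?thesis using symmetrized_perm[OF T] by simp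
  qed
  have cX': "commutes m N M (symmetrized m X')" by (rule Suc.IH) (use Suc.prems X' in auto)
  have "commutes m N M (\<lambda>z x. (\<Sum>u\<in>tuples m N. symmetrized m X' z u * derivation_op m Y u x) - (\<Sum>t\<in>{1..r}. ?Z t z x))"
    by (intro commutes_diff commutes_mult commutes_sum cX' D small)
  moreover have "(\<Sum>u\<in>tuples m N. symmetrized m X' z u * derivation_op m Y u x) - (\<Sum>t\<in>{1..r}. ?Z t z x)
      = of_nat (m - r) * symmetrized m X z x" if zx: "z \<in> tuples m N" "x \<in> tuples m N" for z x
  proof -
    have "{1..m} = {1..r} \<union> {Suc r..m}" using Suc.prems(1) by auto
    then have "(\<Sum>t\<in>{1..m}. ?Z t z x) = (\<Sum>t\<in>{1..r}. ?Z t z x) + (\<Sum>t\<in>{Suc r..m}. ?Z t z x)"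
      by (simp only:) (rule sum.union_disjoint, auto)
    also have "(\<Sum>t\<in>{Suc r..m}. ?Z t z x) = (\<Sum>t\<in>{Suc r..m}. symmetrized m X z x)"
      by (rule sum.cong[OF refl]) (rule large[OF _ zx])
    also have "\<dots> = of_nat (m - r) * symmetrized m X z x" by simp
    finally have e: "(\<Sum>t\<in>{1..m}. ?Z t z x) = (\<Sum>t\<in>{1..r}. ?Z t z x) + of_nat (m - r) * symmetrized m X z x" .
    show ?thesis unfolding symmetrized_derivation[OF zx] e by (rule add_diff_cancel_left')
  qed
  ultimately have "commutes m N M (\<lambda>z x. of_nat (m - r) * symmetrized m X z x)"
    using commutes_cong[of m N "\<lambda>z x. (\<Sum>u\<in>tuples m N. symmetrized m X' z u * derivation_op m Y u x) - (\<Sum>t\<in>{1..r}. ?Z t z x)"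
       "\<lambda>z x. of_nat (m - r) * symmetrized m X z x" M] by blast
  then show ?case by (rule commutes_scaleD) (use Suc.prems(1) in simp)
qed

lemma commutes_symmetrized:
  assumes "\<And>Y. commutes m N M (derivation_op m Y)"
  shows "commutes m N M (symmetrized m X)"
  by (rule commutes_symmetrized_aux[OF assms, of m]) auto

text \<open>For X t the matrix unit at (a t, b t), the symmetrization is the sum over \<tau> of the
  units at (a \<circ> \<tau>, b \<circ> \<tau>). Comparing entries at (z, b) and summing over b
  produces \<open>fix_count\<close> on one side and twisted traces on the other.\<close>

lemma commutant_trace_identity:
  assumes D: "\<And>Y. commutes m N M (derivation_op m Y)" and z: "z \<in> tuples m N" and a: "a \<in> tuples m N"
  shows "(\<Sum>\<tau> | \<tau> permutes {1..m}. M z (a \<circ> \<tau>) * of_nat (fix_count N {1..m} \<tau>))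
    = (\<Sum>\<tau> | \<tau> permutes {1..m}. (if z = a \<circ> \<tau> then 1 else 0) * (\<Sum>b\<in>tuples m N. M (b \<circ> \<tau>) b))"
proof -
  let ?S = "{\<tau>. \<tau> permutes {1..m}}" and ?P = "tuples m N"
  have key: "(\<Sum>\<tau>\<in>?S. M z (a \<circ> \<tau>) * (if b = b \<circ> \<tau> then 1 else 0))
     = (\<Sum>\<tau>\<in>?S. (if z = a \<circ> \<tau> then 1 else 0) * M (b \<circ> \<tau>) b)" if b: "b \<in> ?P" for b
  proof -
    define X :: "nat \<Rightarrow> cmat" where "X t i j = (if i = a t \<and> j = b t then 1 else 0)" for t i j
    have ten: "tensor m (X \<circ> \<tau>) x y = (if x = a \<circ> \<tau> then 1 else 0) * (if y = b \<circ> \<tau> then 1 else 0)"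
      if xy: "x \<in> ?P" "y \<in> ?P" and t: "\<tau> \<in> ?S" for x y \<tau>
    proof -
      have at: "a \<circ> \<tau> \<in> ?P" "b \<circ> \<tau> \<in> ?P" using a b t by (auto intro!: comp_permutes_PiE)
      have "tensor m (X \<circ> \<tau>) x y = (if \<forall>s\<in>{1..m}. x s = a (\<tau> s) \<and> y s = b (\<tau> s) then 1 else 0)"
        unfolding tensor_def X_def by (auto intro!: prod_zero)
      also have "(\<forall>s\<in>{1..m}. x s = a (\<tau> s) \<and> y s = b (\<tau> s)) \<longleftrightarrow> x = a \<circ> \<tau> \<and> y = b \<circ> \<tau>"
        using PiE_ext[OF xy(1) at(1)] PiE_ext[OF xy(2) at(2)] by auto
      finally have e: "tensor m (X \<circ> \<tau>) x y = (if x = a \<circ> \<tau> \<and> y = b \<circ> \<tau> then 1 else 0)" .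
      show ?thesis unfolding e by simp
    qed
    have "(\<Sum>x\<in>?P. symmetrized m X z x * M x b) = (\<Sum>x\<in>?P. M z x * symmetrized m X x b)"
      using commutes_symmetrized[OF D] z b by (simp add: commutes_def)
    moreover have "(\<Sum>x\<in>?P. symmetrized m X z x * M x b) = (\<Sum>\<tau>\<in>?S. (if z = a \<circ> \<tau> then 1 else 0) * M (b \<circ> \<tau>) b)"
    proof -
      have "(\<Sum>x\<in>?P. symmetrized m X z x * M x b) = (\<Sum>x\<in>?P. \<Sum>\<tau>\<in>?S. if x = b \<circ> \<tau> then (if z = a \<circ> \<tau> then 1 else 0) * M x b else 0)"
        unfolding symmetrized_def sum_distrib_right
      proof (intro sum.cong refl)
        fix x \<tau> assume h: "x \<in> ?P" "\<tau> \<in> ?S"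
        show "tensor m (X \<circ> \<tau>) z x * M x b = (if x = b \<circ> \<tau> then (if z = a \<circ> \<tau> then 1 else 0) * M x b else 0)"
          unfolding ten[OF z h] by simp
      qed
      also have "\<dots> = (\<Sum>\<tau>\<in>?S. \<Sum>x\<in>?P. if x = b \<circ> \<tau> then (if z = a \<circ> \<tau> then 1 else 0) * M x b else 0)"
        by (rule sum.swap)
      also have "\<dots> = (\<Sum>\<tau>\<in>?S. (if z = a \<circ> \<tau> then 1 else 0) * M (b \<circ> \<tau>) b)"
      proof (rule sum.cong[OF refl])
        fix \<tau> assume "\<tau> \<in> ?S"
        then have "b \<circ> \<tau> \<in> ?P" using b by (intro comp_permutes_PiE) simp_all
        then show "(\<Sum>x\<in>?P. if x = b \<circ> \<tau> then (if z = a \<circ> \<tau> then 1 else 0) * M x b else 0)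
          = (if z = a \<circ> \<tau> then 1 else 0) * M (b \<circ> \<tau>) b"
          by (subst sum.delta[OF finite_tuples]) simp
      qed
      finally show ?thesis .
    qed
    moreover have "(\<Sum>x\<in>?P. M z x * symmetrized m X x b) = (\<Sum>\<tau>\<in>?S. M z (a \<circ> \<tau>) * (if b = b \<circ> \<tau> then 1 else 0))"
    proof -
      have "(\<Sum>x\<in>?P. M z x * symmetrized m X x b) = (\<Sum>x\<in>?P. \<Sum>\<tau>\<in>?S. if x = a \<circ> \<tau> then M z x * (if b = b \<circ> \<tau> then 1 else 0) else 0)"
        unfolding symmetrized_def sum_distrib_left
      proof (intro sum.cong refl)
        fix x \<tau> assume h: "x \<in> ?P" "\<tau> \<in> ?S"
        show "M z x * tensor m (X \<circ> \<tau>) x b = (if x = a \<circ> \<tau> then M z x * (if b = b \<circ> \<tau> then 1 else 0) else 0)"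
          unfolding ten[OF h(1) b h(2)] by simp
      qed
      also have "\<dots> = (\<Sum>\<tau>\<in>?S. \<Sum>x\<in>?P. if x = a \<circ> \<tau> then M z x * (if b = b \<circ> \<tau> then 1 else 0) else 0)"
        by (rule sum.swap)
      also have "\<dots> = (\<Sum>\<tau>\<in>?S. M z (a \<circ> \<tau>) * (if b = b \<circ> \<tau> then 1 else 0))"
      proof (rule sum.cong[OF refl])
        fix \<tau> assume "\<tau> \<in> ?S"
        then have "a \<circ> \<tau> \<in> ?P" using a by (intro comp_permutes_PiE) simp_all
        then show "(\<Sum>x\<in>?P. if x = a \<circ> \<tau> then M z x * (if b = b \<circ> \<tau> then 1 else 0) else 0)
          = M z (a \<circ> \<tau>) * (if b = b \<circ> \<tau> then 1 else 0)"
          by (subst sum.delta[OF finite_tuples]) simp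
      qed
      finally show ?thesis .
    qed
    ultimately show ?thesis by simp
  qed
  have fc: "of_nat (fix_count N {1..m} \<tau>) = (\<Sum>b\<in>?P. if b = b \<circ> \<tau> then 1 else (0::complex))" if "\<tau> \<in> ?S" for \<tau>
  proof -
    have "(\<forall>s\<in>{1..m}. b (\<tau> s) = b s) \<longleftrightarrow> b = b \<circ> \<tau>" for b :: "nat \<Rightarrow> nat"
    proof
      assume *: "\<forall>s\<in>{1..m}. b (\<tau> s) = b s"
      have "b (\<tau> s) = b s" for s using * that permutes_not_in[of \<tau> "{1..m}" s] by (cases "s \<in> {1..m}") auto
      then show "b = b \<circ> \<tau>" by auto
    qed (metis comp_apply)
    then have "int (fix_count N {1..m} \<tau>) = (\<Sum>b\<in>?P. if b = b \<circ> \<tau> then 1 else 0)"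
      unfolding fix_count_def int_card_sum_if[OF finite_tuples] by simp
    then have "complex_of_int (int (fix_count N {1..m} \<tau>)) = of_int (\<Sum>b\<in>?P. if b = b \<circ> \<tau> then 1 else 0)" by (simp only:)
    then show ?thesis by (simp add: if_distrib cong: if_cong)
  qed
  have "(\<Sum>\<tau>\<in>?S. M z (a \<circ> \<tau>) * of_nat (fix_count N {1..m} \<tau>))
     = (\<Sum>\<tau>\<in>?S. \<Sum>b\<in>?P. M z (a \<circ> \<tau>) * (if b = b \<circ> \<tau> then 1 else 0))"
    by (rule sum.cong[OF refl]) (simp only: fc sum_distrib_left)
  also have "\<dots> = (\<Sum>b\<in>?P. \<Sum>\<tau>\<in>?S. M z (a \<circ> \<tau>) * (if b = b \<circ> \<tau> then 1 else 0))" by (rule sum.swap)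
  also have "\<dots> = (\<Sum>b\<in>?P. \<Sum>\<tau>\<in>?S. (if z = a \<circ> \<tau> then 1 else 0) * M (b \<circ> \<tau>) b)"
    by (rule sum.cong[OF refl]) (rule key)
  also have "\<dots> = (\<Sum>\<tau>\<in>?S. \<Sum>b\<in>?P. (if z = a \<circ> \<tau> then 1 else 0) * M (b \<circ> \<tau>) b)" by (rule sum.swap)
  finally show ?thesis by (simp only: sum_distrib_left)
qed

text \<open>The pseudo-inverse is applied to the function \<open>M z\<close>; after translation by
  \<rho> the inner sum is the trace identity at \<open>a \<circ> \<rho>\<close>. The order of the
  convolution is exchanged at the end because the Weingarten function is a class function.\<close>

theorem weingarten_commutant:
  assumes D: "\<And>Y. commutes m N M (derivation_op m Y)" and z: "z \<in> tuples m N" and a: "a \<in> tuples m N"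
  shows "M z a = (\<Sum>\<sigma> | \<sigma> permutes {1..m}. (if z = a \<circ> \<sigma> then 1 else 0) *
    convolution m (\<lambda>\<tau>. \<Sum>b\<in>tuples m N. M (b \<circ> \<tau>) b) (\<lambda>\<sigma>. Wg_U m \<sigma> (of_nat N)) \<sigma>)"
proof -
  let ?S = "{\<tau>. \<tau> permutes {1..m}}"
  let ?W = "\<lambda>\<sigma>. Wg_U m \<sigma> (of_nat N)" and ?G = "\<lambda>\<sigma>. complex_of_nat (fix_count N {1..m} \<sigma>)"
  let ?t = "\<lambda>\<tau>. \<Sum>b\<in>tuples m N. M (b \<circ> \<tau>) b"
  have shift: "(\<Sum>\<sigma>\<in>?S. F (inv \<rho> \<circ> \<sigma>) \<sigma>) = (\<Sum>\<tau>\<in>?S. F \<tau> (\<rho> \<circ> \<tau>))" if "\<rho> \<in> ?S" for \<rho> and F :: "(nat\<Rightarrow>nat) \<Rightarrow> (nat\<Rightarrow>nat) \<Rightarrow> complex"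
  proof (rule sum.reindex_bij_witness[of _ "\<lambda>\<tau>. \<rho> \<circ> \<tau>" "\<lambda>\<sigma>. inv \<rho> \<circ> \<sigma>"])
    have r: "\<rho> permutes {1..m}" using that by simp
    fix \<sigma> assume s: "\<sigma> \<in> ?S"
    show e: "\<rho> \<circ> (inv \<rho> \<circ> \<sigma>) = \<sigma>" by (simp add: o_assoc permutes_inv_o(1)[OF r])
    show "inv \<rho> \<circ> (\<rho> \<circ> \<sigma>) = \<sigma>" by (simp add: o_assoc permutes_inv_o(2)[OF r])
    show "inv \<rho> \<circ> \<sigma> \<in> ?S" "\<rho> \<circ> \<sigma> \<in> ?S" using s r by (auto intro: permutes_compose permutes_inv)
    show "F (inv \<rho> \<circ> \<sigma>) (\<rho> \<circ> (inv \<rho> \<circ> \<sigma>)) = F (inv \<rho> \<circ> \<sigma>) \<sigma>" unfolding e ..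
  qed
  have "M z a = (\<Sum>\<sigma>\<in>?S. convolution m ?W ?G \<sigma> * M z (a \<circ> \<sigma>))"
    using Wg_U_pseudo_inverse[OF a, of "M z"] by simp
  also have "\<dots> = (\<Sum>\<sigma>\<in>?S. \<Sum>\<rho>\<in>?S. ?W \<rho> * (?G (inv \<rho> \<circ> \<sigma>) * M z (a \<circ> \<sigma>)))"
    unfolding convolution_def sum_distrib_right by (simp add: mult.assoc)
  also have "\<dots> = (\<Sum>\<rho>\<in>?S. \<Sum>\<sigma>\<in>?S. ?W \<rho> * (?G (inv \<rho> \<circ> \<sigma>) * M z (a \<circ> \<sigma>)))" by (rule sum.swap)
  also have "\<dots> = (\<Sum>\<rho>\<in>?S. ?W \<rho> * (\<Sum>\<tau>\<in>?S. (if z = (a \<circ> \<rho>) \<circ> \<tau> then 1 else 0) * ?t \<tau>))"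
  proof (rule sum.cong[OF refl])
    fix \<rho> assume r: "\<rho> \<in> ?S"
    then have ar: "a \<circ> \<rho> \<in> tuples m N" using a by (intro comp_permutes_PiE) simp_all
    have "(\<Sum>\<sigma>\<in>?S. ?G (inv \<rho> \<circ> \<sigma>) * M z (a \<circ> \<sigma>)) = (\<Sum>\<tau>\<in>?S. M z ((a \<circ> \<rho>) \<circ> \<tau>) * ?G \<tau>)"
      using shift[OF r, of "\<lambda>x y. ?G x * M z (a \<circ> y)"] by (simp only: o_assoc mult.commute)
    also have "\<dots> = (\<Sum>\<tau>\<in>?S. (if z = (a \<circ> \<rho>) \<circ> \<tau> then 1 else 0) * ?t \<tau>)"
      by (rule commutant_trace_identity[OF D z ar])
    finally show "(\<Sum>\<sigma>\<in>?S. ?W \<rho> * (?G (inv \<rho> \<circ> \<sigma>) * M z (a \<circ> \<sigma>)))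
      = ?W \<rho> * (\<Sum>\<tau>\<in>?S. (if z = (a \<circ> \<rho>) \<circ> \<tau> then 1 else 0) * ?t \<tau>)"
      by (simp only: sum_distrib_left[symmetric])
  qed
  also have "\<dots> = (\<Sum>\<rho>\<in>?S. \<Sum>\<sigma>\<in>?S. ?W \<rho> * ((if z = a \<circ> \<sigma> then 1 else 0) * ?t (inv \<rho> \<circ> \<sigma>)))"
  proof (rule sum.cong[OF refl])
    fix \<rho> assume r: "\<rho> \<in> ?S"
    show "?W \<rho> * (\<Sum>\<tau>\<in>?S. (if z = (a \<circ> \<rho>) \<circ> \<tau> then 1 else 0) * ?t \<tau>)
      = (\<Sum>\<sigma>\<in>?S. ?W \<rho> * ((if z = a \<circ> \<sigma> then 1 else 0) * ?t (inv \<rho> \<circ> \<sigma>)))"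
      using shift[OF r, of "\<lambda>x y. (if z = a \<circ> y then 1 else 0) * ?t x"]
      by (simp only: sum_distrib_left[symmetric] o_assoc)
  qed
  also have "\<dots> = (\<Sum>\<sigma>\<in>?S. \<Sum>\<rho>\<in>?S. ?W \<rho> * ((if z = a \<circ> \<sigma> then 1 else 0) * ?t (inv \<rho> \<circ> \<sigma>)))" by (rule sum.swap)
  also have "\<dots> = (\<Sum>\<sigma>\<in>?S. (if z = a \<circ> \<sigma> then 1 else 0) * convolution m ?W ?t \<sigma>)"
    unfolding convolution_def sum_distrib_left by (intro sum.cong refl) (rule mult.left_commute)
  also have "\<dots> = (\<Sum>\<sigma>\<in>?S. (if z = a \<circ> \<sigma> then 1 else 0) * convolution m ?t ?W \<sigma>)"
    by (intro sum.cong refl) (simp add: convolution_class_function_commute[OF class_function_Wg_U])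
  finally show ?thesis .
qed

section \<open>Pairs of perfect matchings and the symplectic loop sum\<close>

text \<open>A new point either forms a cycle of its own or lengthens one, and count and sign follow.
  The exponent is the number of cycles, recoverable from the count at any N \<ge> 2.\<close>

lemma fix_count_sign:
  assumes "finite B" "p permutes B"
  shows "\<exists>l. (\<forall>N. fix_count N B p = N ^ l) \<and> sign p = (-1) ^ (card B + l)"
  using assms
proof (induction B arbitrary: p rule: finite_induct)
  case empty
  then have "p = id" by simp
  then show ?case by (intro exI[of _ 0]) (simp add: fix_count_def PiE_empty_domain)
next
  case (insert e B)
  let ?t = "inv p e" and ?B = "insert e B"
  let ?T = "Transposition.transpose (inv p e) e"
  have t: "?t \<in> ?B" using permutes_in_image[OF permutes_inv[OF insert.prems], of e] by simp
  define q where "q = p \<circ> ?T"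
  have T: "?T permutes ?B" using t by (simp add: permutes_swap_id)
  have qB: "q permutes ?B" unfolding q_def using T insert.prems by (rule permutes_compose)
  have "q e = e" using permutes_inverses(1)[OF insert.prems] by (simp add: q_def)
  then have q: "q permutes B" by (intro permutes_superset[OF qB]) auto
  have p: "p = q \<circ> ?T" by (simp add: q_def fun_eq_iff)
  from insert.IH[OF q] obtain l where l: "\<And>N. fix_count N B q = N ^ l" "sign q = (-1) ^ (card B + l)" by blast
  have perm: "permutation q" using q insert.hyps(1) unfolding permutation_permutes by blast
  have sp: "sign p = sign q * (if ?t = e then 1 else - 1)"
    by (subst p) (simp add: sign_compose[OF perm permutation_swap_id] sign_swap_id)
  show ?case
  proof (cases "?t = e")
    case True
    then have "p = q" using p by simp
    then have "fix_count N ?B p = N ^ Suc l" for N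
      using fix_count_insert_fixed[OF insert.hyps q] l(1) by simp
    moreover have "sign p = (-1) ^ (card ?B + Suc l)" using sp True l(2) insert.hyps by simp
    ultimately show ?thesis by blast
  next
    case False
    then have tB: "?t \<in> B" using t by simp
    have "fix_count N ?B p = N ^ l" for N
      using fix_count_insert_transpose[OF insert.hyps tB q, of N] l(1) p by simp
    moreover have "sign p = (-1) ^ (card ?B + l)" using sp False l(2) insert.hyps by simp
    ultimately show ?thesis by blast
  qed
qed

section \<open>The union of two perfect matchings\<close>

locale matching_pair =
  fixes V :: "nat set" and m0 m1 :: "nat \<Rightarrow> nat"
  assumes finV: "finite V"
    and perm0: "m0 permutes V" and perm1: "m1 permutes V"
    and invol0: "m0 (m0 v) = v" and invol1: "m1 (m1 v) = v"
    and nofix0: "v \<in> V \<Longrightarrow> m0 v \<noteq> v" and nofix1: "v \<in> V \<Longrightarrow> m1 v \<noteq> v"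
begin

definition edges :: "(nat \<times> nat) set" where
  "edges = {(u, v). u \<in> V \<and> (v = m0 u \<or> v = m1 u)}"

definition components :: "nat set set" where
  "components = V // edges\<^sup>*"

definition two_colouring :: "nat set \<Rightarrow> bool" where
  "two_colouring P \<longleftrightarrow> P \<subseteq> V \<and> (\<forall>v\<in>V. (m0 v \<in> P \<longleftrightarrow> v \<notin> P) \<and> (m1 v \<in> P \<longleftrightarrow> v \<notin> P))"

lemma in0: "v \<in> V \<Longrightarrow> m0 v \<in> V" and in1: "v \<in> V \<Longrightarrow> m1 v \<in> V"
  using perm0 perm1 by (simp_all add: permutes_in_image)

lemma edges_V: "(u, v) \<in> edges\<^sup>* \<Longrightarrow> u \<in> V \<Longrightarrow> v \<in> V"
  by (induction rule: rtrancl_induct) (auto simp: edges_def in0 in1)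

lemma sym_edges: "sym edges"
  by (auto simp: sym_def edges_def in0 in1 invol0 invol1)

lemma edges_class: "u \<in> V \<Longrightarrow> (u, v) \<in> edges\<^sup>* \<Longrightarrow> edges\<^sup>* `` {u} = edges\<^sup>* `` {v}"
  using sym_rtrancl[OF sym_edges] by (auto dest: symD intro: rtrancl_trans)

lemma finite_components: "finite components"
  unfolding components_def quotient_def using finV by auto

text \<open>Invariance under both involutions means constancy on components, so these functions are
  the functions on the set of components.\<close>

lemma card_invariant:
  "card {f \<in> V \<rightarrow>\<^sub>E {1..N}. \<forall>v\<in>V. f (m0 v) = f v \<and> f (m1 v) = f v} = N ^ card components"
proof -
  let ?F = "{f \<in> V \<rightarrow>\<^sub>E {1..N}. \<forall>v\<in>V. f (m0 v) = f v \<and> f (m1 v) = f v}"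
  let ?cl = "\<lambda>v. edges\<^sup>* `` {v}"
  have const: "f v = f u" if "f \<in> ?F" "(u, v) \<in> edges\<^sup>*" "u \<in> V" for f u v
    using that(2,1,3)
  proof (induction rule: rtrancl_induct)
    case (step y z)
    then have "y \<in> V" using edges_V by blast
    then have "f z = f y" using step.hyps(2) step.prems(1) by (auto simp: edges_def)
    then show ?case using step by simp
  qed simp
  have rep: "(SOME v. v \<in> V \<and> v \<in> C) \<in> V \<and> (SOME v. v \<in> V \<and> v \<in> C) \<in> C" if C: "C \<in> components" for C
  proof -
    obtain v where "v \<in> V" "C = ?cl v" using C unfolding components_def quotient_def by blast
    then have "v \<in> V \<and> v \<in> C" by simp
    then show ?thesis by (rule someI)
  qed
  have cl: "?cl v \<in> components" if "v \<in> V" for v using that unfolding components_def by (rule quotientI)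
  have "bij_betw (\<lambda>g. restrict (\<lambda>v. g (?cl v)) V) (components \<rightarrow>\<^sub>E {1..N}) ?F"
  proof (rule bij_betwI[where g = "\<lambda>f. restrict (\<lambda>C. f (SOME v. v \<in> V \<and> v \<in> C)) components"])
    show "(\<lambda>g. restrict (\<lambda>v. g (?cl v)) V) \<in> (components \<rightarrow>\<^sub>E {1..N}) \<rightarrow> ?F"
    proof
      fix g assume g: "g \<in> components \<rightarrow>\<^sub>E {1..N}"
      have "?cl (m0 v) = ?cl v" "?cl (m1 v) = ?cl v" if "v \<in> V" for v
        using edges_class[OF that, of "m0 v"] edges_class[OF that, of "m1 v"] that
        by (auto simp: edges_def)
      then show "restrict (\<lambda>v. g (?cl v)) V \<in> ?F" using g cl in0 in1 by auto
    qed
    show "(\<lambda>f. restrict (\<lambda>C. f (SOME v. v \<in> V \<and> v \<in> C)) components) \<in> ?F \<rightarrow> (components \<rightarrow>\<^sub>E {1..N})"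
      using rep by fastforce
    show "restrict (\<lambda>C. restrict (\<lambda>v. g (?cl v)) V (SOME v. v \<in> V \<and> v \<in> C)) components = g"
      if g: "g \<in> components \<rightarrow>\<^sub>E {1..N}" for g
    proof
      fix C show "restrict (\<lambda>C. restrict (\<lambda>v. g (?cl v)) V (SOME v. v \<in> V \<and> v \<in> C)) components C = g C"
      proof (cases "C \<in> components")
        case True
        let ?v = "SOME v. v \<in> V \<and> v \<in> C"
        obtain u where u: "u \<in> V" "C = ?cl u" using True unfolding components_def quotient_def by blast
        have "(u, ?v) \<in> edges\<^sup>*" using rep[OF True] u(2) by blast
        then have "?cl ?v = C" by (rule trans[OF edges_class[OF u(1), symmetric] u(2)[symmetric]])
        then show ?thesis using True rep[OF True] by simp
      qed (use g in \<open>auto simp: PiE_iff extensional_def\<close>)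
    qed
    show "restrict (\<lambda>v. restrict (\<lambda>C. f (SOME v. v \<in> V \<and> v \<in> C)) components (?cl v)) V = f" if f: "f \<in> ?F" for f
    proof
      fix v show "restrict (\<lambda>v. restrict (\<lambda>C. f (SOME v. v \<in> V \<and> v \<in> C)) components (?cl v)) V v = f v"
      proof (cases "v \<in> V")
        case True
        have "(v, SOME u. u \<in> V \<and> u \<in> ?cl v) \<in> edges\<^sup>*" using rep[OF cl[OF True]] by blast
        from const[OF f this True] show ?thesis using True cl[OF True] by simp
      qed (use f in \<open>auto simp: PiE_iff extensional_def\<close>)
    qed
  qed
  from bij_betw_same_card[OF this, symmetric] show ?thesis
    using finite_components by (simp add: card_PiE)
qed

definition rot :: "nat \<Rightarrow> nat" where
  "rot v = m1 (m0 v)"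

lemma rot_permutes: "rot permutes V"
proof -
  have "rot = m1 \<circ> m0" by (simp add: rot_def fun_eq_iff)
  then show ?thesis using permutes_compose[OF perm0 perm1] by simp
qed

text \<open>In the dihedral group generated by the two involutions, a rotation composed with \<open>m0\<close> is a
  conjugate of \<open>m0\<close> or of \<open>m1\<close>, hence has no fixed point.\<close>

lemma rot_funpow_neq: "v \<in> V \<Longrightarrow> (rot ^^ j) v \<noteq> m0 v"
proof (induction j arbitrary: v rule: induct_nat_012)
  case 0
  then show ?case using nofix0[of v] by (metis funpow_0)
next
  case 1
  then show ?case using nofix1[of "m0 v"] in0 by (simp add: rot_def)
next
  case (ge2 j)
  show ?case
  proof
    assume "(rot ^^ Suc (Suc j)) v = m0 v"
    then have "rot ((rot ^^ j) (rot v)) = m0 v" by (simp add: funpow_swap1)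
    then have "(rot ^^ j) (rot v) = m0 (m1 (m0 v))" unfolding rot_def by (metis invol0 invol1)
    then have "(rot ^^ j) (rot v) = m0 (rot v)" by (simp add: rot_def)
    moreover have "rot v \<in> V" using ge2.prems by (simp add: rot_def in0 in1)
    ultimately show False using ge2.IH(1)[of "rot v"] by blast
  qed
qed

text \<open>A common period makes orbits under nonnegative powers symmetric.\<close>

lemma rot_order: "\<exists>d>0. \<forall>v. (rot ^^ d) v = v"
proof -
  have fp: "rot ^^ j permutes V" for j
  proof (induction j)
    case (Suc j)
    show ?case unfolding funpow.simps(2) by (rule permutes_compose[OF Suc.IH rot_permutes])
  next
    case 0
    show ?case unfolding funpow.simps(1) by (rule permutes_id)
  qed
  have "range (\<lambda>j. rot ^^ j) \<subseteq> {p. p permutes V}" using fp by auto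
  then have "finite (range (\<lambda>j::nat. rot ^^ j))" using finite_permutations[OF finV] finite_subset by blast
  then have "\<not> inj (\<lambda>j::nat. rot ^^ j)" using finite_imageD infinite_UNIV_nat by blast
  then obtain i j where ij: "rot ^^ i = rot ^^ j" "i < j"
    unfolding inj_def by (metis linorder_neqE_nat)
  have "(rot ^^ (j - i)) v = v" for v
  proof -
    have "(rot ^^ i) ((rot ^^ (j - i)) v) = (rot ^^ (i + (j - i))) v" by (simp only: funpow_add comp_apply)
    also have "\<dots> = (rot ^^ i) v" using ij by simp
    finally show ?thesis using permutes_inj[OF fp[of i]] by (simp only: inj_eq)
  qed
  then show ?thesis using ij(2) by (intro exI[of _ "j - i"]) simp
qed

text \<open>In each component, the rotation orbit of a representative and its image under
  \<open>m0\<close> cover the component and are disjoint by \<open>rot_funpow_neq\<close>. The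
  orbits of the representatives form one colour class.\<close>

lemma two_colouring_exists: "\<exists>P. two_colouring P"
proof -
  obtain d where d: "d > 0" "\<And>v. (rot ^^ d) v = v" using rot_order by blast
  define orb where "orb w = {u. \<exists>j. u = (rot ^^ j) w}" for w
  have dj: "(rot ^^ (d * j)) v = v" for j v
    by (induction j) (simp_all add: funpow_add d(2))
  have orb_sym: "w \<in> orb u" if u: "u \<in> orb w" for u w
  proof -
    obtain j where j: "u = (rot ^^ j) w" using u by (auto simp: orb_def)
    have "j \<le> d * j" using d(1) by simp
    then have "(rot ^^ (d * j - j)) u = (rot ^^ (d * j)) w"
      unfolding j by (simp flip: funpow_add comp_apply[of "rot ^^ _" "rot ^^ _"])
    then have "w = (rot ^^ (d * j - j)) u" by (simp add: dj)
    then show ?thesis by (auto simp: orb_def)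
  qed
  have orb_trans: "v \<in> orb w" if uv: "u \<in> orb w" "v \<in> orb u" for u v w
  proof -
    obtain i j where "u = (rot ^^ j) w" "v = (rot ^^ i) u" using uv unfolding orb_def by blast
    then have "v = (rot ^^ (i + j)) w" by (simp add: funpow_add)
    then show ?thesis by (auto simp: orb_def)
  qed
  have rot_orb: "rot v \<in> orb w \<longleftrightarrow> v \<in> orb w" for v w
  proof -
    have "rot v \<in> orb v" unfolding orb_def by (auto intro: exI[of _ 1])
    then show ?thesis using orb_trans[of v w "rot v"] orb_trans[of "rot v" w v] orb_sym by blast
  qed
  let ?cl = "\<lambda>v. edges\<^sup>* `` {v}"
  define rep where "rep C = (SOME v. v \<in> C)" for C :: "nat set"
  define P where "P = {v\<in>V. v \<in> orb (rep (?cl v))}"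
  have repcl: "(v, rep (?cl v)) \<in> edges\<^sup>*" for v
    using someI[of "\<lambda>u. u \<in> ?cl v" v] unfolding rep_def by simp
  have cover: "u \<in> orb w \<or> m0 u \<in> orb w" if "(w, u) \<in> edges\<^sup>*" "w \<in> V" for w u
    using that
  proof (induction rule: rtrancl_induct)
    case base
    then show ?case by (auto simp: orb_def intro: exI[of _ 0])
  next
    case (step y z)
    have rm: "rot (m0 (m1 y)) = y" "rot (m0 y) = m1 y" "m0 (m0 y) = y" by (simp_all add: rot_def invol0 invol1)
    from step have IH: "y \<in> orb w \<or> m0 y \<in> orb w" by blast
    from step.hyps(2) have "z = m0 y \<or> z = m1 y" by (auto simp: edges_def)
    then show ?case
    proof
      assume "z = m0 y"
      then show ?thesis using IH rm(3) by auto
    next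
      assume z: "z = m1 y"
      have "m0 (m1 y) \<in> orb w \<longleftrightarrow> y \<in> orb w" using rot_orb[of "m0 (m1 y)" w] rm(1) by simp
      moreover have "m1 y \<in> orb w \<longleftrightarrow> m0 y \<in> orb w" using rot_orb[of "m0 y" w] rm(2) by simp
      ultimately show ?thesis using IH z by auto
    qed
  qed
  have disj: "\<not> (u \<in> orb w \<and> m0 u \<in> orb w)" if "u \<in> V" for u w
  proof
    assume "u \<in> orb w \<and> m0 u \<in> orb w"
    then have "m0 u \<in> orb u" using orb_sym orb_trans by blast
    then obtain j where "m0 u = (rot ^^ j) u" unfolding orb_def by blast
    then show False using rot_funpow_neq[OF \<open>u \<in> V\<close>, of j] by simp
  qed
  have P0: "m0 v \<in> P \<longleftrightarrow> v \<notin> P" if v: "v \<in> V" for v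
  proof -
    let ?w = "rep (?cl v)"
    have e: "?cl (m0 v) = ?cl v" using edges_class[OF v, of "m0 v"] v by (auto simp: edges_def)
    have w: "?w \<in> V" using edges_V[OF repcl v] .
    have "(?w, v) \<in> edges\<^sup>*" using repcl sym_rtrancl[OF sym_edges] by (auto dest: symD)
    from cover[OF this w] disj[OF v, of ?w] show ?thesis using v e in0 unfolding P_def by auto
  qed
  have P1: "m1 v \<in> P \<longleftrightarrow> v \<notin> P" if v: "v \<in> V" for v
  proof -
    let ?w = "rep (?cl v)"
    have e: "?cl (m1 v) = ?cl v" using edges_class[OF v, of "m1 v"] v by (auto simp: edges_def)
    have e0: "?cl (m0 v) = ?cl v" using edges_class[OF v, of "m0 v"] v by (auto simp: edges_def)
    have "rot (m0 v) = m1 v" by (simp add: rot_def invol0)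
    then have "m1 v \<in> orb ?w \<longleftrightarrow> m0 v \<in> orb ?w" using rot_orb[of "m0 v" ?w] by simp
    then have "m1 v \<in> P \<longleftrightarrow> m0 v \<in> P" using v e e0 in0 in1 unfolding P_def by auto
    then show ?thesis using P0[OF v] by simp
  qed
  have "two_colouring P" unfolding two_colouring_def using P0 P1 by (auto simp: P_def)
  then show ?thesis ..
qed

text \<open>Restricting to one colour class leaves one cycle per component; on the other class the
  rotation runs through the mirrored cycles backwards.\<close>

definition rot_on :: "nat set \<Rightarrow> nat \<Rightarrow> nat" where
  "rot_on P v = (if v \<in> P then m1 (m0 v) else v)"

context
  fixes P assumes P: "two_colouring P"
begin

lemma PV: "P \<subseteq> V" and P0: "v \<in> V \<Longrightarrow> m0 v \<in> P \<longleftrightarrow> v \<notin> P" and P1: "v \<in> V \<Longrightarrow> m1 v \<in> P \<longleftrightarrow> v \<notin> P"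
  using P by (auto simp: two_colouring_def)

lemma finP: "finite P"
  using PV finV finite_subset by blast

lemma rot_on_permutes: "rot_on P permutes P"
proof (rule bij_imp_permutes)
  have im: "rot_on P v \<in> P" if "v \<in> P" for v using that PV P0[of v] P1[of "m0 v"] in0 by (auto simp: rot_on_def)
  have "inj_on (rot_on P) P" by (rule inj_onI) (metis invol0 invol1 rot_on_def)
  then show "bij_betw (rot_on P) P P" using im finP by (simp add: bij_betw_def endo_inj_surj image_subsetI)
qed (simp add: rot_on_def)

lemma fix_count_rot_on: "fix_count N P (rot_on P) = N ^ card components"
proof -
  let ?F = "{f \<in> V \<rightarrow>\<^sub>E {1..N}. \<forall>v\<in>V. f (m0 v) = f v \<and> f (m1 v) = f v}"
  let ?G = "{b \<in> P \<rightarrow>\<^sub>E {1..N}. \<forall>s\<in>P. b (rot_on P s) = b s}"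
  have "bij_betw (\<lambda>f. restrict f P) ?F ?G"
  proof (rule bij_betwI[where g = "\<lambda>b. restrict (\<lambda>v. if v \<in> P then b v else b (m0 v)) V"])
    show "(\<lambda>f. restrict f P) \<in> ?F \<rightarrow> ?G"
    proof
      fix f assume f: "f \<in> ?F"
      have "f (m1 (m0 s)) = f s" "m1 (m0 s) \<in> P" if "s \<in> P" for s
      proof -
        have "s \<in> V" using that PV by blast
        then show "f (m1 (m0 s)) = f s" "m1 (m0 s) \<in> P" using f in0 that P0[of s] P1[of "m0 s"] by auto
      qed
      then show "restrict f P \<in> ?G" using f PV by (auto simp: rot_on_def)
    qed
    show "(\<lambda>b. restrict (\<lambda>v. if v \<in> P then b v else b (m0 v)) V) \<in> ?G \<rightarrow> ?F"
    proof
      fix b assume b: "b \<in> ?G"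
      have inv: "b (m1 (m0 s)) = b s" if "s \<in> P" for s using b that by (auto simp: rot_on_def)
      let ?f = "restrict (\<lambda>v. if v \<in> P then b v else b (m0 v)) V"
      have "?f (m0 v) = ?f v \<and> ?f (m1 v) = ?f v" if v: "v \<in> V" for v
      proof (cases "v \<in> P")
        case True
        have "m0 (m1 v) \<in> P" using True v P1[of v] P0[of "m1 v"] in1 by auto
        from inv[OF this] have "b (m0 (m1 v)) = b v" by (simp add: invol0 invol1)
        then show ?thesis using True v P0[of v] P1[of v] in0 in1 by (simp add: invol0)
      next
        case False
        have "m0 v \<in> P" using False v P0 by simp
        from inv[OF this] have "b (m1 v) = b (m0 v)" by (simp add: invol0)
        then show ?thesis using False v P0[of v] P1[of v] in0 in1 by simp
      qed
      moreover have "b u \<in> {1..N}" if "u \<in> P" for u using b that by blast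
      then have "?f \<in> V \<rightarrow>\<^sub>E {1..N}" using P0 by simp
      ultimately show "?f \<in> ?F" by blast
    qed
    show "restrict (\<lambda>v. if v \<in> P then restrict f P v else restrict f P (m0 v)) V = f" if f: "f \<in> ?F" for f
    proof
      fix v show "restrict (\<lambda>v. if v \<in> P then restrict f P v else restrict f P (m0 v)) V v = f v"
        using f P0[of v] by (cases "v \<in> V") (auto simp: PiE_iff extensional_def)
    qed
    show "restrict (restrict (\<lambda>v. if v \<in> P then b v else b (m0 v)) V) P = b" if b: "b \<in> ?G" for b
    proof
      fix v show "restrict (restrict (\<lambda>v. if v \<in> P then b v else b (m0 v)) V) P v = b v"
        using b PV by (cases "v \<in> P") (auto simp: PiE_iff extensional_def)
    qed
  qed
  from bij_betw_same_card[OF this] show ?thesis by (simp only: card_invariant fix_count_def)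
qed

text \<open>Comparing the two counts at N = 2 identifies the number of cycles with the number of
  components.\<close>

lemma sign_rot_on: "sign (rot_on P) = (-1) ^ (card P + card components)"
proof -
  obtain l where l: "\<And>N. fix_count N P (rot_on P) = N ^ l" "sign (rot_on P) = (-1) ^ (card P + l)"
    using fix_count_sign[OF finP rot_on_permutes] by blast
  have "(2::nat) ^ l = 2 ^ card components" using l(1)[of 2] fix_count_rot_on[of 2] by simp
  then have "l = card components" by simp
  then show ?thesis using l(2) by simp
qed

lemma card_P: "card V = 2 * card P"
proof -
  have inj: "inj_on m0 P" using permutes_inj[OF perm0] inj_on_subset by blast
  have "V = P \<union> m0 ` P"
  proof (intro equalityI subsetI)
    fix v assume v: "v \<in> V"
    show "v \<in> P \<union> m0 ` P"
      using P0[OF v] invol0[of v] by (cases "v \<in> P") (auto intro: image_eqI[of v m0 "m0 v"])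
  qed (use PV in0 in auto)
  moreover have "P \<inter> m0 ` P = {}" using P0 PV by auto
  ultimately show ?thesis using card_Un_disjoint[of P "m0 ` P"] finP card_image[OF inj] by simp
qed

text \<open>Split \<psi> into \<open>pp\<close> on P and \<open>pm\<close> off P. By the
  intertwining relation, the conjugate of \<open>pp\<close> by \<open>m0\<close> is
  \<open>pm\<close> followed by a conjugate of the rotation. So the sign of \<open>pp\<close> is
  that of \<open>pm\<close> times that of the rotation, and \<open>pm\<close> cancels in the
  product.\<close>

lemma sign_intertwiner:
  assumes \<psi>: "\<psi> permutes V" and tw: "\<And>v. v \<in> V \<Longrightarrow> \<psi> (m0 v) = m1 (\<psi> v)"
    and pres: "\<And>v. v \<in> P \<Longrightarrow> \<psi> v \<in> P"
  shows "sign \<psi> = sign (rot_on P)"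
proof -
  define pp where "pp v = (if v \<in> P then \<psi> v else v)" for v
  define pm where "pm v = (if v \<in> V - P then \<psi> v else v)" for v
  define rm where "rm v = (if v \<in> V - P then m0 (m1 v) else v)" for v
  have \<psi>V: "\<psi> v \<in> V" if "v \<in> V" for v using \<psi> that by (simp add: permutes_in_image)
  have presm: "\<psi> v \<in> V - P" if "v \<in> V - P" for v
  proof -
    have "m0 v \<in> P" using P0 that by simp
    then have "\<psi> (m0 v) \<in> P" by (rule pres)
    then have "m1 (\<psi> v) \<in> P" using tw that by simp
    then show ?thesis using P1[of "\<psi> v"] \<psi>V that by simp
  qed
  have inj: "inj \<psi>" by (rule permutes_inj[OF \<psi>])
  have ppP: "pp permutes V"
  proof (rule permutes_subset[OF _ PV], rule bij_imp_permutes)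
    have "inj_on pp P" using inj by (auto simp: inj_on_def pp_def)
    moreover have "pp ` P \<subseteq> P" using pres by (auto simp: pp_def)
    ultimately show "bij_betw pp P P" using finP by (simp add: bij_betw_def endo_inj_surj)
  qed (simp add: pp_def)
  have pmP: "pm permutes V"
  proof (rule permutes_subset[of _ "V - P"], rule bij_imp_permutes)
    have "inj_on pm (V - P)" using inj by (auto simp: inj_on_def pm_def)
    moreover have "pm ` (V - P) \<subseteq> V - P" using presm unfolding pm_def by auto
    ultimately show "bij_betw pm (V - P) (V - P)" using finV by (simp add: bij_betw_def endo_inj_surj)
  qed (auto simp: pm_def)
  have rP: "rot_on P permutes V" by (rule permutes_subset[OF rot_on_permutes PV])
  have perm: "permutation q" if "q permutes V" for q using that finV unfolding permutation_permutes by blast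
  have rm: "rm = m0 \<circ> rot_on P \<circ> m0"
  proof
    fix v show "rm v = (m0 \<circ> rot_on P \<circ> m0) v"
    proof (cases "v \<in> V")
      case True
      then show ?thesis using P0[OF True] by (auto simp: rm_def rot_on_def invol0)
    next
      case False
      then have "m0 v = v" using perm0 by (simp add: permutes_not_in)
      then show ?thesis using False PV by (auto simp: rm_def rot_on_def)
    qed
  qed
  have conj: "m0 \<circ> pp \<circ> m0 = rm \<circ> pm"
  proof
    fix v show "(m0 \<circ> pp \<circ> m0) v = (rm \<circ> pm) v"
    proof (cases "v \<in> V")
      case True
      show ?thesis
      proof (cases "v \<in> P")
        case vP: True
        then show ?thesis using P0[OF True] by (simp add: pp_def pm_def rm_def invol0)
      next
        case False
        then have vm: "v \<in> V - P" using True by simp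
        have "(m0 \<circ> pp \<circ> m0) v = m0 (\<psi> (m0 v))" using False P0[OF True] by (simp add: pp_def)
        also have "\<dots> = m0 (m1 (\<psi> v))" using tw[OF True] by simp
        also have "\<dots> = (rm \<circ> pm) v" using vm presm[OF vm] by (simp add: pm_def rm_def)
        finally show ?thesis .
      qed
    next
      case False
      then have "m0 v = v" using perm0 by (simp add: permutes_not_in)
      then show ?thesis using False PV by (auto simp: pp_def pm_def rm_def)
    qed
  qed
  have sg: "sign (m0 \<circ> q \<circ> m0) = sign q" if "q permutes V" for q
    using perm[OF that] perm[OF perm0] by (simp add: sign_compose permutation_compose)
  have srm: "sign rm = sign (rot_on P)" unfolding rm by (rule sg[OF rP])
  have rmP: "rm permutes V" unfolding rm by (intro permutes_compose perm0 rP)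
  have "sign pp = sign (rm \<circ> pm)" using sg[OF ppP] conj by simp
  also have "\<dots> = sign (rot_on P) * sign pm" using perm[OF rmP] perm[OF pmP] srm by (simp add: sign_compose)
  finally have spp: "sign pp = sign (rot_on P) * sign pm" .
  have "\<psi> = pp \<circ> pm"
  proof
    fix v show "\<psi> v = (pp \<circ> pm) v"
    proof (cases "v \<in> V - P")
      case True
      then show ?thesis using presm[OF True] by (simp add: pp_def pm_def)
    next
      case False
      then show ?thesis using permutes_not_in[OF \<psi>] by (auto simp: pp_def pm_def)
    qed
  qed
  then have "sign \<psi> = sign pp * sign pm" using perm[OF ppP] perm[OF pmP] by (simp add: sign_compose)
  then show ?thesis unfolding spp by (simp add: mult.assoc)
qed

end

end

section \<open>The two matchings attached to a permutation\<close>

definition mate :: "nat \<Rightarrow> nat \<Rightarrow> nat" where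
  "mate k v = (if v \<in> {1..2*k} then if odd v then v + 1 else v - 1 else v)"

lemma mate_simps: "r \<in> {1..k} \<Longrightarrow> mate k (2*r-1) = 2*r" "r \<in> {1..k} \<Longrightarrow> mate k (2*r) = 2*r-1"
  by (auto simp: mate_def)

lemma mate_mate: "mate k (mate k v) = v"
  unfolding mate_def by (auto elim!: oddE evenE) presburger+

lemma mate_in: "v \<in> {1..2*k} \<Longrightarrow> mate k v \<in> {1..2*k}"
  unfolding mate_def by (auto elim!: oddE evenE) presburger+

lemma mate_neq: "v \<in> {1..2*k} \<Longrightarrow> mate k v \<noteq> v"
  unfolding mate_def by auto

lemma mate_permutes: "mate k permutes {1..2*k}"
proof (rule bij_imp_permutes)
  show "bij_betw (mate k) {1..2*k} {1..2*k}"
    by (rule bij_betwI[where g = "mate k"]) (use mate_in mate_mate in auto)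
qed (simp only: mate_def if_False)

lemma pair_cases:
  fixes v k :: nat
  assumes "v \<in> {1..2*k}"
  obtains r where "r \<in> {1..k}" "v = 2*r-1" | r where "r \<in> {1..k}" "v = 2*r"
proof (cases "odd v")
  case True
  then obtain q where "v = 2 * q + 1" by (elim oddE)
  then show ?thesis using assms that(1)[of "Suc q"] by auto
next
  case False
  then have "even v" by simp
  then obtain q where "v = 2 * q" by (elim evenE)
  then show ?thesis using assms that(2)[of q] by auto
qed

locale coset_pair =
  fixes k :: nat and \<tau> :: "nat \<Rightarrow> nat"
  assumes tau: "\<tau> permutes {1..2*k}"
begin

abbreviation "V \<equiv> {1..2*k}"
abbreviation "m0 \<equiv> mate k"

text \<open>The standard matching transported by \<tau>: it pairs \<tau>(2r-1) with \<tau>(2r), the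
  second family in \<open>coset_edges\<close>.\<close>

definition m1 :: "nat \<Rightarrow> nat" where
  "m1 = \<tau> \<circ> mate k \<circ> inv \<tau>"

lemma m1_tau: "m1 (\<tau> v) = \<tau> (m0 v)"
  by (simp add: m1_def permutes_inverses(2)[OF tau])

sublocale matching_pair V m0 m1
proof
  show "m1 permutes V" unfolding m1_def by (intro permutes_compose permutes_inv tau mate_permutes)
  show "m1 (m1 v) = v" for v
    by (simp add: m1_def permutes_inverses[OF tau] mate_mate)
  show "m1 v \<noteq> v" if "v \<in> V" for v
  proof
    assume "m1 v = v"
    then have "\<tau> (m0 (inv \<tau> v)) = v" by (simp add: m1_def)
    then have "m0 (inv \<tau> v) = inv \<tau> v" using permutes_inverses(2)[OF tau, of "m0 (inv \<tau> v)"] by simp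
    moreover have "inv \<tau> v \<in> V" using that permutes_in_image[OF permutes_inv[OF tau]] by blast
    ultimately show False using mate_neq by blast
  qed
qed (use mate_permutes mate_mate mate_neq in auto)

lemma tau_in: "v \<in> V \<Longrightarrow> \<tau> v \<in> V"
  using permutes_in_image[OF tau] by blast

lemma edges_coset: "edges = coset_edges k \<tau> \<union> (coset_edges k \<tau>)\<inverse>"
proof (intro equalityI subrelI)
  fix u v assume "(u, v) \<in> edges"
  then have u: "u \<in> V" and v: "v = m0 u \<or> v = m1 u" unfolding edges_def by blast+
  from v show "(u, v) \<in> coset_edges k \<tau> \<union> (coset_edges k \<tau>)\<inverse>"
  proof
    assume v: "v = m0 u"
    from u show ?thesis
      by (cases rule: pair_cases) (use v mate_simps in \<open>auto simp: coset_edges_def\<close>)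
  next
    assume v: "v = m1 u"
    have "inv \<tau> u \<in> V" using u permutes_in_image[OF permutes_inv[OF tau]] by blast
    moreover have ut: "u = \<tau> (inv \<tau> u)" by (simp add: permutes_inverses(1)[OF tau])
    moreover have "v = \<tau> (m0 (inv \<tau> u))" using v by (simp add: m1_def)
    ultimately obtain w where w: "w \<in> V" "u = \<tau> w" "v = \<tau> (m0 w)" by blast
    from w(1) show ?thesis
      by (cases rule: pair_cases) (use w(2,3) mate_simps in \<open>auto simp: coset_edges_def\<close>)
  qed
next
  have *: "(u, v) \<in> edges \<and> (v, u) \<in> edges" if "(u, v) \<in> coset_edges k \<tau>" for u v
  proof -
    from that obtain r where r: "r \<in> {1..k}"
      and uv: "u = 2*r-1 \<and> v = 2*r \<or> u = \<tau> (2*r-1) \<and> v = \<tau> (2*r)" by (auto simp: coset_edges_def)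
    have rV: "2*r-1 \<in> V" "2*r \<in> V" using r by auto
    from uv show ?thesis
    proof
      assume "u = 2*r-1 \<and> v = 2*r"
      then show ?thesis unfolding edges_def using rV mate_simps[OF r] by simp
    next
      assume uv: "u = \<tau> (2*r-1) \<and> v = \<tau> (2*r)"
      have "m1 u = v" "m1 v = u" using uv m1_tau mate_simps[OF r] by simp_all
      then show ?thesis unfolding edges_def using uv tau_in[OF rV(1)] tau_in[OF rV(2)] by auto
    qed
  qed
  fix u v assume "(u, v) \<in> coset_edges k \<tau> \<union> (coset_edges k \<tau>)\<inverse>"
  then show "(u, v) \<in> edges" using * by blast
qed

lemma coset_length_eq: "coset_length k \<tau> = card components"
  unfolding coset_length_def coset_type_def coset_components_def components_def edges_coset by simp

text \<open>\<open>(v + 1) div 2\<close> is the number r of the pair {2r-1, 2r} that contains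
  v.\<close>

definition flip :: "nat set \<Rightarrow> nat \<Rightarrow> nat" where
  "flip F v = (if v \<in> V \<and> (v + 1) div 2 \<in> F then m0 v else v)"

lemma half_mate:
  assumes "v \<in> V"
  shows "(m0 v + 1) div 2 = (v + 1) div 2"
proof (cases rule: pair_cases[OF assms])
  case (1 r)
  then show ?thesis unfolding 1(2) mate_simps(1)[OF 1(1)] by auto
next
  case (2 r)
  then show ?thesis unfolding 2(2) mate_simps(2)[OF 2(1)] by auto
qed

lemma flip_mate: "flip F (m0 v) = m0 (flip F v)"
proof (cases "v \<in> V")
  case True
  then show ?thesis using half_mate[OF True] mate_in[OF True] by (simp only: flip_def) auto
next
  case False
  then have "m0 v = v" by (rule permutes_not_in[OF mate_permutes])
  then show ?thesis using False by (simp only: flip_def) auto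
qed

lemma flip_flip: "flip F (flip F v) = v"
proof (cases "v \<in> V \<and> (v + 1) div 2 \<in> F")
  case True
  then have "flip F v = m0 v" by (simp only: flip_def) auto
  moreover have "flip F (m0 v) = v" using True half_mate[of v] mate_in[of v k] mate_mate by (simp only: flip_def) auto
  ultimately show ?thesis by simp
next
  case False
  then show ?thesis by (simp only: flip_def) auto
qed

lemma flip_in: "v \<in> V \<Longrightarrow> flip F v \<in> V"
  unfolding flip_def using mate_in by auto

lemma flip_permutes: "flip F permutes V"
proof (rule bij_imp_permutes)
  show "bij_betw (flip F) V V"
    by (rule bij_betwI[where g = "flip F"]) (use flip_in flip_flip in auto)
qed (simp only: flip_def if_False simp_thms)

lemma perm_V: "p permutes V \<Longrightarrow> permutation p"
  unfolding permutation_permutes by blast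

lemma sign_flip:
  assumes "finite F" "F \<subseteq> {1..k}"
  shows "sign (flip F) = (-1) ^ card F"
  using assms
proof (induction F rule: finite_induct)
  case empty
  have "flip {} = id" by (auto simp: flip_def)
  then show ?case by simp
next
  case (insert r F)
  let ?T = "Transposition.transpose (2*r-1) (2*r)"
  have r: "r \<in> {1..k}" using insert.prems by simp
  have "flip (insert r F) = ?T \<circ> flip F"
  proof
    fix v show "flip (insert r F) v = (?T \<circ> flip F) v"
    proof (cases "v \<in> V")
      case True
      then show ?thesis
      proof (cases rule: pair_cases)
        case (1 q)
        then have h: "(v + 1) div 2 = q" by auto
        show ?thesis
        proof (cases "q = r")
          case True
          then show ?thesis using 1 h insert.hyps r mate_simps[OF r] \<open>v \<in> V\<close> by (simp add: flip_def)
        next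
          case False
          then have "2*q \<noteq> 2*r" "2*q-1 \<noteq> 2*r-1" "2*q \<noteq> 2*r-1" "2*q-1 \<noteq> 2*r" using 1 r by auto
          then show ?thesis using 1 h False mate_simps[OF 1(1)] \<open>v \<in> V\<close> by (simp add: flip_def Transposition.transpose_def)
        qed
      next
        case (2 q)
        then have h: "(v + 1) div 2 = q" by auto
        show ?thesis
        proof (cases "q = r")
          case True
          then show ?thesis using 2 h insert.hyps r mate_simps[OF r] \<open>v \<in> V\<close> by (simp add: flip_def)
        next
          case False
          then have "2*q \<noteq> 2*r" "2*q-1 \<noteq> 2*r-1" "2*q \<noteq> 2*r-1" "2*q-1 \<noteq> 2*r" using 2 r by auto
          then show ?thesis using 2 h False mate_simps[OF 2(1)] \<open>v \<in> V\<close> by (simp add: flip_def Transposition.transpose_def)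
        qed
      qed
    next
      case False
      then have "v \<noteq> 2*r-1" "v \<noteq> 2*r" using r by auto
      moreover have "flip F v = v" "flip (insert r F) v = v"
        using False by (simp_all only: flip_def simp_thms if_False)
      ultimately show ?thesis by (simp add: Transposition.transpose_def)
    qed
  qed
  then have "sign (flip (insert r F)) = sign ?T * sign (flip F)"
    using perm_V[OF flip_permutes] by (simp add: sign_compose permutation_swap_id)
  moreover have "2*r-1 \<noteq> 2*r" using r by auto
  ultimately show ?case using insert by (simp add: sign_swap_id)
qed

text \<open>\<open>flip F0\<close> moves P onto the odd numbers, and \<open>flip F1\<close> moves
  each odd number to the member of its pair that \<tau> sends into P. So \<psi> preserves P and
  carries \<open>m0\<close> to \<open>m1\<close>. Its sign is that of the rotation, and it differs
  from the sign of \<tau> by -1 for every flipped pair.\<close>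

lemma colouring_sign:
  assumes P: "two_colouring P"
  shows "(\<Prod>r\<in>{1..k}. (if 2*r-1 \<in> P then 1 else -1) * (if \<tau> (2*r-1) \<in> P then 1 else -1))
    = sign \<tau> * (-1) ^ (k + card components)"
proof -
  define F0 where "F0 = {r\<in>{1..k}. 2*r-1 \<notin> P}"
  define F1 where "F1 = {r\<in>{1..k}. \<tau> (2*r-1) \<notin> P}"
  have F: "finite F0" "F0 \<subseteq> {1..k}" "finite F1" "F1 \<subseteq> {1..k}" by (auto simp: F0_def F1_def)
  define \<psi> where "\<psi> = \<tau> \<circ> flip F1 \<circ> flip F0"
  have \<psi>: "\<psi> permutes V" unfolding \<psi>_def by (intro permutes_compose flip_permutes tau)
  have "sign \<psi> = sign (rot_on P)"
  proof (rule sign_intertwiner[OF P \<psi>])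
    show "\<psi> (m0 v) = m1 (\<psi> v)" for v by (simp add: \<psi>_def flip_mate m1_tau)
    fix v assume vP: "v \<in> P"
    then have vV: "v \<in> V" using PV[OF P] by blast
    obtain r where r: "r \<in> {1..k}" "flip F0 v = 2*r-1"
    proof (cases rule: pair_cases[OF vV])
      case (1 r)
      then have "(v + 1) div 2 = r" "r \<notin> F0" using vP by (auto simp: F0_def)
      then have "flip F0 v = 2*r-1" using 1 by (simp add: flip_def)
      then show ?thesis using 1 that by blast
    next
      case (2 r)
      have "2*r-1 \<in> V" using 2 by auto
      then have "2*r-1 \<notin> P" using P0[OF P, of "2*r-1"] mate_simps[OF 2(1)] 2 vP by simp
      then have "(v + 1) div 2 = r" "r \<in> F0" using 2 by (auto simp: F0_def)
      then have "flip F0 v = 2*r-1" using 2 vV mate_simps[OF 2(1)] by (simp add: flip_def)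
      then show ?thesis using 2 that by blast
    qed
    have rV: "2*r-1 \<in> V" and h: "(2*r-1+1) div 2 = r" using r by auto
    show "\<psi> v \<in> P"
    proof (cases "\<tau> (2*r-1) \<in> P")
      case True
      then have "r \<notin> F1" by (simp add: F1_def)
      then have "flip F1 (2*r-1) = 2*r-1" unfolding flip_def h by simp
      then show ?thesis using True r by (simp add: \<psi>_def)
    next
      case False
      then have "r \<in> F1" using r by (simp add: F1_def)
      then have "flip F1 (2*r-1) = m0 (2*r-1)" unfolding flip_def h using rV by simp
      then have "\<psi> v = m1 (\<tau> (2*r-1))" using r by (simp add: \<psi>_def m1_tau)
      then show ?thesis using P1[OF P tau_in[OF rV]] False by simp
    qed
  qed
  moreover have "sign \<psi> = sign \<tau> * (-1) ^ card F1 * (-1) ^ card F0"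
    unfolding \<psi>_def using perm_V[OF flip_permutes] perm_V[OF tau]
    by (simp add: sign_compose permutation_compose sign_flip[OF F(1,2)] sign_flip[OF F(3,4)])
  moreover have "card P = k" using card_P[OF P] by simp
  ultimately have eq: "sign \<tau> * (-1) ^ card F1 * (-1) ^ card F0 = (-1) ^ (k + card components)"
    using sign_rot_on[OF P] by simp
  have pr: "(\<Prod>r\<in>{1..k}. if Q r then 1 else -1) = (-1 :: int) ^ card {r\<in>{1..k}. \<not> Q r}" for Q
  proof -
    have "{1..k} \<inter> - {r. Q r} = {r\<in>{1..k}. \<not> Q r}" by auto
    then show ?thesis by (simp add: prod.If_cases)
  qed
  have "(\<Prod>r\<in>{1..k}. (if 2*r-1 \<in> P then 1 else -1) * (if \<tau> (2*r-1) \<in> P then 1 else -1 :: int))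
     = (-1) ^ card F0 * (-1) ^ card F1"
    unfolding prod.distrib pr F0_def F1_def ..
  also have "\<dots> = sign \<tau> * (sign \<tau> * (-1) ^ card F1 * (-1) ^ card F0)"
    by (simp add: mult.assoc[symmetric])
  finally show ?thesis unfolding eq .
qed

end

section \<open>Evaluation of the symplectic loop sum\<close>

definition jpair :: "nat \<Rightarrow> nat \<Rightarrow> nat" where
  "jpair n i = (if i \<le> n then i + n else i - n)"

lemma jpair_in: "i \<in> {1..2*n} \<Longrightarrow> jpair n i \<in> {1..2*n}"
  and jpair_jpair: "i \<in> {1..2*n} \<Longrightarrow> jpair n (jpair n i) = i"
  and jpair_le: "i \<in> {1..2*n} \<Longrightarrow> jpair n i \<le> n \<longleftrightarrow> \<not> i \<le> n"
  by (auto simp: jpair_def)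

lemma Jmat_jpair:
  assumes "i \<in> {1..2*n}" "j \<in> {1..2*n}"
  shows "Jmat n i j = (if j = jpair n i then if i \<le> n then 1 else -1 else 0)"
  using assms unfolding Jmat_def jpair_def by auto

text \<open>A term is nonzero only if \<open>a\<close> takes partner indices of J along every edge
  of both matchings. The positions with index at most n then form a two-colouring, so
  \<open>colouring_sign\<close> gives all these terms the same value, and each component leaves 2n
  choices.\<close>

theorem symplectic_loop_sum:
  assumes tau: "\<tau> permutes {1..2*k}"
  shows "(\<Sum>a\<in>{1..2*k} \<rightarrow>\<^sub>E {1..2*n}. \<Prod>r\<in>{1..k}.
      Jmat n (a (2*r-1)) (a (2*r)) * Jmat n (a (\<tau> (2*r-1))) (a (\<tau> (2*r)))) = T_Sp k \<tau> (of_nat n)"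
proof -
  interpret coset_pair k \<tau> by unfold_locales (rule tau)
  let ?A = "V \<rightarrow>\<^sub>E {1..2*n}"
  let ?K = "card components"
  define supp where "supp = {a\<in>?A. \<forall>v\<in>V. a (m0 v) = jpair n (a v) \<and> a (m1 v) = jpair n (a v)}"
  have aV: "a v \<in> {1..2*n}" if "a \<in> ?A" "v \<in> V" for a v using that by blast
  have on: "(\<Prod>r\<in>{1..k}. Jmat n (a (2*r-1)) (a (2*r)) * Jmat n (a (\<tau> (2*r-1))) (a (\<tau> (2*r))))
      = of_int (sign \<tau> * (-1) ^ (k + ?K))" if a: "a \<in> supp" for a
  proof -
    have aA: "a \<in> ?A" and a0: "\<And>v. v \<in> V \<Longrightarrow> a (m0 v) = jpair n (a v)" and a1: "\<And>v. v \<in> V \<Longrightarrow> a (m1 v) = jpair n (a v)"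
      using a by (auto simp: supp_def)
    define P where "P = {v\<in>V. a v \<le> n}"
    have P: "two_colouring P"
      unfolding two_colouring_def
    proof (intro conjI ballI)
      fix v assume v: "v \<in> V"
      show "m0 v \<in> P \<longleftrightarrow> v \<notin> P" using v in0[OF v] a0[OF v] jpair_le[OF aV[OF aA v]] by (simp add: P_def)
      show "m1 v \<in> P \<longleftrightarrow> v \<notin> P" using v in1[OF v] a1[OF v] jpair_le[OF aV[OF aA v]] by (simp add: P_def)
    qed (auto simp: P_def)
    have "(\<Prod>r\<in>{1..k}. Jmat n (a (2*r-1)) (a (2*r)) * Jmat n (a (\<tau> (2*r-1))) (a (\<tau> (2*r))))
      = (\<Prod>r\<in>{1..k}. of_int ((if 2*r-1 \<in> P then 1 else -1) * (if \<tau> (2*r-1) \<in> P then 1 else -1)))"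
    proof (rule prod.cong[OF refl])
      fix r assume r: "r \<in> {1..k}"
      have rV: "2*r-1 \<in> V" "2*r \<in> V" using r by auto
      have e0: "a (2*r) = jpair n (a (2*r-1))" using a0[OF rV(1)] mate_simps[OF r] by simp
      have e1: "a (\<tau> (2*r)) = jpair n (a (\<tau> (2*r-1)))"
        using a1[OF tau_in[OF rV(1)]] m1_tau[of "2*r-1"] mate_simps[OF r] by simp
      have J0: "Jmat n (a (2*r-1)) (a (2*r)) = (if 2*r-1 \<in> P then 1 else -1)"
        by (subst Jmat_jpair[OF aV[OF aA rV(1)] aV[OF aA rV(2)]]) (use e0 rV(1) in \<open>simp add: P_def\<close>)
      have J1: "Jmat n (a (\<tau> (2*r-1))) (a (\<tau> (2*r))) = (if \<tau> (2*r-1) \<in> P then 1 else -1)"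
        by (subst Jmat_jpair[OF aV[OF aA tau_in[OF rV(1)]] aV[OF aA tau_in[OF rV(2)]]])
          (use e1 tau_in[OF rV(1)] in \<open>simp add: P_def\<close>)
      show "Jmat n (a (2*r-1)) (a (2*r)) * Jmat n (a (\<tau> (2*r-1))) (a (\<tau> (2*r)))
        = of_int ((if 2*r-1 \<in> P then 1 else -1) * (if \<tau> (2*r-1) \<in> P then 1 else -1))"
        unfolding J0 J1 by simp
    qed
    also have "\<dots> = of_int (sign \<tau> * (-1) ^ (k + ?K))"
      unfolding colouring_sign[OF P, symmetric] of_int_prod ..
    finally show ?thesis .
  qed
  have off: "(\<Prod>r\<in>{1..k}. Jmat n (a (2*r-1)) (a (2*r)) * Jmat n (a (\<tau> (2*r-1))) (a (\<tau> (2*r)))) = 0"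
    if a: "a \<in> ?A - supp" for a
  proof (rule ccontr)
    assume nz: "\<not> ?thesis"
    have aA: "a \<in> ?A" using a by blast
    have e: "a (2*r) = jpair n (a (2*r-1)) \<and> a (\<tau> (2*r)) = jpair n (a (\<tau> (2*r-1)))" if r: "r \<in> {1..k}" for r
    proof -
      have rV: "2*r-1 \<in> V" "2*r \<in> V" using r by auto
      have "Jmat n (a (2*r-1)) (a (2*r)) * Jmat n (a (\<tau> (2*r-1))) (a (\<tau> (2*r))) \<noteq> 0"
        using nz r prod_zero[of "{1..k}" "\<lambda>r. Jmat n (a (2*r-1)) (a (2*r)) * Jmat n (a (\<tau> (2*r-1))) (a (\<tau> (2*r)))"] by blast
      then have "Jmat n (a (2*r-1)) (a (2*r)) \<noteq> 0" "Jmat n (a (\<tau> (2*r-1))) (a (\<tau> (2*r))) \<noteq> 0" by auto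
      then show ?thesis
        unfolding Jmat_jpair[OF aV[OF aA rV(1)] aV[OF aA rV(2)]]
          Jmat_jpair[OF aV[OF aA tau_in[OF rV(1)]] aV[OF aA tau_in[OF rV(2)]]] by (simp split: if_splits)
    qed
    have pair: "a (m0 v) = jpair n (a v) \<and> a (\<tau> (m0 v)) = jpair n (a (\<tau> v))" if v: "v \<in> V" for v
    proof (cases rule: pair_cases[OF v])
      case (1 r)
      then show ?thesis using e[OF 1(1)] mate_simps[OF 1(1)] by simp
    next
      case (2 r)
      have rV: "2*r-1 \<in> V" using 2 by auto
      show ?thesis using e[OF 2(1)] mate_simps[OF 2(1)] 2(2) jpair_jpair[OF aV[OF aA rV]] jpair_jpair[OF aV[OF aA tau_in[OF rV]]] by simp
    qed
    have "a (m1 v) = jpair n (a v)" if v: "v \<in> V" for v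
    proof -
      have "inv \<tau> v \<in> V" using v permutes_in_image[OF permutes_inv[OF tau]] by blast
      from pair[OF this] show ?thesis by (simp add: m1_def permutes_inverses(1)[OF tau])
    qed
    then have "a \<in> supp" using pair aA by (simp add: supp_def)
    then show False using a by blast
  qed
  have "card supp = (2*n) ^ ?K"
  proof -
    obtain P where P: "two_colouring P" using two_colouring_exists by blast
    let ?F = "{f \<in> V \<rightarrow>\<^sub>E {1..2*n}. \<forall>v\<in>V. f (m0 v) = f v \<and> f (m1 v) = f v}"
    \<comment> \<open>Applying the partner map off P turns an \<open>a\<close> that alternates along
      edges into one that is constant along edges; the map is its own inverse.\<close>
    let ?h = "\<lambda>a. restrict (\<lambda>v. if v \<in> P then a v else jpair n (a v)) V"
    have tw: "?h a \<in> ?A" if "a \<in> ?A" for a using aV[OF that] jpair_in by auto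
    have hh: "?h (?h a) = a" if a: "a \<in> ?A" for a
    proof
      fix v show "?h (?h a) v = a v"
        using a jpair_jpair[OF aV[OF a, of v]] by (cases "v \<in> V") (auto simp: PiE_iff extensional_def)
    qed
    have "bij_betw ?h supp ?F"
    proof (rule bij_betwI[where g = ?h])
      show "?h \<in> supp \<rightarrow> ?F"
      proof
        fix a assume a: "a \<in> supp"
        then have aA: "a \<in> ?A" by (simp add: supp_def)
        have "?h a (m0 v) = ?h a v \<and> ?h a (m1 v) = ?h a v" if v: "v \<in> V" for v
          using a v in0[OF v] in1[OF v] P0[OF P v] P1[OF P v] jpair_jpair[OF aV[OF aA v]] by (auto simp: supp_def)
        then show "?h a \<in> ?F" using tw[OF aA] by blast
      qed
      show "?h \<in> ?F \<rightarrow> supp"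
      proof
        fix a assume a: "a \<in> ?F"
        then have aA: "a \<in> ?A" by blast
        have "?h a (m0 v) = jpair n (?h a v) \<and> ?h a (m1 v) = jpair n (?h a v)" if v: "v \<in> V" for v
          using a v in0[OF v] in1[OF v] P0[OF P v] P1[OF P v] jpair_jpair[OF aV[OF aA v]] by auto
        then show "?h a \<in> supp" using tw[OF aA] unfolding supp_def by blast
      qed
    qed (use hh in \<open>auto simp: supp_def\<close>)
    from bij_betw_same_card[OF this] show ?thesis by (simp only: card_invariant)
  qed
  moreover have "(\<Sum>a\<in>?A. \<Prod>r\<in>{1..k}. Jmat n (a (2*r-1)) (a (2*r)) * Jmat n (a (\<tau> (2*r-1))) (a (\<tau> (2*r))))
     = (\<Sum>a\<in>supp. of_int (sign \<tau> * (-1) ^ (k + ?K)))"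
  proof -
    have "finite ?A" by (simp add: finite_PiE)
    then have "(\<Sum>a\<in>?A. \<Prod>r\<in>{1..k}. Jmat n (a (2*r-1)) (a (2*r)) * Jmat n (a (\<tau> (2*r-1))) (a (\<tau> (2*r))))
      = (\<Sum>a\<in>supp. \<Prod>r\<in>{1..k}. Jmat n (a (2*r-1)) (a (2*r)) * Jmat n (a (\<tau> (2*r-1))) (a (\<tau> (2*r))))"
      by (rule sum.mono_neutral_right) (use off in \<open>auto simp: supp_def\<close>)
    also have "\<dots> = (\<Sum>a\<in>supp. of_int (sign \<tau> * (-1) ^ (k + ?K)))" by (rule sum.cong[OF refl]) (rule on)
    finally show ?thesis .
  qed
  moreover have "(of_nat ((2*n) ^ ?K) :: complex) * of_int (sign \<tau> * (-1) ^ (k + ?K)) = T_Sp k \<tau> (of_nat n)"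
  proof -
    have "(-2 * of_nat n :: complex) ^ ?K = (-1) ^ ?K * (2 * of_nat n) ^ ?K"
      by (metis mult_minus1 mult_minus_left power_mult_distrib)
    then show ?thesis unfolding T_Sp_def coset_length_eq by (simp add: power_add)
  qed
  ultimately show ?thesis by simp
qed

section \<open>From unitary matrices to derivations\<close>

lemma derivation_op_alt:
  "derivation_op m Y z x = (\<Sum>t\<in>{1..m}. Y (z t) (x t) * (\<Prod>s\<in>{1..m}-{t}. kron (z s) (x s)))"
  unfolding derivation_op_def tensor_def
proof (rule sum.cong[OF refl])
  fix t assume t: "t \<in> {1..m}"
  have "(\<Prod>s\<in>{1..m}. (if s = t then Y else kron) (z s) (x s))
    = Y (z t) (x t) * (\<Prod>s\<in>{1..m}-{t}. (if s = t then Y else kron) (z s) (x s))"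
    by (subst prod.remove[OF _ t]) auto
  also have "(\<Prod>s\<in>{1..m}-{t}. (if s = t then Y else kron) (z s) (x s)) = (\<Prod>s\<in>{1..m}-{t}. kron (z s) (x s))"
    by (rule prod.cong) auto
  finally show "(\<Prod>s\<in>{1..m}. (if s = t then Y else kron) (z s) (x s))
    = Y (z t) (x t) * (\<Prod>s\<in>{1..m}-{t}. kron (z s) (x s))" .
qed

lemma derivation_op_sum:
  "derivation_op m (\<lambda>i j. \<Sum>q\<in>Q. k q * Y q i j) z x = (\<Sum>q\<in>Q. k q * derivation_op m (Y q) z x)"
  unfolding derivation_op_alt sum_distrib_right sum_distrib_left
  by (subst sum.swap) (simp add: mult.assoc)

lemma commutes_derivation_sum:
  assumes "\<And>q. q \<in> Q \<Longrightarrow> commutes m N M (derivation_op m (Y q))"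
  shows "commutes m N M (derivation_op m (\<lambda>i j. \<Sum>q\<in>Q. k q * Y q i j))"
proof -
  have "derivation_op m (\<lambda>i j. \<Sum>q\<in>Q. k q * Y q i j) = (\<lambda>z x. \<Sum>q\<in>Q. k q * derivation_op m (Y q) z x)"
    by (intro ext derivation_op_sum)
  then show ?thesis using assms by (simp only: commutes_sum commutes_scale)
qed

lemma commutes_derivation_cong:
  assumes "\<And>i j. i \<in> {1..N} \<Longrightarrow> j \<in> {1..N} \<Longrightarrow> Y i j = Y' i j"
  shows "commutes m N M (derivation_op m Y) \<longleftrightarrow> commutes m N M (derivation_op m Y')"
proof (rule commutes_cong)
  fix z x assume "z \<in> tuples m N" "x \<in> tuples m N"
  then have "Y (z t) (x t) = Y' (z t) (x t)" if "t \<in> {1..m}" for t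
    using assms tuplesD that by blast
  then show "derivation_op m Y z x = derivation_op m Y' z x"
    unfolding derivation_op_alt by (intro sum.cong refl) simp
qed

text \<open>For a unit vector v the matrix Q = v v^* is a projection, so exp(i \<theta> Q) collapses
  to I + (u - 1) Q with u = exp(i \<theta>), and no matrix exponential is needed.\<close>

definition rank_one_unitary :: "nat \<Rightarrow> (nat \<Rightarrow> complex) \<Rightarrow> complex \<Rightarrow> cmat" where
  "rank_one_unitary N v u = (\<lambda>i j. if i \<in> {1..N} \<and> j \<in> {1..N} then kron i j + (u - 1) * (v i * cnj (v j)) else 0)"

lemma rank_one_unitary_in:
  assumes v: "(\<Sum>i\<in>{1..N}. v i * cnj (v i)) = 1" and u: "cnj u * u = 1"
  shows "rank_one_unitary N v u \<in> unitary_group N"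
  unfolding unitary_group_def
proof (intro CollectI conjI allI impI ext)
  show "rank_one_unitary N v u i j = 0" if "i \<notin> {1..N} \<or> j \<notin> {1..N}" for i j
    using that by (simp only: rank_one_unitary_def) auto
  fix i j
  show "mmult N (madj (rank_one_unitary N v u)) (rank_one_unitary N v u) i j = midentity N i j"
  proof (cases "i \<in> {1..N} \<and> j \<in> {1..N}")
    case False
    then show ?thesis by (simp only: mmult_def madj_def rank_one_unitary_def midentity_def) auto
  next
    case True
    have ck: "cnj (kron a b) = kron a b" for a b by (simp add: kron_def)
    have "mmult N (madj (rank_one_unitary N v u)) (rank_one_unitary N v u) i j
      = (\<Sum>t\<in>{1..N}. (kron t i + (cnj u - 1) * (cnj (v t) * v i)) * (kron t j + (u - 1) * (v t * cnj (v j))))"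
      unfolding mmult_def madj_def rank_one_unitary_def using True by (intro sum.cong refl) (simp add: ck)
    also have "\<dots> = (\<Sum>t\<in>{1..N}. (if t = i then kron t j else 0) + (if t = i then (u - 1) * (v t * cnj (v j)) else 0)
        + (if t = j then (cnj u - 1) * (cnj (v t) * v i) else 0)
        + (cnj u - 1) * (u - 1) * (v i * cnj (v j)) * (v t * cnj (v t)))"
      by (intro sum.cong refl) (simp add: kron_def algebra_simps)
    also have "\<dots> = kron i j + (u - 1) * (v i * cnj (v j)) + (cnj u - 1) * (cnj (v j) * v i)
        + (cnj u - 1) * (u - 1) * (v i * cnj (v j)) * (\<Sum>t\<in>{1..N}. v t * cnj (v t))"
      using True by (simp add: sum.distrib sum_distrib_left)
    also have "\<dots> = kron i j + (cnj u * u - 1) * (v i * cnj (v j))"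
      unfolding v by (simp add: algebra_simps)
    also have "\<dots> = midentity N i j" using True u by (simp add: kron_def midentity_def)
    finally show ?thesis .
  qed
qed

text \<open>The commutation relation is differentiated at 0 along the one-parameter unitary group
  generated by v v^*; the resulting factor i is divided out at the end.\<close>

lemma commutes_rank_one_unit:
  assumes inv: "\<And>W. W \<in> unitary_group N \<Longrightarrow> commutes m N M (tensor m (\<lambda>s. W))"
    and v: "(\<Sum>i\<in>{1..N}. v i * cnj (v i)) = 1"
  shows "commutes m N M (derivation_op m (\<lambda>i j. v i * cnj (v j)))"
proof -
  let ?T = "tuples m N"
  define Y where "Y i j = \<i> * (v i * cnj (v j))" for i j
  \<comment> \<open>Untruncated and defined for complex \<theta>, so that every entry is
    holomorphic. On indices in {1..N} it agrees with \<open>rank_one_unitary\<close>.\<close>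
  define W where "W \<theta> i j = kron i j + (exp (\<i> * \<theta>) - 1) * (v i * cnj (v j))" for \<theta> :: complex and i j
  have der: "((\<lambda>\<theta>. tensor m (\<lambda>s. W \<theta>) z x) has_field_derivative derivation_op m Y z x) (at 0)" for z x
  proof -
    have W: "((\<lambda>\<theta>. W \<theta> i j) has_field_derivative Y i j) (at 0)" for i j
      unfolding W_def Y_def by (auto intro!: derivative_eq_intros)
    have W0: "W 0 = kron" by (simp add: W_def fun_eq_iff)
    have "((\<lambda>\<theta>. \<Prod>s\<in>{1..m}. W \<theta> (z s) (x s)) has_field_derivative
        (\<Sum>t\<in>{1..m}. Y (z t) (x t) * (\<Prod>s\<in>{1..m}-{t}. W 0 (z s) (x s)))) (at 0)"
      by (rule has_field_derivative_prod) (rule W)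
    then show ?thesis unfolding tensor_def derivation_op_alt W0 .
  qed
  have "commutes m N M (derivation_op m Y)"
    unfolding commutes_def
  proof (intro ballI)
    fix z y assume zy: "z \<in> ?T" "y \<in> ?T"
    define \<Phi> where "\<Phi> \<theta> = (\<Sum>x\<in>?T. tensor m (\<lambda>s. W \<theta>) z x * M x y) - (\<Sum>x\<in>?T. M z x * tensor m (\<lambda>s. W \<theta>) x y)" for \<theta>
    let ?D = "(\<Sum>x\<in>?T. derivation_op m Y z x * M x y) - (\<Sum>x\<in>?T. M z x * derivation_op m Y x y)"
    have "(\<Phi> has_field_derivative ?D) (at 0)"
      unfolding \<Phi>_def[abs_def] by (intro DERIV_diff DERIV_sum DERIV_cmult_right DERIV_cmult der)
    then have "(\<Phi> has_field_derivative ?D) (at (of_real 0))" by simp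
    \<comment> \<open>The curve is unitary for real parameters, so \<Phi> is known to vanish on the
      real line; its complex derivative is restricted accordingly.\<close>
    from has_vector_derivative_real_field[OF this, of UNIV]
    have 1: "((\<lambda>t. \<Phi> (of_real t)) has_vector_derivative ?D) (at 0)" by simp
    have zero: "\<Phi> (of_real t) = 0" for t :: real
    proof -
      have u: "cnj (exp (\<i> * of_real t)) * exp (\<i> * of_real t) = 1"
        unfolding cis_conv_exp[symmetric] by (simp add: cis_cnj cis_mult)
      let ?R = "rank_one_unitary N v (exp (\<i> * of_real t))"
      have "commutes m N M (tensor m (\<lambda>s. ?R))" by (rule inv[OF rank_one_unitary_in[OF v u]])
      moreover have e: "tensor m (\<lambda>s. ?R) z x = tensor m (\<lambda>s. W (of_real t)) z x"
        if "z \<in> ?T" "x \<in> ?T" for z x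
      proof (rule tensor_cong)
        fix s assume s: "s \<in> {1..m}"
        show "?R (z s) (x s) = W (of_real t) (z s) (x s)"
          using tuplesD[OF that(1) s] tuplesD[OF that(2) s] by (simp only: rank_one_unitary_def W_def) simp
      qed
      moreover have "commutes m N M (tensor m (\<lambda>s. ?R)) \<longleftrightarrow> commutes m N M (tensor m (\<lambda>s. W (of_real t)))"
        by (rule commutes_cong) (rule e)
      ultimately have "commutes m N M (tensor m (\<lambda>s. W (of_real t)))" by (simp only:)
      then show ?thesis using zy by (simp add: commutes_def \<Phi>_def)
    qed
    have 2: "((\<lambda>t. \<Phi> (of_real t)) has_vector_derivative 0) (at 0)" unfolding zero by simp
    have "?D = 0" by (rule vector_derivative_unique_at[OF 1 2])
    then show "(\<Sum>x\<in>?T. derivation_op m Y z x * M x y) = (\<Sum>x\<in>?T. M z x * derivation_op m Y x y)" by simp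
  qed
  then have "commutes m N M (\<lambda>z x. \<i> * derivation_op m (\<lambda>i j. v i * cnj (v j)) z x)"
    unfolding Y_def derivation_op_alt by (simp add: sum_distrib_left mult.assoc)
  then show ?thesis by (rule commutes_scaleD) simp
qed

text \<open>Normalising v reduces to a unit vector. A v vanishing on {1..N} gives the zero
  derivation, written as an empty sum.\<close>

lemma commutes_rank_one:
  assumes inv: "\<And>W. W \<in> unitary_group N \<Longrightarrow> commutes m N M (tensor m (\<lambda>s. W))"
  shows "commutes m N M (derivation_op m (\<lambda>i j. v i * cnj (v j)))"
proof -
  define c where "c = (\<Sum>i\<in>{1..N}. (cmod (v i))\<^sup>2)"
  have c: "(\<Sum>i\<in>{1..N}. v i * cnj (v i)) = of_real c"
    unfolding c_def by (simp add: complex_norm_square flip: of_real_power)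
  have c0: "0 \<le> c" unfolding c_def by (intro sum_nonneg) simp
  show ?thesis
  proof (cases "c = 0")
    case True
    then have "v i = 0" if "i \<in> {1..N}" for i
      using that unfolding c_def by (subst (asm) sum_nonneg_eq_0_iff) auto
    then have "commutes m N M (derivation_op m (\<lambda>i j. v i * cnj (v j)))
       \<longleftrightarrow> commutes m N M (derivation_op m (\<lambda>i j. \<Sum>q\<in>({} :: nat set). (0::complex) * kron i j))"
      by (intro commutes_derivation_cong) simp
    moreover have "commutes m N M (derivation_op m (\<lambda>i j. \<Sum>q\<in>({} :: nat set). (0::complex) * kron i j))"
      by (rule commutes_derivation_sum) simp
    ultimately show ?thesis by (simp only:)
  next
    case False
    define d where "d = complex_of_real (sqrt c)"
    have d: "d \<noteq> 0" "cnj d = d" "d * d = of_real c" using False c0 by (simp_all add: d_def flip: of_real_mult)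
    define w where "w i = v i / d" for i
    have "(\<Sum>i\<in>{1..N}. w i * cnj (w i)) = (\<Sum>i\<in>{1..N}. v i * cnj (v i)) / (d * d)"
      by (simp add: w_def d(2) sum_divide_distrib)
    also have "\<dots> = 1" using c d False by simp
    finally have "commutes m N M (derivation_op m (\<lambda>i j. w i * cnj (w j)))"
      by (intro commutes_rank_one_unit[where v = w] inv)
    from commutes_derivation_sum[of "{()}" m N M "\<lambda>_ i j. w i * cnj (w j)" "\<lambda>_. of_real c"] this
    have "commutes m N M (derivation_op m (\<lambda>i j. of_real c * (w i * cnj (w j))))" by simp
    moreover have "of_real c * (w i * cnj (w j)) = v i * cnj (v j)" for i j
      using d by (simp add: w_def d(3)[symmetric])
    ultimately show ?thesis by simp
  qed
qed

text \<open>Polarization: \<open>E\<^bsub>pq\<^esub> = (\<Sum>\<omega>. \<omega> v v\<^sup>*) / 4\<close> with \<open>v = e\<^sub>p + \<omega> e\<^sub>q\<close> and \<open>\<omega>\<close> running over the fourth roots of unity.\<close>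

theorem commutes_derivation:
  assumes inv: "\<And>W. W \<in> unitary_group N \<Longrightarrow> commutes m N M (tensor m (\<lambda>s. W))"
  shows "commutes m N M (derivation_op m Y)"
proof -
  let ?\<Omega> = "{1, \<i>, -1, -\<i>}"
  define v where "v p q \<omega> i = kron i p + \<omega> * kron i q" for p q \<omega> i
  have elem: "commutes m N M (derivation_op m (\<lambda>i j. kron i p * kron j q))" for p q
  proof -
    have "commutes m N M (derivation_op m (\<lambda>i j. \<Sum>\<omega>\<in>?\<Omega>. (\<omega> / 4) * (v p q \<omega> i * cnj (v p q \<omega> j))))"
      by (intro commutes_derivation_sum commutes_rank_one inv)
    moreover have "(\<Sum>\<omega>\<in>?\<Omega>. (\<omega> / 4) * (v p q \<omega> i * cnj (v p q \<omega> j))) = kron i p * kron j q" for i j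
    proof -
      \<comment> \<open>The roots must be distinct before the sum over the set
        \<open>?\<Omega>\<close> can be expanded into four terms.\<close>
      have n: "\<i> \<noteq> 1" "\<i> \<noteq> -1" "(1::complex) \<noteq> -1" "\<i> \<noteq> -\<i>" "1 \<noteq> -\<i>" "-1 \<noteq> -\<i>"
        by (simp_all add: complex_eq_iff)
      have ck: "cnj (kron a b) = kron a b" for a b by (simp add: kron_def)
      show ?thesis using n by (simp add: v_def ck algebra_simps)
    qed
    ultimately show ?thesis by simp
  qed
  have "commutes m N M (derivation_op m (\<lambda>i j. \<Sum>pq\<in>{1..N}\<times>{1..N}. Y (fst pq) (snd pq) * (kron i (fst pq) * kron j (snd pq))))"
    by (intro commutes_derivation_sum elem)
  moreover have "(\<Sum>pq\<in>{1..N}\<times>{1..N}. Y (fst pq) (snd pq) * (kron i (fst pq) * kron j (snd pq))) = Y i j"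
    if ij: "i \<in> {1..N}" "j \<in> {1..N}" for i j
  proof -
    have "(\<Sum>pq\<in>{1..N}\<times>{1..N}. Y (fst pq) (snd pq) * (kron i (fst pq) * kron j (snd pq)))
      = (\<Sum>pq\<in>{1..N}\<times>{1..N}. if pq = (i, j) then Y i j else 0)"
      by (intro sum.cong refl) (auto simp: kron_def)
    then show ?thesis using ij by simp
  qed
  ultimately show ?thesis
    using commutes_derivation_cong[of N "\<lambda>i j. \<Sum>pq\<in>{1..N}\<times>{1..N}. Y (fst pq) (snd pq) * (kron i (fst pq) * kron j (snd pq))" Y m M]
    by blast
qed

section \<open>Haar measure on the unitary group\<close>

lemma mmult_assoc: "mmult N (mmult N A B) C = mmult N A (mmult N B C)"
proof (intro ext)
  fix i j
  have "mmult N (mmult N A B) C i j = (\<Sum>t\<in>{1..N}. \<Sum>s\<in>{1..N}. A i s * (B s t * C t j))"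
    by (simp add: mmult_def sum_distrib_right mult.assoc)
  also have "\<dots> = (\<Sum>s\<in>{1..N}. \<Sum>t\<in>{1..N}. A i s * (B s t * C t j))" by (rule sum.swap)
  finally show "mmult N (mmult N A B) C i j = mmult N A (mmult N B C) i j"
    by (simp add: mmult_def sum_distrib_left)
qed

lemma mmult_midentity_left: "mmult N (midentity N) A i j = (if i \<in> {1..N} then A i j else 0)"
proof -
  have "mmult N (midentity N) A i j = (\<Sum>t\<in>{1..N}. if t = i then A i j else 0)"
    unfolding mmult_def midentity_def by (intro sum.cong) auto
  then show ?thesis by simp
qed

lemma mmult_midentity_right: "mmult N A (midentity N) i j = (if j \<in> {1..N} then A i j else 0)"
proof -
  have "mmult N A (midentity N) i j = (\<Sum>t\<in>{1..N}. if t = j then A i j else 0)"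
    unfolding mmult_def midentity_def by (intro sum.cong) auto
  then show ?thesis by simp
qed

lemma madj_mmult: "madj (mmult N A B) = mmult N (madj B) (madj A)"
  by (simp add: madj_def mmult_def fun_eq_iff mult.commute)

lemma madj_madj: "madj (madj A) = A"
  by (simp add: madj_def)

lemma unitary_zero: "U \<in> unitary_group N \<Longrightarrow> i \<notin> {1..N} \<or> j \<notin> {1..N} \<Longrightarrow> U i j = 0"
  unfolding unitary_group_def by blast

lemma unitary_left: "U \<in> unitary_group N \<Longrightarrow> mmult N (madj U) U = midentity N"
  unfolding unitary_group_def by blast

text \<open>A left inverse is a right inverse: \<open>I - U U\<^sup>*\<close> is a Hermitian projection of trace \<open>N - N = 0\<close>.\<close>

lemma unitary_right:
  assumes U: "U \<in> unitary_group N"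
  shows "mmult N U (madj U) = midentity N"
proof -
  let ?E = "mmult N U (madj U)"
  define F where "F = (\<lambda>i j. midentity N i j - ?E i j)"
  have EE: "mmult N ?E ?E = ?E"
  proof -
    have "mmult N ?E ?E = mmult N U (mmult N (mmult N (madj U) U) (madj U))" by (simp only: mmult_assoc)
    also have "\<dots> = mmult N U (mmult N (midentity N) (madj U))" by (simp only: unitary_left[OF U])
    also have "mmult N (midentity N) (madj U) = madj U"
      using unitary_zero[OF U] by (auto simp: fun_eq_iff mmult_midentity_left madj_def)
    finally show ?thesis .
  qed
  have E0: "?E i j = 0" if "i \<notin> {1..N} \<or> j \<notin> {1..N}" for i j
    unfolding mmult_def madj_def using unitary_zero[OF U] that by (intro sum.neutral) auto
  have adjE: "madj ?E = ?E" by (simp add: madj_mmult madj_madj)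
  have adjF: "cnj (F j i) = F i j" for i j
  proof -
    have "cnj (?E j i) = ?E i j" using fun_cong[OF fun_cong[OF adjE, of i], of j] by (simp add: madj_def)
    then show ?thesis by (simp add: F_def midentity_def)
  qed
  have FF: "mmult N F F i j = F i j" if "i \<in> {1..N}" "j \<in> {1..N}" for i j
  proof -
    have "mmult N F F i j = mmult N (midentity N) (midentity N) i j - mmult N ?E (midentity N) i j
        - mmult N (midentity N) ?E i j + mmult N ?E ?E i j"
      unfolding F_def mmult_def[of N "\<lambda>i j. midentity N i j - ?E i j"]
      by (simp add: mmult_def[of N "midentity N"] mmult_def[of N "mmult N U (madj U)"] algebra_simps sum.distrib sum_subtractf)
    then show ?thesis using that by (simp add: EE mmult_midentity_left mmult_midentity_right F_def)
  qed
  have "(\<Sum>i\<in>{1..N}. F i i) = 0"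
  proof -
    have "(\<Sum>i\<in>{1..N}. ?E i i) = (\<Sum>i\<in>{1..N}. mmult N (madj U) U i i)"
      unfolding mmult_def madj_def by (subst sum.swap) (simp add: mult.commute)
    then show ?thesis by (simp add: F_def sum_subtractf unitary_left[OF U])
  qed
  moreover have "(\<Sum>i\<in>{1..N}. F i i) = of_real (\<Sum>i\<in>{1..N}. \<Sum>j\<in>{1..N}. (cmod (F i j))\<^sup>2)"
  proof -
    have "F i i = of_real (\<Sum>j\<in>{1..N}. (cmod (F i j))\<^sup>2)" if "i \<in> {1..N}" for i
    proof -
      have "F i i = (\<Sum>j\<in>{1..N}. F i j * F j i)" using FF[OF that that] by (simp add: mmult_def)
      also have "\<dots> = (\<Sum>j\<in>{1..N}. F i j * cnj (F i j))" using adjF by (intro sum.cong refl) simp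
      also have "\<dots> = of_real (\<Sum>j\<in>{1..N}. (cmod (F i j))\<^sup>2)" by (simp only: complex_norm_square of_real_sum)
      finally show ?thesis .
    qed
    then show ?thesis by simp
  qed
  ultimately have "(\<Sum>i\<in>{1..N}. \<Sum>j\<in>{1..N}. (cmod (F i j))\<^sup>2) = 0" by (simp only: of_real_eq_0_iff)
  then have "F i j = 0" if "i \<in> {1..N}" "j \<in> {1..N}" for i j
    using that by (simp add: sum_nonneg_eq_0_iff sum_nonneg)
  then show ?thesis
    unfolding F_def fun_eq_iff using E0 by (metis (no_types, lifting) eq_iff_diff_eq_0 midentity_def)
qed

lemma unitary_madj: "U \<in> unitary_group N \<Longrightarrow> madj U \<in> unitary_group N"
  using unitary_right[of U N] unitary_zero[of U N] unfolding unitary_group_def by (auto simp: madj_madj) (auto simp: madj_def)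

lemma unitary_mmult:
  assumes U: "U \<in> unitary_group N" and V: "V \<in> unitary_group N"
  shows "mmult N U V \<in> unitary_group N"
  unfolding unitary_group_def
proof (intro CollectI conjI allI impI)
  show "mmult N U V i j = 0" if "i \<notin> {1..N} \<or> j \<notin> {1..N}" for i j
    unfolding mmult_def using unitary_zero[OF U] unitary_zero[OF V] that by (intro sum.neutral) auto
  have "mmult N (madj (mmult N U V)) (mmult N U V) = mmult N (madj V) (mmult N (mmult N (madj U) U) V)"
    by (simp only: madj_mmult mmult_assoc)
  also have "\<dots> = mmult N (madj V) (mmult N (midentity N) V)" by (simp only: unitary_left[OF U])
  also have "mmult N (midentity N) V = V"
    using unitary_zero[OF V] by (auto simp: fun_eq_iff mmult_midentity_left)
  finally show "mmult N (madj (mmult N U V)) (mmult N U V) = midentity N" by (simp only: unitary_left[OF V])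
qed

lemma unitary_cancel_right:
  assumes "U \<in> unitary_group N" "W \<in> unitary_group N"
  shows "mmult N (mmult N U W) (madj W) = U"
  unfolding mmult_assoc unitary_right[OF assms(2)]
  using unitary_zero[OF assms(1)] by (auto simp: fun_eq_iff mmult_midentity_right)

lemma unitary_entry_bound:
  assumes "U \<in> unitary_group N"
  shows "cmod (U i j) \<le> 1"
proof (cases "i \<in> {1..N} \<and> j \<in> {1..N}")
  case True
  have "mmult N (madj U) U j j = 1" using True unitary_left[OF assms] by (simp add: midentity_def)
  then have "(\<Sum>t\<in>{1..N}. of_real ((cmod (U t j))\<^sup>2)) = (1 :: complex)"
    by (simp only: mmult_def madj_def complex_norm_square mult.commute)
  then have s: "(\<Sum>t\<in>{1..N}. (cmod (U t j))\<^sup>2) = 1"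
    by (simp only: of_real_sum[symmetric] of_real_eq_1_iff)
  have "(cmod (U i j))\<^sup>2 \<le> (\<Sum>t\<in>{1..N}. (cmod (U t j))\<^sup>2)"
    using True by (intro member_le_sum) auto
  then show ?thesis unfolding s by (simp add: power_le_one_iff)
qed (use unitary_zero[OF assms] in auto)

text \<open>Matrix entries are unbounded on the whole matrix space. Boundedness on the group
  suffices for integrability because the measure is concentrated there.\<close>

definition unitary_bounded :: "nat \<Rightarrow> (cmat \<Rightarrow> complex) \<Rightarrow> bool" where
  "unitary_bounded N f \<longleftrightarrow> f \<in> borel_measurable borel \<and> (\<exists>K. \<forall>U\<in>unitary_group N. cmod (f U) \<le> K)"

lemma borel_measurable_entry [measurable]: "(\<lambda>U::cmat. U i j) \<in> borel_measurable borel"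
proof -
  have "(\<lambda>U::cmat. U i) \<in> borel_measurable borel"
    by (rule measurable_product_then_coordinatewise[of "\<lambda>U. U"]) simp
  from measurable_product_then_coordinatewise[OF this] show ?thesis .
qed

lemma borel_measurable_cmat:
  assumes "\<And>i j. (\<lambda>x. f x i j) \<in> borel_measurable M"
  shows "(f :: 'a \<Rightarrow> cmat) \<in> borel_measurable M"
  by (intro measurable_coordinatewise_then_product assms)

lemma unitary_bounded_const: "unitary_bounded N (\<lambda>U. k)"
  unfolding unitary_bounded_def by auto

lemma unitary_bounded_entry: "unitary_bounded N (\<lambda>U. U i j)"
  unfolding unitary_bounded_def using unitary_entry_bound by (auto intro!: exI[of _ 1])

lemma unitary_bounded_add:
  assumes "unitary_bounded N f" "unitary_bounded N g"
  shows "unitary_bounded N (\<lambda>U. f U + g U)"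
proof -
  obtain K L where "\<forall>U\<in>unitary_group N. cmod (f U) \<le> K" "\<forall>U\<in>unitary_group N. cmod (g U) \<le> L"
    using assms by (auto simp: unitary_bounded_def)
  then have "\<forall>U\<in>unitary_group N. cmod (f U + g U) \<le> K + L" by (meson add_mono norm_triangle_le)
  then show ?thesis using assms by (auto simp: unitary_bounded_def)
qed

lemma unitary_bounded_mult:
  assumes "unitary_bounded N f" "unitary_bounded N g"
  shows "unitary_bounded N (\<lambda>U. f U * g U)"
proof -
  obtain K L where KL: "\<forall>U\<in>unitary_group N. cmod (f U) \<le> K" "\<forall>U\<in>unitary_group N. cmod (g U) \<le> L"
    using assms by (auto simp: unitary_bounded_def)
  have "cmod (f U * g U) \<le> K * L" if "U \<in> unitary_group N" for U
  proof -
    have "cmod (f U) \<le> K" "cmod (g U) \<le> L" using KL that by auto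
    moreover from this have "0 \<le> K" using norm_ge_zero[of "f U"] by linarith
    ultimately show ?thesis unfolding norm_mult by (intro mult_mono) auto
  qed
  then show ?thesis using assms by (auto simp: unitary_bounded_def)
qed

lemma borel_measurable_cnj: "f \<in> borel_measurable M \<Longrightarrow> (\<lambda>x. cnj (f x)) \<in> borel_measurable M"
  using measurable_compose[of f M borel cnj borel] borel_measurable_continuous_onI[OF continuous_on_cnj[OF continuous_on_id]]
  by simp

lemma unitary_bounded_cnj: "unitary_bounded N f \<Longrightarrow> unitary_bounded N (\<lambda>U. cnj (f U))"
  unfolding unitary_bounded_def by (auto intro: borel_measurable_cnj)

lemma unitary_bounded_sum: "(\<And>q. q \<in> Q \<Longrightarrow> unitary_bounded N (f q)) \<Longrightarrow> unitary_bounded N (\<lambda>U. \<Sum>q\<in>Q. f q U)"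
  by (induction Q rule: infinite_finite_induct) (auto intro: unitary_bounded_add unitary_bounded_const)

lemma unitary_bounded_prod: "(\<And>q. q \<in> Q \<Longrightarrow> unitary_bounded N (f q)) \<Longrightarrow> unitary_bounded N (\<lambda>U. \<Prod>q\<in>Q. f q U)"
  by (induction Q rule: infinite_finite_induct) (auto intro: unitary_bounded_mult unitary_bounded_const)

section \<open>Invariance of the Haar integral\<close>

locale haar =
  fixes N :: nat and \<mu> :: "cmat measure"
  assumes haar: "haar_unitary N \<mu>"
begin

abbreviation "G \<equiv> unitary_group N"

sublocale prob_space \<mu>
  using haar by (simp add: haar_unitary_def)

lemma sets_mu [measurable_cong]: "sets \<mu> = sets borel"
  using haar by (simp add: haar_unitary_def)

lemma G_sets [measurable]: "G \<in> sets borel"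
proof -
  have "G \<in> events" using haar unfolding haar_unitary_def by blast
  then show ?thesis unfolding sets_mu .
qed

lemma AE_G: "AE U in \<mu>. U \<in> G"
proof -
  have "G \<in> events" using haar by (simp add: haar_unitary_def)
  moreover have "prob G = 1" using haar by (simp add: haar_unitary_def measure_def)
  ultimately show ?thesis by (simp add: AE_prob_1)
qed

lemma measurable_mu: "borel_measurable \<mu> = borel_measurable borel"
  by (rule measurable_cong_sets) (simp_all add: sets_mu)

lemma measurable_left [measurable]: "(\<lambda>U. mmult N W U) \<in> borel_measurable borel"
  by (rule borel_measurable_cmat) (simp add: mmult_def)

lemma integral_left:
  assumes f: "f \<in> borel_measurable borel" and W: "W \<in> G"
  shows "(\<integral>U. f (mmult N W U) \<partial>\<mu>) = (\<integral>U. (f U :: complex) \<partial>\<mu>)"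
proof -
  have "(\<integral>U. f U \<partial>\<mu>) = (\<integral>U. f U \<partial>(distr \<mu> borel (\<lambda>U. mmult N W U)))"
    using haar W by (simp add: haar_unitary_def)
  also have "\<dots> = (\<integral>U. f (mmult N W U) \<partial>\<mu>)"
    by (rule integral_distr) (use f in \<open>simp_all add: measurable_mu\<close>)
  finally show ?thesis by simp
qed

lemma measurable_adj: "(\<lambda>U. madj U) \<in> borel_measurable borel"
  by (rule borel_measurable_cmat) (simp add: madj_def borel_measurable_cnj)

text \<open>Integrate f at \<open>mmult N (madj V) U\<close> over both variables. For fixed V, left
  invariance gives the integral of f; for fixed U, the argument is the adjoint of
  \<open>mmult N (madj U) V\<close>, and left invariance gives the integral of f after the
  adjoint.\<close>

lemma integral_adj:
  assumes f: "f \<in> borel_measurable borel" and b: "\<And>U. cmod (f U) \<le> K"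
  shows "(\<integral>U. f U \<partial>\<mu>) = (\<integral>V. (f (madj V) :: complex) \<partial>\<mu>)"
proof -
  interpret P: pair_prob_space \<mu> \<mu> ..
  have meas: "(\<lambda>(V, U). f (mmult N (madj V) U)) \<in> borel_measurable (\<mu> \<Otimes>\<^sub>M \<mu>)"
  proof -
    have "(\<lambda>p. mmult N (madj (fst p)) (snd p)) \<in> borel_measurable (\<mu> \<Otimes>\<^sub>M \<mu>)"
    proof (rule borel_measurable_cmat)
      fix i j
      have 1: "(\<lambda>p. fst p t i) \<in> borel_measurable (\<mu> \<Otimes>\<^sub>M \<mu>)" for t
        using measurable_compose[OF measurable_fst, of "\<lambda>U. U t i" \<mu> borel \<mu>] borel_measurable_entry[of t i] by (simp add: measurable_mu)
      have 2: "(\<lambda>p. snd p t j) \<in> borel_measurable (\<mu> \<Otimes>\<^sub>M \<mu>)" for t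
        using measurable_compose[OF measurable_snd, of "\<lambda>U. U t j" \<mu> borel \<mu>] borel_measurable_entry[of t j] by (simp add: measurable_mu)
      show "(\<lambda>p. mmult N (madj (fst p)) (snd p) i j) \<in> borel_measurable (\<mu> \<Otimes>\<^sub>M \<mu>)"
        unfolding mmult_def madj_def by (intro borel_measurable_sum borel_measurable_times borel_measurable_cnj 1 2)
    qed
    from measurable_compose[OF this f] show ?thesis by (simp add: case_prod_beta)
  qed
  have int: "integrable (\<mu> \<Otimes>\<^sub>M \<mu>) (\<lambda>(V, U). f (mmult N (madj V) U))"
    by (rule P.P.integrable_const_bound[of _ K]) (use meas b in \<open>auto simp: case_prod_beta\<close>)
  have "(\<integral>U. f U \<partial>\<mu>) = (\<integral>V. (\<integral>U. f U \<partial>\<mu>) \<partial>\<mu>)" by (simp add: prob_space)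
  also have "\<dots> = (\<integral>V. (\<integral>U. f (mmult N (madj V) U) \<partial>\<mu>) \<partial>\<mu>)"
  proof (rule integral_cong_AE)
    show "(\<lambda>V. \<integral>U. f (mmult N (madj V) U) \<partial>\<mu>) \<in> borel_measurable \<mu>"
      using borel_measurable_lebesgue_integral[of "\<lambda>V U. f (mmult N (madj V) U)" \<mu>] meas by simp
    show "AE V in \<mu>. (\<integral>U. f U \<partial>\<mu>) = (\<integral>U. f (mmult N (madj V) U) \<partial>\<mu>)"
      using AE_G by eventually_elim (simp add: integral_left[OF f] unitary_madj)
  qed simp
  also have "\<dots> = (\<integral>U. (\<integral>V. f (mmult N (madj V) U) \<partial>\<mu>) \<partial>\<mu>)"
    by (rule P.Fubini_integral[symmetric]) (rule int)
  also have "\<dots> = (\<integral>U. (\<integral>V. f (madj V) \<partial>\<mu>) \<partial>\<mu>)"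
  proof (rule integral_cong_AE)
    have "(\<lambda>(U, V). f (mmult N (madj V) U)) \<in> borel_measurable (\<mu> \<Otimes>\<^sub>M \<mu>)"
      using measurable_compose[OF measurable_pair_swap'[of \<mu> \<mu>] meas] by (simp add: case_prod_beta)
    then show "(\<lambda>U. \<integral>V. f (mmult N (madj V) U) \<partial>\<mu>) \<in> borel_measurable \<mu>"
      using borel_measurable_lebesgue_integral[of "\<lambda>U V. f (mmult N (madj V) U)" \<mu>] by simp
    have fa: "(\<lambda>V. f (madj V)) \<in> borel_measurable borel" by (rule measurable_compose[OF measurable_adj f])
    show "AE U in \<mu>. (\<integral>V. f (mmult N (madj V) U) \<partial>\<mu>) = (\<integral>V. f (madj V) \<partial>\<mu>)"
      using AE_G
    proof eventually_elim
      fix U assume "U \<in> G"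
      then have "(\<integral>V. f (madj (mmult N (madj U) V)) \<partial>\<mu>) = (\<integral>V. f (madj V) \<partial>\<mu>)"
        by (intro integral_left[OF fa] unitary_madj)
      then show "(\<integral>V. f (mmult N (madj V) U) \<partial>\<mu>) = (\<integral>V. f (madj V) \<partial>\<mu>)" by (simp add: madj_mmult madj_madj)
    qed
  qed simp
  finally show ?thesis by (simp add: prob_space)
qed

lemma measurable_right: "(\<lambda>U. mmult N U W) \<in> borel_measurable borel"
  by (rule borel_measurable_cmat) (simp add: mmult_def)

lemma integrable_unitary_bounded:
  assumes "unitary_bounded N f"
  shows "integrable \<mu> f"
proof -
  obtain K where K: "\<forall>U\<in>G. cmod (f U) \<le> K" using assms by (auto simp: unitary_bounded_def)
  have "AE U in \<mu>. cmod (f U) \<le> K" using AE_G by eventually_elim (use K in auto)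
  then show ?thesis using assms by (intro integrable_const_bound) (auto simp: unitary_bounded_def measurable_mu)
qed

text \<open>The adjoint exchanges left and right multiplication, so \<open>integral_left\<close> is
  used between two applications of \<open>integral_adj\<close>. These ask for a bound on the whole
  matrix space, hence the cut-off \<open>g\<close>.\<close>

theorem integral_right:
  assumes f: "unitary_bounded N f" and W: "W \<in> G"
  shows "(\<integral>U. f (mmult N U W) \<partial>\<mu>) = (\<integral>U. f U \<partial>\<mu>)"
proof -
  obtain K where K: "\<forall>U\<in>G. cmod (f U) \<le> K" using f by (auto simp: unitary_bounded_def)
  have fm: "f \<in> borel_measurable borel" using f by (simp add: unitary_bounded_def)
  define g where "g U = indicator G U * f U" for U
  have gm: "g \<in> borel_measurable borel" unfolding g_def[abs_def] using fm by measurable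
  have gb: "cmod (g U) \<le> max K 0" for U using K by (auto simp: g_def indicator_def norm_mult)
  have gm': "(\<lambda>U. g (mmult N U W)) \<in> borel_measurable borel" by (rule measurable_compose[OF measurable_right gm])
  have "(\<integral>U. f (mmult N U W) \<partial>\<mu>) = (\<integral>U. g (mmult N U W) \<partial>\<mu>)"
  proof (rule integral_cong_AE)
    show "AE U in \<mu>. f (mmult N U W) = g (mmult N U W)"
      using AE_G by eventually_elim (simp add: g_def unitary_mmult W)
    show "(\<lambda>U. f (mmult N U W)) \<in> borel_measurable \<mu>" unfolding measurable_mu by (rule measurable_compose[OF measurable_right fm])
    show "(\<lambda>U. g (mmult N U W)) \<in> borel_measurable \<mu>" unfolding measurable_mu by (rule gm')
  qed
  also have "\<dots> = (\<integral>V. g (mmult N (madj V) W) \<partial>\<mu>)" by (rule integral_adj[OF gm']) (rule gb)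
  also have "\<dots> = (\<integral>V. g (madj (mmult N (madj W) V)) \<partial>\<mu>)" by (simp add: madj_mmult madj_madj)
  also have "\<dots> = (\<integral>V. g (madj V) \<partial>\<mu>)"
    by (rule integral_left[OF measurable_compose[OF measurable_adj gm] unitary_madj[OF W]])
  also have "\<dots> = (\<integral>U. g U \<partial>\<mu>)" by (rule integral_adj[OF gm, symmetric]) (rule gb)
  also have "\<dots> = (\<integral>U. f U \<partial>\<mu>)"
  proof (rule integral_cong_AE)
    show "AE U in \<mu>. g U = f U" using AE_G by eventually_elim (simp add: g_def)
  qed (use gm fm in \<open>simp_all add: measurable_mu\<close>)
  finally show ?thesis .
qed

end

section \<open>Moments\<close>

lemma bij_betw_comp_tuples:
  assumes \<tau>: "\<tau> permutes {1..m}"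
  shows "bij_betw (\<lambda>p. p \<circ> \<tau>) (tuples m N) (tuples m N)"
proof (rule bij_betwI[where g = "\<lambda>p. p \<circ> inv \<tau>"])
  show "(\<lambda>p. p \<circ> \<tau>) \<in> tuples m N \<rightarrow> tuples m N"
    using comp_permutes_PiE[OF _ \<tau>] by blast
  show "(\<lambda>p. p \<circ> inv \<tau>) \<in> tuples m N \<rightarrow> tuples m N"
    using comp_permutes_PiE[OF _ permutes_inv[OF \<tau>]] by blast
qed (use permutes_inverses[OF \<tau>] in \<open>simp_all add: fun_eq_iff\<close>)

lemma tensor_comp_permutes:
  assumes \<tau>: "\<tau> permutes {1..m}"
  shows "tensor m (\<lambda>s. A) (p \<circ> \<tau>) (b \<circ> \<tau>) = tensor m (\<lambda>s. A) p b"
  unfolding tensor_def comp_def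
  by (rule prod.reindex_bij_betw[OF permutes_imp_bij[OF \<tau>], of "\<lambda>s. A (p s) (b s)"])

lemma prod_consecutive_pairs:
  "(\<Prod>s\<in>{1..2*k}. g s) = (\<Prod>r\<in>{1..k}. g (2*r-1) * (g (2*r) :: 'a :: comm_monoid_mult))" for k :: nat
proof (induction k)
  case (Suc k)
  have "{1..2 * Suc k} = insert (2*k+2) (insert (2*k+1) {1..2*k})" by auto
  then have "(\<Prod>s\<in>{1..2 * Suc k}. g s) = g (2*k+2) * (g (2*k+1) * (\<Prod>s\<in>{1..2*k}. g s))" by simp
  also have "\<dots> = (\<Prod>r\<in>{1..k}. g (2*r-1) * g (2*r)) * (g (2 * Suc k - 1) * g (2 * Suc k))"
    unfolding Suc by (simp add: mult_ac)
  also have "\<dots> = (\<Prod>r\<in>{1..Suc k}. g (2*r-1) * g (2*r))"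
    by (subst prod.nat_ivl_Suc') (simp_all add: mult.commute)
  finally show ?case .
qed simp

text \<open>Distributivity, with the k pairs of summation indices flattened to one tuple of length
  2k.\<close>

lemma prod_sum_consecutive_pairs:
  fixes h :: "nat \<Rightarrow> nat \<Rightarrow> nat \<Rightarrow> complex"
  shows "(\<Prod>r\<in>{1..k}. \<Sum>i\<in>{1..N}. \<Sum>j\<in>{1..N}. h r i j)
    = (\<Sum>p\<in>tuples (2*k) N. \<Prod>r\<in>{1..k}. h r (p (2*r-1)) (p (2*r)))"
proof -
  let ?I = "{1..N}"
  have "(\<Prod>r\<in>{1..k}. \<Sum>i\<in>?I. \<Sum>j\<in>?I. h r i j) = (\<Prod>r\<in>{1..k}. \<Sum>ij\<in>?I\<times>?I. h r (fst ij) (snd ij))"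
    by (simp add: sum.cartesian_product case_prod_beta)
  also have "\<dots> = (\<Sum>q\<in>{1..k} \<rightarrow>\<^sub>E ?I\<times>?I. \<Prod>r\<in>{1..k}. h r (fst (q r)) (snd (q r)))"
    by (rule prod_sum_PiE) auto
  also have "\<dots> = (\<Sum>p\<in>tuples (2*k) N. \<Prod>r\<in>{1..k}. h r (p (2*r-1)) (p (2*r)))"
  proof (rule sum.reindex_bij_witness[of _ "\<lambda>p. \<lambda>r\<in>{1..k}. (p (2*r-1), p (2*r))"
        "\<lambda>q. \<lambda>s\<in>{1..2*k}. if odd s then fst (q ((s+1) div 2)) else snd (q (s div 2))"])
    fix q assume q: "q \<in> {1..k} \<rightarrow>\<^sub>E ?I\<times>?I"
    let ?p = "\<lambda>s\<in>{1..2*k}. if odd s then fst (q ((s+1) div 2)) else snd (q (s div 2))"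
    have e: "?p (2*r-1) = fst (q r)" "?p (2*r) = snd (q r)" if "r \<in> {1..k}" for r
    proof -
      have "2*r-1 \<in> {1..2*k}" "2*r \<in> {1..2*k}" "odd (2*r-1)" "(2*r-1+1) div 2 = r" using that by auto
      then show "?p (2*r-1) = fst (q r)" "?p (2*r) = snd (q r)" by (simp_all only: restrict_apply if_True even_mult_iff even_numeral simp_thms if_False nonzero_mult_div_cancel_left)
    qed
    have qr: "q r \<in> ?I \<times> ?I" if "r \<in> {1..k}" for r using q that by blast
    show "?p \<in> tuples (2*k) N"
    proof (rule PiE_I)
      fix s assume s: "s \<in> {1..2*k}"
      show "?p s \<in> ?I"
        using s
      proof (cases rule: pair_cases)
        case (1 r)
        then show ?thesis using e(1)[OF 1(1)] qr[OF 1(1)] by (simp only: mem_Times_iff)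
      next
        case (2 r)
        then show ?thesis using e(2)[OF 2(1)] qr[OF 2(1)] by (simp only: mem_Times_iff)
      qed
    next
      fix s assume "s \<notin> {1..2*k}"
      then show "?p s = undefined" by (simp only: restrict_apply if_False)
    qed
    show "(\<lambda>r\<in>{1..k}. (?p (2*r-1), ?p (2*r))) = q"
    proof
      fix r
      show "(\<lambda>r\<in>{1..k}. (?p (2*r-1), ?p (2*r))) r = q r"
      proof (cases "r \<in> {1..k}")
        case True
        then show ?thesis using e[OF True] by (simp only: restrict_apply if_True prod.collapse)
      next
        case False
        then show ?thesis using PiE_arb[OF q False] by (simp only: restrict_apply if_False)
      qed
    qed
    show "(\<Prod>r\<in>{1..k}. h r (?p (2*r-1)) (?p (2*r))) = (\<Prod>r\<in>{1..k}. h r (fst (q r)) (snd (q r)))"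
      by (rule prod.cong[OF refl]) (simp only: e)
  next
    fix p assume p: "p \<in> tuples (2*k) N"
    let ?q = "\<lambda>r\<in>{1..k}. (p (2*r-1), p (2*r))"
    show "?q \<in> {1..k} \<rightarrow>\<^sub>E ?I\<times>?I"
    proof (rule PiE_I)
      fix r assume r: "r \<in> {1..k}"
      then have "2*r-1 \<in> {1..2*k}" "2*r \<in> {1..2*k}" by auto
      then show "?q r \<in> ?I \<times> ?I" using r tuplesD[OF p] by (simp only: restrict_apply if_True mem_Times_iff fst_conv snd_conv)
    qed (simp only: restrict_apply if_False)
    show "(\<lambda>s\<in>{1..2*k}. if odd s then fst (?q ((s+1) div 2)) else snd (?q (s div 2))) = p"
    proof
      fix s
      show "(\<lambda>s\<in>{1..2*k}. if odd s then fst (?q ((s+1) div 2)) else snd (?q (s div 2))) s = p s"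
      proof (cases "s \<in> {1..2*k}")
        case True
        then show ?thesis
        proof (cases rule: pair_cases)
          case (1 r)
          then have "odd s" "(s + 1) div 2 = r" by auto
          then show ?thesis using True 1 by (simp only: restrict_apply if_True fst_conv not_False_eq_True)
        next
          case (2 r)
          then have "even s" "s div 2 = r" by auto
          then show ?thesis using True 2 by (simp only: restrict_apply if_True if_False snd_conv not_True_eq_False)
        qed
      next
        case False
        then show ?thesis using PiE_arb[OF p False] by (simp only: restrict_apply if_False)
      qed
    qed
  qed
  finally show ?thesis .
qed

lemma Jmat_antisym: "Jmat n q p = - Jmat n p q"
  by (auto simp: Jmat_def)

lemma cnj_Jmat: "cnj (Jmat n p q) = Jmat n p q"
  by (simp add: Jmat_def)

lemma Jmat_square:
  assumes "i \<in> {1..2*n}"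
  shows "mmult (2*n) (Jmat n) (Jmat n) i j = - midentity (2*n) i j"
proof -
  have "mmult (2*n) (Jmat n) (Jmat n) i j
      = (\<Sum>t\<in>{1..2*n}. if t = jpair n i then (if i \<le> n then 1 else -1) * Jmat n t j else 0)"
    unfolding mmult_def
  proof (rule sum.cong[OF refl])
    fix t assume "t \<in> {1..2*n}"
    then show "Jmat n i t * Jmat n t j = (if t = jpair n i then (if i \<le> n then 1 else -1) * Jmat n t j else 0)"
      by (cases "t = jpair n i") (simp_all only: Jmat_jpair[OF assms] if_True if_False refl mult_zero_left)
  qed
  also have "\<dots> = (if i \<le> n then 1 else -1) * Jmat n (jpair n i) j"
    using jpair_in[OF assms] by simp
  also have "\<dots> = - midentity (2*n) i j"
    using assms by (auto simp: jpair_def Jmat_def midentity_def)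
  finally show ?thesis .
qed

text \<open>J V = J J U^T J^T U = U^T J U, because J^2 = -I and J^T = -J. Each entry is thus a
  bilinear form in two columns of U.\<close>

lemma vtilde_entry:
  assumes i: "i \<in> {1..2*n}"
  shows "vtilde n U i j = (\<Sum>p\<in>{1..2*n}. \<Sum>q\<in>{1..2*n}. Jmat n p q * (U p i * U q j))"
proof -
  let ?N = "2*n"
  let ?B = "mmult ?N (mtrans U) (mmult ?N (mtrans (Jmat n)) U)"
  have "vtilde n U i j = mmult ?N (mmult ?N (Jmat n) (Jmat n)) ?B i j"
    unfolding vtilde_def sp_dual_def by (simp only: mmult_assoc)
  also have "\<dots> = (\<Sum>t\<in>{1..?N}. - (midentity ?N i t * ?B t j))"
    unfolding mmult_def[of ?N "mmult ?N (Jmat n) (Jmat n)"] by (simp only: Jmat_square[OF i] minus_mult_left)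
  also have "\<dots> = - mmult ?N (midentity ?N) ?B i j"
    by (simp add: mmult_def[of ?N "midentity ?N"] sum_negf)
  also have "\<dots> = - ?B i j" using i by (simp add: mmult_midentity_left)
  also have "\<dots> = (\<Sum>p\<in>{1..?N}. \<Sum>q\<in>{1..?N}. - (U p i * (Jmat n q p * U q j)))"
    by (simp add: mmult_def mtrans_def sum_negf sum_distrib_left)
  also have "\<dots> = (\<Sum>p\<in>{1..?N}. \<Sum>q\<in>{1..?N}. Jmat n p q * (U p i * U q j))"
  proof (intro sum.cong refl)
    show "- (U p i * (Jmat n q p * U q j)) = Jmat n p q * (U p i * U q j)" for p q
      by (simp add: Jmat_antisym[of n q p])
  qed
  finally show ?thesis .
qed

definition vt_prod :: "nat \<Rightarrow> nat \<Rightarrow> (nat \<Rightarrow> nat) \<Rightarrow> cmat \<Rightarrow> complex" where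
  "vt_prod n k x U = (\<Prod>r\<in>{1..k}. vtilde n U (x (2*r-1)) (x (2*r)))"

definition J_prod :: "nat \<Rightarrow> nat \<Rightarrow> (nat \<Rightarrow> nat) \<Rightarrow> complex" where
  "J_prod n k p = (\<Prod>r\<in>{1..k}. Jmat n (p (2*r-1)) (p (2*r)))"

text \<open>In tensor language, the row vector \<open>J_prod\<close> times the tensor power of U;
  right multiplication of U therefore acts linearly on the index tuple.\<close>

lemma vt_prod_expand:
  assumes x: "x \<in> tuples (2*k) (2*n)"
  shows "vt_prod n k x U = (\<Sum>p\<in>tuples (2*k) (2*n). J_prod n k p * tensor (2*k) (\<lambda>s. U) p x)"
proof -
  have xi: "x (2*r-1) \<in> {1..2*n}" if "r \<in> {1..k}" for r
  proof -
    have "2*r-1 \<in> {1..2*k}" using that by auto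
    then show ?thesis by (rule tuplesD[OF x])
  qed
  have "vt_prod n k x U = (\<Prod>r\<in>{1..k}. \<Sum>p\<in>{1..2*n}. \<Sum>q\<in>{1..2*n}.
      Jmat n p q * (U p (x (2*r-1)) * U q (x (2*r))))"
    unfolding vt_prod_def by (rule prod.cong[OF refl]) (rule vtilde_entry[OF xi])
  also have "\<dots> = (\<Sum>p\<in>tuples (2*k) (2*n). \<Prod>r\<in>{1..k}.
      Jmat n (p (2*r-1)) (p (2*r)) * (U (p (2*r-1)) (x (2*r-1)) * U (p (2*r)) (x (2*r))))"
    by (rule prod_sum_consecutive_pairs)
  also have "\<dots> = (\<Sum>p\<in>tuples (2*k) (2*n). J_prod n k p * tensor (2*k) (\<lambda>s. U) p x)"
    unfolding J_prod_def tensor_def prod_consecutive_pairs prod.distrib ..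
  finally show ?thesis .
qed

lemma vt_prod_mmult:
  assumes x: "x \<in> tuples (2*k) (2*n)"
  shows "vt_prod n k x (mmult (2*n) U W) = (\<Sum>p\<in>tuples (2*k) (2*n). tensor (2*k) (\<lambda>s. W) p x * vt_prod n k p U)"
proof -
  let ?T = "tuples (2*k) (2*n)"
  have "vt_prod n k x (mmult (2*n) U W)
      = (\<Sum>q\<in>?T. \<Sum>p\<in>?T. J_prod n k q * (tensor (2*k) (\<lambda>s. U) q p * tensor (2*k) (\<lambda>s. W) p x))"
    unfolding vt_prod_expand[OF x] sum_tensor[symmetric] sum_distrib_left ..
  also have "\<dots> = (\<Sum>p\<in>?T. \<Sum>q\<in>?T. J_prod n k q * (tensor (2*k) (\<lambda>s. U) q p * tensor (2*k) (\<lambda>s. W) p x))"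
    by (rule sum.swap)
  also have "\<dots> = (\<Sum>p\<in>?T. tensor (2*k) (\<lambda>s. W) p x * vt_prod n k p U)"
    by (rule sum.cong[OF refl]) (simp only: vt_prod_expand sum_distrib_left mult_ac)
  finally show ?thesis .
qed

lemma tensor_madj: "tensor m (\<lambda>s. madj W) x z = cnj (tensor m (\<lambda>s. W) z x)"
  by (simp add: tensor_def madj_def)

text \<open>Permuting both index tuples of a tensor power simultaneously changes nothing, so \<tau>
  moves from b to the entries of J. The sum over b then contracts the two tensor powers of U to the
  identity.\<close>

lemma vt_prod_unitary_trace:
  assumes U: "U \<in> unitary_group (2*n)" and \<tau>: "\<tau> permutes {1..2*k}"
  shows "(\<Sum>b\<in>tuples (2*k) (2*n). vt_prod n k b U * cnj (vt_prod n k (b \<circ> \<tau>) U))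
    = (\<Sum>p\<in>tuples (2*k) (2*n). J_prod n k p * J_prod n k (p \<circ> \<tau>))"
proof -
  let ?T = "tuples (2*k) (2*n)" and ?t = "tensor (2*k) (\<lambda>s. U)"
  have orth: "(\<Sum>b\<in>?T. ?t p b * cnj (?t q b)) = (if p = q then 1 else 0)" if pq: "p \<in> ?T" "q \<in> ?T" for p q
  proof -
    have "(\<Sum>b\<in>?T. ?t p b * cnj (?t q b)) = tensor (2*k) (\<lambda>s. mmult (2*n) U (madj U)) p q"
      unfolding tensor_madj[symmetric] by (rule sum_tensor)
    also have "\<dots> = tensor (2*k) (\<lambda>s. kron) p q"
      unfolding unitary_right[OF U]
    proof (rule tensor_cong)
      fix s assume "s \<in> {1..2*k}"
      from tuplesD[OF pq(1) this] show "midentity (2*n) (p s) (q s) = kron (p s) (q s)"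
        by (simp add: midentity_def kron_def)
    qed
    also have "\<dots> = (if p = q then 1 else 0)" by (rule tensor_kron[OF pq])
    finally show ?thesis .
  qed
  have twist: "vt_prod n k (b \<circ> \<tau>) U = (\<Sum>q\<in>?T. J_prod n k (q \<circ> \<tau>) * ?t q b)" if b: "b \<in> ?T" for b
  proof -
    have "vt_prod n k (b \<circ> \<tau>) U = (\<Sum>q\<in>?T. J_prod n k q * ?t q (b \<circ> \<tau>))"
      by (rule vt_prod_expand) (rule comp_permutes_PiE[OF b \<tau>])
    also have "\<dots> = (\<Sum>q\<in>?T. J_prod n k (q \<circ> \<tau>) * ?t (q \<circ> \<tau>) (b \<circ> \<tau>))"
      by (rule sum.reindex_bij_betw[OF bij_betw_comp_tuples[OF \<tau>], symmetric])
    finally show ?thesis by (simp only: tensor_comp_permutes[OF \<tau>])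
  qed
  have cJ: "cnj (J_prod n k p) = J_prod n k p" for p by (simp add: J_prod_def cnj_Jmat)
  have "(\<Sum>b\<in>?T. vt_prod n k b U * cnj (vt_prod n k (b \<circ> \<tau>) U))
      = (\<Sum>b\<in>?T. \<Sum>p\<in>?T. \<Sum>q\<in>?T. J_prod n k p * J_prod n k (q \<circ> \<tau>) * (?t p b * cnj (?t q b)))"
    by (rule sum.cong[OF refl])
      (simp only: twist vt_prod_expand cnj_sum complex_cnj_mult cJ sum_product mult_ac)
  also have "\<dots> = (\<Sum>p\<in>?T. \<Sum>q\<in>?T. \<Sum>b\<in>?T. J_prod n k p * J_prod n k (q \<circ> \<tau>) * (?t p b * cnj (?t q b)))"
    by (subst sum.swap, rule sum.cong[OF refl], rule sum.swap)
  also have "\<dots> = (\<Sum>p\<in>?T. \<Sum>q\<in>?T. if p = q then J_prod n k p * J_prod n k (q \<circ> \<tau>) else 0)"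
    unfolding sum_distrib_left[symmetric] by (intro sum.cong refl) (simp only: orth split: if_split, simp)
  also have "\<dots> = (\<Sum>p\<in>?T. J_prod n k p * J_prod n k (p \<circ> \<tau>))"
    by (rule sum.cong[OF refl]) (simp add: finite_PiE)
  finally show ?thesis .
qed

lemma unitary_bounded_mmult:
  assumes "unitary_bounded N f" "W \<in> unitary_group N"
  shows "unitary_bounded N (\<lambda>U. f (mmult N U W))"
proof -
  have "(\<lambda>U. mmult N U W) \<in> borel_measurable borel"
    by (rule borel_measurable_cmat) (simp add: mmult_def)
  then show ?thesis
    using assms unitary_mmult[OF _ assms(2)] measurable_compose unfolding unitary_bounded_def by blast
qed

lemma unitary_bounded_vt_prod: "unitary_bounded N (vt_prod n k x)"
  unfolding vt_prod_def[abs_def] vtilde_def sp_dual_def mmult_def mtrans_def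
  by (intro unitary_bounded_prod unitary_bounded_sum unitary_bounded_mult unitary_bounded_const unitary_bounded_entry)

context haar
begin

text \<open>Both sides equal the integral of the product at y, taken at U, times the conjugated
  product at z, taken at U times \<open>madj W\<close>. One side expands the conjugated factor; the
  other first substitutes U W for U and expands the factor at y.\<close>

lemma commutes_moments:
  assumes N: "N = 2*n" and W: "W \<in> G"
  shows "commutes (2*k) N (\<lambda>x a. \<integral>U. vt_prod n k a U * cnj (vt_prod n k x U) \<partial>\<mu>) (tensor (2*k) (\<lambda>s. W))"
  unfolding commutes_def
proof (intro ballI)
  let ?T = "tuples (2*k) N" and ?F = "vt_prod n k" and ?t = "tensor (2*k) (\<lambda>s. W)"
  fix z y assume z: "z \<in> ?T" and y: "y \<in> ?T"
  have int: "integrable \<mu> (\<lambda>U. w * (?F p U * cnj (?F q U)))" for w p q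
    by (intro integrable_unitary_bounded unitary_bounded_mult unitary_bounded_cnj unitary_bounded_vt_prod unitary_bounded_const)
  have adj: "cnj (?F z (mmult N U (madj W))) = (\<Sum>x\<in>?T. ?t z x * cnj (?F x U))" for U
    using vt_prod_mmult[of z k n U "madj W"] z unfolding N
    by (simp only: tensor_madj cnj_sum complex_cnj_mult complex_cnj_cnj)
  have "(\<Sum>x\<in>?T. ?t z x * (\<integral>U. ?F y U * cnj (?F x U) \<partial>\<mu>))
      = (\<integral>U. (\<Sum>x\<in>?T. ?t z x * (?F y U * cnj (?F x U))) \<partial>\<mu>)"
    by (subst Bochner_Integration.integral_sum[OF int]) simp
  also have "\<dots> = (\<integral>U. ?F y U * cnj (?F z (mmult N U (madj W))) \<partial>\<mu>)"
    unfolding adj by (simp only: sum_distrib_left mult.left_commute)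
  also have "\<dots> = (\<integral>U. ?F y (mmult N U W) * cnj (?F z (mmult N (mmult N U W) (madj W))) \<partial>\<mu>)"
    by (rule integral_right[OF _ W, symmetric])
      (intro unitary_bounded_mult unitary_bounded_cnj unitary_bounded_vt_prod
        unitary_bounded_mmult[of N "vt_prod n k z"] unitary_madj W)
  also have "\<dots> = (\<integral>U. (\<Sum>p\<in>?T. ?t p y * (?F p U * cnj (?F z U))) \<partial>\<mu>)"
  proof (rule integral_cong_AE)
    show "AE U in \<mu>. ?F y (mmult N U W) * cnj (?F z (mmult N (mmult N U W) (madj W)))
        = (\<Sum>p\<in>?T. ?t p y * (?F p U * cnj (?F z U)))"
      using AE_G
    proof eventually_elim
      fix U assume U: "U \<in> G"
      have "?F y (mmult N U W) = (\<Sum>p\<in>?T. ?t p y * ?F p U)"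
        using y unfolding N by (rule vt_prod_mmult)
      then show "?F y (mmult N U W) * cnj (?F z (mmult N (mmult N U W) (madj W)))
        = (\<Sum>p\<in>?T. ?t p y * (?F p U * cnj (?F z U)))"
        by (simp only: unitary_cancel_right[OF U W] sum_distrib_right mult.assoc)
    qed
    have "unitary_bounded N (\<lambda>U. ?F z (mmult N (mmult N U W) (madj W)))"
      by (intro unitary_bounded_mmult[of N "\<lambda>U. ?F z (mmult N U (madj W))"]
          unitary_bounded_mmult[of N "vt_prod n k z"] unitary_bounded_vt_prod unitary_madj W)
    then show "(\<lambda>U. ?F y (mmult N U W) * cnj (?F z (mmult N (mmult N U W) (madj W)))) \<in> borel_measurable \<mu>"
      by (intro borel_measurable_integrable integrable_unitary_bounded unitary_bounded_mult unitary_bounded_cnj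
          unitary_bounded_mmult[of N "vt_prod n k y"] unitary_bounded_vt_prod W)
    show "(\<lambda>U. \<Sum>p\<in>?T. ?t p y * (?F p U * cnj (?F z U))) \<in> borel_measurable \<mu>"
      by (intro borel_measurable_integrable Bochner_Integration.integrable_sum int)
  qed
  also have "\<dots> = (\<Sum>x\<in>?T. (\<integral>U. ?F x U * cnj (?F z U) \<partial>\<mu>) * ?t x y)"
    by (subst Bochner_Integration.integral_sum[OF int]) (simp add: mult.commute)
  finally show "(\<Sum>x\<in>?T. ?t z x * (\<integral>U. ?F y U * cnj (?F x U) \<partial>\<mu>))
      = (\<Sum>x\<in>?T. (\<integral>U. ?F x U * cnj (?F z U) \<partial>\<mu>) * ?t x y)" .
qed

text \<open>By unitarity the integrand is almost surely constant, and the constant is the symplectic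
  loop sum.\<close>

lemma moment_trace:
  assumes N: "N = 2*n" and \<tau>: "\<tau> permutes {1..2*k}"
  shows "(\<Sum>b\<in>tuples (2*k) N. \<integral>U. vt_prod n k b U * cnj (vt_prod n k (b \<circ> \<tau>) U) \<partial>\<mu>) = T_Sp k \<tau> (of_nat n)"
proof -
  let ?T = "tuples (2*k) N" and ?F = "vt_prod n k"
  have int: "integrable \<mu> (\<lambda>U. ?F p U * cnj (?F q U))" for p q
    by (intro integrable_unitary_bounded unitary_bounded_mult unitary_bounded_cnj unitary_bounded_vt_prod)
  have "(\<Sum>b\<in>?T. \<integral>U. ?F b U * cnj (?F (b \<circ> \<tau>) U) \<partial>\<mu>) = (\<integral>U. (\<Sum>b\<in>?T. ?F b U * cnj (?F (b \<circ> \<tau>) U)) \<partial>\<mu>)"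
    by (rule Bochner_Integration.integral_sum[OF int, symmetric])
  also have "\<dots> = (\<integral>U. T_Sp k \<tau> (of_nat n) \<partial>\<mu>)"
  proof (rule integral_cong_AE)
    show "AE U in \<mu>. (\<Sum>b\<in>?T. ?F b U * cnj (?F (b \<circ> \<tau>) U)) = T_Sp k \<tau> (of_nat n)"
      using AE_G
    proof eventually_elim
      fix U assume U: "U \<in> G"
      show "(\<Sum>b\<in>?T. ?F b U * cnj (?F (b \<circ> \<tau>) U)) = T_Sp k \<tau> (of_nat n)"
        using vt_prod_unitary_trace[OF U[unfolded N] \<tau>] symplectic_loop_sum[OF \<tau>, of n]
        by (simp only: N J_prod_def prod.distrib comp_def)
    qed
    show "(\<lambda>U. \<Sum>b\<in>?T. ?F b U * cnj (?F (b \<circ> \<tau>) U)) \<in> borel_measurable \<mu>"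
      by (intro borel_measurable_integrable Bochner_Integration.integrable_sum int)
  qed simp
  finally show ?thesis by (simp add: prob_space)
qed

lemma moment_formula:
  assumes N: "N = 2*n" and i: "\<forall>s\<in>{1..2*k}. i s \<in> {1..N}" and j: "\<forall>s\<in>{1..2*k}. j s \<in> {1..N}"
  shows "(\<integral>U. vt_moment n U k i k j \<partial>\<mu>)
    = (\<Sum>\<sigma> | \<sigma> permutes {1..2*k}. delta_perm k \<sigma> i j * Wg_AII n k \<sigma>)"
proof -
  define M where "M x a = (\<integral>U. vt_prod n k a U * cnj (vt_prod n k x U) \<partial>\<mu>)" for x a
  \<comment> \<open>Restriction makes the sequences extensional tuples. The first index of
    \<open>M\<close> belongs to the conjugated factor, so z comes from j and a from i.\<close>
  define a where "a = restrict i {1..2*k}"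
  define z where "z = restrict j {1..2*k}"
  have a: "a \<in> tuples (2*k) N" and z: "z \<in> tuples (2*k) N"
    unfolding a_def z_def using i j by (auto intro!: restrict_PiE_iff[THEN iffD2])
  have vt: "vt_prod n k (restrict x {1..2*k}) U = (\<Prod>r\<in>{1..k}. vtilde n U (x (2*r-1)) (x (2*r)))" for x U
    unfolding vt_prod_def by (rule prod.cong[OF refl]) auto
  have "(\<integral>U. vt_moment n U k i k j \<partial>\<mu>) = M z a"
    unfolding M_def a_def z_def vt vt_moment_def ..
  also have "\<dots> = (\<Sum>\<sigma> | \<sigma> permutes {1..2*k}. (if z = a \<circ> \<sigma> then 1 else 0) *
    convolution (2*k) (\<lambda>\<tau>. \<Sum>b\<in>tuples (2*k) N. M (b \<circ> \<tau>) b) (\<lambda>\<sigma>. Wg_U (2*k) \<sigma> (of_nat N)) \<sigma>)"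
  proof (rule weingarten_commutant[OF _ z a])
    show "commutes (2*k) N M (derivation_op (2*k) Y)" for Y
      by (rule commutes_derivation) (use commutes_moments[OF N] in \<open>simp only: M_def[abs_def]\<close>)
  qed
  also have "\<dots> = (\<Sum>\<sigma> | \<sigma> permutes {1..2*k}. delta_perm k \<sigma> i j * Wg_AII n k \<sigma>)"
  proof (intro sum.cong refl arg_cong2[where f = "(*)"])
    fix \<sigma> assume "\<sigma> \<in> {\<sigma>. \<sigma> permutes {1..2*k}}"
    then have \<sigma>: "\<sigma> permutes {1..2*k}" by simp
    have "z = a \<circ> \<sigma> \<longleftrightarrow> (\<forall>s\<in>{1..2*k}. i (\<sigma> s) = j s)"
    proof -
      have "(a \<circ> \<sigma>) s = i (\<sigma> s)" if "s \<in> {1..2*k}" for s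
        using that permutes_in_image[OF \<sigma>, of s] by (simp add: a_def)
      moreover have "z s = j s" if "s \<in> {1..2*k}" for s using that by (simp add: z_def)
      ultimately show ?thesis
        using PiE_ext[OF z comp_permutes_PiE[OF a \<sigma>]] by (metis (no_types, lifting))
    qed
    moreover have "delta_perm k \<sigma> i j = (if \<forall>s\<in>{1..2*k}. i (\<sigma> s) = j s then 1 else 0)"
      unfolding delta_perm_def by (auto intro: prod.neutral)
    ultimately show "(if z = a \<circ> \<sigma> then 1 else 0) = delta_perm k \<sigma> i j" by simp
    show "convolution (2*k) (\<lambda>\<tau>. \<Sum>b\<in>tuples (2*k) N. M (b \<circ> \<tau>) b) (\<lambda>\<sigma>. Wg_U (2*k) \<sigma> (of_nat N)) \<sigma>
        = Wg_AII n k \<sigma>"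
      unfolding convolution_def Wg_AII_def
      by (rule sum.cong[OF refl], simp only: mem_Collect_eq M_def moment_trace[OF N], simp only: N)
  qed
  finally show ?thesis .
qed

lemma moment_eq_0:
  assumes N: "N = 2*n" and kl: "k \<noteq> l"
    and i: "\<forall>s\<in>{1..2*k}. i s \<in> {1..N}" and j: "\<forall>s\<in>{1..2*l}. j s \<in> {1..N}"
  shows "(\<integral>U. vt_moment n U k i l j \<partial>\<mu>) = 0"
proof -
  \<comment> \<open>Each entry of the matrix is quadratic in U, so scaling U by u multiplies the
    integrand by u^(2k) times the conjugate of u^(2l), that is, by u to the power 2(k - l). This
    angle, negative for k < l, makes that factor cis pi = -1.\<close>
  define u where "u = cis (pi / (2 * (real k - real l)))"
  define W :: cmat where "W p q = (if p = q \<and> p \<in> {1..N} then u else 0)" for p q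
  have uu: "cnj u * u = 1" by (simp add: u_def cis_cnj cis_mult)
  have Wrow: "mmult N W A p q = (if p \<in> {1..N} then u * A p q else 0)" for A p q
  proof -
    have "mmult N W A p q = (\<Sum>t\<in>{1..N}. if t = p then u * A p q else 0)"
      unfolding mmult_def W_def by (intro sum.cong) auto
    then show ?thesis by simp
  qed
  have W: "W \<in> G"
    unfolding unitary_group_def
  proof (intro CollectI conjI allI impI)
    have "mmult N (madj W) W p q = midentity N p q" for p q
    proof -
      have "mmult N (madj W) W p q = (\<Sum>t\<in>{1..N}. if t = p then cnj u * W p q else 0)"
        unfolding mmult_def madj_def W_def by (intro sum.cong) auto
      then show ?thesis using uu by (simp add: W_def midentity_def)
    qed
    then show "mmult N (madj W) W = midentity N" by blast
  qed (auto simp: W_def)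
  have vt: "vtilde n (mmult N W U) p q = u^2 * vtilde n U p q" if "p \<in> {1..N}" for U p q
    using that unfolding N by (simp only: vtilde_entry Wrow[unfolded N] if_True sum_distrib_left power2_eq_square cong: sum.cong) (simp add: mult_ac)
  have ev: "x (2*r-1) \<in> {1..N}" if "\<forall>s\<in>{1..2*h}. x s \<in> {1..N}" "r \<in> {1..h}" for x :: "nat \<Rightarrow> nat" and r h
  proof -
    have "2*r-1 \<in> {1..2*h}" using that(2) by auto
    then show ?thesis using that(1) by blast
  qed
  have vtp: "(\<Prod>r\<in>{1..h}. vtilde n (mmult N W U) (x (2*r-1)) (x (2*r)))
      = u^(2*h) * (\<Prod>r\<in>{1..h}. vtilde n U (x (2*r-1)) (x (2*r)))"
    if "\<forall>s\<in>{1..2*h}. x s \<in> {1..N}" for x U h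
    by (simp only: vt[OF ev[OF that]] prod.distrib prod_constant card_atLeastAtMost power_mult cong: prod.cong) simp
  have "u^(2*k) * cnj (u^(2*l)) = cis ((2 * real k - 2 * real l) * (pi / (2 * (real k - real l))))"
    unfolding u_def complex_cnj_power cis_cnj Complex.DeMoivre cis_mult
    by (simp add: algebra_simps add_divide_distrib diff_divide_distrib)
  also have "(2 * real k - 2 * real l) * (pi / (2 * (real k - real l))) = pi"
    using kl by (simp add: field_simps)
  finally have um: "u^(2*k) * cnj (u^(2*l)) = -1" by simp
  have "vt_moment n (mmult N W U) k i l j = (u^(2*k) * cnj (u^(2*l))) * vt_moment n U k i l j" for U
    unfolding vt_moment_def vtp[OF i] vtp[OF j] by simp
  then have neg: "vt_moment n (mmult N W U) k i l j = - vt_moment n U k i l j" for U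
    unfolding um by simp
  have "unitary_bounded N (\<lambda>U. vt_moment n U k i l j)"
    unfolding vt_moment_def vt_prod_def[symmetric]
    by (intro unitary_bounded_mult unitary_bounded_cnj unitary_bounded_vt_prod)
  then have "(\<lambda>U. vt_moment n U k i l j) \<in> borel_measurable borel" by (simp add: unitary_bounded_def)
  from integral_left[OF this W] have "(\<integral>U. vt_moment n U k i l j \<partial>\<mu>) = - (\<integral>U. vt_moment n U k i l j \<partial>\<mu>)"
    by (simp add: neg)
  then show ?thesis by simp
qed

end

theorem theorem3p3:
  fixes n :: nat and \<mu> :: "cmat measure"
  assumes "n \<ge> 1"
    and "haar_unitary (2*n) \<mu>"
  shows "(\<forall>k\<ge>1. \<forall>i j. (\<forall>s\<in>{1..2*k}. i s \<in> {1..2*n} \<and> j s \<in> {1..2*n}) \<longrightarrow>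
            (\<integral>U. vt_moment n U k i k j \<partial>\<mu>) =
            (\<Sum>\<sigma> | \<sigma> permutes {1..2*k}. delta_perm k \<sigma> i j * Wg_AII n k \<sigma>))
       \<and> (\<forall>k l i j. k \<noteq> l \<longrightarrow> (\<forall>s\<in>{1..2*k}. i s \<in> {1..2*n}) \<longrightarrow> (\<forall>s\<in>{1..2*l}. j s \<in> {1..2*n}) \<longrightarrow>
            (\<integral>U. vt_moment n U k i l j \<partial>\<mu>) = 0)"
proof -
  interpret haar "2*n" \<mu> by unfold_locales (rule assms(2))
  show ?thesis using moment_formula[OF refl] moment_eq_0[OF refl] by blast
qed

end
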